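(* Let $\mathbb{B}_3^{123}=\{\mathrm{per}(x)\in\mathbb{B}_3 : x\in X_{\mathbb{R}}^{123}\}$. For $v\in\mathbb{B}_3^{123}$, $$b_1(Rv)=\frac{\sqrt{(a(v)+b_3(v))(b_1(v)+b_2(v))}}{2},\quad b_2(Rv)=\frac{\sqrt{(a(v)+b_2(v))(b_1(v)+b_3(v))}}{2},\quad b_3(Rv)=\frac{\sqrt{(a(v)+b_1(v))(b_2(v)+b_3(v))}}{2}.$$
   Context: **Curves, cycles, periods.** Let $X_{\mathbb{R}}^{123}=\{x=(x_1,x_2,x_3)\in\mathbb{R}^3: 0<x_1<x_2<x_3<1\}$. For $x\in X_{\mathbb{R}}^{123}$ let $C(x)$ be the compact Riemann surface (non-singular projective model) of $w^4=z(z-x_1)(z-x_2)(z-x_3)(z-1)$, with automorphism $\rho(z,w)=(z,iw)$. Let $L_1,\dots,L_6$ be the paths in $C(x)$ between ramification points of $(z,w)\mapsto z$ whose interiors project onto the intervals $(-\infty,0),(0,x_1),(x_1,x_2),(x_2,x_3),(x_3,1),(1,\infty)$ (traversed with $z$ increasing) and on which $\arg w$ equals $\frac54\pi,\pi,\frac34\pi,\frac12\pi,\frac14\pi,0$, respectively. Put $c_j=(1-\rho^2)L_j=L_j-\rho^2L_j$ and $B_1=c_6$, $B_2=(1-\rho)c_1$, $B_3=-(1-\rho)c_3-c_4$, $B_4=-\rho c_4$. Then $\mathrm{per}(x)$ is the class in $\mathbb{B}_3$ of ${}^t\bigl(\int_{B_1}\frac{dz}{w},\dots,\int_{B_4}\frac{dz}{w}\bigr)$.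 **Ball and theta constants.** Let $U=\begin{pmatrix}0&1&0&0\\1&0&0&0\\0&0&1&0\\0&0&0&1\end{pmatrix}$, $\mathcal{B}=\{v\in\mathbb{C}^4: v^*Uv<0\}$ (column vectors, $v^*={}^t\bar v$), $\mathbb{B}_3=\mathcal{B}/\mathbb{C}^\times$. For $v\in\mathcal{B}$ one has ${}^tvUv\neq0$ and $\tau(v)=iU\bigl(I_4-\frac{2}{{}^tvUv}\,v\,{}^tv\,U\bigr)$ lies in the Siegel upper half-space $\mathfrak{S}_4$ and depends only on the class of $v$; the period vectors above lie in $\mathcal{B}$. For $a,b\in\mathbb{Z}^4$, $\tau\in\mathfrak{S}_4$: $\vartheta_{a,b}(\tau)=\sum_{k\in\mathbb{Z}^4}\exp\Bigl(2\pi i\bigl(\frac12(k+\frac a2)\tau\,{}^t(k+\frac a2)+(k+\frac a2)\,{}^t(\frac b2)\bigr)\Bigr)$ (entries of $a,b$ written without commas). Let $N=\begin{pmatrix}N_{11}&N_{12}\\N_{21}&N_{22}\end{pmatrix}$ with $N_{11}=N_{22}=\mathrm{diag}(1,0,1,1)$, $N_{21}=-N_{12}=\mathrm{diag}(0,1,0,0)$, and $\tau(v)^\sharp=N\cdot\tau(v)=(N_{11}\tau(v)+N_{12})(N_{21}\tau(v)+N_{22})^{-1}$. **Functions on $\mathbb{B}_3$.** $a(v)=\vartheta_{0000,0000}(\tau(v)^\sharp)^2+\vartheta_{1100,0000}(\tau(v)^\sharp)^2$, $b_1(v)=\vartheta_{0000,0000}(\tau(v)^\sharp)^2-\vartheta_{1100,0000}(\tau(v)^\sharp)^2$,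 $b_2(v)=\vartheta_{0000,1100}(\tau(v)^\sharp)^2+\vartheta_{1111,1111}(\tau(v)^\sharp)^2$, $b_3(v)=\vartheta_{0000,1100}(\tau(v)^\sharp)^2-\vartheta_{1111,1111}(\tau(v)^\sharp)^2$. The transformation $R=\frac{1}{1-i}\begin{pmatrix}1&0&0&0\\0&2&0&0\\0&0&1&-i\\0&0&-i&1\end{pmatrix}$ satisfies $RUR^*=U$ and acts on $\mathbb{B}_3$ by $v\mapsto Rv$. Square roots denote the positive square roots of positive real numbers. *)

theory Defs
  imports "HOL-Analysis.Analysis" "HOL-Library.Poly_Mapping"
begin

section \<open>The curves and their periods\<close>

definition X123 :: "(real^3) set" where
  "X123 = {x. 0 < x$1 \<and> x$1 < x$2 \<and> x$2 < x$3 \<and> x$3 < 1}"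

definition curve_poly :: "real^3 \<Rightarrow> complex \<Rightarrow> complex" where
  "curve_poly x z = z * (z - of_real (x$1)) * (z - of_real (x$2)) * (z - of_real (x$3)) * (z - 1)"

text \<open>
  The affine curve \<open>w\<^sup>4 = curve_poly x z\<close> is smooth for distinct branch points, and as
  \<open>gcd(4, 5) = 1\<close> its non-singular projective model has exactly one further point, which lies
  above \<open>z = \<infinity>\<close> and is totally ramified. It is represented here by \<open>None\<close>.
\<close>

type_synonym point = "(complex \<times> complex) option"

definition curve :: "real^3 \<Rightarrow> point set" where
  "curve x = insert None (Some ` {(z, w). w ^ 4 = curve_poly x z})"

definition rho :: "point \<Rightarrow> point" where
  "rho = map_option (\<lambda>(z, w). (z, \<i> * w))"

text \<open>
  A path \<open>(a, b, \<gamma>)\<close> is a map \<open>\<gamma>\<close> on the closed interval from \<open>a\<close> to \<open>b\<close> in the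
  extended real line; chains are formal integer combinations of paths.
\<close>

type_synonym path = "ereal \<times> ereal \<times> (ereal \<Rightarrow> point)"
type_synonym chain = "path \<Rightarrow>\<^sub>0 int"

definition rho_chain :: "chain \<Rightarrow> chain" where
  "rho_chain = frag_extend (\<lambda>(a, b, \<gamma>). frag_of (a, b, rho \<circ> \<gamma>))"

text \<open>The integral of \<open>dz/w\<close>; the endpoints of the parameter interval are irrelevant to it.\<close>

fun path_integral :: "path \<Rightarrow> complex" where
  "path_integral (a, b, \<gamma>) =
     (LBINT t=a..b. vector_derivative (\<lambda>s. fst (the (\<gamma> (ereal s)))) (at t) / snd (the (\<gamma> (ereal t))))"

definition chain_integral :: "chain \<Rightarrow> complex" where
  "chain_integral c =
     (\<Sum>p\<in>Poly_Mapping.keys c. of_int (Poly_Mapping.lookup c p) * path_integral p)"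

text \<open>
  The lift to \<open>curve x\<close> of the real line with \<open>arg w = \<theta>\<close> (as a condition modulo \<open>2\<pi>\<close>, and
  vacuous where \<open>w = 0\<close>, i.e. at the finite ramification points).
\<close>

definition arg_lift :: "real^3 \<Rightarrow> real \<Rightarrow> ereal \<Rightarrow> point" where
  "arg_lift x \<theta> t = (if \<bar>t\<bar> = \<infinity> then None
     else Some (of_real (real_of_ereal t),
       THE w. Some (of_real (real_of_ereal t), w) \<in> curve x \<and> w = of_real (cmod w) * cis \<theta>))"

definition path_L :: "real^3 \<Rightarrow> nat \<Rightarrow> path" where
  "path_L x j =
    (if j = 1 then (- \<infinity>, 0, arg_lift x (5/4 * pi))
     else if j = 2 then (0, ereal (x$1), arg_lift x pi)
     else if j = 3 then (ereal (x$1), ereal (x$2), arg_lift x (3/4 * pi))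
     else if j = 4 then (ereal (x$2), ereal (x$3), arg_lift x (1/2 * pi))
     else if j = 5 then (ereal (x$3), 1, arg_lift x (1/4 * pi))
     else (1, \<infinity>, arg_lift x 0))"

lemma arg_lift_unique:
  assumes "curve_poly x (of_real t) = of_real r * cis (4 * \<theta>)" "r \<ge> 0"
  shows "\<exists>!w. Some (of_real t, w) \<in> curve x \<and> w = of_real (cmod w) * cis \<theta>"
    and "arg_lift x \<theta> (ereal t) = Some (of_real t, of_real (root 4 r) * cis \<theta>)"
proof -
  have iff: "Some (of_real t, w) \<in> curve x \<and> w = of_real (cmod w) * cis \<theta>
      \<longleftrightarrow> w = of_real (root 4 r) * cis \<theta>" for w
  proof
    assume *: "Some (of_real t, w) \<in> curve x \<and> w = of_real (cmod w) * cis \<theta>"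
    then have "w ^ 4 = of_real r * cis (4 * \<theta>)"
      using assms by (auto simp: curve_def)
    then have "cmod w ^ 4 = r"
      using assms(2) by (metis abs_of_nonneg norm_cis norm_mult norm_of_real norm_power mult_1_right)
    then have "cmod w = root 4 r"
      by (metis norm_ge_zero real_root_power_cancel zero_less_numeral)
    then show "w = of_real (root 4 r) * cis \<theta>" using * by metis
  next
    assume *: "w = of_real (root 4 r) * cis \<theta>"
    have "cmod w = root 4 r" using assms(2) by (simp add: * norm_mult)
    moreover have "w ^ 4 = of_real (root 4 r ^ 4) * cis (4 * \<theta>)"
      by (simp add: * power_mult_distrib Complex.DeMoivre)
    ultimately show "Some (of_real t, w) \<in> curve x \<and> w = of_real (cmod w) * cis \<theta>"
      using assms * by (auto simp: curve_def)
  qed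
  show "\<exists>!w. Some (of_real t, w) \<in> curve x \<and> w = of_real (cmod w) * cis \<theta>"
    unfolding iff by simp
  show "arg_lift x \<theta> (ereal t) = Some (of_real t, of_real (root 4 r) * cis \<theta>)"
    unfolding arg_lift_def by (simp add: iff)
qed

definition cyc :: "real^3 \<Rightarrow> nat \<Rightarrow> chain" where
  "cyc x j = frag_of (path_L x j) - rho_chain (rho_chain (frag_of (path_L x j)))"

definition B1 :: "real^3 \<Rightarrow> chain" where "B1 x = cyc x 6"
definition B2 :: "real^3 \<Rightarrow> chain" where "B2 x = cyc x 1 - rho_chain (cyc x 1)"
definition B3 :: "real^3 \<Rightarrow> chain" where "B3 x = - (cyc x 3 - rho_chain (cyc x 3)) - cyc x 4"
definition B4 :: "real^3 \<Rightarrow> chain" where "B4 x = - rho_chain (cyc x 4)"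

definition period_vector :: "real^3 \<Rightarrow> complex^4" where
  "period_vector x = vector [chain_integral (B1 x), chain_integral (B2 x),
                             chain_integral (B3 x), chain_integral (B4 x)]"


section \<open>The ball\<close>

definition U_mat :: "complex^4^4" where
  "U_mat = vector [vector [0, 1, 0, 0], vector [1, 0, 0, 0], vector [0, 0, 1, 0], vector [0, 0, 0, 1]]"

definition herm :: "complex^4 \<Rightarrow> complex" where
  "herm v = (\<Sum>i\<in>UNIV. \<Sum>j\<in>UNIV. cnj (v$i) * U_mat$i$j * v$j)"

text \<open>In the order on the complex numbers, \<open>z < 0\<close> means that \<open>z\<close> is a negative real number.\<close>

definition ball_cone :: "(complex^4) set" where
  "ball_cone = {v. herm v < 0}"

definition ball_rel :: "complex^4 \<Rightarrow> complex^4 \<Rightarrow> bool" where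
  "ball_rel u v \<longleftrightarrow> u \<in> ball_cone \<and> v \<in> ball_cone \<and> (\<exists>k. k \<noteq> 0 \<and> u = k *s v)"

lemma vector_4 [simp]:
  "(vector [x, y, z, w] :: 'a::zero^4) $ 1 = x"
  "(vector [x, y, z, w] :: 'a::zero^4) $ 2 = y"
  "(vector [x, y, z, w] :: 'a::zero^4) $ 3 = z"
  "(vector [x, y, z, w] :: 'a::zero^4) $ 4 = w"
  unfolding vector_def by simp_all

lemma herm_eq: "herm v = cnj (v$1) * v$2 + cnj (v$2) * v$1 + cnj (v$3) * v$3 + cnj (v$4) * v$4"
  by (simp add: herm_def U_mat_def sum_4)

quotient_type ball3 = "complex^4" / partial: ball_rel
proof (rule part_equivpI)
  have "herm (vector [1, -1, 0, 0]) < 0"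
    by (simp add: herm_eq less_complex_def)
  then have "ball_rel (vector [1, -1, 0, 0]) (vector [1, -1, 0, 0])"
    by (auto simp: ball_rel_def ball_cone_def intro!: exI[of _ 1])
  then show "\<exists>v. ball_rel v v" ..
  show "symp ball_rel"
  proof (rule sympI)
    fix u v assume "ball_rel u v"
    then obtain k where "k \<noteq> 0" "u = k *s v" "u \<in> ball_cone" "v \<in> ball_cone"
      by (auto simp: ball_rel_def)
    then show "ball_rel v u"
      by (auto simp: ball_rel_def vec_eq_iff intro!: exI[of _ "inverse k"])
  qed
  show "transp ball_rel"
  proof (rule transpI)
    fix u v w assume "ball_rel u v" "ball_rel v w"
    then obtain k l where "k \<noteq> 0" "l \<noteq> 0" "u = k *s v" "v = l *s w" "u \<in> ball_cone" "w \<in> ball_cone"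
      by (auto simp: ball_rel_def)
    then show "ball_rel u w"
      by (auto simp: ball_rel_def vec_eq_iff intro!: exI[of _ "k * l"])
  qed
qed

definition per :: "real^3 \<Rightarrow> ball3" where
  "per x = abs_ball3 (period_vector x)"

definition ball3_123 :: "ball3 set" where
  "ball3_123 = per ` X123"

definition R_mat :: "complex^4^4" where
  "R_mat = mat (1 / (1 - \<i>)) **
     vector [vector [1, 0, 0, 0], vector [0, 2, 0, 0], vector [0, 0, 1, - \<i>], vector [0, 0, - \<i>, 1]]"

lemma mat_mult_left: "mat k ** A = (\<chi> i j. k * A$i$j)" for A :: "complex^4^4"
  by (simp add: matrix_matrix_mult_def mat_def vec_eq_iff if_distrib if_distribR cong: if_cong)

lemma R_mat_mult:
  "R_mat *v v = (1 / (1 - \<i>)) *s vector [v$1, 2 * v$2, v$3 - \<i> * v$4, v$4 - \<i> * v$3]"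
  by (simp add: R_mat_def mat_mult_left matrix_vector_mult_def vec_eq_iff forall_4 sum_4
      diff_divide_distrib)

lemma herm_R_matrix: "herm (R_mat *v v) = herm v"
proof -
  have *: "cnj (1 / (1 - \<i>)) * (1 / (1 - \<i>)) = 1 / 2"
    by (simp add: complex_eq_iff field_simps)
  have "herm (R_mat *v v) = (cnj (1 / (1 - \<i>)) * (1 / (1 - \<i>))) * (2 * herm v)"
    unfolding herm_eq R_mat_mult by (simp add: algebra_simps)
  then show ?thesis unfolding * by simp
qed

lift_definition R_act :: "ball3 \<Rightarrow> ball3" is "\<lambda>v. R_mat *v v"
  by (auto simp: ball_rel_def ball_cone_def herm_R_matrix vector_scalar_commute[symmetric])


section \<open>Theta constants\<close>

definition bilin :: "complex^4 \<Rightarrow> complex" where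
  "bilin v = (\<Sum>i\<in>UNIV. \<Sum>j\<in>UNIV. v$i * U_mat$i$j * v$j)"

lift_definition tau :: "ball3 \<Rightarrow> complex^4^4" is
  "\<lambda>v. mat \<i> ** U_mat ** (mat 1 - mat (2 / bilin v) ** (\<chi> i j. v$i * v$j) ** U_mat)"
proof -
  fix u v assume "ball_rel u v"
  then obtain k where k: "k \<noteq> 0" "u = k *s v" by (auto simp: ball_rel_def)
  have b: "bilin u = k\<^sup>2 * bilin v"
    by (simp add: k bilin_def sum_distrib_left power2_eq_square ac_simps)
  have "mat (2 / bilin u) ** (\<chi> i j. u$i * u$j) = mat (2 / bilin v) ** (\<chi> i j. v$i * v$j)"
    using k(1) by (simp add: b mat_mult_left power2_eq_square vec_eq_iff) (simp add: k(2))
  then show "mat \<i> ** U_mat ** (mat 1 - mat (2 / bilin u) ** (\<chi> i j. u$i * u$j) ** U_mat)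
      = mat \<i> ** U_mat ** (mat 1 - mat (2 / bilin v) ** (\<chi> i j. v$i * v$j) ** U_mat)"
    by simp
qed

definition theta :: "int^4 \<Rightarrow> int^4 \<Rightarrow> complex^4^4 \<Rightarrow> complex" where
  "theta a b \<tau> = (\<Sum>\<^sub>\<infinity>k\<in>UNIV.
     let p = (\<chi> i. of_int (k$i) + of_int (a$i) / 2 :: complex^4)
     in exp (2 * of_real pi * \<i> *
          (1/2 * (\<Sum>i\<in>UNIV. \<Sum>j\<in>UNIV. p$i * \<tau>$i$j * p$j)
           + (\<Sum>i\<in>UNIV. p$i * (of_int (b$i) / 2)))))"

definition diag_mat :: "complex^4 \<Rightarrow> complex^4^4" where
  "diag_mat d = (\<chi> i j. if i = j then d$i else 0)"

definition N11 :: "complex^4^4" where "N11 = diag_mat (vector [1, 0, 1, 1])"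
definition N22 :: "complex^4^4" where "N22 = diag_mat (vector [1, 0, 1, 1])"
definition N21 :: "complex^4^4" where "N21 = diag_mat (vector [0, 1, 0, 0])"
definition N12 :: "complex^4^4" where "N12 = - diag_mat (vector [0, 1, 0, 0])"

definition tau_sharp :: "ball3 \<Rightarrow> complex^4^4" where
  "tau_sharp v = (N11 ** tau v + N12) ** matrix_inv (N21 ** tau v + N22)"

definition a_fun :: "ball3 \<Rightarrow> complex" where
  "a_fun v = (theta (vector [0,0,0,0]) (vector [0,0,0,0]) (tau_sharp v))\<^sup>2
       + (theta (vector [1,1,0,0]) (vector [0,0,0,0]) (tau_sharp v))\<^sup>2"

definition b1_fun :: "ball3 \<Rightarrow> complex" where
  "b1_fun v = (theta (vector [0,0,0,0]) (vector [0,0,0,0]) (tau_sharp v))\<^sup>2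
        - (theta (vector [1,1,0,0]) (vector [0,0,0,0]) (tau_sharp v))\<^sup>2"

definition b2_fun :: "ball3 \<Rightarrow> complex" where
  "b2_fun v = (theta (vector [0,0,0,0]) (vector [1,1,0,0]) (tau_sharp v))\<^sup>2
        + (theta (vector [1,1,1,1]) (vector [1,1,1,1]) (tau_sharp v))\<^sup>2"

definition b3_fun :: "ball3 \<Rightarrow> complex" where
  "b3_fun v = (theta (vector [0,0,0,0]) (vector [1,1,0,0]) (tau_sharp v))\<^sup>2
        - (theta (vector [1,1,1,1]) (vector [1,1,1,1]) (tau_sharp v))\<^sup>2"

end

(*
  Up to a scalar the period vector is (1, -Y, i r, s) with real Y, r, s. Cauchy's theorem for the
  integrand dz/w on the upper half plane gives two linear relations between its integrals over the
  six real intervals, hence 0 < s < r < 1 and r + s < Y.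

  At such a point the four theta constants are sums over the Gaussian integers kappa of
  exp(-pi Y |kappa|^2) f(r kappa) f(s kappa), f a theta function with parameter i, and R becomes
  (Y, r, s) |-> (2 Y, r - s, r + s), that is, division of kappa by 1 - i. The isogeny 1 - i acts on
  products of two theta functions by a formula of degree two, which follows from Poisson summation
  at parameter 1 + i, and acts on pairs of cosets of (1 + i) Z[i]. Together they express the squares
  of the b_j(Rv) by a and the b_j at v.

  The signs of the square roots come from A > 0 (a sum of positive terms after partial Poisson
  summation) and C > 0, where A and C are the theta constants 0000,0000 and 0000,1100. The latter
  holds only in the region above, as C vanishes at r = Y; it is proved by estimating the leading
  terms at the cusps Y = infinity and Y = 0.
*)

theory Submission
  imports Defs "HOL-Complex_Analysis.Complex_Analysis" "HOL-Probability.Probability"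
begin

section \<open>Poisson summation for Gaussian series\<close>

text \<open>The algebra yields only squares; the signs are the difficulty. As b3(Rv) = A C, a proof
  of C > 0 has to reach up to the zero of C at r = Y, where no fixed error bound can work.
  Interchanging the cusps turns C into the constant B = 1100,0000 at (1/Y, r/Y, s/Y), a sum over
  kappa in Z[i] + (1 + i)/2, and at such kappa every factor f(r kappa) vanishes for r = 1. So
  leading terms and remainder both carry a factor 1 - r, and only their coefficients have to be
  compared. Put H = Y - (r^2 + s^2)/2. The interchange sends H to H/Y^2 >= 1/(4 H); one estimate
  serves H >= 13/25, the other a swapped parameter >= 12/25, and 1/(4 * 13/25) = 25/52 > 12/25
  closes the gap. For b1(Rv) = A'^2 - B'^2 no product formula exists; instead 4 b1(Rv)^2 = 4
  b2(Rv)^2 + 4 B^2 D^2, with D the constant 1111,1111, excludes a zero on the whole ray of larger Y,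
  at whose end the sign is visible.\<close>

lemma summable_on_exp_neg_abs_int: "(\<lambda>k::int. exp (- \<bar>real_of_int k\<bar>)) summable_on UNIV"
proof -
  have s: "summable (\<lambda>n::nat. exp (- 1 :: real) ^ n)"
    by (intro summable_geometric) simp
  have n: "(\<lambda>n::nat. exp (- real n)) summable_on UNIV"
    using s by (subst summable_on_UNIV_nonneg_real_iff) (auto simp flip: exp_of_nat_mult)
  have "(\<lambda>k::int. exp (- \<bar>real_of_int k\<bar>)) summable_on (range int)"
    by (subst summable_on_reindex) (use n in \<open>auto simp: o_def inj_on_def\<close>)
  moreover have "(\<lambda>k::int. exp (- \<bar>real_of_int k\<bar>)) summable_on (range (\<lambda>n. - int n))"
    by (subst summable_on_reindex) (use n in \<open>auto simp: o_def inj_on_def\<close>)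
  ultimately have "(\<lambda>k::int. exp (- \<bar>real_of_int k\<bar>)) summable_on (range int \<union> range (\<lambda>n. - int n))"
    by (rule summable_on_union)
  moreover have "range int \<union> range (\<lambda>n. - int n) = UNIV"
  proof -
    have "x \<in> range int \<union> range (\<lambda>n. - int n)" for x
      by (cases x rule: int_cases2) auto
    then show ?thesis by blast
  qed
  ultimately show ?thesis by simp
qed

text \<open>One \<open>\<bar>k\<bar>\<close> beyond the bound \<open>d * \<bar>k\<bar>\<close> of
  the linear term is set aside before the square is completed. The constant does not depend on
  \<open>b\<close>, so \<open>exp (- \<bar>k\<bar>)\<close> majorises a single series as well as a
  compact family of them.\<close>

lemma gauss_exponent_le:
  fixes a b d :: real
  assumes "a < 0" "\<bar>b\<bar> \<le> d"
  shows "a * k\<^sup>2 + b * k \<le> (d + 1)\<^sup>2 / (4 * - a) - \<bar>k\<bar>"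
proof -
  have "b * k \<le> d * \<bar>k\<bar>"
    using mult_right_mono[OF assms(2), of "\<bar>k\<bar>"] abs_ge_self[of "b * k"] by (simp add: abs_mult)
  moreover have "(d + 1) * \<bar>k\<bar> + a * k\<^sup>2 \<le> (d + 1)\<^sup>2 / (4 * - a)"
  proof -
  have "0 \<le> (2 * - a * \<bar>k\<bar> - (d + 1))\<^sup>2" by simp
  moreover have "(2 * - a * \<bar>k\<bar> - (d + 1))\<^sup>2 = (d + 1)\<^sup>2 - ((d + 1) * \<bar>k\<bar> + a * \<bar>k\<bar>\<^sup>2) * (4 * - a)"
    by algebra
  ultimately have "((d + 1) * \<bar>k\<bar> + a * \<bar>k\<bar>\<^sup>2) * (4 * - a) \<le> (d + 1)\<^sup>2"
    by linarith
  then have "(d + 1) * \<bar>k\<bar> + a * \<bar>k\<bar>\<^sup>2 \<le> (d + 1)\<^sup>2 / (4 * - a)"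
    by (rule mult_imp_le_div_pos[rotated]) (use assms(1) in simp)
  then have "(d + 1) * \<bar>k\<bar> + a * k\<^sup>2 \<le> (d + 1)\<^sup>2 / (4 * - a)"
    unfolding power2_abs .
  then show ?thesis .
  qed
  ultimately show ?thesis by (simp add: algebra_simps)
qed

lemma abs_summable_gauss_int:
  fixes p q :: complex
  assumes "Re p < 0"
  shows "(\<lambda>k::int. norm (exp (p * of_int k ^ 2 + q * of_int k))) summable_on UNIV"
proof (rule summable_on_comparison_test)
  show "(\<lambda>k::int. exp ((\<bar>Re q\<bar> + 1)\<^sup>2 / (4 * - Re p)) * exp (- \<bar>real_of_int k\<bar>)) summable_on UNIV"
    by (intro summable_on_cmult_right summable_on_exp_neg_abs_int)
  fix k :: int
  have "Re p * (of_int k)\<^sup>2 + Re q * of_int k \<le> (\<bar>Re q\<bar> + 1)\<^sup>2 / (4 * - Re p) - \<bar>of_int k\<bar>"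
    by (rule gauss_exponent_le) (use assms in auto)
  moreover have "Re (p * of_int k ^ 2 + q * of_int k) = Re p * (of_int k)\<^sup>2 + Re q * of_int k"
    by (simp add: power2_eq_square)
  ultimately have "Re (p * of_int k ^ 2 + q * of_int k) \<le> (\<bar>Re q\<bar> + 1)\<^sup>2 / (4 * - Re p) + - \<bar>of_int k\<bar>"
    by linarith
  then show "norm (exp (p * of_int k ^ 2 + q * of_int k))
      \<le> exp ((\<bar>Re q\<bar> + 1)\<^sup>2 / (4 * - Re p)) * exp (- \<bar>real_of_int k\<bar>)"
    unfolding norm_exp_eq_Re exp_add[symmetric] by (simp only: exp_le_cancel_iff)
qed auto

definition gauss_sum :: "complex \<Rightarrow> complex \<Rightarrow> complex" where
  "gauss_sum p q = (\<Sum>\<^sub>\<infinity>k::int. exp (p * of_int k ^ 2 + q * of_int k))"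

text \<open>Holomorphic dependence on both coefficients is what later carries Poisson summation from
  real to complex parameters. On a closed ball \<open>Re (p z)\<close> stays below some
  \<open>a < 0\<close> and \<open>norm (q z)\<close> below some \<open>d\<close>, which gives a
  single majorant.\<close>

lemma holomorphic_gauss_sum:
  assumes S: "open S" and p: "p holomorphic_on S" and q: "q holomorphic_on S"
    and neg: "\<And>z. z \<in> S \<Longrightarrow> Re (p z) < 0"
  shows "(\<lambda>z. gauss_sum (p z) (q z)) holomorphic_on S"
proof -
  have "\<exists>e>0. (\<lambda>z. gauss_sum (p z) (q z)) holomorphic_on ball z0 e" if z0: "z0 \<in> S" for z0
  proof -
    obtain e where e: "e > 0" "cball z0 e \<subseteq> S"
      using S z0 open_contains_cball by blast
    have cp: "continuous_on (cball z0 e) p" and cq: "continuous_on (cball z0 e) q"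
      using p q e by (auto intro: holomorphic_on_imp_continuous_on holomorphic_on_subset)
    have "compact ((\<lambda>z. Re (p z)) ` cball z0 e)"
      by (intro compact_continuous_image continuous_intros cp) auto
    moreover have "(\<lambda>z. Re (p z)) ` cball z0 e \<noteq> {}" using e by auto
    ultimately obtain a where "a \<in> (\<lambda>z. Re (p z)) ` cball z0 e" "\<forall>x\<in>(\<lambda>z. Re (p z)) ` cball z0 e. x \<le> a"
      using compact_attains_sup by blast
    then have a: "a < 0" "\<And>z. z \<in> cball z0 e \<Longrightarrow> Re (p z) \<le> a"
      using neg e(2) by (auto simp del: mem_cball)
    have "compact (q ` cball z0 e)"
      by (intro compact_continuous_image cq) auto
    then obtain d where d: "\<And>z. z \<in> cball z0 e \<Longrightarrow> norm (q z) \<le> d"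
      by (metis bounded_iff compact_imp_bounded image_eqI)
    define M where "M = (\<lambda>k::int. exp ((d + 1)\<^sup>2 / (4 * - a)) * exp (- \<bar>real_of_int k\<bar>))"
    have M: "M summable_on UNIV"
      unfolding M_def by (intro summable_on_cmult_right summable_on_exp_neg_abs_int)
    have le: "norm (exp (p z * of_int k ^ 2 + q z * of_int k)) \<le> M k" if "z \<in> cball z0 e" for z k
    proof -
      have "\<bar>Re (q z)\<bar> \<le> d" using d[OF that] abs_Re_le_cmod order_trans by blast
      then have "a * (of_int k)\<^sup>2 + Re (q z) * of_int k \<le> (d + 1)\<^sup>2 / (4 * - a) - \<bar>of_int k\<bar>"
        by (rule gauss_exponent_le[OF a(1)])
      moreover have "Re (p z) * (of_int k)\<^sup>2 \<le> a * (of_int k)\<^sup>2"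
        by (intro mult_right_mono a that) auto
      moreover have "Re (p z * of_int k ^ 2 + q z * of_int k) = Re (p z) * (of_int k)\<^sup>2 + Re (q z) * of_int k"
        by (simp add: power2_eq_square)
      ultimately have "Re (p z * of_int k ^ 2 + q z * of_int k) \<le> (d + 1)\<^sup>2 / (4 * - a) + - \<bar>of_int k\<bar>"
        by linarith
      then show ?thesis
        unfolding norm_exp_eq_Re M_def exp_add[symmetric] by (simp only: exp_le_cancel_iff)
    qed
    have "uniform_limit (cball z0 e) (\<lambda>X z. \<Sum>k\<in>X. exp (p z * of_int k ^ 2 + q z * of_int k))
        (\<lambda>z. \<Sum>\<^sub>\<infinity>k. exp (p z * of_int k ^ 2 + q z * of_int k)) (finite_subsets_at_top UNIV)"
      by (rule Weierstrass_m_test_general[OF le M])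
    then have ul: "uniform_limit (cball z0 e) (\<lambda>X z. \<Sum>k\<in>X. exp (p z * of_int k ^ 2 + q z * of_int k))
        (\<lambda>z. gauss_sum (p z) (q z)) (finite_subsets_at_top UNIV)"
      by (simp add: gauss_sum_def)
    have "p holomorphic_on ball z0 e" "q holomorphic_on ball z0 e"
      using e(2) p q ball_subset_cball holomorphic_on_subset by blast+
    then have "continuous_on (cball z0 e) (\<lambda>z. \<Sum>k\<in>X. exp (p z * of_int k ^ 2 + q z * of_int k)) \<and>
        (\<lambda>z. \<Sum>k\<in>X. exp (p z * of_int k ^ 2 + q z * of_int k)) holomorphic_on ball z0 e" for X
      by (intro conjI continuous_intros holomorphic_intros cp cq)
    then have "\<forall>\<^sub>F X in finite_subsets_at_top UNIV.
        continuous_on (cball z0 e) (\<lambda>z. \<Sum>k\<in>X. exp (p z * of_int k ^ 2 + q z * of_int k)) \<and>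
        (\<lambda>z. \<Sum>k\<in>X. exp (p z * of_int k ^ 2 + q z * of_int k)) holomorphic_on ball z0 e"
      by (intro always_eventually allI)
    then have "(\<lambda>z. gauss_sum (p z) (q z)) holomorphic_on ball z0 e"
      using holomorphic_uniform_limit[OF _ ul] finite_subsets_at_top_neq_bot by blast
    with e show ?thesis by blast
  qed
  then have "(\<lambda>z. gauss_sum (p z) (q z)) field_differentiable at z" if "z \<in> S" for z
    using that holomorphic_on_imp_differentiable_at[OF _ open_ball centre_in_ball[THEN iffD2]] by blast
  then show ?thesis
    unfolding holomorphic_on_def by (blast intro: field_differentiable_at_within)
qed

section \<open>Uniqueness of the Fourier coefficients of a continuous periodic function\<close>

inductive trig_poly :: "(real \<Rightarrow> complex) \<Rightarrow> bool" where
  monomial: "trig_poly (\<lambda>x. c * cis (2 * pi * of_int n * x))"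
| add: "trig_poly f \<Longrightarrow> trig_poly g \<Longrightarrow> trig_poly (\<lambda>x. f x + g x)"

lemma trig_poly_mult:
  assumes "trig_poly f" "trig_poly g"
  shows "trig_poly (\<lambda>x. f x * g x)"
  using assms(1)
proof induction
  case (monomial c n)
  show ?case using assms(2)
  proof induction
    case (monomial d m)
    have "(\<lambda>x. c * cis (2 * pi * of_int n * x) * (d * cis (2 * pi * of_int m * x)))
        = (\<lambda>x. c * d * cis (2 * pi * of_int (n + m) * x))"
      by (auto simp: cis_mult[symmetric] distrib_left distrib_right fun_eq_iff)
    then show ?case by (simp only: trig_poly.monomial)
  next
    case (add f g)
    then show ?case using trig_poly.add by (simp add: distrib_left)
  qed
next
  case (add f g)
  then show ?case using trig_poly.add by (simp add: distrib_right)
qed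

text \<open>Stone-Weierstrass supplies real polynomials in the coordinates of the plane. On the unit
  circle Euler's formulas turn a linear form into exponentials of frequency 1 and -1; products
  follow from \<open>trig_poly_mult\<close>.\<close>

lemma trig_poly_real_polynomial:
  assumes "real_polynomial_function g"
  shows "trig_poly (\<lambda>x. of_real (g (cis (2 * pi * x))))"
  using assms
proof induction
  case (linear f)
  then have lin: "linear f" by (simp add: bounded_linear.linear)
  have "(\<lambda>x. complex_of_real (f (cis (2 * pi * x)))) =
     (\<lambda>x. Complex (f 1) (- f \<i>) / 2 * cis (2 * pi * of_int 1 * x)
        + Complex (f 1) (f \<i>) / 2 * cis (2 * pi * of_int (-1) * x))"
  proof
    fix x :: real
    have "cis (2 * pi * x) = cos (2 * pi * x) *\<^sub>R 1 + sin (2 * pi * x) *\<^sub>R \<i>"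
      by (simp add: complex_eq_iff)
    then have "f (cis (2 * pi * x)) = cos (2 * pi * x) * f 1 + sin (2 * pi * x) * f \<i>"
      by (simp only: linear_add[OF lin] linear_scale[OF lin]) simp
    then show "complex_of_real (f (cis (2 * pi * x))) =
        Complex (f 1) (- f \<i>) / 2 * cis (2 * pi * of_int 1 * x)
        + Complex (f 1) (f \<i>) / 2 * cis (2 * pi * of_int (-1) * x)"
      by (simp add: complex_eq_iff field_simps)
  qed
  then show ?case by (simp only: trig_poly.intros)
next
  case (const c)
  show ?case using trig_poly.monomial[of "of_real c" 0] by simp
next
  case (add f g)
  then show ?case using trig_poly.add by simp
next
  case (mult f g)
  then show ?case using trig_poly_mult by simp
qed

lemma continuous_on_trig_poly: "trig_poly f \<Longrightarrow> continuous_on S f"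
  by (induction rule: trig_poly.induct) (auto intro!: continuous_intros)

text \<open>Each argument function has a jump on the circle, \<open>Arg2pi\<close> at 1 and
  \<open>Arg\<close> at -1. By periodicity both define the same \<open>U\<close>, so each proves
  continuity where the other one jumps.\<close>

lemma periodic_lift_circle:
  fixes u :: "real \<Rightarrow> real"
  assumes "continuous_on UNIV u" and per: "\<And>x. u (x + 1) = u x"
  obtains U where "continuous_on (sphere 0 1) U" "\<And>x. x \<in> {0..1} \<Longrightarrow> U (cis (2 * pi * x)) = u x"
proof
  define U where "U z = u (Arg2pi z / (2 * pi))" for z
  have U2: "U z = u (Arg z / (2 * pi))" if z: "z \<noteq> 0" for z
  proof (cases "Arg z < 0")
    case True
    have "cis (Arg z + 2 * pi) = cis (Arg z)"
      by (simp add: complex_eq_iff)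
    then have "exp (\<i> * of_real (Arg z + 2 * pi)) = exp (\<i> * of_real (Arg z))"
      by (simp only: cis_conv_exp)
    then have "of_real (norm z) * exp (\<i> * of_real (Arg z + 2 * pi)) = z"
      using Arg_eq[OF z] by simp
    moreover have "0 \<le> Arg z + 2 * pi" "Arg z + 2 * pi < 2 * pi"
      using True mpi_less_Arg[of z] by linarith+
    moreover have "norm z > 0" using z by simp
    ultimately have "Arg2pi z = Arg z + 2 * pi"
      by (metis Arg2pi_unique)
    then have "U z = u (Arg z / (2 * pi) + 1)" by (simp add: U_def add_divide_distrib)
    then show ?thesis by (simp only: per)
  next
    case False
    have "Arg z < 2 * pi" using Arg_le_pi[of z] pi_gt_zero by linarith
    moreover have "norm z > 0" using z by simp
    ultimately have "Arg2pi z = Arg z"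
      using Arg_eq[OF z] False by (metis Arg2pi_unique not_less)
    then show ?thesis by (simp add: U_def)
  qed
  have uc: "isCont u x" for x using assms(1) by (simp add: continuous_on_eq_continuous_at)
  have "isCont U z" if "z \<in> sphere 0 1" for z
  proof (cases "z \<in> \<real>\<^sub>\<ge>\<^sub>0")
    case False
    then have "isCont (\<lambda>z. Arg2pi z / (2 * pi)) z"
      using continuous_at_Arg2pi[OF False] by (intro isCont_divide continuous_const) auto
    then show ?thesis unfolding U_def by (rule isCont_o2[OF _ uc])
  next
    case True
    then have nz: "z \<notin> \<real>\<^sub>\<le>\<^sub>0" "z \<noteq> 0"
      using that by (auto simp: complex_nonneg_Reals_iff complex_nonpos_Reals_iff complex_eq_iff norm_complex_def)
    have "isCont (\<lambda>z. Arg z / (2 * pi)) z"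
      using continuous_at_Arg[OF nz(1)] by (intro isCont_divide continuous_const) auto
    then have "isCont (\<lambda>z. u (Arg z / (2 * pi))) z" by (rule isCont_o2[OF _ uc])
    moreover have "\<forall>\<^sub>F w in nhds z. U w = u (Arg w / (2 * pi))"
      using t1_space_nhds[OF nz(2)] by eventually_elim (rule U2)
    ultimately show ?thesis using isCont_cong[THEN iffD2] by fastforce
  qed
  then show "continuous_on (sphere 0 1) U" by (blast intro: continuous_at_imp_continuous_on)
  fix x :: real assume x: "x \<in> {0..1}"
  show "U (cis (2 * pi * x)) = u x"
  \<comment> \<open>\<open>Arg2pi\<close> takes values in \<open>[0, 2 * pi)\<close>, so the
    endpoint 1 is read off at 0 and needs \<open>u 1 = u 0\<close>.\<close>
  proof (cases "x = 1")
    case True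
    have "u 1 = u 0" using per[of 0] by simp
    moreover have "Arg2pi 1 = 0" by (rule Arg2pi_unique[of 1]) auto
    then have "U 1 = u 0" by (simp add: U_def)
    moreover have "cis (2 * pi * x) = 1" by (simp add: True)
    ultimately show ?thesis by (simp add: True)
  next
    case False
    then have "2 * pi * x < 2 * pi" using x by simp
    moreover have "of_real 1 * exp (\<i> * of_real (2 * pi * x)) = cis (2 * pi * x)"
      unfolding cis_conv_exp by (simp only: of_real_1 mult_1_left)
    ultimately have "Arg2pi (cis (2 * pi * x)) = 2 * pi * x"
      using x by (intro Arg2pi_unique[of 1]) (simp_all only:, auto)
    then show ?thesis by (simp add: U_def)
  qed
qed

text \<open>If a trigonometric polynomial \<open>p\<close> is within \<open>e\<close> of
  \<open>u\<close>, orthogonality makes the integral of \<open>u * u\<close> equal to that of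
  \<open>u * (u - p)\<close>, which is at most \<open>e\<close> times the integral of
  \<open>\<bar>u\<bar>\<close>. So the integral of the square is zero.\<close>

lemma real_periodic_zero:
  fixes u :: "real \<Rightarrow> real"
  assumes c: "continuous_on UNIV u" and per: "\<And>x. u (x + 1) = u x"
    and z: "\<And>f. trig_poly f \<Longrightarrow> integral {0..1} (\<lambda>x. of_real (u x) * f x) = 0"
    and x: "x \<in> {0..1}"
  shows "u x = 0"
proof -
  obtain U where U: "continuous_on (sphere 0 1) U" "\<And>x. x \<in> {0..1} \<Longrightarrow> U (cis (2 * pi * x)) = u x"
    using periodic_lift_circle[OF c per] by blast
  have cu: "continuous_on {0..1} u" using c continuous_on_subset by blast
  define J where "J = integral {0..1} (\<lambda>x. \<bar>u x\<bar>)"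
  have sq: "(\<lambda>x. u x * u x) integrable_on {0..1}"
    by (intro integrable_continuous_interval continuous_intros cu)
  have "integral {0..1} (\<lambda>x. u x * u x) \<le> e * J" if e: "e > 0" for e
  proof -
    obtain g where g: "real_polynomial_function g" "\<And>z. z \<in> sphere 0 1 \<Longrightarrow> \<bar>U z - g z\<bar> < e"
      using Stone_Weierstrass_real_polynomial_function[OF compact_sphere U(1) e] by blast
    define p where "p x = g (cis (2 * pi * x))" for x
    have tp: "trig_poly (\<lambda>x. of_real (p x))"
      unfolding p_def by (rule trig_poly_real_polynomial[OF g(1)])
    have cp: "continuous_on {0..1} p"
      using continuous_on_Re[OF continuous_on_trig_poly[OF tp, of "{0..1}"]] by simp
    have up: "(\<lambda>x. u x * p x) integrable_on {0..1}"
      by (intro integrable_continuous_interval continuous_intros cu cp)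
    have "integral {0..1} (\<lambda>x. complex_of_real (u x * p x)) = 0"
      using z[OF tp] by simp
    then have "integral {0..1} (\<lambda>x. u x * p x) = 0"
      using integral_linear[OF up bounded_linear_of_real[where 'a=complex]] by (simp add: o_def)
    then have "integral {0..1} (\<lambda>x. u x * u x) = integral {0..1} (\<lambda>x. u x * u x - u x * p x)"
      by (simp add: integral_diff[OF sq up])
    also have "\<dots> \<le> integral {0..1} (\<lambda>x. e * \<bar>u x\<bar>)"
    proof (rule integral_le)
      show "(\<lambda>x. u x * u x - u x * p x) integrable_on {0..1}" by (intro integrable_diff sq up)
      show "(\<lambda>x. e * \<bar>u x\<bar>) integrable_on {0..1}"
        by (intro integrable_continuous_interval continuous_intros cu)
      fix x :: real assume "x \<in> {0..1}"
      then have "\<bar>u x - p x\<bar> \<le> e"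
        using g(2)[of "cis (2 * pi * x)"] U(2) by (simp add: p_def less_imp_le)
      then have "\<bar>u x\<bar> * \<bar>u x - p x\<bar> \<le> \<bar>u x\<bar> * e" by (intro mult_left_mono) auto
      moreover have "u x * u x - u x * p x \<le> \<bar>u x\<bar> * \<bar>u x - p x\<bar>"
        by (metis abs_ge_self abs_mult right_diff_distrib)
      ultimately show "u x * u x - u x * p x \<le> e * \<bar>u x\<bar>" by (simp add: mult.commute)
    qed
    finally show ?thesis by (simp add: J_def)
  qed
  note le = this
  have "J \<ge> 0" unfolding J_def by (rule integral_nonneg) (intro integrable_continuous_interval continuous_intros cu, auto)
  have "integral {0..1} (\<lambda>x. u x * u x) \<le> 0"
  proof (rule field_le_epsilon)
    fix e :: real assume "e > 0"
    then have "integral {0..1} (\<lambda>x. u x * u x) \<le> e / (J + 1) * J"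
      using \<open>J \<ge> 0\<close> by (intro le) simp
    also have "\<dots> \<le> e" using \<open>e > 0\<close> \<open>J \<ge> 0\<close> by (simp add: field_simps)
    finally show "integral {0..1} (\<lambda>x. u x * u x) \<le> 0 + e" by simp
  qed
  moreover have "integral {0..1} (\<lambda>x. u x * u x) \<ge> 0" by (rule integral_nonneg[OF sq]) auto
  ultimately have "integral {0..1} (\<lambda>x. u x * u x) = 0" by linarith
  then have "u x * u x = 0"
    using integral_eq_0_iff[OF continuous_on_mult[OF cu cu]] x by (metis zero_less_one zero_le_square)
  then show ?thesis by simp
qed

text \<open>Conjugation preserves trigonometric polynomials, so \<open>cnj u\<close> has vanishing
  coefficients too, and with it the real and the imaginary part of \<open>u\<close>.\<close>

lemma periodic_zero:
  fixes u :: "real \<Rightarrow> complex"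
  assumes c: "continuous_on UNIV u" and per: "\<And>x. u (x + 1) = u x"
    and z: "\<And>n::int. integral {0..1} (\<lambda>x. u x * cis (2 * pi * of_int n * x)) = 0"
    and x: "x \<in> {0..1}"
  shows "u x = 0"
proof -
  have cu: "continuous_on {0..1} u" using c continuous_on_subset by blast
  have int: "(\<lambda>x. u x * f x) integrable_on {0..1}" if "trig_poly f" for f
    by (intro integrable_continuous_interval continuous_intros cu continuous_on_trig_poly that)
  have t: "integral {0..1} (\<lambda>x. u x * f x) = 0" if "trig_poly f" for f
    using that
  proof induction
    case (monomial a n)
    have "integral {0..1} (\<lambda>x. u x * (a * cis (2 * pi * of_int n * x)))
       = a * integral {0..1} (\<lambda>x. u x * cis (2 * pi * of_int n * x))"
      by (subst integral_mult_right[symmetric]) (simp add: mult_ac)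
    then show ?case using z by simp
  next
    case (add f g)
    then show ?case by (simp add: distrib_left integral_add[OF int int])
  qed
  have tc: "trig_poly (\<lambda>x. cnj (f x))" if "trig_poly f" for f
    using that
  proof induction
    case (monomial a n)
    have "(\<lambda>x. cnj (a * cis (2 * pi * of_int n * x))) = (\<lambda>x. cnj a * cis (2 * pi * of_int (-n) * x))"
      by (simp add: cis_cnj fun_eq_iff)
    then show ?case by (simp only: trig_poly.monomial)
  qed (auto intro: trig_poly.add)
  have tcu: "integral {0..1} (\<lambda>x. cnj (u x) * f x) = 0" if "trig_poly f" for f
  proof -
    have "integral {0..1} (\<lambda>x. cnj (u x * cnj (f x))) = cnj (integral {0..1} (\<lambda>x. u x * cnj (f x)))"
      by (rule integral_cnj[symmetric])
    then show ?thesis using t[OF tc[OF that]] by simp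
  qed
  have intc: "(\<lambda>x. cnj (u x) * f x) integrable_on {0..1}" if "trig_poly f" for f
    by (intro integrable_continuous_interval continuous_intros cu continuous_on_trig_poly that)
  have "Re (u x) = 0"
  proof (rule real_periodic_zero[OF _ _ _ x])
    show "continuous_on UNIV (\<lambda>x. Re (u x))" by (intro continuous_intros c)
    show "Re (u (x + 1)) = Re (u x)" for x by (simp add: per)
    fix f assume f: "trig_poly f"
    have "(\<lambda>x. complex_of_real (Re (u x)) * f x) = (\<lambda>x. (u x * f x + cnj (u x) * f x) / 2)"
      by (auto simp: fun_eq_iff complex_eq_iff)
    then show "integral {0..1} (\<lambda>x. complex_of_real (Re (u x)) * f x) = 0"
      using integral_add[OF int[OF f] intc[OF f]] t[OF f] tcu[OF f] by simp
  qed
  moreover have "Im (u x) = 0"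
  proof (rule real_periodic_zero[OF _ _ _ x])
    show "continuous_on UNIV (\<lambda>x. Im (u x))" by (intro continuous_intros c)
    show "Im (u (x + 1)) = Im (u x)" for x by (simp add: per)
    fix f assume f: "trig_poly f"
    have "(\<lambda>x. complex_of_real (Im (u x)) * f x) = (\<lambda>x. (u x * f x - cnj (u x) * f x) / (2 * \<i>))"
      by (simp only: left_diff_distrib[symmetric] complex_diff_cnj) (simp add: field_simps)
    then show "integral {0..1} (\<lambda>x. complex_of_real (Im (u x)) * f x) = 0"
      using integral_diff[OF int[OF f] intc[OF f]] t[OF f] tcu[OF f] by simp
  qed
  ultimately show ?thesis by (simp add: complex_eq_iff)
qed

section \<open>The Fourier transform of the Gaussian and the unfolding of integrals\<close>

lemma gauss_fourier:
  fixes t f :: real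
  assumes t: "t > 0"
  shows "(LINT x|lborel. exp (- pi * t * x\<^sup>2) *\<^sub>R cis (2 * pi * f * x)) = exp (- pi * f\<^sup>2 / t) / sqrt t"
    and "integrable lborel (\<lambda>x. exp (- pi * t * x\<^sup>2) *\<^sub>R cis (2 * pi * f * x))"
proof -
  \<comment> \<open>The substitution \<open>x \<mapsto> c * x\<close> turns the Gaussian into the
    standard normal density up to \<open>sqrt (2 * pi)\<close>; its transform is then the
    characteristic function at \<open>s\<close>.\<close>
  define c where "c = sqrt (2 * pi * t)"
  define s where "s = 2 * pi * f / c"
  have c: "c > 0" "c\<^sup>2 = 2 * pi * t" using t by (simp_all add: c_def)
  have dens: "std_normal_density (0 + c * x) = exp (- pi * t * x\<^sup>2) / sqrt (2 * pi)" for x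
    by (simp add: normal_density_def power_mult_distrib c(2))
  have iex: "iexp (s * (0 + c * x)) = cis (2 * pi * f * x)" for x
  proof -
    have "s * (0 + c * x) = 2 * pi * f * x" using c(1) by (simp add: s_def)
    then show ?thesis by (simp only: cis_conv_exp)
  qed
  define g where "g x = exp (- pi * t * x\<^sup>2) *\<^sub>R cis (2 * pi * f * x)" for x
  have sc: "std_normal_density (0 + c * x) *\<^sub>R iexp (s * (0 + c * x)) = (1 / sqrt (2 * pi)) *\<^sub>R g x" for x
    unfolding dens iex g_def by simp
  have "exp (- (s\<^sup>2) / 2) = (CLINT x|std_normal_distribution. iexp (s * x))"
    using fun_cong[OF char_std_normal_distribution, of s] unfolding char_def by simp
  also have "\<dots> = (LINT x|lborel. std_normal_density x *\<^sub>R iexp (s * x))"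
    by (rule integral_density) (auto simp: normal_density_nonneg)
  also have "\<dots> = \<bar>c\<bar> *\<^sub>R (LINT x|lborel. std_normal_density (0 + c * x) *\<^sub>R iexp (s * (0 + c * x)))"
    using c(1) by (intro lborel_integral_real_affine) simp
  also have "\<dots> = c *\<^sub>R (LINT x|lborel. (1 / sqrt (2 * pi)) *\<^sub>R g x)"
    unfolding sc using c(1) by simp
  also have "\<dots> = c *\<^sub>R ((1 / sqrt (2 * pi)) *\<^sub>R (LINT x|lborel. g x))"
    by (simp only: integral_scaleR_right)
  also have "\<dots> = (c / sqrt (2 * pi)) *\<^sub>R (LINT x|lborel. g x)" by simp
  also have "c / sqrt (2 * pi) = sqrt t" by (simp add: c_def real_sqrt_mult)
  finally have eq: "of_real (exp (- (s\<^sup>2) / 2)) = sqrt t *\<^sub>R (LINT x|lborel. g x)" .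
  have "s\<^sup>2 / 2 = pi * f\<^sup>2 / t"
    using t unfolding s_def power_divide power_mult_distrib c(2) by (simp add: field_simps power2_eq_square)
  then have s2: "- (s\<^sup>2) / 2 = - pi * f\<^sup>2 / t" by simp
  have "sqrt t > 0" using t by simp
  then have "(LINT x|lborel. g x) = exp (- pi * f\<^sup>2 / t) / sqrt t"
    using eq unfolding s2 scaleR_conv_of_real by (simp add: field_simps)
  then show "(LINT x|lborel. exp (- pi * t * x\<^sup>2) *\<^sub>R cis (2 * pi * f * x)) = exp (- pi * f\<^sup>2 / t) / sqrt t"
    unfolding g_def .
  have "integrable lborel (\<lambda>x. std_normal_density (0 + c * x))"
    using c(1) by (intro lborel_integrable_real_affine integrable_normal_density) simp_all
  then have "integrable lborel (\<lambda>x. sqrt (2 * pi) * (exp (- pi * t * x\<^sup>2) / sqrt (2 * pi)))"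
    unfolding dens by (rule integrable_mult_right)
  then have i: "integrable lborel (\<lambda>x. exp (- pi * t * x\<^sup>2))" by simp
  show "integrable lborel (\<lambda>x. exp (- pi * t * x\<^sup>2) *\<^sub>R cis (2 * pi * f * x))"
  proof (rule Bochner_Integration.integrable_bound[OF i])
    have "continuous_on UNIV (\<lambda>x. exp (- pi * t * x\<^sup>2) *\<^sub>R cis (2 * pi * f * x))"
      by (intro continuous_intros)
    then show "(\<lambda>x. exp (- pi * t * x\<^sup>2) *\<^sub>R cis (2 * pi * f * x)) \<in> borel_measurable lborel"
      using borel_measurable_continuous_onI by simp
  qed simp
qed

text \<open>Half-open intervals, because the unit intervals that start at
  \<open>- N, ..., N - 1\<close> fill exactly \<open>[- N, N]\<close>.\<close>

lemma filterlim_symmetric_int_intervals: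
  "filterlim (\<lambda>N. {- int N..<int N}) (finite_subsets_at_top UNIV) sequentially"
proof -
  have "\<forall>\<^sub>F N in sequentially. finite {- int N..<int N} \<and> X \<subseteq> {- int N..<int N} \<and> {- int N..<int N} \<subseteq> UNIV"
    if fin: "finite X" for X :: "int set"
  proof -
    obtain b where "abs ` X \<subseteq> {..b}"
      using finite_int_iff_bounded_le[THEN iffD1, OF fin] ..
    then have b: "\<bar>x\<bar> \<le> b" if "x \<in> X" for x using imageI[OF that, of abs] by blast
    have "X \<subseteq> {- int N..<int N}" if "N \<ge> nat (b + 1)" for N
    proof
      fix x assume "x \<in> X"
      then have "\<bar>x\<bar> \<le> b" by (rule b)
      then show "x \<in> {- int N..<int N}" using that by auto
    qed
    then show ?thesis
      by (intro eventually_sequentiallyI[of "nat (b + 1)"] conjI finite_atLeastLessThan_int subset_UNIV)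
  qed
  then show ?thesis by (simp add: filterlim_finite_subsets_at_top)
qed

lemma integral_symmetric_interval:
  fixes f :: "real \<Rightarrow> complex"
  assumes c: "continuous_on UNIV f"
  shows "integral {- real N..real N} f = (\<Sum>k\<in>{- int N..<int N}. integral {0..1} (\<lambda>x. f (x + of_int k)))"
proof (induction N)
  case (Suc N)
  have ci: "f integrable_on {a..b}" for a b
    using c continuous_on_subset by (blast intro: integrable_continuous_interval)
  have sh: "integral {0..1} (\<lambda>x. f (x + of_int k)) = integral {of_int k..of_int k + 1} f" for k
    using integral_shift[of 0 "of_int k" 1 f] continuous_on_subset[OF c] by (simp add: o_def add.commute)
  have "integral {- real (Suc N)..real (Suc N)} f
      = integral {- real (Suc N)..- real N} f + integral {- real N..real (Suc N)} f"
    by (rule Henstock_Kurzweil_Integration.integral_combine[symmetric]) (use ci in auto)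
  also have "integral {- real N..real (Suc N)} f = integral {- real N..real N} f + integral {real N..real (Suc N)} f"
    by (rule Henstock_Kurzweil_Integration.integral_combine[symmetric]) (use ci in auto)
  also have "integral {real N..real (Suc N)} f = integral {0..1} (\<lambda>x. f (x + of_int (int N)))"
    unfolding sh by (simp add: add.commute)
  also have "integral {- real (Suc N)..- real N} f = integral {0..1} (\<lambda>x. f (x + of_int (- int (Suc N))))"
    unfolding sh by (simp add: add.commute)
  finally have "integral {- real (Suc N)..real (Suc N)} f =
      integral {0..1} (\<lambda>x. f (x + of_int (- int (Suc N)))) +
      (integral {0..1} (\<lambda>x. f (x + of_int (int N))) + integral {- real N..real N} f)"
    by (simp only: add_ac)
  moreover have "{- int (Suc N)..<int (Suc N)} = insert (- int (Suc N)) (insert (int N) {- int N..<int N})"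
    by auto
  ultimately show ?case by (simp only: Suc) simp
qed simp

text \<open>Both values are limits of the integrals over \<open>[- N, N]\<close>: the unconditional
  sum along a cofinal sequence of finite sets, the Lebesgue integral by dominated
  convergence.\<close>

lemma has_sum_unit_integrals:
  fixes f :: "real \<Rightarrow> complex"
  assumes c: "continuous_on UNIV f" and i: "integrable lborel f"
    and s: "((\<lambda>k::int. integral {0..1} (\<lambda>x. f (x + of_int k))) has_sum J) UNIV"
  shows "J = (LINT x|lborel. f x)"
proof (rule LIMSEQ_unique)
  have "((\<lambda>X. \<Sum>k\<in>X. integral {0..1} (\<lambda>x. f (x + of_int k))) \<longlongrightarrow> J) (finite_subsets_at_top UNIV)"
    using s by (simp add: has_sum_def)
  from filterlim_compose[OF this filterlim_symmetric_int_intervals]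
  show "(\<lambda>N. integral {- real N..real N} f) \<longlonglongrightarrow> J"
    by (simp add: integral_symmetric_interval[OF c])
  have "(\<lambda>N. LINT x|lborel. indicator {- real N..real N} x *\<^sub>R f x) \<longlonglongrightarrow> (LINT x|lborel. f x)"
  proof (rule integral_dominated_convergence[where w="\<lambda>x. norm (f x)"])
    show "f \<in> borel_measurable lborel" using i by auto
    then show "(\<lambda>x. indicat_real {- real N..real N} x *\<^sub>R f x) \<in> borel_measurable lborel" for N by measurable
    show "integrable lborel (\<lambda>x. norm (f x))" using i by (rule integrable_norm)
    have "(\<lambda>N. indicator {- real N..real N} x *\<^sub>R f x) \<longlonglongrightarrow> f x" for x
    proof (rule tendsto_eventually, rule eventually_sequentiallyI[of "nat \<lceil>\<bar>x\<bar>\<rceil>"])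
      fix N assume "nat \<lceil>\<bar>x\<bar>\<rceil> \<le> N"
      then have "\<bar>x\<bar> \<le> real N" by linarith
      then show "indicat_real {- real N..real N} x *\<^sub>R f x = f x" by (auto simp: indicator_def)
    qed
    then show "AE x in lborel. (\<lambda>N. indicat_real {- real N..real N} x *\<^sub>R f x) \<longlonglongrightarrow> f x" by simp
    show "AE x in lborel. norm (indicat_real {- real N..real N} x *\<^sub>R f x) \<le> norm (f x)" for N
      by (simp add: indicator_def)
  qed
  moreover have "(LINT x|lborel. indicator {- real N..real N} x *\<^sub>R f x) = integral {- real N..real N} f" for N
  proof -
    have "set_integrable lborel {- real N..real N} f"
      unfolding set_integrable_def by (rule integrable_mult_indicator[OF _ i]) simp
    from set_borel_integral_eq_integral(2)[OF this] show ?thesis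
      by (simp add: set_lebesgue_integral_def)
  qed
  ultimately show "(\<lambda>N. integral {- real N..real N} f) \<longlonglongrightarrow> (LINT x|lborel. f x)" by simp
qed

section \<open>The periodised Gaussian and its dual series\<close>

definition gauss_period :: "complex \<Rightarrow> complex \<Rightarrow> complex" where
  "gauss_period t w = (\<Sum>\<^sub>\<infinity>k::int. exp (- of_real pi * t * (of_int k + w)\<^sup>2))"

lemma gauss_period_term:
  "exp (- of_real pi * t * (of_int k + w)\<^sup>2) =
     exp (- of_real pi * t * w\<^sup>2) * exp (- of_real pi * t * of_int k ^ 2 + (- 2 * of_real pi * t * w) * of_int k)"
  for t w :: complex
  unfolding exp_add[symmetric] by (rule arg_cong[where f = exp]) (simp add: power2_eq_square algebra_simps)

lemma gauss_period_eq:
  "gauss_period t w = exp (- of_real pi * t * w\<^sup>2) * gauss_sum (- of_real pi * t) (- 2 * of_real pi * t * w)"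
  unfolding gauss_period_def gauss_sum_def gauss_period_term by (rule infsum_cmult_right')

lemma abs_summable_gauss_period:
  assumes "Re t > 0"
  shows "(\<lambda>k::int. norm (exp (- of_real pi * t * (of_int k + w)\<^sup>2))) summable_on UNIV"
  unfolding gauss_period_term norm_mult
  by (intro summable_on_cmult_right abs_summable_gauss_int) (use assms in simp)

lemma gauss_period_shift: "gauss_period t (w + of_int m) = gauss_period t w"
proof -
  have "gauss_period t (w + of_int m) = (\<Sum>\<^sub>\<infinity>k. exp (- of_real pi * t * (of_int (k + m) + w)\<^sup>2))"
    by (simp add: gauss_period_def algebra_simps)
  also have "\<dots> = gauss_period t w"
    unfolding gauss_period_def
    by (rule infsum_reindex_bij_witness[where i="\<lambda>k. k - m" and j="\<lambda>k. k + m"]) auto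
  finally show ?thesis .
qed

definition gauss_dual :: "complex \<Rightarrow> complex \<Rightarrow> complex" where
  "gauss_dual t w = gauss_sum (- of_real pi / t) (2 * of_real pi * \<i> * w)"

lemma exp_2pi_int: "exp (2 * of_real pi * \<i> * of_int m) = 1"
  using exp_integer_2pi[of "of_int m"] by (simp add: mult_ac)

lemma gauss_dual_shift: "gauss_dual t (w + of_int m) = gauss_dual t w"
proof -
  have "exp (2 * of_real pi * \<i> * (w + of_int m) * of_int k) = exp (2 * of_real pi * \<i> * w * of_int k)" for k
    using exp_2pi_int[of "m * k"] by (simp add: algebra_simps exp_add)
  then show ?thesis unfolding gauss_dual_def gauss_sum_def exp_add by (simp only:)
qed

lemma Re_inverse_pos: "Re t > 0 \<Longrightarrow> Re (1 / t) > 0"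
  by (simp add: Re_divide divide_pos_pos sum_power2_gt_zero_iff)

lemma continuous_gauss_period: "Re t > 0 \<Longrightarrow> continuous_on UNIV (gauss_period t)"
  unfolding gauss_period_eq[abs_def]
  by (intro holomorphic_on_imp_continuous_on holomorphic_intros holomorphic_gauss_sum) auto

lemma continuous_gauss_dual: "Re t > 0 \<Longrightarrow> continuous_on UNIV (gauss_dual t)"
  unfolding gauss_dual_def[abs_def] using Re_inverse_pos[of t]
  by (intro holomorphic_on_imp_continuous_on holomorphic_gauss_sum holomorphic_intros)
    (auto simp: Re_divide zero_less_divide_iff)

text \<open>Unfolding: an exponential of period 1 can be moved inside the periodisation, so the
  integral over one period becomes the integral of a single Gaussian over the line. The line has
  height \<open>b\<close> because the identity is wanted at complex \<open>w\<close>.\<close>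

lemma gauss_period_coeff:
  fixes t b :: real and n :: int
  assumes t: "t > 0"
  shows "integral {0..1} (\<lambda>x. gauss_period t (of_real x + \<i> * b) * cis (2 * pi * n * x)) =
    exp (- pi * n\<^sup>2 / t + 2 * pi * n * b) / sqrt t"
proof -
  define f where "f x = exp (- complex_of_real pi * complex_of_real t * (of_real x + \<i> * b)\<^sup>2) * cis (2 * pi * n * x)" for x :: real
  have fk: "f (x + of_int k) = exp (- complex_of_real pi * complex_of_real t * (of_int k + (of_real x + \<i> * b))\<^sup>2) * cis (2 * pi * n * x)" for x k
  proof -
    have "cis (2 * pi * n * (x + of_int k)) = cis (2 * pi * n * x) * cis (2 * pi * of_int (n * k))"
      by (simp add: cis_mult algebra_simps)
    also have "cis (2 * pi * of_int (n * k)) = 1" by (rule cis_multiple_2pi) simp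
    finally show ?thesis by (simp add: f_def add_ac)
  qed
  have f_eq: "f x = exp (pi * t * b\<^sup>2) * (exp (- pi * t * x\<^sup>2) *\<^sub>R cis (2 * pi * (n - t * b) * x))" for x
    unfolding f_def scaleR_conv_of_real exp_of_real[symmetric] cis_conv_exp mult_exp_exp
    by (rule arg_cong[where f=exp]) (simp add: power2_eq_square algebra_simps)
  have cf: "continuous_on UNIV f" unfolding f_def by (intro continuous_intros)
  have i: "integrable lborel f"
    unfolding f_eq[abs_def] by (intro integrable_mult_right gauss_fourier(2) t)
  have "(LINT x|lborel. f x) = exp (pi * t * b\<^sup>2) * (exp (- pi * (n - t * b)\<^sup>2 / t) / sqrt t)"
    unfolding f_eq integral_mult_right_zero gauss_fourier(1)[OF t] by (simp only: of_real_mult)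
  also have "\<dots> = exp (pi * t * b\<^sup>2 + (- pi * (n - t * b)\<^sup>2 / t)) / sqrt t"
    by (simp only: exp_add of_real_mult of_real_divide times_divide_eq_right)
  also have "pi * t * b\<^sup>2 + (- pi * (n - t * b)\<^sup>2 / t) = - pi * n\<^sup>2 / t + 2 * pi * n * b"
    using t by (simp add: field_simps power2_eq_square)
  finally have L: "(LINT x|lborel. f x) = exp (- pi * n\<^sup>2 / t + 2 * pi * n * b) / sqrt t" .
  \<comment> \<open>From \<open>(x + k)\<^sup>2 \<ge> k\<^sup>2 / 2 - x\<^sup>2\<close> and
    \<open>x\<^sup>2 \<le> 1\<close> comes a majorant with parameter \<open>t / 2\<close>, uniform
    in \<open>x\<close>.\<close>
  define M where "M k = exp (pi * t * b\<^sup>2) * (exp (pi * t) * norm (exp (- complex_of_real pi * of_real (t/2) * (of_int k + 0)\<^sup>2)))" for k :: int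
  have M: "M summable_on UNIV"
    unfolding M_def by (intro summable_on_cmult_right abs_summable_gauss_period) (use t in simp)
  have le: "norm (f (x + of_int k)) \<le> M k" if "x \<in> {0..1}" for x k
  proof -
    have "(of_int k)\<^sup>2 / 2 \<le> (x + of_int k)\<^sup>2 + x\<^sup>2"
      using sum_squares_bound[of "x + of_int k" "- x"] by (simp add: power2_eq_square algebra_simps)
    moreover have "x\<^sup>2 \<le> 1" using that by (simp add: power_le_one_iff abs_square_le_1)
    ultimately have "(of_int k)\<^sup>2 / 2 - 1 \<le> (x + of_int k)\<^sup>2" by linarith
    then have "pi * t * ((of_int k)\<^sup>2 / 2 - 1) \<le> pi * t * (x + of_int k)\<^sup>2"
      using t by (intro mult_left_mono) auto
    then have "exp (- pi * t * (x + of_int k)\<^sup>2) \<le> exp (pi * t + (- pi * (t/2) * (of_int k)\<^sup>2))"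
      by (simp add: algebra_simps)
    also have "\<dots> = exp (pi * t) * norm (exp (- complex_of_real pi * of_real (t/2) * (of_int k + 0)\<^sup>2))"
    proof -
      have "Re (- complex_of_real pi * of_real (t/2) * (of_int k + 0)\<^sup>2) = - pi * (t/2) * (of_int k)\<^sup>2"
        by (simp add: power2_eq_square)
      then show ?thesis unfolding exp_add norm_exp_eq_Re by (simp only:)
    qed
    finally show ?thesis
      unfolding f_eq M_def norm_mult norm_scaleR by (simp add: mult_left_mono)
  qed
  have ul: "uniform_limit {0..1} (\<lambda>X x. \<Sum>k\<in>X. f (x + of_int k)) (\<lambda>x. \<Sum>\<^sub>\<infinity>k. f (x + of_int k))
      (finite_subsets_at_top UNIV)"
    by (rule Weierstrass_m_test_general[OF le M])
  have cfk: "continuous_on {0..1} (\<lambda>x. f (x + of_int k))" for k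
    by (rule continuous_on_compose2[OF cf]) (auto intro!: continuous_intros)
  obtain I J where IJ: "\<And>X. ((\<lambda>x. \<Sum>k\<in>X. f (x + of_int k)) has_integral I X) {0..1}"
      "((\<lambda>x. \<Sum>\<^sub>\<infinity>k. f (x + of_int k)) has_integral J) {0..1}"
      "(I \<longlongrightarrow> J) (finite_subsets_at_top UNIV)"
    by (rule uniform_limit_integral[OF ul]) (auto intro!: continuous_intros cfk)
  have "I X = (\<Sum>k\<in>X. integral {0..1} (\<lambda>x. f (x + of_int k)))" for X
  \<comment> \<open>The formula for \<open>I X\<close> is wanted for every set; a sum over an
    infinite set is 0 by convention, on both sides.\<close>
  proof (cases "finite X")
    case True
    have "((\<lambda>x. \<Sum>k\<in>X. f (x + of_int k)) has_integral (\<Sum>k\<in>X. integral {0..1} (\<lambda>x. f (x + of_int k)))) {0..1}"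
      by (intro has_integral_sum True integrable_integral integrable_continuous_interval cfk)
    then show ?thesis using IJ(1) has_integral_unique by blast
  next
    case False
    then show ?thesis using IJ(1)[of X] has_integral_unique[OF has_integral_0] by simp
  qed
  then have "((\<lambda>k. integral {0..1} (\<lambda>x. f (x + of_int k))) has_sum J) UNIV"
    using IJ(3) unfolding has_sum_def by presburger
  then have "J = exp (- pi * n\<^sup>2 / t + 2 * pi * n * b) / sqrt t"
    using has_sum_unit_integrals[OF cf i] L by simp
  moreover have "(\<Sum>\<^sub>\<infinity>k. f (x + of_int k)) = gauss_period t (of_real x + \<i> * b) * cis (2 * pi * n * x)" for x
    unfolding fk gauss_period_def by (rule infsum_cmult_left')
  ultimately show ?thesis using IJ(2) by (simp add: integral_unique)
qed

text \<open>Orthogonality of exponentials: only the summand \<open>m = - n\<close> has a nonzero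
  integral, so the integrals of the partial sums are eventually constant.\<close>

lemma gauss_dual_coeff:
  fixes t b :: real and n :: int
  assumes t: "t > 0"
  shows "integral {0..1} (\<lambda>x. gauss_dual t (of_real x + \<i> * b) * cis (2 * pi * n * x)) =
    exp (- pi * n\<^sup>2 / t + 2 * pi * n * b)"
proof -
  define g where "g m x = exp (- complex_of_real pi / complex_of_real t * of_int m ^ 2 + 2 * of_real pi * \<i> * (of_real x + \<i> * b) * of_int m)
      * cis (2 * pi * n * x)" for m :: int and x :: real
  have g_eq: "g m x = of_real (exp (- pi / t * of_int m ^ 2 - 2 * pi * b * of_int m)) * cis (2 * pi * of_int (m + n) * x)" for m x
    unfolding g_def exp_of_real[symmetric] cis_conv_exp mult_exp_exp
    by (rule arg_cong[where f=exp]) (simp add: power2_eq_square algebra_simps)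
  have M: "(\<lambda>m::int. exp (- pi / t * of_int m ^ 2 - 2 * pi * b * of_int m)) summable_on UNIV"
  proof -
    have "(\<lambda>k::int. norm (exp (complex_of_real (- pi / t) * of_int k ^ 2 + of_real (- 2 * pi * b) * of_int k))) summable_on UNIV"
      by (rule abs_summable_gauss_int) (use t in \<open>simp add: field_simps\<close>)
    then show ?thesis by (simp add: norm_exp_eq_Re power2_eq_square)
  qed
  have ul: "uniform_limit {0..1} (\<lambda>X x. \<Sum>k\<in>X. g k x) (\<lambda>x. \<Sum>\<^sub>\<infinity>k. g k x) (finite_subsets_at_top UNIV)"
    by (rule Weierstrass_m_test_general[OF _ M]) (simp add: g_eq norm_mult)
  have cg: "continuous_on {0..1} (g k)" for k unfolding g_def by (intro continuous_intros)
  obtain I J where IJ: "\<And>X. ((\<lambda>x. \<Sum>k\<in>X. g k x) has_integral I X) {0..1}"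
      "((\<lambda>x. \<Sum>\<^sub>\<infinity>k. g k x) has_integral J) {0..1}" "(I \<longlongrightarrow> J) (finite_subsets_at_top UNIV)"
    by (rule uniform_limit_integral[OF ul]) (auto intro!: continuous_intros cg)
  have gi: "(g m has_integral (if m = - n then exp (- pi * n\<^sup>2 / t + 2 * pi * n * b) else 0)) {0..1}" for m
  proof (cases "m = - n")
    case True
    have "g m = (\<lambda>x. exp (- pi * n\<^sup>2 / t + 2 * pi * n * b))"
      unfolding g_eq[abs_def] True by (simp add: fun_eq_iff)
    then show ?thesis
      using True has_integral_const_real[of "complex_of_real (exp (- pi * n\<^sup>2 / t + 2 * pi * n * b))" 0 1] by simp
  next
    case False
    define a where "a = 2 * pi * of_int (m + n)"
    have a: "a \<noteq> 0" using False by (auto simp: a_def simp flip: of_int_add)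
    have "((\<lambda>x. cis (a * x)) has_integral (cis (a * 1) / (\<i> * a) - cis (a * 0) / (\<i> * a))) {0..1}"
    proof (rule fundamental_theorem_of_calculus)
      fix x :: real
      have "((\<lambda>z. exp (\<i> * of_real a * z) / (\<i> * of_real a)) has_field_derivative exp (\<i> * of_real a * of_real x))
          (at (of_real x))"
        using a by (auto intro!: derivative_eq_intros)
      from has_vector_derivative_real_field[OF this, of "{0..1}"]
      show "((\<lambda>x. cis (a * x) / (\<i> * a)) has_vector_derivative cis (a * x)) (at x within {0..1})"
        by (simp add: cis_conv_exp mult.assoc)
    qed simp
    moreover have "cis (a * 1) = 1" unfolding a_def mult_1_right by (rule cis_multiple_2pi) simp
    ultimately have "((\<lambda>x. cis (a * x)) has_integral 0) {0..1}" by simp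
    from has_integral_mult_right[OF this] False show ?thesis
      unfolding g_eq[abs_def] a_def by simp
  qed
  have "\<forall>\<^sub>F X in finite_subsets_at_top UNIV. finite X \<and> - n \<in> X"
    by (subst eventually_finite_subsets_at_top) (intro exI[of _ "{- n}"], blast)
  then have "\<forall>\<^sub>F X in finite_subsets_at_top UNIV. I X = exp (- pi * n\<^sup>2 / t + 2 * pi * n * b)"
  proof eventually_elim
    case (elim X)
    then have "((\<lambda>x. \<Sum>k\<in>X. g k x) has_integral
        (\<Sum>m\<in>X. complex_of_real (if m = - n then exp (- pi * n\<^sup>2 / t + 2 * pi * n * b) else 0))) {0..1}"
      using gi by (intro has_integral_sum) blast+
    from has_integral_unique[OF IJ(1) this] show ?case using elim by (simp add: sum.delta flip: of_real_sum)
  qed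
  then have "J = exp (- pi * n\<^sup>2 / t + 2 * pi * n * b)"
    using IJ(3) tendsto_unique[OF finite_subsets_at_top_neq_bot] tendsto_eventually by blast
  moreover have "(\<Sum>\<^sub>\<infinity>k. g k x) = gauss_dual t (of_real x + \<i> * b) * cis (2 * pi * n * x)" for x
    unfolding g_def gauss_dual_def gauss_sum_def by (rule infsum_cmult_left')
  ultimately show ?thesis using IJ(2) by (simp add: integral_unique)
qed

text \<open>On the horizontal line through \<open>w\<close> both sides are continuous of period 1
  with the same Fourier coefficients.\<close>

lemma poisson_gauss_real:
  fixes t :: real and w :: complex
  assumes t: "t > 0"
  shows "gauss_period t w = gauss_dual t w / sqrt t"
proof -
  define b where "b = Im w"
  define u where "u x = gauss_period t (of_real x + \<i> * b) - gauss_dual t (of_real x + \<i> * b) / sqrt t" for x :: real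
  have Re_t: "Re (complex_of_real t) > 0" using t by simp
  have cp: "continuous_on A (\<lambda>x. gauss_period t (of_real x + \<i> * b))" for A :: "real set"
    by (rule continuous_on_compose2[OF continuous_gauss_period[OF Re_t]]) (auto intro!: continuous_intros)
  have cd: "continuous_on A (\<lambda>x. gauss_dual t (of_real x + \<i> * b))" for A :: "real set"
    by (rule continuous_on_compose2[OF continuous_gauss_dual[OF Re_t]]) (auto intro!: continuous_intros)
  have sqrt: "complex_of_real (sqrt t) \<noteq> 0" using t by simp
  have c: "continuous_on UNIV u"
    unfolding u_def by (intro continuous_intros cp cd ballI sqrt)
  have shift: "u (x + of_int k) = u x" for x k
    using gauss_period_shift[of t "of_real x + \<i> * b" k] gauss_dual_shift[of t "of_real x + \<i> * b" k]
    by (simp add: u_def add_ac)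
  have "u x = 0" if "x \<in> {0..1}" for x
  proof (rule periodic_zero[OF c _ _ that])
    show "u (x + 1) = u x" for x using shift[of x 1] by simp
    fix n :: int
    have "integral {0..1} (\<lambda>x. u x * cis (2 * pi * of_int n * x)) =
        integral {0..1} (\<lambda>x. gauss_period t (of_real x + \<i> * b) * cis (2 * pi * n * x)
          - (gauss_dual t (of_real x + \<i> * b) * cis (2 * pi * n * x)) / sqrt t)"
      by (simp add: u_def left_diff_distrib)
    also have "\<dots> = integral {0..1} (\<lambda>x. gauss_period t (of_real x + \<i> * b) * cis (2 * pi * n * x))
          - integral {0..1} (\<lambda>x. gauss_dual t (of_real x + \<i> * b) * cis (2 * pi * n * x) / sqrt t)"
      by (rule integral_diff) (intro integrable_continuous_interval continuous_intros cp cd ballI sqrt)+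
    also have "\<dots> = 0"
      unfolding integral_divide gauss_period_coeff[OF t] gauss_dual_coeff[OF t] by simp
    finally show "integral {0..1} (\<lambda>x. u x * cis (2 * pi * of_int n * x)) = 0" .
  qed
  then have "u (frac (Re w)) = 0" by (simp add: frac_lt_1 less_imp_le)
  moreover have "u (Re w) = u (frac (Re w))"
    using shift[of "frac (Re w)" "\<lfloor>Re w\<rfloor>"] by (simp add: frac_def)
  moreover have "complex_of_real (Re w) + \<i> * b = w" by (simp add: complex_eq_iff b_def)
  ultimately show ?thesis by (simp add: u_def)
qed

text \<open>For fixed \<open>w\<close> both sides are holomorphic in \<open>t\<close> on the right
  half plane and agree on the positive reals. The value used later is
  \<open>t = 1 + \<i>\<close>.\<close>

theorem poisson_gauss:
  fixes t w :: complex
  assumes "Re t > 0"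
  shows "gauss_period t w = gauss_dual t w / csqrt t"
proof -
  define S where "S = {t :: complex. Re t > 0}"
  have S: "open S" "connected S"
    unfolding S_def by (auto simp: open_halfspace_Re_gt intro!: convex_connected convex_halfspace_Re_gt)
  have nz: "t \<noteq> 0" "t \<notin> \<real>\<^sub>\<le>\<^sub>0" "csqrt t \<noteq> 0" if "t \<in> S" for t
    using that by (auto simp: S_def complex_nonpos_Reals_iff)
  define F where "F t = gauss_period t w - gauss_dual t w / csqrt t" for t
  have hF: "F holomorphic_on S"
    unfolding F_def gauss_period_eq gauss_dual_def
    by (intro holomorphic_intros holomorphic_gauss_sum S(1) holomorphic_on_csqrt)
      (use nz Re_inverse_pos in \<open>auto simp: S_def Re_divide zero_less_divide_iff complex_nonpos_Reals_iff\<close>)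
  have "F t = 0"
  proof (rule analytic_continuation[OF hF S, of "of_real ` {0<..}" 1])
    show "complex_of_real ` {0<..} \<subseteq> S" by (auto simp: S_def)
    show "1 islimpt complex_of_real ` {0<..}"
    proof (unfold islimpt_approachable, intro allI impI)
      fix e :: real assume e: "e > 0"
      have "dist (complex_of_real (1 + e / 2)) (of_real 1) = e / 2"
        unfolding dist_of_real using e by (simp add: dist_real_def)
      then have d: "dist (complex_of_real (1 + e / 2)) 1 = e / 2" by (simp only: of_real_1)
      have "complex_of_real (1 + e / 2) \<noteq> 1 \<and> dist (complex_of_real (1 + e / 2)) 1 < e"
        using e d by (metis dist_self field_sum_of_halves half_gt_zero less_add_same_cancel2 less_irrefl)
      moreover have "complex_of_real (1 + e / 2) \<in> complex_of_real ` {0<..}"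
        using e by (intro imageI) simp
      ultimately show "\<exists>x'\<in>complex_of_real ` {0<..}. x' \<noteq> 1 \<and> dist x' 1 < e" by blast
    qed
    show "F z = 0" if "z \<in> complex_of_real ` {0<..}" for z
    proof -
      obtain x where x: "x > 0" "z = of_real x" using \<open>z \<in> _\<close> by blast
      then have "csqrt z = sqrt x" by (simp add: csqrt_of_real_nonneg)
      then show ?thesis unfolding F_def x(2) using poisson_gauss_real[OF x(1), of w] by simp
    qed
    show "t \<in> S" "1 \<in> S" using assms by (simp_all add: S_def)
  qed
  then show ?thesis by (simp add: F_def)
qed

section \<open>Theta functions and the isogeny of degree two\<close>

lemma abs_summable_times:
  fixes f :: "'a \<Rightarrow> 'c::{real_normed_div_algebra,banach}" and g :: "'b \<Rightarrow> 'c"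
  assumes "(\<lambda>x. norm (f x)) summable_on A" "(\<lambda>y. norm (g y)) summable_on B"
  shows "(\<lambda>(x, y). norm (f x * g y)) summable_on A \<times> B"
proof -
  have "(\<lambda>p. norm (case p of (x, y) \<Rightarrow> f x * g y)) summable_on A \<times> B"
  proof (rule Infinite_Sum.abs_summable_on_Sigma_iff[THEN iffD2], intro conjI ballI)
    show "(\<lambda>y. norm (case (x, y) of (x, y) \<Rightarrow> f x * g y)) summable_on B" for x
      using summable_on_cmult_right[OF assms(2), of "norm (f x)"] by (simp add: norm_mult)
    have "(\<Sum>\<^sub>\<infinity>y\<in>B. norm (case (x, y) of (x, y) \<Rightarrow> f x * g y)) = norm (f x) * (\<Sum>\<^sub>\<infinity>y\<in>B. norm (g y))" for x
      by (simp add: norm_mult infsum_cmult_right')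
    then show "(\<lambda>x. norm (\<Sum>\<^sub>\<infinity>y\<in>B. norm (case (x, y) of (x, y) \<Rightarrow> f x * g y))) summable_on A"
      using summable_on_cmult_left[OF assms(1), of "\<Sum>\<^sub>\<infinity>y\<in>B. norm (g y)"]
      by (simp add: abs_mult infsum_nonneg)
  qed
  then show ?thesis by (simp add: case_prod_unfold)
qed

lemma infsum_times:
  fixes f :: "'a \<Rightarrow> 'c::{real_normed_field,banach}" and g :: "'b \<Rightarrow> 'c"
  assumes "(\<lambda>x. norm (f x)) summable_on A" "(\<lambda>y. norm (g y)) summable_on B"
  shows "(\<Sum>\<^sub>\<infinity>(x, y)\<in>A \<times> B. f x * g y) = infsum f A * infsum g B"
proof -
  have "(\<lambda>p. case p of (x, y) \<Rightarrow> f x * g y) summable_on A \<times> B"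
    by (rule abs_summable_summable) (use abs_summable_times[OF assms] in \<open>simp add: case_prod_unfold\<close>)
  then have "(\<Sum>\<^sub>\<infinity>(x, y)\<in>A \<times> B. f x * g y) = (\<Sum>\<^sub>\<infinity>x\<in>A. \<Sum>\<^sub>\<infinity>y\<in>B. f x * g y)"
    by (subst infsum_Sigma'_banach) auto
  then show ?thesis by (simp add: infsum_cmult_right' infsum_cmult_left')
qed

text \<open>The two parity classes of \<open>n + m\<close> are parametrised separately by sum and
  difference of new variables, the usual device behind theta formulas of degree two.\<close>

lemma infsum_parity_split:
  fixes f :: "int \<Rightarrow> int \<Rightarrow> 'c::banach"
  assumes "(\<lambda>(n, m). norm (f n m)) summable_on UNIV"
  shows "(\<Sum>\<^sub>\<infinity>(n, m). f n m) = (\<Sum>\<^sub>\<infinity>(k, l). f (k + l) (k - l)) + (\<Sum>\<^sub>\<infinity>(k, l). f (k + l + 1) (k - l))"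
proof -
  have s: "(\<lambda>(n, m). f n m) summable_on X" for X
  proof (rule summable_on_subset_banach[OF abs_summable_summable])
    show "(\<lambda>p. norm (case p of (n, m) \<Rightarrow> f n m)) summable_on UNIV"
      using assms by (simp only: case_prod_unfold)
  qed simp
  let ?E = "{(n, m). even (n + m :: int)}" and ?O = "{(n, m). odd (n + m :: int)}"
  have "?E \<union> ?O = UNIV" by auto
  then have "(\<Sum>\<^sub>\<infinity>(n, m). f n m) = infsum (\<lambda>(n, m). f n m) (?E \<union> ?O)" by simp
  also have "\<dots> = infsum (\<lambda>(n, m). f n m) ?E + infsum (\<lambda>(n, m). f n m) ?O"
    by (intro infsum_Un_disjoint s) auto
  also have "infsum (\<lambda>(n, m). f n m) ?E = (\<Sum>\<^sub>\<infinity>(k, l). f (k + l) (k - l))"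
  proof (rule infsum_reindex_bij_witness[where i="\<lambda>(k, l). (k + l, k - l)" and j="\<lambda>(n, m). ((n + m) div 2, (n - m) div 2)"])
    fix a assume "a \<in> ?E"
    then obtain n m where a: "a = (n, m)" "even (n + m)" by blast
    then obtain c where "n + m = 2 * c" by (elim evenE)
    then have c: "n = 2 * c - m" by simp
    show "(case case a of (n, m) \<Rightarrow> ((n + m) div 2, (n - m) div 2) of (k, l) \<Rightarrow> (k + l, k - l)) = a"
      unfolding a(1) c by simp
    show "(case case a of (n, m) \<Rightarrow> ((n + m) div 2, (n - m) div 2) of (k, l) \<Rightarrow> f (k + l) (k - l)) = (case a of (n, m) \<Rightarrow> f n m)"
      unfolding a(1) c by simp
  qed auto
  also have "infsum (\<lambda>(n, m). f n m) ?O = (\<Sum>\<^sub>\<infinity>(k, l). f (k + l + 1) (k - l))"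
  proof (rule infsum_reindex_bij_witness[where i="\<lambda>(k, l). (k + l + 1, k - l)" and j="\<lambda>(n, m). ((n + m - 1) div 2, (n - m - 1) div 2)"])
    fix a assume "a \<in> ?O"
    then obtain n m where a: "a = (n, m)" "odd (n + m)" by blast
    then obtain c where "n + m = 2 * c + 1" by (elim oddE)
    then have c: "n = 2 * c + 1 - m" by simp
    have "n + m - 1 = c * 2" "n - m - 1 = (c - m) * 2" unfolding c by simp_all
    then have d: "(n + m - 1) div 2 = c" "(n - m - 1) div 2 = c - m"
      by (metis nonzero_mult_div_cancel_right zero_neq_numeral)+
    show "(case case a of (n, m) \<Rightarrow> ((n + m - 1) div 2, (n - m - 1) div 2) of (k, l) \<Rightarrow> (k + l + 1, k - l)) = a"
      unfolding a(1) case_prod_conv d c by simp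
    show "(case case a of (n, m) \<Rightarrow> ((n + m - 1) div 2, (n - m - 1) div 2) of (k, l) \<Rightarrow> f (k + l + 1) (k - l)) = (case a of (n, m) \<Rightarrow> f n m)"
      unfolding a(1) case_prod_conv d c by (simp add: algebra_simps)
  qed auto
  finally show ?thesis .
qed

text \<open>The theta function with characteristic \<open>p, q\<close> and parameter \<open>\<i>\<close>, times a Gaussian factor that makes
  multiplication of \<open>z\<close> by \<open>\<i>\<close> act by permuting the characteristics.\<close>

definition ph :: "real \<Rightarrow> real \<Rightarrow> complex \<Rightarrow> complex" where
  "ph p q z = exp (- of_real pi * z\<^sup>2 / 2) *
     (\<Sum>\<^sub>\<infinity>k::int. exp (- of_real pi * (of_int k + of_real p)\<^sup>2
        + 2 * of_real pi * (of_int k + of_real p) * (z + \<i> * of_real q)))"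

definition theta3 :: "real \<Rightarrow> real" where
  "theta3 t = (\<Sum>\<^sub>\<infinity>k::int. exp (- pi * t * (of_int k)\<^sup>2))"

lemma summable_real_gauss:
  assumes "t > 0"
  shows "(\<lambda>k::int. exp (- pi * t * (of_int k + a)\<^sup>2)) summable_on UNIV"
proof -
  have "(\<lambda>k::int. norm (exp (- complex_of_real pi * of_real t * (of_int k + of_real a)\<^sup>2))) summable_on UNIV"
    by (rule abs_summable_gauss_period) (use assms in simp)
  moreover have "norm (exp (- complex_of_real pi * of_real t * (of_int k + of_real a)\<^sup>2)) = exp (- pi * t * (of_int k + a)\<^sup>2)" for k :: int
  proof -
    have "- complex_of_real pi * of_real t * (of_int k + of_real a)\<^sup>2 = of_real (- pi * t * (of_int k + a)\<^sup>2)" by simp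
    then show ?thesis by (simp only: norm_exp_eq_Re Re_complex_of_real)
  qed
  ultimately show ?thesis by simp
qed

lemma gauss_period_of_real:
  assumes "t > 0"
  shows "gauss_period (of_real t) (of_real a) = of_real (\<Sum>\<^sub>\<infinity>k::int. exp (- pi * t * (of_int k + a)\<^sup>2))"
proof -
  have "exp (- complex_of_real pi * of_real t * (of_int k + of_real a)\<^sup>2) = of_real (exp (- pi * t * (of_int k + a)\<^sup>2))" for k :: int
  proof -
    have "- complex_of_real pi * of_real t * (of_int k + of_real a)\<^sup>2 = of_real (- pi * t * (of_int k + a)\<^sup>2)" by simp
    then show ?thesis by (simp only: exp_of_real)
  qed
  then show ?thesis
    unfolding gauss_period_def
    by (simp only:) (rule infsumI, rule has_sum_of_real, rule has_sum_infsum[OF summable_real_gauss[OF assms]])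
qed

text \<open>Poisson summation turns the shift into a phase in a series with positive coefficients,
  so the sum is largest without a shift.\<close>

lemma real_gauss_le_theta3:
  assumes "t > 0"
  shows "(\<Sum>\<^sub>\<infinity>k::int. exp (- pi * t * (of_int k + a)\<^sup>2)) \<le> theta3 t"
proof -
  let ?s = "\<lambda>a. \<Sum>\<^sub>\<infinity>k::int. exp (- pi * t * (of_int k + a)\<^sup>2)"
  have P: "complex_of_real (?s a) = gauss_dual (of_real t) (of_real a) / sqrt t" for a
    unfolding gauss_period_of_real[OF assms, symmetric] by (rule poisson_gauss_real[OF assms])
  have eq: "exp (- of_real pi / of_real t * of_int k ^ 2 + 2 * of_real pi * \<i> * of_real a * of_int k)
     = of_real (exp (- pi / t * (of_int k)\<^sup>2)) * cis (2 * pi * a * of_int k)" for k :: int and a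
    unfolding cis_conv_exp exp_of_real[symmetric] mult_exp_exp by (simp add: mult_ac)
  have s: "(\<lambda>k::int. exp (- pi / t * (of_int k)\<^sup>2)) summable_on UNIV"
    using summable_real_gauss[of "1 / t" 0] assms by simp
  have D0: "gauss_dual (of_real t) (of_real 0) = of_real (\<Sum>\<^sub>\<infinity>k::int. exp (- pi / t * (of_int k)\<^sup>2))"
    unfolding gauss_dual_def gauss_sum_def eq
    by (simp, rule infsumI, rule has_sum_of_real) (use has_sum_infsum[OF s] in simp)
  have "norm (gauss_dual (of_real t) (of_real a)) \<le> (\<Sum>\<^sub>\<infinity>k::int. exp (- pi / t * (of_int k)\<^sup>2))"
    unfolding gauss_dual_def gauss_sum_def eq
  proof (rule norm_infsum_le[OF has_sum_infsum has_sum_infsum[OF s]])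
    have n: "norm (complex_of_real (exp (- pi / t * (of_int k)\<^sup>2)) * cis (2 * pi * a * of_int k)) = exp (- pi / t * (of_int k)\<^sup>2)" for k :: int
      by (simp add: norm_mult)
    then show "norm (complex_of_real (exp (- pi / t * (of_int k)\<^sup>2)) * cis (2 * pi * a * of_int k)) \<le> exp (- pi / t * (of_int k)\<^sup>2)" for k :: int
      by (simp only: order_refl)
    show "(\<lambda>k::int. complex_of_real (exp (- pi / t * (of_int k)\<^sup>2)) * cis (2 * pi * a * of_int k)) summable_on UNIV"
      by (rule abs_summable_summable) (unfold n, rule s)
  qed
  also have "\<dots> = norm (gauss_dual (of_real t) (of_real 0))"
    unfolding D0 norm_of_real by (intro abs_of_nonneg[symmetric] infsum_nonneg) auto
  finally have "norm (complex_of_real (?s a)) \<le> norm (complex_of_real (?s 0))"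
    unfolding P norm_divide by (intro divide_right_mono) auto
  then have "\<bar>?s a\<bar> \<le> \<bar>?s 0\<bar>" unfolding norm_of_real .
  moreover have "?s a \<ge> 0" "?s 0 \<ge> 0" by (intro infsum_nonneg; simp)+
  ultimately show ?thesis by (simp add: theta3_def)
qed

lemma ph_term_norm:
  "norm (exp (- of_real pi * (of_int k + of_real p)\<^sup>2 + 2 * of_real pi * (of_int k + of_real p) * (z + \<i> * of_real q)))
    = exp (pi * (Re z)\<^sup>2) * exp (- pi * 1 * (of_int k + (p - Re z))\<^sup>2)" for p q :: real
proof -
  have "Re (- of_real pi * (of_int k + of_real p)\<^sup>2 + 2 * of_real pi * (of_int k + of_real p) * (z + \<i> * of_real q))
     = pi * (Re z)\<^sup>2 + - pi * 1 * (of_int k + (p - Re z))\<^sup>2"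
    by (simp add: power2_eq_square algebra_simps)
  then show ?thesis unfolding norm_exp_eq_Re exp_add[symmetric] by (simp only:)
qed

lemma abs_summable_ph:
  "(\<lambda>k::int. norm (exp (- of_real pi * (of_int k + of_real p)\<^sup>2
      + 2 * of_real pi * (of_int k + of_real p) * (z + \<i> * of_real q)))) summable_on UNIV" for p q :: real
  unfolding ph_term_norm by (intro summable_on_cmult_right summable_real_gauss) simp

text \<open>Thanks to the Gaussian factor in \<open>ph\<close> the bound depends on
  \<open>norm z\<close> alone. The shift by \<open>Re z\<close> that remains inside the sum is
  removed by \<open>real_gauss_le_theta3\<close>.\<close>

lemma norm_ph_le: "norm (ph p q z) \<le> theta3 1 * exp (pi * (norm z)\<^sup>2 / 2)"
proof -
  have "norm (ph p q z) \<le> norm (exp (- of_real pi * z\<^sup>2 / 2)) *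
      (\<Sum>\<^sub>\<infinity>k::int. norm (exp (- of_real pi * (of_int k + of_real p)\<^sup>2
        + 2 * of_real pi * (of_int k + of_real p) * (z + \<i> * of_real q))))"
    unfolding ph_def norm_mult
    by (intro mult_left_mono norm_infsum_bound abs_summable_ph norm_ge_zero)
  also have "\<dots> = exp (Re (- of_real pi * z\<^sup>2 / 2)) *
      (\<Sum>\<^sub>\<infinity>k::int. exp (pi * (Re z)\<^sup>2) * exp (- pi * 1 * (of_int k + (p - Re z))\<^sup>2))"
    unfolding ph_term_norm unfolding norm_exp_eq_Re ..
  also have "\<dots> = exp (Re (- of_real pi * z\<^sup>2 / 2)) * (exp (pi * (Re z)\<^sup>2) *
      (\<Sum>\<^sub>\<infinity>k::int. exp (- pi * 1 * (of_int k + (p - Re z))\<^sup>2)))"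
    by (simp only: infsum_cmult_right')
  also have "\<dots> \<le> exp (Re (- of_real pi * z\<^sup>2 / 2)) * (exp (pi * (Re z)\<^sup>2) * theta3 1)"
    by (intro mult_left_mono real_gauss_le_theta3) auto
  also have "\<dots> = theta3 1 * (exp (Re (- of_real pi * z\<^sup>2 / 2)) * exp (pi * (Re z)\<^sup>2))" by simp
  also have "exp (Re (- of_real pi * z\<^sup>2 / 2)) * exp (pi * (Re z)\<^sup>2) = exp (pi * (norm z)\<^sup>2 / 2)"
    unfolding exp_add[symmetric] cmod_power2
    by (rule arg_cong[where f=exp]) (simp add: power2_eq_square field_simps)
  finally show ?thesis .
qed

text \<open>Translation adds to the characteristics, up to an exponential. The isogeny formulas for
  other characteristics are thereby translates of the one for \<open>ph 0 0\<close>.\<close>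

lemma ph_shift:
  "ph p q (z + \<i> * of_real q' - of_real p') =
     exp (of_real pi * (z\<^sup>2 - (z + \<i> * of_real q' - of_real p')\<^sup>2) / 2 + of_real pi * of_real p' ^ 2
       - 2 * of_real pi * of_real p' * (z + \<i> * of_real (q + q'))) * ph (p + p') (q + q') z"
proof -
  let ?z = "z + \<i> * of_real q' - of_real p'"
  let ?X = "of_real pi * of_real p' ^ 2 - 2 * of_real pi * of_real p' * (z + \<i> * of_real (q + q'))"
  have "exp (- of_real pi * (of_int k + of_real p)\<^sup>2 + 2 * of_real pi * (of_int k + of_real p) * (?z + \<i> * of_real q))
     = exp ?X * exp (- of_real pi * (of_int k + of_real (p + p'))\<^sup>2
        + 2 * of_real pi * (of_int k + of_real (p + p')) * (z + \<i> * of_real (q + q')))" for k :: int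
    unfolding mult_exp_exp by (rule arg_cong[where f=exp]) (simp add: power2_eq_square algebra_simps)
  then have "ph p q ?z = exp (- of_real pi * ?z\<^sup>2 / 2) * exp ?X * (\<Sum>\<^sub>\<infinity>k::int. exp (- of_real pi * (of_int k + of_real (p + p'))\<^sup>2
        + 2 * of_real pi * (of_int k + of_real (p + p')) * (z + \<i> * of_real (q + q'))))"
    unfolding ph_def by (simp only: infsum_cmult_right' mult.assoc)
  also have "exp (- of_real pi * ?z\<^sup>2 / 2) * exp ?X = exp (of_real pi * (z\<^sup>2 - ?z\<^sup>2) / 2 + of_real pi * of_real p' ^ 2
       - 2 * of_real pi * of_real p' * (z + \<i> * of_real (q + q'))) * exp (- of_real pi * z\<^sup>2 / 2)"
    unfolding mult_exp_exp by (rule arg_cong[where f=exp]) (simp add: field_simps)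
  finally show ?thesis unfolding ph_def[of "p + p'"] by (simp only: mult.assoc)
qed

lemma ph_add_1_left: "ph (p + 1) q z = ph p q z"
proof -
  let ?f = "\<lambda>a. exp (- of_real pi * a\<^sup>2 + 2 * of_real pi * a * (z + \<i> * of_real q))"
  have "(\<Sum>\<^sub>\<infinity>k::int. ?f (of_int k + of_real (p + 1))) = (\<Sum>\<^sub>\<infinity>k::int. ?f (of_int k + of_real p))"
    by (rule infsum_reindex_bij_witness[where i="\<lambda>k. k - 1" and j="\<lambda>k. k + 1"]) (auto simp: add_ac)
  then show ?thesis unfolding ph_def by (simp only:)
qed

lemma ph_add_1_right: "ph p (q + 1) z = cis (2 * pi * p) * ph p q z"
proof -
  have "exp (- of_real pi * (of_int k + of_real p)\<^sup>2 + 2 * of_real pi * (of_int k + of_real p) * (z + \<i> * of_real (q + 1)))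
    = cis (2 * pi * p) * exp (- of_real pi * (of_int k + of_real p)\<^sup>2 + 2 * of_real pi * (of_int k + of_real p) * (z + \<i> * of_real q))" for k :: int
  proof -
    have "exp (- of_real pi * (of_int k + of_real p)\<^sup>2 + 2 * of_real pi * (of_int k + of_real p) * (z + \<i> * of_real (q + 1)))
      = exp (2 * of_real pi * \<i> * of_int k) * (cis (2 * pi * p) * exp (- of_real pi * (of_int k + of_real p)\<^sup>2 + 2 * of_real pi * (of_int k + of_real p) * (z + \<i> * of_real q)))"
      unfolding cis_conv_exp mult_exp_exp by (rule arg_cong[where f=exp]) (simp add: algebra_simps)
    then show ?thesis unfolding exp_2pi_int by simp
  qed
  then show ?thesis unfolding ph_def by (simp only: infsum_cmult_right') (simp add: mult_ac)
qed

lemma ph_minus: "ph p q (- z) = ph (- p) (- q) z"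
proof -
  let ?f = "\<lambda>(k::int) (p::real) (q::real) z. exp (- of_real pi * (of_int k + of_real p)\<^sup>2 + 2 * of_real pi * (of_int k + of_real p) * (z + \<i> * of_real q))"
  have "(\<Sum>\<^sub>\<infinity>k::int. ?f k p q (- z)) = (\<Sum>\<^sub>\<infinity>k::int. ?f k (- p) (- q) z)"
    by (rule infsum_reindex_bij_witness[where i=uminus and j=uminus])
      (auto simp: power2_eq_square algebra_simps)
  then show ?thesis unfolding ph_def by (simp only: power2_minus)
qed

text \<open>Poisson summation at parameter 1, that is, the transformation of theta functions under
  tau -> -1/tau at its fixed point \<open>\<i>\<close>. The Gaussian factor of \<open>ph\<close>
  absorbs the exponential that usually appears.\<close>

lemma ph_imaginary: "ph p q (\<i> * z) = cis (2 * pi * p * q) * ph (- q) p z"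
proof -
  let ?w = "of_real p - \<i> * z - \<i> * of_real q"
  have "ph p q (\<i> * z) = exp (of_real pi * z\<^sup>2 / 2 - of_real pi * (z + of_real q)\<^sup>2) * gauss_period 1 ?w"
  proof -
    have "exp (- of_real pi * (of_int k + of_real p)\<^sup>2 + 2 * of_real pi * (of_int k + of_real p) * (\<i> * z + \<i> * of_real q))
      = exp (- of_real pi * (z + of_real q)\<^sup>2) * exp (- of_real pi * 1 * (of_int k + ?w)\<^sup>2)" for k :: int
      unfolding mult_exp_exp by (rule arg_cong[where f=exp]) (simp add: power2_eq_square algebra_simps)
    moreover have "exp (- of_real pi * (\<i> * z)\<^sup>2 / 2) * exp (- of_real pi * (z + of_real q)\<^sup>2) = exp (of_real pi * z\<^sup>2 / 2 - of_real pi * (z + of_real q)\<^sup>2)"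
      unfolding mult_exp_exp by (rule arg_cong[where f=exp]) (simp add: power2_eq_square algebra_simps)
    ultimately show ?thesis
      unfolding ph_def gauss_period_def by (simp only: infsum_cmult_right' mult.assoc[symmetric])
  qed
  also have "gauss_period 1 ?w = gauss_dual 1 ?w" using poisson_gauss[of 1 ?w] by simp
  also have "\<dots> = exp (of_real pi * of_real q ^ 2 + 2 * of_real pi * of_real q * (z + \<i> * of_real p)) *
      (\<Sum>\<^sub>\<infinity>k::int. exp (- of_real pi * (of_int k + of_real (- q))\<^sup>2 + 2 * of_real pi * (of_int k + of_real (- q)) * (z + \<i> * of_real p)))"
    unfolding gauss_dual_def gauss_sum_def infsum_cmult_right'[symmetric] mult_exp_exp
    by (intro infsum_cong arg_cong[where f=exp]) (simp add: power2_eq_square algebra_simps)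
  also have "exp (of_real pi * z\<^sup>2 / 2 - of_real pi * (z + of_real q)\<^sup>2) *
     (exp (of_real pi * of_real q ^ 2 + 2 * of_real pi * of_real q * (z + \<i> * of_real p)) * S)
     = cis (2 * pi * p * q) * (exp (- of_real pi * z\<^sup>2 / 2) * S)" for S
    unfolding cis_conv_exp mult.assoc[symmetric] mult_exp_exp
    by (intro arg_cong2[where f="(*)"] arg_cong[where f=exp] refl) (simp add: power2_eq_square field_simps)
  finally show ?thesis unfolding ph_def[of "- q"] .
qed

lemma ph_half_left: "ph (- (1 / 2)) q z = ph (1 / 2) q z"
  using ph_add_1_left[of "- (1 / 2)" q z] by simp

lemma ph_half_right: "ph 0 (- (1 / 2)) z = ph 0 (1 / 2) z" "ph (1 / 2) (- (1 / 2)) z = - ph (1 / 2) (1 / 2) z"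
  using ph_add_1_right[of 0 "- (1 / 2)" z] ph_add_1_right[of "1 / 2" "- (1 / 2)" z] by simp_all

lemma ph_i: "ph 0 0 (\<i> * z) = ph 0 0 z" "ph 0 (1 / 2) (\<i> * z) = ph (1 / 2) 0 z"
  "ph (1 / 2) 0 (\<i> * z) = ph 0 (1 / 2) z" "ph (1 / 2) (1 / 2) (\<i> * z) = \<i> * ph (1 / 2) (1 / 2) z"
  by (simp_all add: ph_imaginary ph_half_left)

text \<open>As \<open>k\<^sup>2 - k\<close> is even, the parameter \<open>1\<close> may be replaced by \<open>1 + \<i>\<close>; Poisson summation for
  the latter is an eighth turn, and two of them combine to the isogeny by \<open>1 - \<i>\<close>.\<close>

lemma ph_eighth_turn:
  "ph 0 0 z = (\<Sum>\<^sub>\<infinity>n::int. exp (- of_real pi * z\<^sup>2 / 2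
      - of_real pi * (1 - \<i>) / 2 * (of_int n - 1 / 2 + \<i> * z)\<^sup>2)) / csqrt (1 + \<i>)"
    (is "_ = (\<Sum>\<^sub>\<infinity>n. ?E n) / _")
  and abs_summable_ph_eighth_turn: "(\<lambda>n::int. norm (exp (- of_real pi * z\<^sup>2 / 2
      - of_real pi * (1 - \<i>) / 2 * (of_int n - 1 / 2 + \<i> * z)\<^sup>2))) summable_on UNIV"
proof -
  let ?t = "1 + \<i>"
  have t0: "?t \<noteq> 0" by (simp add: complex_eq_iff)
  have inv: "1 / ?t = (1 - \<i>) / 2" by (simp add: complex_eq_iff Re_divide Im_divide)
  let ?a = "z + \<i> / 2"
  have "exp (- of_real pi * (of_int k)\<^sup>2 + 2 * of_real pi * of_int k * z)
     = exp (of_real pi / ?t * ?a\<^sup>2) * exp (- of_real pi * ?t * (of_int k + - ?a / ?t)\<^sup>2)" for k :: int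
  proof -
    \<comment> \<open>Passing from parameter 1 to \<open>1 + \<i>\<close> costs a factor
      \<open>exp (- pi * \<i> * k\<^sup>2) = exp (- pi * \<i> * k)\<close>, which the shift of
      \<open>z\<close> by \<open>\<i> / 2\<close> cancels.\<close>
    have "even (k * k - k)" by simp
    then obtain m where m: "k * k - k = 2 * m" by (rule evenE)
    have "exp (2 * of_real pi * \<i> * of_int m) = 1" by (rule exp_2pi_int)
    moreover have "of_int k * of_int k - of_int k = 2 * complex_of_int m"
      using arg_cong[OF m, of complex_of_int] by simp
    then have "of_real pi * \<i> * (of_int k * of_int k - of_int k) = 2 * of_real pi * \<i> * of_int m"
      by (simp only:) simp
    ultimately have e1: "exp (of_real pi * \<i> * (of_int k * of_int k - of_int k)) = 1"
      by (simp only:)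
    have sq: "of_real pi / t * a\<^sup>2 + - of_real pi * t * (of_int k + - a / t)\<^sup>2
      = - of_real pi * t * (of_int k)\<^sup>2 + 2 * of_real pi * of_int k * a" if "t \<noteq> 0" for a t :: complex
      using that by (simp add: power2_eq_square field_simps)
    have "of_real pi / ?t * ?a\<^sup>2 + - of_real pi * ?t * (of_int k + - ?a / ?t)\<^sup>2
      = - of_real pi * ?t * (of_int k)\<^sup>2 + 2 * of_real pi * of_int k * ?a"
      by (rule sq[OF t0])
    also have "\<dots> = - of_real pi * (of_int k)\<^sup>2 + 2 * of_real pi * of_int k * z - of_real pi * \<i> * (of_int k * of_int k - of_int k)"
      by (simp add: power2_eq_square algebra_simps)
    finally have "exp (of_real pi / ?t * ?a\<^sup>2 + - of_real pi * ?t * (of_int k + - ?a / ?t)\<^sup>2)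
      = exp (- of_real pi * (of_int k)\<^sup>2 + 2 * of_real pi * of_int k * z)"
      by (simp only: exp_diff e1 div_by_1)
    then show ?thesis unfolding mult_exp_exp by (rule sym)
  qed
  then have "ph 0 0 z = exp (- of_real pi * z\<^sup>2 / 2) * (exp (of_real pi / ?t * ?a\<^sup>2) * gauss_period ?t (- ?a / ?t))"
    unfolding ph_def gauss_period_def infsum_cmult_right'[symmetric] of_real_0 mult_zero_right add_0_right
    by (simp only:)
  also have "gauss_period ?t (- ?a / ?t) = gauss_dual ?t (- ?a / ?t) / csqrt ?t"
    by (rule poisson_gauss) simp
  finally have p: "ph 0 0 z = exp (- of_real pi * z\<^sup>2 / 2) * exp (of_real pi / ?t * ?a\<^sup>2) * gauss_dual ?t (- ?a / ?t) / csqrt ?t"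
    by (simp only: mult.assoc times_divide_eq_right)
  have E: "?E n = exp (- of_real pi * z\<^sup>2 / 2) * exp (of_real pi / ?t * ?a\<^sup>2) *
       exp (- of_real pi / ?t * of_int n ^ 2 + 2 * of_real pi * \<i> * (- ?a / ?t) * of_int n)" for n :: int
  proof -
    have "of_real pi / ?t * ?a\<^sup>2 + (- of_real pi / ?t * of_int n ^ 2 + 2 * of_real pi * \<i> * (- ?a / ?t) * of_int n)
        = of_real pi * (1 / ?t) * (?a\<^sup>2 - (of_int n)\<^sup>2 - 2 * \<i> * ?a * of_int n)"
      unfolding divide_inverse mult_1_left by (simp add: algebra_simps)
    also have "?a\<^sup>2 - (of_int n)\<^sup>2 - 2 * \<i> * ?a * of_int n = - (of_int n - 1 / 2 + \<i> * z)\<^sup>2"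
      by (simp add: power2_eq_square field_simps)
    finally show ?thesis unfolding mult_exp_exp inv
      by (intro arg_cong[where f=exp]) (simp add: algebra_simps)
  qed
  show "ph 0 0 z = (\<Sum>\<^sub>\<infinity>n. ?E n) / csqrt ?t"
    unfolding p E infsum_cmult_right' gauss_dual_def gauss_sum_def ..
  have "Re (- of_real pi / ?t) < 0"
    by (simp add: Re_divide power2_eq_square)
  then show "(\<lambda>n::int. norm (?E n)) summable_on UNIV"
    unfolding E norm_mult by (intro summable_on_cmult_right abs_summable_gauss_int)
qed

lemma ph_imaginary_minus: "ph p q (- (\<i> * z)) = cis (2 * pi * p * q) * ph q (- p) z"
  using ph_imaginary[of p q "- z"] by (simp add: ph_minus)

text \<open>With \<open>K = k + a\<close> and \<open>L = l + b\<close> the exponents at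
  \<open>K + L\<close> and \<open>K - L\<close> add up to a function of \<open>K\<close> plus a
  function of \<open>L\<close>. Left over is the phase of \<open>K\<^sup>2 + L\<^sup>2\<close>; by
  \<open>ab\<close> it is linear in \<open>K\<close> and \<open>L\<close> up to an eighth root of
  unity, and the linear part goes into the second characteristics \<open>- b\<close> and
  \<open>- a\<close>.\<close>

lemma ph_eighth_turn_pair:
  fixes x y z1 z2 :: complex and a b :: real
  assumes x: "x = (z1 + z2) / (1 - \<i>)" and y: "y = (z1 - z2) / (1 - \<i>)"
    and ab: "\<And>k l :: int. exp (of_real pi * \<i> * ((of_int k + of_real a)\<^sup>2 + (of_int l + of_real b)\<^sup>2)) =
      cis (pi / 4) * exp (- (2 * of_real pi * \<i> * ((of_int k + of_real a) * of_real b + (of_int l + of_real b) * of_real a)))"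
  shows "(\<Sum>\<^sub>\<infinity>(k::int, l::int).
      exp (- of_real pi * x\<^sup>2 / 2 - of_real pi * (1 - \<i>) / 2 * (of_int k + of_int l + of_real (a + b) + \<i> * x)\<^sup>2) *
      exp (- of_real pi * y\<^sup>2 / 2 - of_real pi * (1 - \<i>) / 2 * (of_int k - of_int l + of_real (a - b) + \<i> * y)\<^sup>2))
    = cis (pi / 4) * (ph a (- b) (- (\<i> * z1)) * ph b (- a) (- (\<i> * z2)))"
proof -
  let ?T = "\<lambda>(k::int) p q z. exp (- of_real pi * (of_int k + of_real p)\<^sup>2 + 2 * of_real pi * (of_int k + of_real p) * (z + \<i> * of_real q))"
  have t: "exp (- of_real pi * x\<^sup>2 / 2 - of_real pi * (1 - \<i>) / 2 * (of_int k + of_int l + of_real (a + b) + \<i> * x)\<^sup>2) *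
      exp (- of_real pi * y\<^sup>2 / 2 - of_real pi * (1 - \<i>) / 2 * (of_int k - of_int l + of_real (a - b) + \<i> * y)\<^sup>2)
    = cis (pi / 4) * (exp (- of_real pi * (- (\<i> * z1))\<^sup>2 / 2) * exp (- of_real pi * (- (\<i> * z2))\<^sup>2 / 2) *
       (?T k a (- b) (- (\<i> * z1)) * ?T l b (- a) (- (\<i> * z2))))" for k l :: int
  proof -
    define K L :: complex where "K = of_int k + of_real a" and "L = of_int l + of_real b"
    have z: "z1 = (1 - \<i>) / 2 * (x + y)" "z2 = (1 - \<i>) / 2 * (x - y)"
      by (simp_all add: x y complex_eq_iff Re_divide Im_divide power2_eq_square field_simps)
    have i2: "\<i> * (\<i> * w) = - w" for w by (simp flip: mult.assoc)
    have "- of_real pi * x\<^sup>2 / 2 - of_real pi * (1 - \<i>) / 2 * (K + L + \<i> * x)\<^sup>2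
        + (- of_real pi * y\<^sup>2 / 2 - of_real pi * (1 - \<i>) / 2 * (K - L + \<i> * y)\<^sup>2)
      = of_real pi * \<i> * (K\<^sup>2 + L\<^sup>2) + (- of_real pi * (- (\<i> * z1))\<^sup>2 / 2 + - of_real pi * (- (\<i> * z2))\<^sup>2 / 2 +
         ((- of_real pi * K\<^sup>2 + 2 * of_real pi * K * (- (\<i> * z1))) + (- of_real pi * L\<^sup>2 + 2 * of_real pi * L * (- (\<i> * z2)))))"
      unfolding z by (simp add: power2_eq_square field_simps i2)
    then have "exp (- of_real pi * x\<^sup>2 / 2 - of_real pi * (1 - \<i>) / 2 * (K + L + \<i> * x)\<^sup>2) *
        exp (- of_real pi * y\<^sup>2 / 2 - of_real pi * (1 - \<i>) / 2 * (K - L + \<i> * y)\<^sup>2)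
      = exp (of_real pi * \<i> * (K\<^sup>2 + L\<^sup>2)) * (exp (- of_real pi * (- (\<i> * z1))\<^sup>2 / 2) * exp (- of_real pi * (- (\<i> * z2))\<^sup>2 / 2) *
         (exp (- of_real pi * K\<^sup>2 + 2 * of_real pi * K * (- (\<i> * z1))) * exp (- of_real pi * L\<^sup>2 + 2 * of_real pi * L * (- (\<i> * z2)))))"
      by (simp only: mult_exp_exp)
    also have "exp (of_real pi * \<i> * (K\<^sup>2 + L\<^sup>2)) = cis (pi / 4) * exp (- (2 * of_real pi * \<i> * (K * of_real b + L * of_real a)))"
      unfolding K_def L_def by (rule ab)
    also have "cis (pi / 4) * exp (- (2 * of_real pi * \<i> * (K * of_real b + L * of_real a))) *
        (exp (- of_real pi * (- (\<i> * z1))\<^sup>2 / 2) * exp (- of_real pi * (- (\<i> * z2))\<^sup>2 / 2) *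
         (exp (- of_real pi * K\<^sup>2 + 2 * of_real pi * K * (- (\<i> * z1))) * exp (- of_real pi * L\<^sup>2 + 2 * of_real pi * L * (- (\<i> * z2)))))
      = cis (pi / 4) * (exp (- of_real pi * (- (\<i> * z1))\<^sup>2 / 2) * exp (- of_real pi * (- (\<i> * z2))\<^sup>2 / 2) *
         (exp (- of_real pi * K\<^sup>2 + 2 * of_real pi * K * (- (\<i> * z1) + \<i> * of_real (- b))) *
          exp (- of_real pi * L\<^sup>2 + 2 * of_real pi * L * (- (\<i> * z2) + \<i> * of_real (- a)))))"
      unfolding mult.assoc mult_exp_exp
      by (intro arg_cong2[where f="(*)"] arg_cong[where f=exp] refl) (simp add: algebra_simps)
    finally show ?thesis unfolding K_def L_def by (simp add: algebra_simps)
  qed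
  have "(\<Sum>\<^sub>\<infinity>(k::int, l::int). ?T k a (- b) (- (\<i> * z1)) * ?T l b (- a) (- (\<i> * z2)))
     = (\<Sum>\<^sub>\<infinity>k. ?T k a (- b) (- (\<i> * z1))) * (\<Sum>\<^sub>\<infinity>l. ?T l b (- a) (- (\<i> * z2)))"
    using infsum_times[OF abs_summable_ph[of a "- (\<i> * z1)" "- b"] abs_summable_ph[of b "- (\<i> * z2)" "- a"]] by simp
  then show ?thesis
    unfolding t ph_def case_prod_unfold infsum_cmult_right' by (simp add: mult_ac)
qed

lemma exp_pi_i_even: "even m \<Longrightarrow> exp (of_real pi * \<i> * of_int m) = 1"
  by (elim evenE) (use exp_2pi_int in \<open>simp add: mult_ac\<close>)

text \<open>Each factor is expanded by its eighth turn, and the parity split yields the shifts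
  \<open>(- 1/2, 0)\<close> and \<open>(0, 1/2)\<close>. The two factors
  \<open>1 / csqrt (1 + \<i>)\<close> and the constant \<open>cis (pi / 4)\<close> combine to
  \<open>1 / sqrt 2\<close>.\<close>

lemma isogeny_00:
  fixes z1 z2 :: complex
  assumes x: "x = (z1 + z2) / (1 - \<i>)" and y: "y = (z1 - z2) / (1 - \<i>)"
  shows "ph 0 0 x * ph 0 0 y =
    (ph 0 (1/2) z1 * ph (1/2) 0 z2 + ph (1/2) 0 z1 * ph 0 (1/2) z2) / sqrt 2"
proof -
  let ?E = "\<lambda>(n::int) z. exp (- of_real pi * z\<^sup>2 / 2 - of_real pi * (1 - \<i>) / 2 * (of_int n - 1 / 2 + \<i> * z)\<^sup>2)"
  have c: "csqrt (1 + \<i>) * csqrt (1 + \<i>) = 1 + \<i>"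
    by (metis power2_csqrt power2_eq_square)
  have E1: "?E (k + l) x * ?E (k - l) y =
      exp (- of_real pi * x\<^sup>2 / 2 - of_real pi * (1 - \<i>) / 2 * (of_int k + of_int l + of_real (- (1/2) + 0) + \<i> * x)\<^sup>2) *
      exp (- of_real pi * y\<^sup>2 / 2 - of_real pi * (1 - \<i>) / 2 * (of_int k - of_int l + of_real (- (1/2) - 0) + \<i> * y)\<^sup>2)" for k l
    by simp
  have E2: "?E (k + l + 1) x * ?E (k - l) y =
      exp (- of_real pi * x\<^sup>2 / 2 - of_real pi * (1 - \<i>) / 2 * (of_int k + of_int l + of_real (0 + 1/2) + \<i> * x)\<^sup>2) *
      exp (- of_real pi * y\<^sup>2 / 2 - of_real pi * (1 - \<i>) / 2 * (of_int k - of_int l + of_real (0 - 1/2) + \<i> * y)\<^sup>2)" for k l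
  proof -
    have "of_int (k + l + 1) - 1 / 2 = of_int k + of_int l + complex_of_real (0 + 1/2)"
      "of_int (k - l) - 1 / 2 = of_int k - of_int l + complex_of_real (0 - 1/2)" by (simp_all add: field_simps)
    then show ?thesis by (simp only:)
  qed
  have s1: "(\<Sum>\<^sub>\<infinity>(k, l). ?E (k + l) x * ?E (k - l) y) =
      cis (pi / 4) * (ph (- (1/2)) (- 0) (- (\<i> * z1)) * ph 0 (- (- (1/2))) (- (\<i> * z2)))"
    unfolding E1
  proof (rule ph_eighth_turn_pair[OF x y])
    fix k l :: int
    have "exp (of_real pi * \<i> * ((of_int k + complex_of_real (- (1/2)))\<^sup>2 + (of_int l + complex_of_real 0)\<^sup>2))
       = exp (\<i> * of_real (pi / 4)) * exp (- (2 * of_real pi * \<i> * ((of_int k + of_real (- (1/2))) * of_real 0 + (of_int l + of_real 0) * of_real (- (1/2)))))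
        * exp (of_real pi * \<i> * of_int ((k * k - k) + (l * l - l)))"
      unfolding mult_exp_exp by (rule arg_cong[where f=exp]) (simp add: power2_eq_square field_simps)
    also have "exp (of_real pi * \<i> * of_int ((k * k - k) + (l * l - l))) = 1"
      by (rule exp_pi_i_even) simp
    finally show "exp (of_real pi * \<i> * ((of_int k + complex_of_real (- (1/2)))\<^sup>2 + (of_int l + complex_of_real 0)\<^sup>2))
       = cis (pi / 4) * exp (- (2 * of_real pi * \<i> * ((of_int k + of_real (- (1/2))) * of_real 0 + (of_int l + of_real 0) * of_real (- (1/2)))))"
      by (simp only: cis_conv_exp mult_1_right)
  qed
  have s2: "(\<Sum>\<^sub>\<infinity>(k, l). ?E (k + l + 1) x * ?E (k - l) y) =
      cis (pi / 4) * (ph 0 (- (1/2)) (- (\<i> * z1)) * ph (1/2) (- 0) (- (\<i> * z2)))"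
    unfolding E2
  proof (rule ph_eighth_turn_pair[OF x y])
    fix k l :: int
    have "exp (of_real pi * \<i> * ((of_int k + complex_of_real 0)\<^sup>2 + (of_int l + complex_of_real (1/2))\<^sup>2))
       = exp (\<i> * of_real (pi / 4)) * exp (- (2 * of_real pi * \<i> * ((of_int k + of_real 0) * of_real (1/2) + (of_int l + of_real (1/2)) * of_real 0)))
        * exp (of_real pi * \<i> * of_int ((k * k + k) + (l * l + l)))"
      unfolding mult_exp_exp by (rule arg_cong[where f=exp]) (simp add: power2_eq_square field_simps)
    also have "exp (of_real pi * \<i> * of_int ((k * k + k) + (l * l + l))) = 1"
      by (rule exp_pi_i_even) simp
    finally show "exp (of_real pi * \<i> * ((of_int k + complex_of_real 0)\<^sup>2 + (of_int l + complex_of_real (1/2))\<^sup>2))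
       = cis (pi / 4) * exp (- (2 * of_real pi * \<i> * ((of_int k + of_real 0) * of_real (1/2) + (of_int l + of_real (1/2)) * of_real 0)))"
      by (simp only: cis_conv_exp mult_1_right)
  qed
  have "ph 0 0 x * ph 0 0 y = (infsum (\<lambda>n. ?E n x) UNIV * infsum (\<lambda>n. ?E n y) UNIV) / (1 + \<i>)"
    unfolding ph_eighth_turn[of x] ph_eighth_turn[of y] by (simp only: times_divide_times_eq c)
  also have "infsum (\<lambda>n. ?E n x) UNIV * infsum (\<lambda>n. ?E n y) UNIV = (\<Sum>\<^sub>\<infinity>(n, m). ?E n x * ?E m y)"
    using infsum_times[OF abs_summable_ph_eighth_turn[of x] abs_summable_ph_eighth_turn[of y]] by simp
  also have "\<dots> = (\<Sum>\<^sub>\<infinity>(k, l). ?E (k + l) x * ?E (k - l) y) + (\<Sum>\<^sub>\<infinity>(k, l). ?E (k + l + 1) x * ?E (k - l) y)"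
    by (rule infsum_parity_split)
      (use abs_summable_times[OF abs_summable_ph_eighth_turn[of x] abs_summable_ph_eighth_turn[of y]] in simp)
  also have "\<dots> = cis (pi / 4) * (ph 0 (1/2) z1 * ph (1/2) 0 z2 + ph (1/2) 0 z1 * ph 0 (1/2) z2)"
    unfolding s1 s2 ph_imaginary_minus by (simp add: ph_half_left ph_half_right distrib_left)
  also have "cis (pi / 4) = (1 + \<i>) / sqrt 2"
    by (simp add: complex_eq_iff cos_45 sin_45 real_div_sqrt field_simps)
  finally show ?thesis by (simp add: add_eq_0_iff complex_eq_iff)
qed

lemma ph_shift_i:
  "ph p q (z + \<i> * of_real c) = exp (- of_real pi * \<i> * of_real c * z + of_real (pi * c\<^sup>2 / 2)) * ph p (q + c) z"
proof -
  have "ph p q (z + \<i> * of_real c - of_real 0) = exp (- of_real pi * \<i> * of_real c * z + of_real (pi * c\<^sup>2 / 2)) * ph (p + 0) (q + c) z"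
    unfolding ph_shift by (intro arg_cong2[where f="(*)"] arg_cong[where f=exp] refl) (simp add: power2_eq_square field_simps)
  then show ?thesis by simp
qed

lemma ph_shift_real:
  "ph p q (z + of_real c) = exp (of_real pi * of_real c * z + of_real (pi * c\<^sup>2 / 2)) * cis (2 * pi * c * q) * ph (p - c) q z"
proof -
  have "ph p q (z + \<i> * of_real 0 - of_real (- c)) = exp (of_real pi * of_real c * z + of_real (pi * c\<^sup>2 / 2)) * cis (2 * pi * c * q) * ph (p + - c) (q + 0) z"
    unfolding ph_shift cis_conv_exp mult_exp_exp
    by (intro arg_cong2[where f="(*)"] arg_cong[where f=exp] refl) (simp add: power2_eq_square field_simps)
  then show ?thesis by simp
qed

context
  fixes z1 z2 x y :: complex
  assumes x: "x = (z1 + z2) / (1 - \<i>)" and y: "y = (z1 - z2) / (1 - \<i>)"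
begin

private lemma xy: "z1 = (1 - \<i>) / 2 * (x + y)" "z2 = (1 - \<i>) / 2 * (x - y)"
  by (simp_all add: x y complex_eq_iff Re_divide Im_divide power2_eq_square field_simps)

private lemma isogeny_shift:
  "ph 0 0 (x + a) * ph 0 0 (y + b) =
    (ph 0 (1/2) (z1 + (1 - \<i>) / 2 * (a + b)) * ph (1/2) 0 (z2 + (1 - \<i>) / 2 * (a - b))
     + ph (1/2) 0 (z1 + (1 - \<i>) / 2 * (a + b)) * ph 0 (1/2) (z2 + (1 - \<i>) / 2 * (a - b))) / sqrt 2"
  by (rule isogeny_00) (simp_all add: x y complex_eq_iff Re_divide Im_divide power2_eq_square field_simps)

private lemma i_mult: "\<i> * (\<i> * w) = - w" by (simp flip: mult.assoc)

text \<open>Translating \<open>x\<close> and \<open>y\<close> by \<open>\<i> / 2\<close> moves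
  \<open>z1\<close> by \<open>(1 + \<i>) / 2\<close> and leaves \<open>z2\<close> in place; the
  exponential \<open>?X\<close> common to both sides cancels.\<close>

lemma isogeny_0101:
  "ph 0 (1/2) x * ph 0 (1/2) y =
    (cis (pi / 4) * (ph 0 (1/2) z1 * ph 0 (1/2) z2) + cis (- (pi / 4)) * (ph (1/2) 0 z1 * ph (1/2) 0 z2)) / sqrt 2"
proof -
  let ?X = "exp (- of_real pi * \<i> * (x + y) / 2 + of_real (pi / 4))"
  let ?w = "z1 + 1 / 2 + \<i> / 2"
  have L: "ph 0 0 (x + \<i> / 2) * ph 0 0 (y + \<i> / 2) = ?X * (ph 0 (1/2) x * ph 0 (1/2) y)"
  proof -
    have "ph 0 0 (v + \<i> / 2) = exp (- of_real pi * \<i> * v / 2 + of_real (pi / 8)) * ph 0 (1/2) v" for v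
      using ph_shift_i[of 0 0 v "1/2"] by (simp add: power2_eq_square)
    moreover have "exp (- of_real pi * \<i> * x / 2 + of_real (pi / 8)) * exp (- of_real pi * \<i> * y / 2 + of_real (pi / 8)) = ?X"
      unfolding mult_exp_exp by (rule arg_cong[where f=exp]) (simp add: field_simps)
    ultimately show ?thesis by (simp only:) (simp only: mult_ac)
  qed
  have a: "(1 - \<i>) / 2 * (\<i> / 2 + \<i> / 2) = 1 / 2 + \<i> / 2" by (simp add: field_simps)
  have W: "ph 0 (1/2) ?w = ?X * cis (- (pi / 4)) * ph (1/2) 0 z1" "ph (1/2) 0 ?w = ?X * cis (pi / 4) * ph 0 (1/2) z1"
  proof -
    have r1: "ph 0 1 z1 = ph 0 0 z1" "ph (1/2) 1 z1 = - ph (1/2) 0 z1"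
      using ph_add_1_right[of 0 0 z1] ph_add_1_right[of "1/2" 0 z1] by simp_all
    have "ph 0 (1/2) ?w = exp (- of_real pi * \<i> * (1/2) * (z1 + 1/2) + of_real (pi / 8)) *
        (exp (of_real pi * (1/2) * z1 + of_real (pi / 8)) * cis (2 * pi * (1/2) * 1) * ph (- (1/2)) 1 z1)"
      using ph_shift_i[of 0 "1/2" "z1 + 1/2" "1/2"] ph_shift_real[of 0 1 z1 "1/2"] by (simp add: power2_eq_square)
    also have "\<dots> = exp (- of_real pi * \<i> * (1/2) * (z1 + 1/2) + of_real (pi / 8)) *
        exp (of_real pi * (1/2) * z1 + of_real (pi / 8)) * ph (1/2) 0 z1"
      by (simp add: ph_half_left r1)
    also have "exp (- of_real pi * \<i> * (1/2) * (z1 + 1/2) + of_real (pi / 8)) *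
        exp (of_real pi * (1/2) * z1 + of_real (pi / 8)) = ?X * cis (- (pi / 4))"
      unfolding cis_conv_exp mult_exp_exp xy by (rule arg_cong[where f=exp]) (simp add: field_simps i_mult)
    finally show "ph 0 (1/2) ?w = ?X * cis (- (pi / 4)) * ph (1/2) 0 z1" .
    have "ph (1/2) 0 ?w = exp (- of_real pi * \<i> * (1/2) * (z1 + 1/2) + of_real (pi / 8)) *
        (exp (of_real pi * (1/2) * z1 + of_real (pi / 8)) * cis (2 * pi * (1/2) * (1/2)) * ph 0 (1/2) z1)"
      using ph_shift_i[of "1/2" 0 "z1 + 1/2" "1/2"] ph_shift_real[of "1/2" "1/2" z1 "1/2"] by (simp add: power2_eq_square)
    also have "\<dots> = exp (- of_real pi * \<i> * (1/2) * (z1 + 1/2) + of_real (pi / 8)) *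
        exp (of_real pi * (1/2) * z1 + of_real (pi / 8)) * exp (\<i> * of_real (pi / 2)) * ph 0 (1/2) z1"
      by (simp add: cis_conv_exp)
    also have "exp (- of_real pi * \<i> * (1/2) * (z1 + 1/2) + of_real (pi / 8)) *
        exp (of_real pi * (1/2) * z1 + of_real (pi / 8)) * exp (\<i> * of_real (pi / 2)) = ?X * cis (pi / 4)"
      unfolding cis_conv_exp mult_exp_exp xy by (rule arg_cong[where f=exp]) (simp add: field_simps i_mult)
    finally show "ph (1/2) 0 ?w = ?X * cis (pi / 4) * ph 0 (1/2) z1" .
  qed
  have "?X * (ph 0 (1/2) x * ph 0 (1/2) y) =
     (ph 0 (1/2) ?w * ph (1/2) 0 z2 + ph (1/2) 0 ?w * ph 0 (1/2) z2) / sqrt 2"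
    using isogeny_shift[of "\<i> / 2" "\<i> / 2"] unfolding L a by (simp add: add_ac)
  also have "\<dots> = ?X * ((cis (pi / 4) * (ph 0 (1/2) z1 * ph 0 (1/2) z2) + cis (- (pi / 4)) * (ph (1/2) 0 z1 * ph (1/2) 0 z2)) / sqrt 2)"
    unfolding W by (simp add: algebra_simps)
  finally show ?thesis by (subst (asm) mult_left_cancel) (simp_all only: mult_eq_0_iff exp_not_eq_zero cis_neq_zero not_False_eq_True simp_thms)
qed

text \<open>Both arguments are translated by \<open>(\<i> - 1) / 2\<close>, so \<open>z1\<close>
  moves by the full period \<open>\<i>\<close>. The sign that \<open>ph (1/2) 0\<close> acquires
  there makes the right-hand side antisymmetric.\<close>

lemma isogeny_11:
  "ph (1/2) (1/2) x * ph (1/2) (1/2) y =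
    \<i> / sqrt 2 * (ph 0 (1/2) z1 * ph (1/2) 0 z2 - ph (1/2) 0 z1 * ph 0 (1/2) z2)"
proof -
  let ?a = "\<i> / 2 - 1 / 2"
  let ?X = "exp (- of_real pi * (\<i> + 1) * (x + y) / 2 + of_real (pi / 2)) * cis (- (pi / 2))"
  have sh: "ph 0 0 (v + ?a) = exp (- of_real pi * (\<i> + 1) * v / 2 + of_real (pi / 4)) * cis (- (pi / 4)) * ph (1/2) (1/2) v" for v
  proof -
    have "ph 0 0 (v + ?a) = exp (- of_real pi * \<i> * (1/2) * (v - 1/2) + of_real (pi / 8)) *
        (exp (- of_real pi * (1/2) * v + of_real (pi / 8)) * cis (- (pi / 2)) * ph (1/2) (1/2) v)"
    proof -
      have "v + ?a = v - 1/2 + \<i> * of_real (1/2)" by simp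
      moreover have "ph 0 0 (v - 1/2 + \<i> * of_real (1/2)) = exp (- of_real pi * \<i> * (1/2) * (v - 1/2) + of_real (pi / 8)) *
        (exp (- of_real pi * (1/2) * v + of_real (pi / 8)) * cis (- (pi / 2)) * ph (1/2) (1/2) v)"
        using ph_shift_i[of 0 0 "v - 1/2" "1/2"] ph_shift_real[of 0 "1/2" v "- (1/2)"] by (simp add: power2_eq_square)
      ultimately show ?thesis by (simp only:)
    qed
    also have "\<dots> = exp (- of_real pi * \<i> * (1/2) * (v - 1/2) + of_real (pi / 8)) *
        exp (- of_real pi * (1/2) * v + of_real (pi / 8)) * cis (- (pi / 2)) * ph (1/2) (1/2) v"
      by (simp only: mult.assoc)
    also have "exp (- of_real pi * \<i> * (1/2) * (v - 1/2) + of_real (pi / 8)) *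
        exp (- of_real pi * (1/2) * v + of_real (pi / 8)) * cis (- (pi / 2)) =
        exp (- of_real pi * (\<i> + 1) * v / 2 + of_real (pi / 4)) * cis (- (pi / 4))"
      unfolding cis_conv_exp mult_exp_exp by (rule arg_cong[where f=exp]) (simp add: field_simps)
    finally show ?thesis .
  qed
  have L: "ph 0 0 (x + ?a) * ph 0 0 (y + ?a) = ?X * (ph (1/2) (1/2) x * ph (1/2) (1/2) y)"
  proof -
    have "exp (- of_real pi * (\<i> + 1) * x / 2 + of_real (pi / 4)) * cis (- (pi / 4)) *
      (exp (- of_real pi * (\<i> + 1) * y / 2 + of_real (pi / 4)) * cis (- (pi / 4))) = ?X"
      unfolding cis_conv_exp mult_exp_exp by (rule arg_cong[where f=exp]) (simp add: field_simps)
    moreover have "a * b * P * (c * d * Q) = a * b * (c * d) * (P * Q)" for a b c d P Q :: complex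
      by (simp only: mult_ac)
    ultimately show ?thesis unfolding sh by (simp only:)
  qed
  have a: "(1 - \<i>) / 2 * (?a + ?a) = \<i>" by (simp add: field_simps)
  have W: "ph 0 (1/2) (z1 + \<i>) = exp (- of_real pi * \<i> * z1 + of_real (pi / 2)) * ph 0 (1/2) z1"
      "ph (1/2) 0 (z1 + \<i>) = - exp (- of_real pi * \<i> * z1 + of_real (pi / 2)) * ph (1/2) 0 z1"
    using ph_shift_i[of 0 "1/2" z1 1] ph_shift_i[of "1/2" 0 z1 1] ph_add_1_right[of 0 "1/2" z1] ph_add_1_right[of "1/2" 0 z1]
    by simp_all
  have e: "exp (- of_real pi * \<i> * z1 + of_real (pi / 2)) = ?X * \<i>"
  proof -
    have "exp (- of_real pi * \<i> * z1 + of_real (pi / 2)) = ?X * exp (\<i> * of_real (pi / 2))"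
      unfolding cis_conv_exp mult_exp_exp xy by (rule arg_cong[where f=exp]) (simp add: field_simps i_mult)
    also have "exp (\<i> * of_real (pi / 2)) = \<i>" by (simp only: cis_conv_exp[symmetric] cis_pi_half)
    finally show ?thesis .
  qed
  have "?X * (ph (1/2) (1/2) x * ph (1/2) (1/2) y) =
     (ph 0 (1/2) (z1 + \<i>) * ph (1/2) 0 z2 + ph (1/2) 0 (z1 + \<i>) * ph 0 (1/2) z2) / sqrt 2"
    using isogeny_shift[of ?a ?a] unfolding L a by simp
  also have "\<dots> = ?X * (\<i> / sqrt 2 * (ph 0 (1/2) z1 * ph (1/2) 0 z2 - ph (1/2) 0 z1 * ph 0 (1/2) z2))"
    unfolding W e by (simp add: algebra_simps diff_divide_distrib)
  finally show ?thesis by (subst (asm) mult_left_cancel) (simp_all only: mult_eq_0_iff exp_not_eq_zero cis_neq_zero not_False_eq_True simp_thms)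
qed

text \<open>Different translations, \<open>\<i> / 2\<close> for \<open>x\<close> and
  \<open>- 1/2\<close> for \<open>y\<close>, move \<open>z1\<close> by \<open>\<i> / 2\<close> and
  \<open>z2\<close> by \<open>1/2\<close>.\<close>

lemma isogeny_0110:
  "ph 0 (1/2) x * ph (1/2) 0 y = (ph 0 0 z1 * ph 0 0 z2 + \<i> * (ph (1/2) (1/2) z1 * ph (1/2) (1/2) z2)) / sqrt 2"
proof -
  let ?X = "exp (- of_real pi * \<i> * x / 2 - of_real pi * y / 2 + of_real (pi / 4))"
  have "ph 0 0 (x + \<i> / 2) = exp (- of_real pi * \<i> * x / 2 + of_real (pi / 8)) * ph 0 (1/2) x"
    using ph_shift_i[of 0 0 x "1/2"] by (simp add: power2_eq_square)
  moreover have "ph 0 0 (y - 1 / 2) = exp (- of_real pi * y / 2 + of_real (pi / 8)) * ph (1/2) 0 y"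
    using ph_shift_real[of 0 0 y "- (1/2)"] by (simp add: power2_eq_square)
  moreover have "exp (- of_real pi * \<i> * x / 2 + of_real (pi / 8)) * exp (- of_real pi * y / 2 + of_real (pi / 8)) = ?X"
    unfolding mult_exp_exp by (rule arg_cong[where f=exp]) (simp add: field_simps)
  ultimately have L: "ph 0 0 (x + \<i> / 2) * ph 0 0 (y + - (1 / 2)) = ?X * (ph 0 (1/2) x * ph (1/2) 0 y)"
    by (simp only: diff_conv_add_uminus[symmetric]) (simp only: mult_ac)
  have a: "(1 - \<i>) / 2 * (\<i> / 2 + - (1 / 2)) = \<i> / 2" "(1 - \<i>) / 2 * (\<i> / 2 - - (1 / 2)) = 1 / 2"
    by (simp_all add: field_simps)
  have r: "ph 0 1 z1 = ph 0 0 z1" using ph_add_1_right[of 0 0 z1] by simp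
  have W1: "ph 0 (1/2) (z1 + \<i> / 2) = exp (- of_real pi * \<i> * z1 / 2 + of_real (pi / 8)) * ph 0 0 z1"
      "ph (1/2) 0 (z1 + \<i> / 2) = exp (- of_real pi * \<i> * z1 / 2 + of_real (pi / 8)) * ph (1/2) (1/2) z1"
    using ph_shift_i[of 0 "1/2" z1 "1/2"] ph_shift_i[of "1/2" 0 z1 "1/2"] r by (simp_all add: power2_eq_square)
  have W2: "ph (1/2) 0 (z2 + 1 / 2) = exp (of_real pi * z2 / 2 + of_real (pi / 8)) * ph 0 0 z2"
      "ph 0 (1/2) (z2 + 1 / 2) = exp (of_real pi * z2 / 2 + of_real (pi / 8)) * (\<i> * ph (1/2) (1/2) z2)"
    using ph_shift_real[of "1/2" 0 z2 "1/2"] ph_shift_real[of 0 "1/2" z2 "1/2"]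
    by (simp_all add: power2_eq_square ph_half_left)
  have e: "exp (- of_real pi * \<i> * z1 / 2 + of_real (pi / 8)) * exp (of_real pi * z2 / 2 + of_real (pi / 8)) = ?X"
    unfolding mult_exp_exp xy by (rule arg_cong[where f=exp]) (simp add: field_simps i_mult)
  have "?X * (ph 0 (1/2) x * ph (1/2) 0 y) =
     (ph 0 (1/2) (z1 + \<i> / 2) * ph (1/2) 0 (z2 + 1 / 2) + ph (1/2) 0 (z1 + \<i> / 2) * ph 0 (1/2) (z2 + 1 / 2)) / sqrt 2"
    using isogeny_shift[of "\<i> / 2" "- (1 / 2)"] unfolding L a .
  also have "\<dots> = ?X * ((ph 0 0 z1 * ph 0 0 z2 + \<i> * (ph (1/2) (1/2) z1 * ph (1/2) (1/2) z2)) / sqrt 2)"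
    unfolding W1 W2 e[symmetric] by (simp only: distrib_left mult_ac times_divide_eq_right)
  finally show ?thesis by (subst (asm) mult_left_cancel) (simp_all only: mult_eq_0_iff exp_not_eq_zero cis_neq_zero not_False_eq_True simp_thms)
qed

end

section \<open>Sums over cosets in the Gaussian integers\<close>

text \<open>For \<open>p = 0\<close> and \<open>p = 1/2\<close> these are the four cosets of the
  ideal generated by \<open>1 + \<i>\<close> in the fractional ideal generated by
  \<open>1 / (1 + \<i>)\<close>.\<close>

definition coset :: "real \<Rightarrow> bool \<Rightarrow> complex set" where
  "coset p e = {Complex (of_int m + p) (of_int n + p) | m n. even (m + n) = e}"

lemma coset_I: "even (m + n) = e \<Longrightarrow> Complex (of_int m + p) (of_int n + p) \<in> coset p e"
  by (auto simp: coset_def)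

lemma coset_E:
  assumes "z \<in> coset p e"
  obtains m n where "z = Complex (of_int m + p) (of_int n + p)" "even (m + n) = e"
  using assms by (auto simp: coset_def)

lemma coset_disjoint: "coset p True \<inter> coset p False = {}"
  by (auto simp: coset_def)

abbreviation "K0 \<equiv> coset 0 True"
abbreviation "K1 \<equiv> coset 0 False"
abbreviation "K2 \<equiv> coset (1/2) True"
abbreviation "K3 \<equiv> coset (1/2) False"

lemma summable_coset_gauss:
  assumes "H > 0"
  shows "(\<lambda>z. exp (- pi * H * (norm z)\<^sup>2)) summable_on coset p e"
proof -
  let ?j = "\<lambda>(m::int, n::int). Complex (of_int m + p) (of_int n + p)"
  have inj: "inj ?j" by (auto simp: inj_def)
  have "(\<lambda>(m::int, n::int). norm (exp (- pi * H * (of_int m + p)\<^sup>2) * exp (- pi * H * (of_int n + p)\<^sup>2))) summable_on UNIV \<times> UNIV"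
    by (rule abs_summable_times) (use summable_real_gauss[OF assms] in auto)
  also have "(\<lambda>(m::int, n::int). norm (exp (- pi * H * (of_int m + p)\<^sup>2) * exp (- pi * H * (of_int n + p)\<^sup>2)))
      = (\<lambda>z. exp (- pi * H * (norm z)\<^sup>2)) \<circ> ?j"
    by (auto simp: fun_eq_iff cmod_power2 norm_mult mult_exp_exp algebra_simps)
  finally have "(\<lambda>z. exp (- pi * H * (norm z)\<^sup>2)) summable_on range ?j"
    using inj by (subst summable_on_reindex) (auto simp: o_def)
  then show ?thesis by (rule summable_on_subset) (auto simp: coset_def)
qed

definition lterm :: "(complex \<Rightarrow> complex) \<Rightarrow> (complex \<Rightarrow> complex) \<Rightarrow> real \<Rightarrow> real \<Rightarrow> real \<Rightarrow> complex \<Rightarrow> complex" where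
  "lterm f g Y r s z = of_real (exp (- pi * Y * (norm z)\<^sup>2)) * (f (of_real r * z) * g (of_real s * z))"

definition lsum :: "complex set \<Rightarrow> (complex \<Rightarrow> complex) \<Rightarrow> (complex \<Rightarrow> complex) \<Rightarrow> real \<Rightarrow> real \<Rightarrow> real \<Rightarrow> complex" where
  "lsum K f g Y r s = infsum (lterm f g Y r s) K"

definition gauss_bounded :: "(complex \<Rightarrow> complex) \<Rightarrow> bool" where
  "gauss_bounded f \<longleftrightarrow> (\<forall>z. norm (f z) \<le> theta3 1 * exp (pi * (norm z)\<^sup>2 / 2))"

lemma gauss_bounded_ph: "gauss_bounded (ph p q)"
  by (simp add: gauss_bounded_def norm_ph_le)

text \<open>The two theta factors use up \<open>(r\<^sup>2 + s\<^sup>2) / 2\<close> of the decay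
  rate \<open>Y\<close>. The convergence condition \<open>r\<^sup>2 + s\<^sup>2 < 2 * Y\<close>
  therefore says that the point \<open>(1, - Y, \<i> * r, s)\<close> lies in the ball.\<close>

lemma norm_lterm_le:
  assumes "gauss_bounded f" "gauss_bounded g"
  shows "norm (lterm f g Y r s z) \<le> (theta3 1)\<^sup>2 * exp (- pi * (Y - (r\<^sup>2 + s\<^sup>2) / 2) * (norm z)\<^sup>2)"
proof -
  have "norm (lterm f g Y r s z) = exp (- pi * Y * (norm z)\<^sup>2) * (norm (f (of_real r * z)) * norm (g (of_real s * z)))"
    by (simp add: lterm_def norm_mult)
  also have "\<dots> \<le> exp (- pi * Y * (norm z)\<^sup>2) * ((theta3 1 * exp (pi * (norm (of_real r * z))\<^sup>2 / 2)) * (theta3 1 * exp (pi * (norm (of_real s * z))\<^sup>2 / 2)))"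
  proof (intro mult_left_mono mult_mono)
    show "norm (f (of_real r * z)) \<le> theta3 1 * exp (pi * (norm (of_real r * z))\<^sup>2 / 2)"
      and "norm (g (of_real s * z)) \<le> theta3 1 * exp (pi * (norm (of_real s * z))\<^sup>2 / 2)"
      using assms unfolding gauss_bounded_def by blast+
    then show "0 \<le> theta3 1 * exp (pi * (norm (of_real r * z))\<^sup>2 / 2)" using norm_ge_zero order_trans by blast
  qed auto
  also have "\<dots> = (theta3 1)\<^sup>2 * (exp (- pi * Y * (norm z)\<^sup>2) * exp (pi * (norm (of_real r * z))\<^sup>2 / 2) * exp (pi * (norm (of_real s * z))\<^sup>2 / 2))"
    by (simp only: power2_eq_square mult_ac)
  also have "exp (- pi * Y * (norm z)\<^sup>2) * exp (pi * (norm (of_real r * z))\<^sup>2 / 2) * exp (pi * (norm (of_real s * z))\<^sup>2 / 2)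
      = exp (- pi * (Y - (r\<^sup>2 + s\<^sup>2) / 2) * (norm z)\<^sup>2)"
    unfolding mult_exp_exp by (rule arg_cong[where f=exp]) (simp add: norm_mult power_mult_distrib field_simps)
  finally show ?thesis .
qed

lemma abs_summable_lterm:
  assumes "gauss_bounded f" "gauss_bounded g" "r\<^sup>2 + s\<^sup>2 < 2 * Y"
  shows "(\<lambda>z. norm (lterm f g Y r s z)) summable_on coset p e"
proof (rule summable_on_comparison_test)
  show "(\<lambda>z. (theta3 1)\<^sup>2 * exp (- pi * (Y - (r\<^sup>2 + s\<^sup>2) / 2) * (norm z)\<^sup>2)) summable_on coset p e"
    using assms(3) by (intro summable_on_cmult_right summable_coset_gauss) simp
qed (use norm_lterm_le[OF assms(1,2)] in auto)

lemma infsum_pair_union: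
  fixes F G F' G' :: "complex \<Rightarrow> complex"
  assumes "\<And>X. X \<in> {A, B, C, D} \<Longrightarrow> (\<lambda>z. norm (F z)) summable_on X"
    and "\<And>X. X \<in> {A, B, C, D} \<Longrightarrow> (\<lambda>z. norm (G z)) summable_on X"
    and disj: "A \<times> B \<inter> C \<times> D = {}"
  shows "(\<Sum>\<^sub>\<infinity>(x, y)\<in>A \<times> B \<union> C \<times> D. F x * G y) = infsum F A * infsum G B + infsum F C * infsum G D"
    and "(\<lambda>(x, y). F x * G y) summable_on (A \<times> B \<union> C \<times> D)"
proof -
  have s: "(\<lambda>(x, y). F x * G y) summable_on X \<times> Y" if "X \<in> {A, B, C, D}" "Y \<in> {A, B, C, D}" for X Y
    by (rule abs_summable_summable) (use abs_summable_times[OF assms(1)[OF that(1)] assms(2)[OF that(2)]] in \<open>simp add: case_prod_unfold\<close>)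
  show "(\<Sum>\<^sub>\<infinity>(x, y)\<in>A \<times> B \<union> C \<times> D. F x * G y) = infsum F A * infsum G B + infsum F C * infsum G D"
    using infsum_Un_disjoint[OF s s disj] infsum_times[OF assms(1) assms(2)] by simp
  show "(\<lambda>(x, y). F x * G y) summable_on (A \<times> B \<union> C \<times> D)"
    by (rule summable_on_Un_disjoint[OF s s disj]) auto
qed

section \<open>The isogeny on pairs of cosets\<close>

definition isog :: "complex \<times> complex \<Rightarrow> complex \<times> complex" where
  "isog = (\<lambda>(x, y). ((x + y) / (1 - \<i>), (x - y) / (1 - \<i>)))"

lemma divide_1_minus_i: "z / (1 - \<i>) = Complex ((Re z - Im z) / 2) ((Re z + Im z) / 2)"
  by (simp add: complex_eq_iff Re_divide Im_divide power2_eq_square field_simps)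

lemma isog_isog: "isog (isog (x, y)) = (\<i> * x, \<i> * y)"
  by (simp add: isog_def divide_1_minus_i complex_eq_iff field_simps)

lemma norm_isog:
  "(norm ((x + y) / (1 - \<i>)))\<^sup>2 + (norm ((x - y) / (1 - \<i>)))\<^sup>2 = (norm x)\<^sup>2 + (norm y)\<^sup>2"
  unfolding divide_1_minus_i cmod_power2 by (simp add: power2_eq_square field_simps)

lemma i_coset: "z \<in> coset 0 e \<Longrightarrow> \<i> * z \<in> coset 0 e" "z \<in> coset (1/2) e \<Longrightarrow> \<i> * z \<in> coset (1/2) (\<not> e)"
proof -
  assume "z \<in> coset 0 e"
  then obtain m n where z: "z = Complex (of_int m + 0) (of_int n + 0)" "even (m + n) = e" by (rule coset_E)
  have "\<i> * z = Complex (of_int (- n) + 0) (of_int m + 0)" by (simp add: z complex_eq_iff)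
  moreover have "even (- n + m) = e" using z(2) by auto
  ultimately show "\<i> * z \<in> coset 0 e" by (metis coset_I)
next
  assume "z \<in> coset (1/2) e"
  then obtain m n where z: "z = Complex (of_int m + 1/2) (of_int n + 1/2)" "even (m + n) = e" by (rule coset_E)
  have "\<i> * z = Complex (of_int (- n - 1) + 1/2) (of_int m + 1/2)" by (simp add: z complex_eq_iff)
  moreover have "even (- n - 1 + m) = (\<not> e)" using z(2) by auto
  ultimately show "\<i> * z \<in> coset (1/2) (\<not> e)" by (metis coset_I)
qed

lemma coset_i_image: "bij_betw ((*) \<i>) (coset 0 e) (coset 0 e)" "bij_betw ((*) \<i>) (coset (1/2) e) (coset (1/2) (\<not> e))"
proof -
  have i4: "\<i> * (\<i> * (\<i> * (\<i> * z))) = z" for z by (simp add: complex_eq_iff)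
  have i4': "\<i> * (- \<i> * z) = z" "- \<i> * (\<i> * z) = z" "- \<i> * z = \<i> * (\<i> * (\<i> * z))" for z by (simp_all add: complex_eq_iff)
  show "bij_betw ((*) \<i>) (coset 0 e) (coset 0 e)"
    by (rule bij_betw_byWitness[where f'="\<lambda>z. - \<i> * z"]) (auto simp only: i4' i4 i_coset)
  have "\<i> * (\<i> * (\<i> * z)) \<in> coset (1/2) e" if "z \<in> coset (1/2) (\<not> e)" for z
    using i_coset(2)[OF i_coset(2)[OF i_coset(2)[OF that]]] by simp
  then show "bij_betw ((*) \<i>) (coset (1/2) e) (coset (1/2) (\<not> e))"
    by (intro bij_betw_byWitness[where f'="\<lambda>z. - \<i> * z"]) (auto simp only: i4' i4 i_coset)
qed

text \<open>The parity of \<open>a + b + c + d\<close> decides between integral and half-integral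
  coordinates, that of \<open>a + c\<close> between the two parity classes. The halves for
  \<open>p = 1/2\<close> only move one coordinate of the first component by 1, which puts the two
  components into different classes.\<close>

lemma isog_coset:
  assumes "z \<in> coset p e" "w \<in> coset p e'"
  shows "p = 0 \<Longrightarrow> e = e' \<Longrightarrow> isog (z, w) \<in> K0 \<times> K0 \<union> K1 \<times> K1"
    and "p = 0 \<Longrightarrow> e \<noteq> e' \<Longrightarrow> isog (z, w) \<in> K2 \<times> K2 \<union> K3 \<times> K3"
    and "p = 1/2 \<Longrightarrow> e = e' \<Longrightarrow> isog (z, w) \<in> K0 \<times> K1 \<union> K1 \<times> K0"
    and "p = 1/2 \<Longrightarrow> e \<noteq> e' \<Longrightarrow> isog (z, w) \<in> K2 \<times> K3 \<union> K3 \<times> K2"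
proof -
  obtain a b where z: "z = Complex (of_int a + p) (of_int b + p)" "even (a + b) = e" using assms(1) by (rule coset_E)
  obtain c d where w: "w = Complex (of_int c + p) (of_int d + p)" "even (c + d) = e'" using assms(2) by (rule coset_E)
  have I: "isog (z, w) = (Complex (of_int (a + c - b - d) / 2) (of_int (a + b + c + d) / 2 + 2 * p),
      Complex (of_int (a - c - b + d) / 2) (of_int (a - c + b - d) / 2))"
    by (simp add: isog_def divide_1_minus_i z w complex_eq_iff field_simps)
  have mem: "(Complex x y, Complex x' y') \<in> coset q u \<times> coset q u'"
    if "x = of_int m + q" "y = of_int n + q" "x' = of_int m' + q" "y' = of_int n' + q" "even (m + n) = u" "even (m' + n') = u'"
    for x y x' y' q u u' and m n m' n' :: int
    using that by (auto intro: coset_I)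
  {
    assume p: "p = 0" and "e = e'"
    then have "even (a + b + c + d)" using z(2) w(2) by (metis add.assoc even_add)
    then obtain h where "a + b + c + d = 2 * h" by (rule evenE)
    then have h: "a = 2 * h - b - c - d" by simp
    have "isog (z, w) \<in> coset 0 (even (a + c)) \<times> coset 0 (even (a + c))"
      unfolding I by (rule mem[of _ "h - b - d" _ _ h _ "h - b - c" _ "h - c - d"]) (simp_all add: h p field_simps)
    then show "isog (z, w) \<in> K0 \<times> K0 \<union> K1 \<times> K1" by (cases "even (a + c)") (simp_all only:, auto)
  }
  {
    assume p: "p = 1/2" and "e = e'"
    then have "even (a + b + c + d)" using z(2) w(2) by (metis add.assoc even_add)
    then obtain h where "a + b + c + d = 2 * h" by (rule evenE)
    then have h: "a = 2 * h - b - c - d" by simp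
    have "isog (z, w) \<in> coset 0 (\<not> even (a + c)) \<times> coset 0 (even (a + c))"
      unfolding I by (rule mem[of _ "h - b - d" _ _ "h + 1" _ "h - b - c" _ "h - c - d"]) (simp_all add: h p field_simps)
    then show "isog (z, w) \<in> K0 \<times> K1 \<union> K1 \<times> K0" by (cases "even (a + c)") (simp_all only:, auto)
  }
  {
    assume p: "p = 0" and "e \<noteq> e'"
    then have "odd (a + b + c + d)" using z(2) w(2) by (metis add.assoc even_add)
    then obtain h where "a + b + c + d = 2 * h + 1" by (rule oddE)
    then have h: "a = 2 * h + 1 - b - c - d" by simp
    have "isog (z, w) \<in> coset (1/2) (\<not> even (a + c)) \<times> coset (1/2) (\<not> even (a + c))"
      unfolding I by (rule mem[of _ "h - b - d" _ _ h _ "h - b - c" _ "h - c - d"]) (simp_all add: h p field_simps)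
    then show "isog (z, w) \<in> K2 \<times> K2 \<union> K3 \<times> K3" by (cases "even (a + c)") (simp_all only:, auto)
  }
  {
    assume p: "p = 1/2" and "e \<noteq> e'"
    then have "odd (a + b + c + d)" using z(2) w(2) by (metis add.assoc even_add)
    then obtain h where "a + b + c + d = 2 * h + 1" by (rule oddE)
    then have h: "a = 2 * h + 1 - b - c - d" by simp
    have "isog (z, w) \<in> coset (1/2) (even (a + c)) \<times> coset (1/2) (\<not> even (a + c))"
      unfolding I by (rule mem[of _ "h - b - d" _ _ "h + 1" _ "h - b - c" _ "h - c - d"]) (simp_all add: h p field_simps)
    then show "isog (z, w) \<in> K2 \<times> K3 \<union> K3 \<times> K2" by (cases "even (a + c)") (simp_all only:, auto)
  }
qed

text \<open>\<open>isog\<close> applied twice is multiplication by \<open>\<i>\<close>, which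
  preserves each of these unions. So \<open>isog\<close> followed by multiplication by
  \<open>- \<i>\<close> inverts it, and it is enough that \<open>isog\<close> maps the two unions
  into each other.\<close>

lemma bij_betw_isog:
  "bij_betw isog (K0 \<times> K0 \<union> K1 \<times> K1) (K0 \<times> K0 \<union> K1 \<times> K1)"
  "bij_betw isog (K2 \<times> K2 \<union> K3 \<times> K3) (K0 \<times> K1 \<union> K1 \<times> K0)"
  "bij_betw isog (K0 \<times> K1 \<union> K1 \<times> K0) (K2 \<times> K2 \<union> K3 \<times> K3)"
  "bij_betw isog (K2 \<times> K3 \<union> K3 \<times> K2) (K2 \<times> K3 \<union> K3 \<times> K2)"
proof -
  have inv: "bij_betw isog A B"
    if AB: "\<And>p. p \<in> A \<Longrightarrow> isog p \<in> B" and BA: "\<And>p. p \<in> B \<Longrightarrow> isog p \<in> A"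
      and iA: "\<And>x y. (x, y) \<in> A \<Longrightarrow> (\<i> * x, \<i> * y) \<in> A" for A B
  proof -
    let ?g = "\<lambda>p. case isog p of (x, y) \<Rightarrow> (- \<i> * x, - \<i> * y)"
    have mi: "- \<i> * x = \<i> * (\<i> * (\<i> * x))" for x by (simp add: complex_eq_iff)
    have h: "isog (- \<i> * x, - \<i> * y) = (case isog (x, y) of (u, v) \<Rightarrow> (- \<i> * u, - \<i> * v))" for x y
      by (simp add: isog_def divide_1_minus_i complex_eq_iff field_simps)
    have "?g (isog p) = p" "isog (?g p) = p" for p
    proof -
      obtain x y where p: "p = (x, y)" by (cases p)
      have c: "- \<i> * (\<i> * u) = u" for u by (simp add: complex_eq_iff)
      show "?g (isog p) = p" unfolding p isog_isog by (simp only: prod.case c)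
      show "isog (?g p) = p"
        unfolding p by (cases "isog (x, y)") (use h isog_isog[of x y] c in \<open>auto simp only: prod.case\<close>)
    qed
    moreover have "?g p \<in> A" if "p \<in> B" for p
    proof -
      obtain x y where xy: "isog p = (x, y)" by (cases "isog p")
      have "(x, y) \<in> A" using BA[OF \<open>p \<in> B\<close>] xy by simp
      then show ?thesis unfolding xy prod.case mi by (intro iA)
    qed
    ultimately show ?thesis
      using AB by (intro bij_betw_byWitness[where f'="?g"]) auto
  qed
  show "bij_betw isog (K0 \<times> K0 \<union> K1 \<times> K1) (K0 \<times> K0 \<union> K1 \<times> K1)"
    by (rule inv; use isog_coset(1)[of _ 0] i_coset in blast)
  show "bij_betw isog (K2 \<times> K2 \<union> K3 \<times> K3) (K0 \<times> K1 \<union> K1 \<times> K0)"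
    by (rule inv; use isog_coset(2)[of _ 0 True _ False] isog_coset(2)[of _ 0 False _ True] isog_coset(3)[of _ "1/2" True _ True] isog_coset(3)[of _ "1/2" False _ False] i_coset(2)[of _ True] i_coset(2)[of _ False] in fastforce)
  show "bij_betw isog (K0 \<times> K1 \<union> K1 \<times> K0) (K2 \<times> K2 \<union> K3 \<times> K3)"
    by (rule inv; use isog_coset(2)[of _ 0 True _ False] isog_coset(2)[of _ 0 False _ True] isog_coset(3)[of _ "1/2" True _ True] isog_coset(3)[of _ "1/2" False _ False] i_coset(1) in fastforce)
  show "bij_betw isog (K2 \<times> K3 \<union> K3 \<times> K2) (K2 \<times> K3 \<union> K3 \<times> K2)"
    by (rule inv; use isog_coset(4)[of _ "1/2" True _ False] isog_coset(4)[of _ "1/2" False _ True] i_coset(2)[of _ True] i_coset(2)[of _ False] in fastforce)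
qed

lemma lsum_i:
  assumes "\<And>z. f (\<i> * z) = a * f' z" "\<And>z. g (\<i> * z) = b * g' z"
  shows "lsum (coset 0 e) f g Y r s = a * b * lsum (coset 0 e) f' g' Y r s"
    and "lsum (coset (1/2) e) f g Y r s = a * b * lsum (coset (1/2) (\<not> e)) f' g' Y r s"
proof -
  have t: "lterm f g Y r s (\<i> * z) = a * b * lterm f' g' Y r s z" for z
  proof -
    have c: "of_real x * (\<i> * z) = \<i> * (of_real x * z)" for x :: real by simp
    have n: "norm (\<i> * z) = norm z" by (simp add: norm_mult)
    have "u * (a * v * (b * w)) = a * b * (u * (v * w))" for u v w by (simp only: mult_ac)
    then show ?thesis unfolding lterm_def c n assms .
  qed
  have r: "lsum K f g Y r s = a * b * lsum K' f' g' Y r s" if "bij_betw ((*) \<i>) K' K" for K K'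
  proof -
    have "lsum K f g Y r s = (\<Sum>\<^sub>\<infinity>z\<in>K'. lterm f g Y r s (\<i> * z))"
      unfolding lsum_def by (rule infsum_reindex_bij_betw[OF that, symmetric])
    then show ?thesis unfolding t lsum_def infsum_cmult_right' .
  qed
  show "lsum (coset 0 e) f g Y r s = a * b * lsum (coset 0 e) f' g' Y r s"
    by (rule r[OF coset_i_image(1)])
  show "lsum (coset (1/2) e) f g Y r s = a * b * lsum (coset (1/2) (\<not> e)) f' g' Y r s"
    by (rule r) (use coset_i_image(2)[of "\<not> e"] in simp)
qed

lemma isogeny_expansion:
  fixes c e :: complex
  shows "(u * v) * ((c * (h1 * l1 + e * (k1 * m1))) * (c * (h2 * l2 + e * (k2 * m2)))) =
    c\<^sup>2 * ((u * (h1 * h2)) * (v * (l1 * l2)) + e * ((u * (h1 * k2)) * (v * (l1 * m2)))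
      + e * ((u * (k1 * h2)) * (v * (m1 * l2))) + (e * e) * ((u * (k1 * k2)) * (v * (m1 * m2))))"
  by (simp add: algebra_simps power2_eq_square)

text \<open>The isogeny formula is applied at the arguments scaled by \<open>r\<close> and at those
  scaled by \<open>s\<close>, and \<open>norm_isog\<close> keeps the Gaussian weight of the pair.
  The sign \<open>\<epsilon>\<close> separates the even theta function from the odd one.\<close>

lemma isogeny_sums:
  fixes f h k :: "complex \<Rightarrow> complex" and Y r s :: real
  assumes iso: "\<And>x y. f ((x + y) / (1 - \<i>)) * f ((x - y) / (1 - \<i>)) = c * (h x * k y + \<epsilon> * (k x * h y))"
    and eps: "\<epsilon> * \<epsilon> = 1"
    and gb: "gauss_bounded f" "gauss_bounded h" "gauss_bounded k" and rs: "r\<^sup>2 + s\<^sup>2 < 2 * Y"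
    and bij: "bij_betw isog (A \<times> B \<union> C \<times> D) (A' \<times> B' \<union> C' \<times> D')"
    and disj: "A \<times> B \<inter> C \<times> D = {}" "A' \<times> B' \<inter> C' \<times> D' = {}"
    and cos: "{A, B, C, D, A', B', C', D'} \<subseteq> range (case_prod coset)"
  defines "S \<equiv> \<lambda>X f g. lsum X f g Y r s"
  shows "S A' f f * S B' f f + S C' f f * S D' f f =
    c\<^sup>2 * ((S A h h * S B k k + S C h h * S D k k) + \<epsilon> * (S A h k * S B k h + S C h k * S D k h)
      + \<epsilon> * (S A k h * S B h k + S C k h * S D h k) + (S A k k * S B h h + S C k k * S D h h))"
proof -
  let ?L = "\<lambda>f g. lterm f g Y r s"
  let ?P = "A \<times> B \<union> C \<times> D"
  have sm: "(\<lambda>z. norm (?L f g z)) summable_on X"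
    if "gauss_bounded f" "gauss_bounded g" "X \<in> {A, B, C, D, A', B', C', D'}" for f g X
  proof -
    have "X \<in> range (case_prod coset)" by (rule subsetD[OF cos that(3)])
    then obtain p e where "X = coset p e" by auto
    then show ?thesis by (simp only: abs_summable_lterm[OF that(1,2) rs])
  qed
  have ps: "(\<Sum>\<^sub>\<infinity>(x, y)\<in>?P. ?L u v x * ?L u' v' y) = S A u v * S B u' v' + S C u v * S D u' v'"
    and pm: "(\<lambda>(x, y). ?L u v x * ?L u' v' y) summable_on ?P"
    if "gauss_bounded u" "gauss_bounded v" "gauss_bounded u'" "gauss_bounded v'" for u v u' v'
    unfolding S_def lsum_def
    by (rule infsum_pair_union[OF _ _ disj(1)]; rule sm[OF that(1,2)] sm[OF that(3,4)]; simp only: insert_iff; blast)+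
  have t: "(case isog (x, y) of (x, y) \<Rightarrow> ?L f f x * ?L f f y) =
      c\<^sup>2 * (?L h h x * ?L k k y + \<epsilon> * (?L h k x * ?L k h y) + \<epsilon> * (?L k h x * ?L h k y) + ?L k k x * ?L h h y)" for x y
  proof -
    let ?x = "(x + y) / (1 - \<i>)" and ?y = "(x - y) / (1 - \<i>)"
    have e: "exp (- pi * Y * (norm ?x)\<^sup>2) * exp (- pi * Y * (norm ?y)\<^sup>2) = exp (- pi * Y * (norm x)\<^sup>2) * exp (- pi * Y * (norm y)\<^sup>2)"
      unfolding mult_exp_exp distrib_left[symmetric] norm_isog ..
    have R: "f (of_real r * ?x) * f (of_real r * ?y) = c * (h (of_real r * x) * k (of_real r * y) + \<epsilon> * (k (of_real r * x) * h (of_real r * y)))" for r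
      using iso[of "of_real r * x" "of_real r * y"] by (simp add: distrib_left right_diff_distrib)
    have "?L f f ?x * ?L f f ?y = of_real (exp (- pi * Y * (norm ?x)\<^sup>2) * exp (- pi * Y * (norm ?y)\<^sup>2)) *
       ((f (of_real r * ?x) * f (of_real r * ?y)) * (f (of_real s * ?x) * f (of_real s * ?y)))"
    proof -
      have "(a * (b * c)) * (a' * (b' * c')) = (a * a') * ((b * b') * (c * c'))" for a b c a' b' c' :: complex
        by (simp only: mult_ac)
      then show ?thesis unfolding lterm_def of_real_mult .
    qed
    also have "\<dots> = of_real (exp (- pi * Y * (norm x)\<^sup>2) * exp (- pi * Y * (norm y)\<^sup>2)) *
       ((c * (h (of_real r * x) * k (of_real r * y) + \<epsilon> * (k (of_real r * x) * h (of_real r * y)))) *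
        (c * (h (of_real s * x) * k (of_real s * y) + \<epsilon> * (k (of_real s * x) * h (of_real s * y)))))"
      unfolding e R ..
    also have "\<dots> = c\<^sup>2 * (?L h h x * ?L k k y + \<epsilon> * (?L h k x * ?L k h y) + \<epsilon> * (?L k h x * ?L h k y) + (\<epsilon> * \<epsilon>) * (?L k k x * ?L h h y))"
      unfolding lterm_def of_real_mult by (rule isogeny_expansion)
    finally show ?thesis unfolding isog_def prod.case eps mult_1_left .
  qed
  have "S A' f f * S B' f f + S C' f f * S D' f f = (\<Sum>\<^sub>\<infinity>(x, y)\<in>A' \<times> B' \<union> C' \<times> D'. ?L f f x * ?L f f y)"
    unfolding S_def lsum_def
    by (rule infsum_pair_union(1)[symmetric, OF _ _ disj(2)]; rule sm[OF gb(1) gb(1)]; simp only: insert_iff; blast)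
  also have "\<dots> = (\<Sum>\<^sub>\<infinity>p\<in>?P. case isog p of (x, y) \<Rightarrow> ?L f f x * ?L f f y)"
    by (rule infsum_reindex_bij_betw[OF bij, symmetric])
  also have "\<dots> = (\<Sum>\<^sub>\<infinity>p\<in>?P. c\<^sup>2 * ((case p of (x, y) \<Rightarrow> ?L h h x * ?L k k y) + \<epsilon> * (case p of (x, y) \<Rightarrow> ?L h k x * ?L k h y)
      + \<epsilon> * (case p of (x, y) \<Rightarrow> ?L k h x * ?L h k y) + (case p of (x, y) \<Rightarrow> ?L k k x * ?L h h y)))"
  proof (rule infsum_cong)
    fix p assume "p \<in> ?P"
    obtain x y where p: "p = (x, y)" by (cases p)
    show "(case isog p of (x, y) \<Rightarrow> ?L f f x * ?L f f y) = c\<^sup>2 * ((case p of (x, y) \<Rightarrow> ?L h h x * ?L k k y) + \<epsilon> * (case p of (x, y) \<Rightarrow> ?L h k x * ?L k h y)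
      + \<epsilon> * (case p of (x, y) \<Rightarrow> ?L k h x * ?L h k y) + (case p of (x, y) \<Rightarrow> ?L k k x * ?L h h y))"
      unfolding p t prod.case ..
  qed
  also have "\<dots> = c\<^sup>2 * ((S A h h * S B k k + S C h h * S D k k) + \<epsilon> * (S A h k * S B k h + S C h k * S D k h)
      + \<epsilon> * (S A k h * S B h k + S C k h * S D h k) + (S A k k * S B h h + S C k k * S D h h))"
    unfolding infsum_cmult_right'
    by (subst infsum_add | intro summable_on_add summable_on_cmult_right pm gb | simp only: infsum_cmult_right' ps gb)+
  finally show ?thesis .
qed

abbreviation "p00 \<equiv> ph 0 0"
abbreviation "p01 \<equiv> ph 0 (1/2)"
abbreviation "p10 \<equiv> ph (1/2) 0"
abbreviation "p11 \<equiv> ph (1/2) (1/2)"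

context
  fixes Y r s :: real
  assumes rs: "r\<^sup>2 + s\<^sup>2 < 2 * Y"
begin

private abbreviation (input) "S X f g \<equiv> lsum X f g Y r s"

text \<open>All come from the substitution \<open>z \<mapsto> \<i> * z\<close>. Two factors
  \<open>p11\<close> produce \<open>\<i> * \<i> = - 1\<close>, so their sum over \<open>K0\<close>
  or \<open>K1\<close> is its own negative, whereas \<open>K2\<close> and \<open>K3\<close> are
  exchanged.\<close>

lemma lsum_symmetries:
  "S (coset 0 e) p11 p11 = 0" "S (coset 0 e) p10 p10 = S (coset 0 e) p01 p01" "S (coset 0 e) p10 p01 = S (coset 0 e) p01 p10"
  "S K3 p00 p00 = S K2 p00 p00" "S K3 p11 p11 = - S K2 p11 p11"
  "S K2 p10 p10 = S K3 p01 p01" "S K3 p10 p10 = S K2 p01 p01"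
  "S K2 p10 p01 = S K3 p01 p10" "S K3 p10 p01 = S K2 p01 p10"
proof -
  have i: "p00 (\<i> * z) = 1 * p00 z" "p01 (\<i> * z) = 1 * p10 z" "p10 (\<i> * z) = 1 * p01 z" "p11 (\<i> * z) = \<i> * p11 z" for z
    by (simp_all add: ph_i)
  show "S (coset 0 e) p11 p11 = 0"
    using lsum_i(1)[of p11 \<i> p11 p11 \<i> p11 e Y r s, OF i(4) i(4)] by simp
  show "S (coset 0 e) p10 p10 = S (coset 0 e) p01 p01" "S (coset 0 e) p10 p01 = S (coset 0 e) p01 p10"
    "S K3 p00 p00 = S K2 p00 p00" "S K3 p11 p11 = - S K2 p11 p11"
    "S K2 p10 p10 = S K3 p01 p01" "S K3 p10 p10 = S K2 p01 p01"
    "S K2 p10 p01 = S K3 p01 p10" "S K3 p10 p01 = S K2 p01 p10"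
    using lsum_i(1)[of p10 1 p01 p10 1 p01 e Y r s, OF i(3) i(3)] lsum_i(1)[of p10 1 p01 p01 1 p10 e Y r s, OF i(3) i(2)]
      lsum_i(2)[of p00 1 p00 p00 1 p00 False Y r s, OF i(1) i(1)] lsum_i(2)[of p11 \<i> p11 p11 \<i> p11 False Y r s, OF i(4) i(4)]
      lsum_i(2)[of p10 1 p01 p10 1 p01 True Y r s, OF i(3) i(3)] lsum_i(2)[of p10 1 p01 p10 1 p01 False Y r s, OF i(3) i(3)]
      lsum_i(2)[of p10 1 p01 p01 1 p10 True Y r s, OF i(3) i(2)] lsum_i(2)[of p10 1 p01 p01 1 p10 False Y r s, OF i(3) i(2)] by simp_all
qed

lemma coset_pairs_disjoint:
  "coset p True \<times> X \<inter> coset p False \<times> X' = {}" "coset p False \<times> X \<inter> coset p True \<times> X' = {}"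
  using coset_disjoint[of p] by auto

text \<open>The first two sums of squares and products are those of the even theta function, the other
  two those of the odd one.\<close>

lemma lsum_relations:
  "(S K0 p00 p00)\<^sup>2 + (S K1 p00 p00)\<^sup>2 = (S K0 p01 p01)\<^sup>2 + (S K1 p01 p01)\<^sup>2 + (S K0 p01 p10)\<^sup>2 + (S K1 p01 p10)\<^sup>2"
  "(S K0 p01 p01)\<^sup>2 + (S K1 p01 p01)\<^sup>2 = (S K0 p01 p10)\<^sup>2 + (S K1 p01 p10)\<^sup>2"
  "S K0 p00 p00 * S K1 p00 p00 = S K2 p01 p01 * S K3 p01 p01 + S K2 p01 p10 * S K3 p01 p10"
  "S K2 p01 p01 * S K3 p01 p01 = S K2 p01 p10 * S K3 p01 p10"
  "(S K2 p00 p00)\<^sup>2 = S K0 p01 p01 * S K1 p01 p01 + S K0 p01 p10 * S K1 p01 p10"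
  "(S K2 p11 p11)\<^sup>2 = S K0 p01 p10 * S K1 p01 p10 - S K0 p01 p01 * S K1 p01 p01"
  "2 * (S K2 p00 p00)\<^sup>2 = (S K2 p01 p01)\<^sup>2 + (S K3 p01 p01)\<^sup>2 + (S K2 p01 p10)\<^sup>2 + (S K3 p01 p10)\<^sup>2"
  "2 * (S K2 p11 p11)\<^sup>2 = (S K2 p01 p01)\<^sup>2 + (S K3 p01 p01)\<^sup>2 - (S K2 p01 p10)\<^sup>2 - (S K3 p01 p10)\<^sup>2"
proof -
  have c: "(1 / complex_of_real (sqrt 2))\<^sup>2 = 1 / 2" "(\<i> / complex_of_real (sqrt 2))\<^sup>2 = - 1 / 2"
    by (simp_all add: power_divide flip: of_real_power)
  have i0: "p00 ((x + y) / (1 - \<i>)) * p00 ((x - y) / (1 - \<i>)) = 1 / complex_of_real (sqrt 2) * (p01 x * p10 y + 1 * (p10 x * p01 y))" for x y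
    using isogeny_00[OF refl refl, of x y] by simp
  have i1: "p11 ((x + y) / (1 - \<i>)) * p11 ((x - y) / (1 - \<i>)) = \<i> / complex_of_real (sqrt 2) * (p01 x * p10 y + (- 1) * (p10 x * p01 y))" for x y
    using isogeny_11[OF refl refl, of x y] by simp
  have m1: "(- 1) * (- 1) = (1 :: complex)" by simp
  note even = isogeny_sums[OF i0 _ gauss_bounded_ph gauss_bounded_ph gauss_bounded_ph rs, unfolded c]
  note odd = isogeny_sums[OF i1 _ gauss_bounded_ph gauss_bounded_ph gauss_bounded_ph rs, unfolded c]
  have "coset q u \<in> range (case_prod coset)" for q u by (rule range_eqI[of _ _ "(q, u)"]) simp
  then have cs: "{coset q1 u1, coset q2 u2, coset q3 u3, coset q4 u4, coset q5 u5, coset q6 u6, coset q7 u7, coset q8 u8}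
    \<subseteq> range (case_prod coset)" for q1 u1 q2 u2 q3 u3 q4 u4 q5 u5 q6 u6 q7 u7 q8 u8 by (simp only: insert_subset empty_subsetI simp_thms)
  show "(S K0 p00 p00)\<^sup>2 + (S K1 p00 p00)\<^sup>2 = (S K0 p01 p01)\<^sup>2 + (S K1 p01 p01)\<^sup>2 + (S K0 p01 p10)\<^sup>2 + (S K1 p01 p10)\<^sup>2"
    using even[OF mult_1_left bij_betw_isog(1) coset_pairs_disjoint(1) coset_pairs_disjoint(1) cs]
    unfolding lsum_symmetries by algebra
  show "(S K0 p01 p01)\<^sup>2 + (S K1 p01 p01)\<^sup>2 = (S K0 p01 p10)\<^sup>2 + (S K1 p01 p10)\<^sup>2"
    using odd[OF m1 bij_betw_isog(1) coset_pairs_disjoint(1) coset_pairs_disjoint(1) cs]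
    unfolding lsum_symmetries by algebra
  show "S K0 p00 p00 * S K1 p00 p00 = S K2 p01 p01 * S K3 p01 p01 + S K2 p01 p10 * S K3 p01 p10"
    using even[OF mult_1_left bij_betw_isog(2) coset_pairs_disjoint(1) coset_pairs_disjoint(1) cs]
    unfolding lsum_symmetries by algebra
  show "S K2 p01 p01 * S K3 p01 p01 = S K2 p01 p10 * S K3 p01 p10"
    using odd[OF m1 bij_betw_isog(2) coset_pairs_disjoint(1) coset_pairs_disjoint(1) cs]
    unfolding lsum_symmetries by algebra
  show "(S K2 p00 p00)\<^sup>2 = S K0 p01 p01 * S K1 p01 p01 + S K0 p01 p10 * S K1 p01 p10"
    using even[OF mult_1_left bij_betw_isog(3) coset_pairs_disjoint(1) coset_pairs_disjoint(1) cs]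
    unfolding lsum_symmetries by algebra
  show "(S K2 p11 p11)\<^sup>2 = S K0 p01 p10 * S K1 p01 p10 - S K0 p01 p01 * S K1 p01 p01"
    using odd[OF m1 bij_betw_isog(3) coset_pairs_disjoint(1) coset_pairs_disjoint(1) cs]
    unfolding lsum_symmetries by algebra
  show "2 * (S K2 p00 p00)\<^sup>2 = (S K2 p01 p01)\<^sup>2 + (S K3 p01 p01)\<^sup>2 + (S K2 p01 p10)\<^sup>2 + (S K3 p01 p10)\<^sup>2"
    using even[OF mult_1_left bij_betw_isog(4) coset_pairs_disjoint(1) coset_pairs_disjoint(1) cs]
    unfolding lsum_symmetries by algebra
  show "2 * (S K2 p11 p11)\<^sup>2 = (S K2 p01 p01)\<^sup>2 + (S K3 p01 p01)\<^sup>2 - (S K2 p01 p10)\<^sup>2 - (S K3 p01 p10)\<^sup>2"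
    using odd[OF m1 bij_betw_isog(4) coset_pairs_disjoint(1) coset_pairs_disjoint(1) cs]
    unfolding lsum_symmetries by algebra
qed

end

section \<open>Dilation by the prime element and the quadratic transformation\<close>

lemma bij_betw_mult_1_i:
  "bij_betw ((*) (1 + \<i>)) (K0 \<union> K1) K0" "bij_betw ((*) (1 + \<i>)) (K2 \<union> K3) K1"
proof -
  have m: "(1 + \<i>) * Complex a b = Complex (a - b) (a + b)" for a b
    by (simp add: complex_eq_iff)
  have inj: "inj_on ((*) (1 + \<i>)) X" for X
    by (rule inj_onI) (simp add: complex_eq_iff)
  have "(*) (1 + \<i>) ` (K0 \<union> K1) = K0"
  proof (intro subset_antisym subsetI)
    fix z assume "z \<in> (*) (1 + \<i>) ` (K0 \<union> K1)"
    then obtain e w where "w \<in> coset 0 e" "z = (1 + \<i>) * w" by blast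
    then obtain a b where "z = Complex (of_int (a - b) + 0) (of_int (a + b) + 0)" by (auto elim!: coset_E simp: m)
    then show "z \<in> K0" by (simp only: coset_I) (rule coset_I, simp)
  next
    fix z assume "z \<in> K0"
    then obtain a b where z: "z = Complex (of_int a + 0) (of_int b + 0)" "even (a + b)" by (elim coset_E) simp
    obtain h where "a + b = 2 * h" using z(2) by (rule evenE)
    then have h: "b = 2 * h - a" by simp
    have "z = (1 + \<i>) * Complex (of_int h + 0) (of_int (h - a) + 0)" by (simp add: m z h)
    moreover have "Complex (of_int h + 0) (of_int (h - a) + 0) \<in> coset 0 (even (h + (h - a)))" by (rule coset_I) simp
    then have "Complex (of_int h + 0) (of_int (h - a) + 0) \<in> K0 \<union> K1" by (cases "even (h + (h - a))") (simp_all only:, auto)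
    ultimately show "z \<in> (*) (1 + \<i>) ` (K0 \<union> K1)" by blast
  qed
  then show "bij_betw ((*) (1 + \<i>)) (K0 \<union> K1) K0" using inj by (simp add: bij_betw_def)
  have "(*) (1 + \<i>) ` (K2 \<union> K3) = K1"
  proof (intro subset_antisym subsetI)
    fix z assume "z \<in> (*) (1 + \<i>) ` (K2 \<union> K3)"
    then obtain e w where "w \<in> coset (1/2) e" "z = (1 + \<i>) * w" by blast
    then obtain a b where "z = Complex (of_int (a - b) + 0) (of_int (a + b + 1) + 0)" by (auto elim!: coset_E simp: m)
    then show "z \<in> K1" by (simp only: coset_I) (rule coset_I, simp)
  next
    fix z assume "z \<in> K1"
    then obtain a b where z: "z = Complex (of_int a + 0) (of_int b + 0)" "odd (a + b)" by (elim coset_E) simp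
    obtain h where "a + b = 2 * h + 1" using z(2) by (rule oddE)
    then have h: "b = 2 * h + 1 - a" by simp
    have "z = (1 + \<i>) * Complex (of_int h + 1/2) (of_int (h - a) + 1/2)" by (simp add: m z h)
    moreover have "Complex (of_int h + 1/2) (of_int (h - a) + 1/2) \<in> coset (1/2) (even (h + (h - a)))" by (rule coset_I) simp
    then have "Complex (of_int h + 1/2) (of_int (h - a) + 1/2) \<in> K2 \<union> K3" by (cases "even (h + (h - a))") (simp_all only:, auto)
    ultimately show "z \<in> (*) (1 + \<i>) ` (K2 \<union> K3)" by blast
  qed
  then show "bij_betw ((*) (1 + \<i>)) (K2 \<union> K3) K1" using inj by (simp add: bij_betw_def)
qed

text \<open>As \<open>1 + \<i> = 2 / (1 - \<i>)\<close>, the arguments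
  \<open>r * (1 + \<i>) * z\<close> and \<open>s * (1 + \<i>) * z\<close> are the isogeny images of
  \<open>(r + s) * z\<close> and \<open>(r - s) * z\<close>, and \<open>norm z\<close> squared
  doubles. A sum at \<open>(Y, r, s)\<close> thus becomes a combination of sums at
  \<open>(2 * Y, r - s, r + s)\<close>.\<close>

lemma lsum_dilation:
  assumes fg: "\<And>x y. f ((x + y) / (1 - \<i>)) * g ((x - y) / (1 - \<i>)) = c * (h x * k y) + c' * (h' x * k' y)"
    and gb: "gauss_bounded h" "gauss_bounded k" "gauss_bounded h'" "gauss_bounded k'" and rs: "r\<^sup>2 + s\<^sup>2 < 2 * Y"
    and bij: "bij_betw ((*) (1 + \<i>)) (coset p True \<union> coset p False) K"
  shows "lsum K f g Y r s =
     c * (lsum (coset p True) k h (2 * Y) (r - s) (r + s) + lsum (coset p False) k h (2 * Y) (r - s) (r + s))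
   + c' * (lsum (coset p True) k' h' (2 * Y) (r - s) (r + s) + lsum (coset p False) k' h' (2 * Y) (r - s) (r + s))"
proof -
  let ?K = "coset p True \<union> coset p False"
  have rs': "(r - s)\<^sup>2 + (r + s)\<^sup>2 < 2 * (2 * Y)"
    using rs by (simp add: power2_eq_square algebra_simps)
  have sm: "lterm u v (2 * Y) (r - s) (r + s) summable_on coset p e" if "gauss_bounded u" "gauss_bounded v" for u v e
    using abs_summable_summable[OF abs_summable_lterm[OF that rs']] .
  have un: "infsum (lterm u v (2 * Y) (r - s) (r + s)) ?K = lsum (coset p True) u v (2 * Y) (r - s) (r + s) + lsum (coset p False) u v (2 * Y) (r - s) (r + s)"
    "lterm u v (2 * Y) (r - s) (r + s) summable_on ?K"
    if "gauss_bounded u" "gauss_bounded v" for u v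
    unfolding lsum_def using infsum_Un_disjoint[OF sm sm coset_disjoint] summable_on_Un_disjoint[OF sm sm coset_disjoint] that by blast+
  have t: "lterm f g Y r s ((1 + \<i>) * z) = c * lterm k h (2 * Y) (r - s) (r + s) z + c' * lterm k' h' (2 * Y) (r - s) (r + s) z" for z
  proof -
    let ?x = "of_real (r + s) * z" and ?y = "of_real (r - s) * z"
    have "of_real r * ((1 + \<i>) * z) = (?x + ?y) / (1 - \<i>)" "of_real s * ((1 + \<i>) * z) = (?x - ?y) / (1 - \<i>)"
      by (simp_all add: divide_1_minus_i complex_eq_iff algebra_simps)
    then have F: "f (of_real r * ((1 + \<i>) * z)) * g (of_real s * ((1 + \<i>) * z)) = c * (h ?x * k ?y) + c' * (h' ?x * k' ?y)"
      by (simp only: fg)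
    have "(norm (1 + \<i>))\<^sup>2 = 2" by (simp add: cmod_power2)
    then have "- pi * Y * (norm ((1 + \<i>) * z))\<^sup>2 = - pi * (2 * Y) * (norm z)\<^sup>2"
      by (simp only: norm_mult power_mult_distrib)
    then have "lterm f g Y r s ((1 + \<i>) * z) = of_real (exp (- pi * (2 * Y) * (norm z)\<^sup>2)) * (c * (h ?x * k ?y) + c' * (h' ?x * k' ?y))"
      unfolding lterm_def F by (simp only:)
    also have "\<dots> = c * lterm k h (2 * Y) (r - s) (r + s) z + c' * lterm k' h' (2 * Y) (r - s) (r + s) z"
      unfolding lterm_def by (simp only: distrib_left mult_ac)
    finally show ?thesis .
  qed
  have "lsum K f g Y r s = (\<Sum>\<^sub>\<infinity>z\<in>?K. lterm f g Y r s ((1 + \<i>) * z))"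
    unfolding lsum_def by (rule infsum_reindex_bij_betw[OF bij, symmetric])
  also have "\<dots> = c * infsum (lterm k h (2 * Y) (r - s) (r + s)) ?K + c' * infsum (lterm k' h' (2 * Y) (r - s) (r + s)) ?K"
    unfolding t infsum_cmult_right'[symmetric]
    by (rule infsum_add; intro summable_on_cmult_right un gb)
  finally show ?thesis by (simp only: un(1) gb)
qed

lemma lsum_dilations:
  assumes rs: "r\<^sup>2 + s\<^sup>2 < 2 * Y"
  defines "S' \<equiv> \<lambda>X f g. lsum X f g (2 * Y) (r - s) (r + s)"
  shows "lsum K0 p00 p00 Y r s = of_real (sqrt 2) * (S' K0 p01 p10 + S' K1 p01 p10)"
    "lsum K1 p00 p00 Y r s = of_real (sqrt 2) * (S' K2 p01 p10 + S' K3 p01 p10)"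
    "lsum K0 p01 p01 Y r s = S' K0 p01 p01 + S' K1 p01 p01"
    "lsum K1 p01 p01 Y r s = S' K2 p01 p01 + S' K3 p01 p01"
    "of_real (sqrt 2) * lsum K0 p01 p10 Y r s = S' K0 p00 p00 + S' K1 p00 p00"
    "of_real (sqrt 2) * lsum K1 p01 p10 Y r s = 2 * S' K2 p00 p00"
proof -
  have rs': "(r - s)\<^sup>2 + (r + s)\<^sup>2 < 2 * (2 * Y)"
    using rs by (simp add: power2_eq_square algebra_simps)
  note sym = lsum_symmetries[OF rs']
  let ?q = "complex_of_real (sqrt 2)"
  have q: "?q * ?q = 2" by (simp flip: of_real_mult)
  have q0: "?q \<noteq> 0" by simp
  have q2: "1 / ?q = ?q / 2" using q by (simp add: field_simps)
  have i0: "p00 ((x + y) / (1 - \<i>)) * p00 ((x - y) / (1 - \<i>)) = 1 / ?q * (p01 x * p10 y) + 1 / ?q * (p10 x * p01 y)" for x y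
    using isogeny_00[OF refl refl, of x y] by (simp add: add_divide_distrib)
  have i1: "p01 ((x + y) / (1 - \<i>)) * p01 ((x - y) / (1 - \<i>)) = cis (pi / 4) / ?q * (p01 x * p01 y) + cis (- (pi / 4)) / ?q * (p10 x * p10 y)" for x y
    using isogeny_0101[OF refl refl, of x y] by (simp add: add_divide_distrib)
  have i2: "p01 ((x + y) / (1 - \<i>)) * p10 ((x - y) / (1 - \<i>)) = 1 / ?q * (p00 x * p00 y) + \<i> / ?q * (p11 x * p11 y)" for x y
    using isogeny_0110[OF refl refl, of x y] by (simp add: add_divide_distrib)
  note gp = gauss_bounded_ph gauss_bounded_ph gauss_bounded_ph gauss_bounded_ph
  have c1: "cis (pi / 4) / ?q + cis (- (pi / 4)) / ?q = 1"
    by (simp add: complex_eq_iff cos_45 Re_divide Im_divide power2_eq_square field_simps)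
  show "lsum K0 p00 p00 Y r s = ?q * (S' K0 p01 p10 + S' K1 p01 p10)"
    unfolding lsum_dilation[OF i0 gp rs bij_betw_mult_1_i(1)] sym S'_def q2 by (simp add: field_simps)
  show "lsum K1 p00 p00 Y r s = ?q * (S' K2 p01 p10 + S' K3 p01 p10)"
    unfolding lsum_dilation[OF i0 gp rs bij_betw_mult_1_i(2)] sym S'_def q2 by (simp add: field_simps)
  have c1': "cis (pi / 4) / ?q * u + cis (- (pi / 4)) / ?q * u = u" for u
    using c1 by (simp only: distrib_right[symmetric] mult_1_left)
  show "lsum K0 p01 p01 Y r s = S' K0 p01 p01 + S' K1 p01 p01"
    unfolding lsum_dilation[OF i1 gp rs bij_betw_mult_1_i(1)] sym S'_def by (rule c1')
  show "lsum K1 p01 p01 Y r s = S' K2 p01 p01 + S' K3 p01 p01"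
    unfolding lsum_dilation[OF i1 gp rs bij_betw_mult_1_i(2)] sym S'_def
    using c1'[of "S' K2 p01 p01 + S' K3 p01 p01"] by (simp only: S'_def add.commute)
  show "?q * lsum K0 p01 p10 Y r s = S' K0 p00 p00 + S' K1 p00 p00"
    unfolding lsum_dilation[OF i2 gp rs bij_betw_mult_1_i(1)] sym S'_def using q0 by (simp add: field_simps)
  show "?q * lsum K1 p01 p10 Y r s = 2 * S' K2 p00 p00"
    unfolding lsum_dilation[OF i2 gp rs bij_betw_mult_1_i(2)] sym S'_def using q0 by (simp add: field_simps)
qed

text \<open>The theta constants \<open>0000,0000\<close>, \<open>1100,0000\<close>, \<open>0000,1100\<close> and the square of \<open>1111,1111\<close> at the
  point \<open>(1, - Y, \<i> r, s)\<close>, as sums over the Gaussian integers.\<close>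

definition tA :: "real \<Rightarrow> real \<Rightarrow> real \<Rightarrow> complex" where
  "tA Y r s = lsum K0 p00 p00 Y r s + lsum K1 p00 p00 Y r s"
definition tB :: "real \<Rightarrow> real \<Rightarrow> real \<Rightarrow> complex" where
  "tB Y r s = 2 * lsum K2 p00 p00 Y r s"
definition tC :: "real \<Rightarrow> real \<Rightarrow> real \<Rightarrow> complex" where
  "tC Y r s = lsum K0 p00 p00 Y r s - lsum K1 p00 p00 Y r s"
definition tD2 :: "real \<Rightarrow> real \<Rightarrow> real \<Rightarrow> complex" where
  "tD2 Y r s = - 4 * (lsum K2 p11 p11 Y r s)\<^sup>2"

text \<open>The relations at \<open>(Y, r, s)\<close> turn the four factors on the right into 4
  times the squares of \<open>f0 + f1\<close>, \<open>f0 - f1\<close>, \<open>e0 + e1\<close> and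
  \<open>e0 - e1\<close>, and the dilation expresses the constants at the image by the same four
  sums.\<close>

theorem quadratic_transformation:
  assumes rs: "r\<^sup>2 + s\<^sup>2 < 2 * Y"
  defines "A \<equiv> tA Y r s" and "B \<equiv> tB Y r s" and "C \<equiv> tC Y r s" and "D2 \<equiv> tD2 Y r s"
    and "A' \<equiv> tA (2 * Y) (r - s) (r + s)" and "B' \<equiv> tB (2 * Y) (r - s) (r + s)"
    and "C' \<equiv> tC (2 * Y) (r - s) (r + s)" and "D2' \<equiv> tD2 (2 * Y) (r - s) (r + s)"
  shows "4 * (A'\<^sup>2 - B'\<^sup>2)\<^sup>2 = (A\<^sup>2 + B\<^sup>2 + C\<^sup>2 - D2) * (A\<^sup>2 - B\<^sup>2 + C\<^sup>2 + D2)"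
    "4 * (C'\<^sup>2 + D2')\<^sup>2 = (A\<^sup>2 + B\<^sup>2 + C\<^sup>2 + D2) * (A\<^sup>2 - B\<^sup>2 + C\<^sup>2 - D2)"
    "C'\<^sup>2 - D2' = A * C"
proof -
  have rs': "(r - s)\<^sup>2 + (r + s)\<^sup>2 < 2 * (2 * Y)"
    using rs by (simp add: power2_eq_square algebra_simps)
  note R = lsum_relations[OF rs] and R' = lsum_relations[OF rs'] and L = lsum_dilations[OF rs]
  define q where "q = complex_of_real (sqrt 2)"
  have q: "q * q = 2" by (simp add: q_def flip: of_real_mult)
  define f0 f1 e0 e1 where "f0 = lsum K0 p01 p10 Y r s" and "f1 = lsum K1 p01 p10 Y r s"
    and "e0 = lsum K0 p01 p01 Y r s" and "e1 = lsum K1 p01 p01 Y r s"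
  define S0 S1 S2 d where "S0 = lsum K0 p00 p00 Y r s" and "S1 = lsum K1 p00 p00 Y r s"
    and "S2 = lsum K2 p00 p00 Y r s" and "d = lsum K2 p11 p11 Y r s"
  have r: "S0\<^sup>2 + S1\<^sup>2 = e0\<^sup>2 + e1\<^sup>2 + f0\<^sup>2 + f1\<^sup>2" "e0\<^sup>2 + e1\<^sup>2 = f0\<^sup>2 + f1\<^sup>2" "S2\<^sup>2 = e0 * e1 + f0 * f1" "d\<^sup>2 = f0 * f1 - e0 * e1"
    using R(1,2,5,6) unfolding f0_def f1_def e0_def e1_def S0_def S1_def S2_def d_def .
  have P: "A\<^sup>2 + B\<^sup>2 + C\<^sup>2 - D2 = 4 * (f0 + f1)\<^sup>2" "A\<^sup>2 - B\<^sup>2 + C\<^sup>2 + D2 = 4 * (f0 - f1)\<^sup>2"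
    "A\<^sup>2 + B\<^sup>2 + C\<^sup>2 + D2 = 4 * (e0 + e1)\<^sup>2" "A\<^sup>2 - B\<^sup>2 + C\<^sup>2 - D2 = 4 * (e0 - e1)\<^sup>2"
    unfolding A_def B_def C_def D2_def tA_def tB_def tC_def tD2_def S0_def[symmetric] S1_def[symmetric] S2_def[symmetric] d_def[symmetric]
    using r by algebra+
  have "A' = q * f0" "B' = q * f1"
    unfolding A'_def B'_def tA_def tB_def f0_def f1_def q_def using L(5,6) by simp_all
  then have "A'\<^sup>2 - B'\<^sup>2 = 2 * (f0\<^sup>2 - f1\<^sup>2)" using q by algebra
  then show "4 * (A'\<^sup>2 - B'\<^sup>2)\<^sup>2 = (A\<^sup>2 + B\<^sup>2 + C\<^sup>2 - D2) * (A\<^sup>2 - B\<^sup>2 + C\<^sup>2 + D2)"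
    unfolding P by algebra
  define F0 F1 F2 F3 E0 E1 E2 E3 where "F0 = lsum K0 p01 p10 (2 * Y) (r - s) (r + s)" and "F1 = lsum K1 p01 p10 (2 * Y) (r - s) (r + s)"
    and "F2 = lsum K2 p01 p10 (2 * Y) (r - s) (r + s)" and "F3 = lsum K3 p01 p10 (2 * Y) (r - s) (r + s)"
    and "E0 = lsum K0 p01 p01 (2 * Y) (r - s) (r + s)" and "E1 = lsum K1 p01 p01 (2 * Y) (r - s) (r + s)"
    and "E2 = lsum K2 p01 p01 (2 * Y) (r - s) (r + s)" and "E3 = lsum K3 p01 p01 (2 * Y) (r - s) (r + s)"
  define T0 T1 T2 d' where "T0 = lsum K0 p00 p00 (2 * Y) (r - s) (r + s)" and "T1 = lsum K1 p00 p00 (2 * Y) (r - s) (r + s)"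
    and "T2 = lsum K2 p00 p00 (2 * Y) (r - s) (r + s)" and "d' = lsum K2 p11 p11 (2 * Y) (r - s) (r + s)"
  have r': "T0\<^sup>2 + T1\<^sup>2 = E0\<^sup>2 + E1\<^sup>2 + F0\<^sup>2 + F1\<^sup>2" "E0\<^sup>2 + E1\<^sup>2 = F0\<^sup>2 + F1\<^sup>2"
    "T0 * T1 = E2 * E3 + F2 * F3" "E2 * E3 = F2 * F3" "T2\<^sup>2 = E0 * E1 + F0 * F1" "d'\<^sup>2 = F0 * F1 - E0 * E1"
    "2 * T2\<^sup>2 = E2\<^sup>2 + E3\<^sup>2 + F2\<^sup>2 + F3\<^sup>2" "2 * d'\<^sup>2 = E2\<^sup>2 + E3\<^sup>2 - F2\<^sup>2 - F3\<^sup>2"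
    using R' unfolding F0_def F1_def F2_def F3_def E0_def E1_def E2_def E3_def T0_def T1_def T2_def d'_def .
  have e: "e0 = E0 + E1" "e1 = E2 + E3" "S0 = q * (F0 + F1)" "S1 = q * (F2 + F3)"
    using L(3,4,1,2) unfolding F0_def F1_def F2_def F3_def E0_def E1_def E2_def E3_def e0_def e1_def S0_def S1_def q_def .
  have CD: "C' = T0 - T1" "D2' = - 4 * d'\<^sup>2"
    unfolding C'_def D2'_def tC_def tD2_def T0_def T1_def d'_def by (rule refl)+
  have F: "F2\<^sup>2 + F3\<^sup>2 = T2\<^sup>2 - d'\<^sup>2" "E2\<^sup>2 + E3\<^sup>2 = T2\<^sup>2 + d'\<^sup>2" "2 * (F0 * F1) = T2\<^sup>2 + d'\<^sup>2" "2 * (E0 * E1) = T2\<^sup>2 - d'\<^sup>2"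
    "T0\<^sup>2 + T1\<^sup>2 = 2 * (E0\<^sup>2 + E1\<^sup>2)" "T0 * T1 = 2 * (E2 * E3)"
    using r' by algebra+
  have "C'\<^sup>2 + D2' = 2 * (e0\<^sup>2 - e1\<^sup>2)"
  proof -
    have "C'\<^sup>2 = (T0\<^sup>2 + T1\<^sup>2) - 2 * (T0 * T1)" unfolding CD by algebra
    also have "\<dots> = 2 * (E0\<^sup>2 + E1\<^sup>2) - 4 * (E2 * E3)" unfolding F by simp
    finally show ?thesis unfolding CD e using F(2,4) by algebra
  qed
  then show "4 * (C'\<^sup>2 + D2')\<^sup>2 = (A\<^sup>2 + B\<^sup>2 + C\<^sup>2 + D2) * (A\<^sup>2 - B\<^sup>2 + C\<^sup>2 - D2)"
    unfolding P by algebra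
  show "C'\<^sup>2 - D2' = A * C"
  proof -
    have "A * C = S0\<^sup>2 - S1\<^sup>2" unfolding A_def C_def tA_def tC_def S0_def S1_def by algebra
    also have "\<dots> = 2 * ((F0 + F1)\<^sup>2 - (F2 + F3)\<^sup>2)"
      unfolding e by (simp only: power_mult_distrib power2_eq_square[of q] q right_diff_distrib)
    finally have AC: "A * C = 2 * ((F0 + F1)\<^sup>2 - (F2 + F3)\<^sup>2)" .
    have "C'\<^sup>2 = (T0\<^sup>2 + T1\<^sup>2) - 2 * (T0 * T1)" unfolding CD by algebra
    also have "\<dots> = 2 * (F0\<^sup>2 + F1\<^sup>2) - 4 * (F2 * F3)" using F(5,6) r'(2,4) by algebra
    finally show ?thesis unfolding CD AC using F(1,3) by algebra
  qed
qed

section \<open>The interchange of two cusps\<close>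

definition phterm :: "real \<Rightarrow> real \<Rightarrow> complex \<Rightarrow> int \<Rightarrow> complex" where
  "phterm p q z k = exp (- of_real pi * z\<^sup>2 / 2) * exp (- of_real pi * (of_int k + of_real p)\<^sup>2
        + 2 * of_real pi * (of_int k + of_real p) * (z + \<i> * of_real q))"

lemma ph_eq_infsum: "ph p q z = (\<Sum>\<^sub>\<infinity>k. phterm p q z k)"
  unfolding ph_def phterm_def by (rule infsum_cmult_right'[symmetric])

lemma abs_summable_phterm: "(\<lambda>k. norm (phterm p q z k)) summable_on UNIV"
  unfolding phterm_def norm_mult by (intro summable_on_cmult_right abs_summable_ph)

lemma infsum_norm_phterm_le: "(\<Sum>\<^sub>\<infinity>k. norm (phterm p q z k)) \<le> theta3 1 * exp (pi * (norm z)\<^sup>2 / 2)"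
proof -
  have "(\<Sum>\<^sub>\<infinity>k. norm (phterm p q z k)) = exp (Re (- of_real pi * z\<^sup>2 / 2)) * (exp (pi * (Re z)\<^sup>2) *
      (\<Sum>\<^sub>\<infinity>k::int. exp (- pi * 1 * (of_int k + (p - Re z))\<^sup>2)))"
    unfolding phterm_def norm_mult ph_term_norm infsum_cmult_right' unfolding norm_exp_eq_Re ..
  also have "\<dots> \<le> exp (Re (- of_real pi * z\<^sup>2 / 2)) * (exp (pi * (Re z)\<^sup>2) * theta3 1)"
    by (intro mult_left_mono real_gauss_le_theta3) auto
  also have "\<dots> = theta3 1 * (exp (Re (- of_real pi * z\<^sup>2 / 2)) * exp (pi * (Re z)\<^sup>2))" by simp
  also have "exp (Re (- of_real pi * z\<^sup>2 / 2)) * exp (pi * (Re z)\<^sup>2) = exp (pi * (norm z)\<^sup>2 / 2)"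
    unfolding exp_add[symmetric] cmod_power2
    by (rule arg_cong[where f=exp]) (simp add: power2_eq_square field_simps)
  finally show ?thesis .
qed

abbreviation lpt :: "real \<Rightarrow> int \<Rightarrow> int \<Rightarrow> complex" where
  "lpt p m n \<equiv> Complex (of_int m + p) (of_int n + p)"

text \<open>A term of the four-dimensional theta series, with the first two variables combined into
  one lattice point and \<open>c\<close> a phase depending on its parity class.
  \<open>\<alpha>\<close> and \<open>\<beta>\<close> are complex because the theta constants arise
  with \<open>\<alpha> = \<i> * r\<close>.\<close>

definition theta_term :: "real \<Rightarrow> (bool \<Rightarrow> complex) \<Rightarrow> real \<Rightarrow> real \<Rightarrow> real \<Rightarrow> real \<Rightarrow> real \<Rightarrow> complex \<Rightarrow> complex
    \<Rightarrow> (int \<times> int) \<times> (int \<times> int) \<Rightarrow> complex" where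
  "theta_term p c p3 q3 p4 q4 Y \<alpha> \<beta> = (\<lambda>((m, n), (k, l)). c (even (m + n)) *
     of_real (exp (- pi * Y * (norm (lpt p m n))\<^sup>2)) * (phterm p3 q3 (\<alpha> * lpt p m n) k * phterm p4 q4 (\<beta> * lpt p m n) l))"

lemma summable_lpt_gauss:
  assumes "H > 0"
  shows "(\<lambda>(m, n). exp (- pi * H * (norm (lpt p m n))\<^sup>2)) summable_on UNIV"
proof -
  have "(\<lambda>(m::int, n::int). norm (exp (- pi * H * (of_int m + p)\<^sup>2) * exp (- pi * H * (of_int n + p)\<^sup>2))) summable_on UNIV \<times> UNIV"
    by (rule abs_summable_times) (use summable_real_gauss[OF assms] in auto)
  moreover have "norm (exp (- pi * H * (of_int m + p)\<^sup>2) * exp (- pi * H * (of_int n + p)\<^sup>2)) = exp (- pi * H * (norm (lpt p m n))\<^sup>2)" for m n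
    unfolding cmod_power2 complex.sel distrib_left exp_add by (simp add: abs_mult)
  ultimately show ?thesis by (simp only: UNIV_Times_UNIV)
qed

lemma abs_summable_theta_term:
  assumes rs: "(norm \<alpha>)\<^sup>2 + (norm \<beta>)\<^sup>2 < 2 * Y" and c: "\<And>e. norm (c e) \<le> 1"
  shows "(\<lambda>x. norm (theta_term p c p3 q3 p4 q4 Y \<alpha> \<beta> x)) summable_on UNIV"
    and "(\<Sum>\<^sub>\<infinity>x. theta_term p c p3 q3 p4 q4 Y \<alpha> \<beta> x) =
      (\<Sum>\<^sub>\<infinity>(m, n). c (even (m + n)) * of_real (exp (- pi * Y * (norm (lpt p m n))\<^sup>2)) *
        (ph p3 q3 (\<alpha> * lpt p m n) * ph p4 q4 (\<beta> * lpt p m n)))"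
proof -
  let ?t = "theta_term p c p3 q3 p4 q4 Y \<alpha> \<beta>"
  let ?w = "\<lambda>(m, n). c (even (m + n)) * of_real (exp (- pi * Y * (norm (lpt p m n))\<^sup>2))"
  let ?H = "Y - ((norm \<alpha>)\<^sup>2 + (norm \<beta>)\<^sup>2) / 2"
  have t: "?t (x, y) = ?w x * (case y of (k, l) \<Rightarrow> phterm p3 q3 (\<alpha> * case_prod (lpt p) x) k * phterm p4 q4 (\<beta> * case_prod (lpt p) x) l)" for x y
    by (simp add: theta_term_def case_prod_unfold)
  have ab: "(\<lambda>(k, l). norm (phterm p3 q3 u k * phterm p4 q4 v l)) summable_on UNIV" for u v
    using abs_summable_times[OF abs_summable_phterm abs_summable_phterm, of p3 q3 u p4 q4 v] by simp
  have in1: "(\<Sum>\<^sub>\<infinity>y. norm (?t (x, y))) = norm (?w x) * ((\<Sum>\<^sub>\<infinity>k. norm (phterm p3 q3 (\<alpha> * case_prod (lpt p) x) k)) * (\<Sum>\<^sub>\<infinity>l. norm (phterm p4 q4 (\<beta> * case_prod (lpt p) x) l)))" for x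
  proof -
    let ?u = "\<alpha> * case_prod (lpt p) x" and ?v = "\<beta> * case_prod (lpt p) x"
    have "(\<Sum>\<^sub>\<infinity>(k, l)\<in>UNIV \<times> UNIV. norm (phterm p3 q3 ?u k) * norm (phterm p4 q4 ?v l))
       = (\<Sum>\<^sub>\<infinity>k. norm (phterm p3 q3 ?u k)) * (\<Sum>\<^sub>\<infinity>l. norm (phterm p4 q4 ?v l))"
      by (rule infsum_times) (simp_all add: abs_summable_phterm)
    moreover have "norm (?t (x, y)) = norm (?w x) * (case y of (k, l) \<Rightarrow> norm (phterm p3 q3 ?u k) * norm (phterm p4 q4 ?v l))" for y
      unfolding t norm_mult by (cases y) (simp add: norm_mult)
    ultimately show ?thesis by (simp add: infsum_cmult_right')
  qed
  have le: "(\<Sum>\<^sub>\<infinity>y. norm (?t (x, y))) \<le> (theta3 1)\<^sup>2 * (case x of (m, n) \<Rightarrow> exp (- pi * ?H * (norm (lpt p m n))\<^sup>2))" for x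
  proof -
    obtain m n where x: "x = (m, n)" by (cases x)
    let ?z = "lpt p m n"
    have nn: "(\<Sum>\<^sub>\<infinity>k. norm (phterm p q z k)) \<ge> 0" for p q z by (rule infsum_nonneg) simp
    have "(\<Sum>\<^sub>\<infinity>y. norm (?t (x, y))) \<le> exp (- pi * Y * (norm ?z)\<^sup>2) * ((theta3 1 * exp (pi * (norm (\<alpha> * ?z))\<^sup>2 / 2)) * (theta3 1 * exp (pi * (norm (\<beta> * ?z))\<^sup>2 / 2)))"
      unfolding in1 x prod.case
    proof (intro mult_mono infsum_norm_phterm_le nn mult_nonneg_nonneg)
      show "norm (c (even (m + n)) * of_real (exp (- pi * Y * (norm ?z)\<^sup>2))) \<le> exp (- pi * Y * (norm ?z)\<^sup>2)"
        using mult_right_mono[OF c[of "even (m + n)"], of "exp (- pi * Y * (norm ?z)\<^sup>2)"] by (simp add: norm_mult)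
      show "0 \<le> theta3 1" unfolding theta3_def by (rule infsum_nonneg) simp
    qed auto
    also have "\<dots> = (theta3 1)\<^sup>2 * (exp (- pi * Y * (norm ?z)\<^sup>2) * exp (pi * (norm (\<alpha> * ?z))\<^sup>2 / 2) * exp (pi * (norm (\<beta> * ?z))\<^sup>2 / 2))"
      by (simp only: power2_eq_square mult_ac)
    also have "exp (- pi * Y * (norm ?z)\<^sup>2) * exp (pi * (norm (\<alpha> * ?z))\<^sup>2 / 2) * exp (pi * (norm (\<beta> * ?z))\<^sup>2 / 2)
      = exp (- pi * ?H * (norm ?z)\<^sup>2)"
      unfolding mult_exp_exp norm_mult power_mult_distrib by (rule arg_cong[where f=exp]) (simp add: field_simps)
    finally show ?thesis unfolding x prod.case .
  qed
  have abs: "(\<lambda>x. norm (?t x)) summable_on UNIV \<times> UNIV"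
  proof (rule Infinite_Sum.abs_summable_on_Sigma_iff[THEN iffD2], intro conjI ballI)
    show "(\<lambda>y. norm (?t (x, y))) summable_on UNIV" for x
      using summable_on_cmult_right[OF ab, of "norm (?w x)"] unfolding t norm_mult by (simp add: case_prod_unfold norm_mult)
    show "(\<lambda>x. norm (\<Sum>\<^sub>\<infinity>y. norm (?t (x, y)))) summable_on UNIV"
    proof (rule summable_on_comparison_test)
      have "?H > 0" using rs by simp
      then show "(\<lambda>x. (theta3 1)\<^sup>2 * (case x of (m, n) \<Rightarrow> exp (- pi * ?H * (norm (lpt p m n))\<^sup>2))) summable_on UNIV"
        by (intro summable_on_cmult_right summable_lpt_gauss)
      show "norm (\<Sum>\<^sub>\<infinity>y. norm (?t (x, y))) \<le> (theta3 1)\<^sup>2 * (case x of (m, n) \<Rightarrow> exp (- pi * ?H * (norm (lpt p m n))\<^sup>2))" for x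
        using le[of x] by (simp add: infsum_nonneg)
    qed auto
  qed
  then show "(\<lambda>x. norm (?t x)) summable_on UNIV" by simp
  have in2: "(\<Sum>\<^sub>\<infinity>y. ?t (x, y)) = ?w x * (ph p3 q3 (\<alpha> * case_prod (lpt p) x) * ph p4 q4 (\<beta> * case_prod (lpt p) x))" for x
    unfolding t infsum_cmult_right' ph_eq_infsum
    using infsum_times[OF abs_summable_phterm abs_summable_phterm, of p3 q3 "\<alpha> * case_prod (lpt p) x" p4 q4 "\<beta> * case_prod (lpt p) x"] by simp
  have "(\<Sum>\<^sub>\<infinity>x\<in>UNIV \<times> UNIV. ?t x) = (\<Sum>\<^sub>\<infinity>x. \<Sum>\<^sub>\<infinity>y. ?t (x, y))"
    by (subst infsum_Sigma_banach[OF abs_summable_summable[OF abs]]) simp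
  then show "(\<Sum>\<^sub>\<infinity>x. ?t x) = (\<Sum>\<^sub>\<infinity>(m, n). c (even (m + n)) * of_real (exp (- pi * Y * (norm (lpt p m n))\<^sup>2)) *
        (ph p3 q3 (\<alpha> * lpt p m n) * ph p4 q4 (\<beta> * lpt p m n)))"
    unfolding in2 UNIV_Times_UNIV case_prod_unfold .
qed

lemma infsum_cosets:
  fixes f :: "complex \<Rightarrow> complex"
  assumes "\<And>e. (\<lambda>z. norm (f z)) summable_on coset p e"
  shows "(\<Sum>\<^sub>\<infinity>(m, n). c (even (m + n)) * f (lpt p m n)) = c True * infsum f (coset p True) + c False * infsum f (coset p False)"
proof -
  let ?E = "\<lambda>e. {(m, n). even (m + n :: int) = e}"
  have bij: "bij_betw (\<lambda>(m, n). lpt p m n) (?E e) (coset p e)" for e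
    unfolding bij_betw_def by (auto simp: inj_on_def coset_def)
  have fs: "f summable_on coset p e" for e by (rule abs_summable_summable[OF assms])
  have eq: "infsum (\<lambda>(m, n). c (even (m + n)) * f (lpt p m n)) (?E e) = c e * infsum f (coset p e)" for e
  proof -
    have "infsum (\<lambda>(m, n). c (even (m + n)) * f (lpt p m n)) (?E e) = infsum (\<lambda>x. c e * f (case x of (m, n) \<Rightarrow> lpt p m n)) (?E e)"
      by (rule infsum_cong) auto
    also have "\<dots> = infsum (\<lambda>z. c e * f z) (coset p e)"
      by (rule infsum_reindex_bij_betw[OF bij])
    finally show ?thesis by (simp add: infsum_cmult_right')
  qed
  have s: "(\<lambda>(m, n). c (even (m + n)) * f (lpt p m n)) summable_on (?E e)" for e
  proof -
    have "(\<lambda>x. c e * f (case x of (m, n) \<Rightarrow> lpt p m n)) summable_on (?E e)"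
      using summable_on_reindex_bij_betw[OF bij, of "\<lambda>z. c e * f z"] summable_on_cmult_right[OF fs] by blast
    then show ?thesis by (rule summable_on_cong[THEN iffD1, rotated]) auto
  qed
  have "UNIV = ?E True \<union> ?E False" by auto
  then have "(\<Sum>\<^sub>\<infinity>(m, n). c (even (m + n)) * f (lpt p m n)) = infsum (\<lambda>(m, n). c (even (m + n)) * f (lpt p m n)) (?E True \<union> ?E False)" by simp
  also have "\<dots> = infsum (\<lambda>(m, n). c (even (m + n)) * f (lpt p m n)) (?E True) + infsum (\<lambda>(m, n). c (even (m + n)) * f (lpt p m n)) (?E False)"
    by (rule infsum_Un_disjoint[OF s s]) auto
  finally show ?thesis unfolding eq .
qed

lemma infsum_theta_term:
  assumes rs: "r\<^sup>2 + s\<^sup>2 < 2 * Y" and c: "\<And>e. norm (c e) \<le> 1"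
  shows "(\<Sum>\<^sub>\<infinity>x. theta_term p c p3 q3 p4 q4 Y (of_real r) (of_real s) x) =
    c True * lsum (coset p True) (ph p3 q3) (ph p4 q4) Y r s + c False * lsum (coset p False) (ph p3 q3) (ph p4 q4) Y r s"
proof -
  have "(norm (complex_of_real r))\<^sup>2 + (norm (complex_of_real s))\<^sup>2 < 2 * Y" using rs by simp
  from abs_summable_theta_term(2)[where c=c, OF this c]
  have "(\<Sum>\<^sub>\<infinity>x. theta_term p c p3 q3 p4 q4 Y (of_real r) (of_real s) x) =
     (\<Sum>\<^sub>\<infinity>(m, n). c (even (m + n)) * lterm (ph p3 q3) (ph p4 q4) Y r s (lpt p m n))"
    by (simp only: lterm_def mult.assoc)
  also have "\<dots> = c True * lsum (coset p True) (ph p3 q3) (ph p4 q4) Y r s + c False * lsum (coset p False) (ph p3 q3) (ph p4 q4) Y r s"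
    unfolding lsum_def by (rule infsum_cosets) (rule abs_summable_lterm[OF gauss_bounded_ph gauss_bounded_ph rs])
  finally show ?thesis .
qed

section \<open>Partial Poisson summation in the imaginary part of the lattice point\<close>

lemma poisson_characteristic:
  fixes H L p :: real
  assumes H: "H > 0"
  shows "(\<Sum>\<^sub>\<infinity>n::int. of_real (exp (- pi * H * (of_int n + p)\<^sup>2)) * cis (2 * pi * (of_int n + p) * L))
    = of_real (1 / sqrt H) * (\<Sum>\<^sub>\<infinity>j::int. cis (2 * pi * p * of_int j) * of_real (exp (- pi * (of_int j - L)\<^sup>2 / H)))"
proof -
  let ?w = "complex_of_real p - \<i> * L / H"
  have "of_real (exp (- pi * H * (of_int n + p)\<^sup>2)) * cis (2 * pi * (of_int n + p) * L)
     = of_real (exp (- pi * L\<^sup>2 / H)) * exp (- complex_of_real pi * of_real H * (of_int n + ?w)\<^sup>2)" for n :: int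
    unfolding cis_conv_exp exp_of_real[symmetric] mult_exp_exp using H
    by (intro arg_cong[where f=exp]) (simp add: power2_eq_square field_simps)
  then have "(\<Sum>\<^sub>\<infinity>n::int. of_real (exp (- pi * H * (of_int n + p)\<^sup>2)) * cis (2 * pi * (of_int n + p) * L))
     = of_real (exp (- pi * L\<^sup>2 / H)) * gauss_period (of_real H) ?w"
    unfolding gauss_period_def by (simp only: infsum_cmult_right')
  also have "gauss_period (of_real H) ?w = of_real (1 / sqrt H) * gauss_dual (of_real H) ?w"
    using poisson_gauss_real[OF H, of ?w] by simp
  also have "of_real (exp (- pi * L\<^sup>2 / H)) * (of_real (1 / sqrt H) * gauss_dual (of_real H) ?w)
     = of_real (1 / sqrt H) * (of_real (exp (- pi * L\<^sup>2 / H)) * gauss_dual (of_real H) ?w)"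
    by (simp only: mult_ac)
  also have "of_real (exp (- pi * L\<^sup>2 / H)) * gauss_dual (of_real H) ?w =
     (\<Sum>\<^sub>\<infinity>j::int. cis (2 * pi * p * of_int j) * of_real (exp (- pi * (of_int j - L)\<^sup>2 / H)))"
    unfolding gauss_dual_def gauss_sum_def infsum_cmult_right'[symmetric]
    unfolding cis_conv_exp exp_of_real[symmetric] mult_exp_exp using H
    by (intro infsum_cong arg_cong[where f=exp]) (simp add: power2_eq_square field_simps)
  finally show ?thesis .
qed

text \<open>The positive majorant of the form \<open>k\<^sup>2 + l\<^sup>2 - 2 * x * y\<close> of
  signature (3,1) attached to the negative vector \<open>(x, y, k, l) = (1, Y, r, s)\<close>: the
  last summand is the squared pairing with this vector, divided by minus half its norm. Here
  \<open>x\<close> is the surviving lattice variable and \<open>y\<close> the dual one.\<close>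

definition qform :: "real \<Rightarrow> real \<Rightarrow> real \<Rightarrow> real \<Rightarrow> real \<Rightarrow> real \<Rightarrow> real \<Rightarrow> real" where
  "qform Y r s x y k l = k\<^sup>2 + l\<^sup>2 - 2 * x * y + (y - r * k - s * l + Y * x)\<^sup>2 / (Y - (r\<^sup>2 + s\<^sup>2) / 2)"

lemma qform_eq:
  assumes "r\<^sup>2 + s\<^sup>2 < 2 * Y"
  defines "H \<equiv> Y - (r\<^sup>2 + s\<^sup>2) / 2"
  shows "qform Y r s x y k l = (k - r * x)\<^sup>2 + (l - s * x)\<^sup>2 + H * x\<^sup>2 + (y - (r * k + s * l - (r\<^sup>2 + s\<^sup>2) * x / 2))\<^sup>2 / H"
proof -
  have aux: "k\<^sup>2 + l\<^sup>2 - 2 * x * y + (y - r * k - s * l + (h + (r\<^sup>2 + s\<^sup>2) / 2) * x)\<^sup>2 / h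
      = (k - r * x)\<^sup>2 + (l - s * x)\<^sup>2 + h * x\<^sup>2 + (y - (r * k + s * l - (r\<^sup>2 + s\<^sup>2) * x / 2))\<^sup>2 / h"
    if "h \<noteq> 0" for h
    using that by (simp add: field_simps power2_eq_square)
  have H0: "H \<noteq> 0" using assms by simp
  have "Y = H + (r\<^sup>2 + s\<^sup>2) / 2" by (simp add: H_def)
  then show ?thesis
    using aux[OF H0] unfolding qform_def H_def[symmetric] by (simp only:)
qed

text \<open>Interchanging \<open>x\<close> and \<open>y\<close> preserves the indefinite form and
  sends the vector \<open>(1, Y, r, s)\<close> to \<open>Y\<close> times
  \<open>(1, 1 / Y, r / Y, s / Y)\<close>.\<close>

lemma qform_swap:
  assumes "Y > 0"
  shows "qform (1 / Y) (r / Y) (s / Y) y x k l = qform Y r s x y k l"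
proof -
  have "(1 / Y) - ((r / Y)\<^sup>2 + (s / Y)\<^sup>2) / 2 = (Y - (r\<^sup>2 + s\<^sup>2) / 2) / Y\<^sup>2"
    "x - r / Y * k - s / Y * l + 1 / Y * y = (y - r * k - s * l + Y * x) / Y"
    using assms by (simp_all add: field_simps power2_eq_square)
  then show ?thesis unfolding qform_def by (simp only: power_divide) (use assms in simp)
qed

definition real_theta :: "real \<Rightarrow> real \<Rightarrow> real \<Rightarrow> real \<Rightarrow> real \<Rightarrow> (int \<times> int \<times> int) \<times> int \<Rightarrow> complex" where
  "real_theta p q Y r s = (\<lambda>((m, k, l), j). cis (2 * pi * (q * (of_int m + p) + p * of_int j)) *
     of_real (exp (- pi * qform Y r s (of_int m + p) (of_int j - q) (of_int k) (of_int l))))"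

text \<open>Iterated bounds along the squares of \<open>qform_eq\<close>: the shifted sums over
  \<open>j\<close>, then over \<open>k\<close> and \<open>l\<close>, are bounded by theta constants
  uniformly in the shifts, so that only a Gaussian series in \<open>m\<close> remains.\<close>

lemma abs_summable_real_theta:
  assumes rs: "r\<^sup>2 + s\<^sup>2 < 2 * Y"
  shows "(\<lambda>x. norm (real_theta p q Y r s x)) summable_on UNIV"
proof -
  define H where "H = Y - (r\<^sup>2 + s\<^sup>2) / 2"
  have H: "H > 0" using rs by (simp add: H_def)
  let ?L = "\<lambda>m k l. r * of_int k + s * of_int l - (r\<^sup>2 + s\<^sup>2) * (of_int m + p) / 2"
  let ?g = "\<lambda>(m::int, k::int, l::int). exp (- pi * H * (of_int m + p)\<^sup>2) * (exp (- pi * 1 * (of_int k + - (r * (of_int m + p)))\<^sup>2) * exp (- pi * 1 * (of_int l + - (s * (of_int m + p)))\<^sup>2))"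
  let ?f = "\<lambda>((m::int, k::int, l::int), j::int). ?g (m, k, l) * exp (- pi * (1 / H) * (of_int j + - (q + ?L m k l))\<^sup>2)"
  have n: "norm (real_theta p q Y r s x) = ?f x" for x
  proof -
    obtain m k l j where x: "x = ((m, k, l), j)" by (metis prod.exhaust)
    have "- pi * qform Y r s (of_int m + p) (of_int j - q) (of_int k) (of_int l) =
      - pi * H * (of_int m + p)\<^sup>2 + (- pi * 1 * (of_int k + - (r * (of_int m + p)))\<^sup>2 + - pi * 1 * (of_int l + - (s * (of_int m + p)))\<^sup>2)
        + - pi * (1 / H) * (of_int j + - (q + ?L m k l))\<^sup>2"
      unfolding qform_eq[OF rs] H_def[symmetric] by (simp add: algebra_simps)
    then show ?thesis unfolding x real_theta_def prod.case mult_exp_exp norm_mult norm_cis norm_of_real mult_1_left abs_exp_cancel by (simp only:)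
  qed
  have kl: "(\<lambda>(k::int, l::int). norm (exp (- pi * 1 * (of_int k + a)\<^sup>2) * exp (- pi * 1 * (of_int l + b)\<^sup>2))) summable_on UNIV \<times> UNIV" for a b :: real
    by (rule abs_summable_times) (use summable_real_gauss[of 1] in auto)
  have klsum: "(\<Sum>\<^sub>\<infinity>(k::int, l::int)\<in>UNIV \<times> UNIV. exp (- pi * 1 * (of_int k + a)\<^sup>2) * exp (- pi * 1 * (of_int l + b)\<^sup>2)) \<le> (theta3 1)\<^sup>2" for a b :: real
  proof -
    have "(\<Sum>\<^sub>\<infinity>(k::int, l::int)\<in>UNIV \<times> UNIV. exp (- pi * 1 * (of_int k + a)\<^sup>2) * exp (- pi * 1 * (of_int l + b)\<^sup>2))
      = (\<Sum>\<^sub>\<infinity>k::int. exp (- pi * 1 * (of_int k + a)\<^sup>2)) * (\<Sum>\<^sub>\<infinity>l::int. exp (- pi * 1 * (of_int l + b)\<^sup>2))"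
      by (rule infsum_times) (use summable_real_gauss[of 1] in auto)
    also have "\<dots> \<le> theta3 1 * theta3 1"
      by (intro mult_mono real_gauss_le_theta3 infsum_nonneg) (auto simp: theta3_def intro!: infsum_nonneg)
    finally show ?thesis by (simp add: power2_eq_square)
  qed
  have g: "?g summable_on UNIV"
  proof -
    have "(\<lambda>x. norm (?g x)) summable_on UNIV \<times> UNIV"
    proof (rule Infinite_Sum.abs_summable_on_Sigma_iff[THEN iffD2], intro conjI ballI)
      show "(\<lambda>y. norm (?g (m, y))) summable_on UNIV" for m
        using summable_on_cmult_right[OF kl[of "- (r * (of_int m + p))" "- (s * (of_int m + p))"], of "exp (- pi * H * (of_int m + p)\<^sup>2)"]
        by (simp add: case_prod_unfold norm_mult abs_mult)
      have "(\<Sum>\<^sub>\<infinity>y. norm (?g (m, y))) \<le> (theta3 1)\<^sup>2 * exp (- pi * H * (of_int m + p)\<^sup>2)" for m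
      proof -
        have "(\<Sum>\<^sub>\<infinity>y. norm (?g (m, y))) = exp (- pi * H * (of_int m + p)\<^sup>2) * (\<Sum>\<^sub>\<infinity>(k::int, l::int)\<in>UNIV \<times> UNIV. exp (- pi * 1 * (of_int k + - (r * (of_int m + p)))\<^sup>2) * exp (- pi * 1 * (of_int l + - (s * (of_int m + p)))\<^sup>2))"
          unfolding infsum_cmult_right'[symmetric] by (simp add: case_prod_unfold norm_mult abs_mult)
        also have "\<dots> \<le> exp (- pi * H * (of_int m + p)\<^sup>2) * (theta3 1)\<^sup>2"
          by (intro mult_left_mono klsum) auto
        finally show ?thesis by (simp only: mult.commute)
      qed
      then show "(\<lambda>m. norm (\<Sum>\<^sub>\<infinity>y. norm (?g (m, y)))) summable_on UNIV"
        by (intro summable_on_comparison_test[OF summable_on_cmult_right[OF summable_real_gauss[OF H]]])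
          (simp_all only: real_norm_def abs_of_nonneg infsum_nonneg norm_ge_zero abs_ge_zero)
    qed
    then show ?thesis using abs_summable_summable by fastforce
  qed
  have "(\<lambda>x. norm (?f x)) summable_on UNIV \<times> UNIV"
  proof (rule Infinite_Sum.abs_summable_on_Sigma_iff[THEN iffD2], intro conjI ballI)
    have H': "1 / H > 0" using H by simp
    have e: "?f (x, j) = ?g x * exp (- pi * (1 / H) * (of_int j + - (q + (case x of (m, k, l) \<Rightarrow> ?L m k l)))\<^sup>2)" for x j
      by (simp add: case_prod_unfold)
    have gp: "?g x \<ge> 0" for x by (simp add: case_prod_unfold)
    have ne: "norm (?f (x, j)) = ?g x * exp (- pi * (1 / H) * (of_int j + - (q + (case x of (m, k, l) \<Rightarrow> ?L m k l)))\<^sup>2)" for x j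
      unfolding e real_norm_def abs_mult using gp[of x] by (simp only: abs_of_nonneg abs_exp_cancel)
    show "(\<lambda>j. norm (?f (x, j))) summable_on UNIV" for x
      unfolding ne by (intro summable_on_cmult_right summable_real_gauss H')
    have "(\<Sum>\<^sub>\<infinity>j. norm (?f (x, j))) \<le> theta3 (1 / H) * ?g x" for x
      unfolding ne infsum_cmult_right' using mult_left_mono[OF real_gauss_le_theta3[OF H'] gp] by (simp only: mult.commute)
    then show "(\<lambda>x. norm (\<Sum>\<^sub>\<infinity>j. norm (?f (x, j)))) summable_on UNIV"
      by (intro summable_on_comparison_test[OF summable_on_cmult_right[OF g]])
        (simp_all only: real_norm_def abs_of_nonneg infsum_nonneg norm_ge_zero abs_ge_zero)
  qed
  then show ?thesis unfolding n by (simp add: case_prod_unfold)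
qed

lemma p00_theta_term_real:
  fixes Y r s p q :: real and c :: "bool \<Rightarrow> complex"
  assumes c: "\<And>m n :: int. c (even (m + n)) = cis (2 * pi * q * (of_int m + p + (of_int n + p)))"
  defines "H \<equiv> Y - (r\<^sup>2 + s\<^sup>2) / 2"
  shows "theta_term p c 0 0 0 0 Y (of_real r) (of_real s) ((m, n), (k, l)) =
    (cis (2 * pi * q * (of_int m + p)) * of_real (exp (- pi * ((of_int k - r * (of_int m + p))\<^sup>2 + (of_int l - s * (of_int m + p))\<^sup>2 + H * (of_int m + p)\<^sup>2)))) *
    (of_real (exp (- pi * H * (of_int n + p)\<^sup>2)) * cis (2 * pi * (of_int n + p) * (r * of_int k + s * of_int l - (r\<^sup>2 + s\<^sup>2) * (of_int m + p) / 2 + q)))"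
proof -
  define x y where "x = of_int m + p" and "y = of_int n + p"
  have Y: "Y = H + (r\<^sup>2 + s\<^sup>2) / 2" by (simp add: H_def)
  have z: "Complex x y = of_real x + \<i> * of_real y" by (simp add: complex_eq_iff)
  have n: "(norm (Complex x y))\<^sup>2 = x\<^sup>2 + y\<^sup>2" by (simp add: cmod_power2)
  have i2: "\<i> * (\<i> * w) = - w" for w by (simp flip: mult.assoc)
  show ?thesis
    unfolding theta_term_def prod.case c phterm_def x_def[symmetric] y_def[symmetric] n
    unfolding cis_conv_exp exp_of_real[symmetric] mult_exp_exp z Y
    by (rule arg_cong[where f=exp]) (simp add: power2_eq_square field_simps i2)
qed

text \<open>After Poisson summation in \<open>n\<close> alone the only oscillation left is that of
  the characteristics. For the three pairs \<open>(p, q)\<close> used below it is a sign, so reality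
  and, for \<open>tA\<close>, positivity can be read off. The phase \<open>c\<close> has become the
  shift \<open>q\<close> of the dual variable.\<close>

lemma real_theta_sum:
  assumes rs: "r\<^sup>2 + s\<^sup>2 < 2 * Y" and c: "\<And>m n :: int. c (even (m + n)) = cis (2 * pi * q * (of_int m + p + (of_int n + p)))"
  defines "H \<equiv> Y - (r\<^sup>2 + s\<^sup>2) / 2"
  shows "c True * lsum (coset p True) p00 p00 Y r s + c False * lsum (coset p False) p00 p00 Y r s =
     of_real (1 / sqrt H) * (\<Sum>\<^sub>\<infinity>x. real_theta p q Y r s x)"
proof -
  have H: "H > 0" using rs by (simp add: H_def)
  let ?t = "theta_term p c 0 0 0 0 Y (of_real r) (of_real s)"
  have c1: "norm (c e) \<le> 1" for e
  proof -
    have "c True = c (even (0 + 0 :: int))" "c False = c (even (1 + 0 :: int))" by simp_all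
    then have "norm (c True) = 1" "norm (c False) = 1" by (simp_all only: c norm_cis)
    then show ?thesis by (cases e) simp_all
  qed
  have rs': "(norm (complex_of_real r))\<^sup>2 + (norm (complex_of_real s))\<^sup>2 < 2 * Y" using rs by simp
  let ?h = "\<lambda>((m, k, l), n). ((m, n), (k, l)) :: (int \<times> int) \<times> (int \<times> int)"
  have bij: "bij ?h"
    by (rule bij_betw_byWitness[where f'="\<lambda>((m, n), (k, l)). ((m, k, l), n)"]) auto
  have abs: "(\<lambda>x. norm (?t (?h x))) summable_on UNIV"
    using summable_on_reindex_bij_betw[OF bij, of "\<lambda>x. norm (?t x)"] abs_summable_theta_term(1)[where c=c, OF rs' c1] by simp
  then have sm: "(\<lambda>x. ?t (?h x)) summable_on UNIV \<times> UNIV" using abs_summable_summable by simp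
  let ?W = "\<lambda>(m::int, k::int, l::int). cis (2 * pi * q * (of_int m + p)) * complex_of_real (exp (- pi * ((of_int k - r * (of_int m + p))\<^sup>2 + (of_int l - s * (of_int m + p))\<^sup>2 + H * (of_int m + p)\<^sup>2)))"
  let ?L = "\<lambda>(m::int, k::int, l::int). r * of_int k + s * of_int l - (r\<^sup>2 + s\<^sup>2) * (of_int m + p) / 2 + q"
  have inner: "(\<Sum>\<^sub>\<infinity>n. ?t (?h (x, n))) = of_real (1 / sqrt H) * (\<Sum>\<^sub>\<infinity>j. real_theta p q Y r s (x, j))" for x
  proof -
    obtain m k l where x: "x = (m, k, l)" by (metis prod.exhaust)
    have "(\<Sum>\<^sub>\<infinity>n. ?t (?h (x, n))) = ?W x * (\<Sum>\<^sub>\<infinity>n::int. of_real (exp (- pi * H * (of_int n + p)\<^sup>2)) * cis (2 * pi * (of_int n + p) * ?L x))"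
      unfolding x prod.case p00_theta_term_real[where c=c, OF c] H_def[symmetric] by (rule infsum_cmult_right')
    also have "\<dots> = of_real (1 / sqrt H) * (?W x * (\<Sum>\<^sub>\<infinity>j::int. cis (2 * pi * p * of_int j) * of_real (exp (- pi * (of_int j - ?L x)\<^sup>2 / H))))"
      unfolding poisson_characteristic[OF H] by (simp only: mult_ac)
    also have "?W x * (\<Sum>\<^sub>\<infinity>j::int. cis (2 * pi * p * of_int j) * of_real (exp (- pi * (of_int j - ?L x)\<^sup>2 / H)))
       = (\<Sum>\<^sub>\<infinity>j. real_theta p q Y r s (x, j))"
      unfolding infsum_cmult_right'[symmetric]
    proof (rule infsum_cong)
      fix j :: int
      have e: "- pi * qform Y r s (of_int m + p) (of_int j - q) (of_int k) (of_int l) =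
        - pi * ((of_int k - r * (of_int m + p))\<^sup>2 + (of_int l - s * (of_int m + p))\<^sup>2 + H * (of_int m + p)\<^sup>2) + - pi * (of_int j - ?L x)\<^sup>2 / H"
        unfolding qform_eq[OF rs] H_def[symmetric] x prod.case by (simp add: algebra_simps)
      show "?W x * (cis (2 * pi * p * of_int j) * of_real (exp (- pi * (of_int j - ?L x)\<^sup>2 / H))) = real_theta p q Y r s (x, j)"
        unfolding x prod.case real_theta_def
        unfolding e[unfolded x prod.case] exp_add of_real_mult
        unfolding cis_conv_exp exp_of_real[symmetric] mult_exp_exp
        by (rule arg_cong[where f=exp]) (simp add: algebra_simps)
    qed
    finally show ?thesis .
  qed
  have "c True * lsum (coset p True) p00 p00 Y r s + c False * lsum (coset p False) p00 p00 Y r s = (\<Sum>\<^sub>\<infinity>x. ?t x)"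
    by (rule infsum_theta_term[where c=c, OF rs c1, symmetric])
  also have "\<dots> = (\<Sum>\<^sub>\<infinity>x\<in>UNIV \<times> UNIV. ?t (?h x))"
    using infsum_reindex_bij_betw[OF bij, of ?t] by simp
  also have "\<dots> = (\<Sum>\<^sub>\<infinity>x. \<Sum>\<^sub>\<infinity>n. ?t (?h (x, n)))"
    by (rule infsum_Sigma_banach[OF sm, symmetric])
  also have "\<dots> = of_real (1 / sqrt H) * (\<Sum>\<^sub>\<infinity>x. \<Sum>\<^sub>\<infinity>j. real_theta p q Y r s (x, j))"
    unfolding inner by (rule infsum_cmult_right')
  also have "(\<Sum>\<^sub>\<infinity>x. \<Sum>\<^sub>\<infinity>j. real_theta p q Y r s (x, j)) = (\<Sum>\<^sub>\<infinity>x\<in>UNIV \<times> UNIV. real_theta p q Y r s x)"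
    by (rule infsum_Sigma_banach) (use abs_summable_summable[OF abs_summable_real_theta[OF rs]] in simp)
  finally show ?thesis by simp
qed

lemma tA_real_theta:
  assumes "r\<^sup>2 + s\<^sup>2 < 2 * Y"
  shows "tA Y r s = of_real (1 / sqrt (Y - (r\<^sup>2 + s\<^sup>2) / 2)) * (\<Sum>\<^sub>\<infinity>x. real_theta 0 0 Y r s x)"
  unfolding tA_def using real_theta_sum[OF assms, of "\<lambda>_. 1" 0 0] by simp

lemma tB_real_theta:
  assumes "r\<^sup>2 + s\<^sup>2 < 2 * Y"
  shows "tB Y r s = of_real (1 / sqrt (Y - (r\<^sup>2 + s\<^sup>2) / 2)) * (\<Sum>\<^sub>\<infinity>x. real_theta (1/2) 0 Y r s x)"
  unfolding tB_def using real_theta_sum[OF assms, of "\<lambda>_. 1" 0 "1/2"] lsum_symmetries(4)[OF assms] by simp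

lemma cis_pi_int: "cis (pi * of_int m) = (if even m then 1 else - 1)"
proof (cases "even m")
  case True
  then obtain h where "m = 2 * h" by (rule evenE)
  then have "cis (pi * of_int m) = cis (2 * pi * of_int h)" by (simp add: mult_ac)
  also have "\<dots> = 1" by (rule cis_multiple_2pi) simp
  finally show ?thesis using True by simp
next
  case False
  then obtain h where "m = 2 * h + 1" by (rule oddE)
  then have "pi * of_int m = 2 * pi * of_int h + pi" by (simp add: algebra_simps)
  then have "cis (pi * of_int m) = cis (2 * pi * of_int h) * cis pi" by (simp only: cis_mult)
  also have "cis (2 * pi * of_int h) = 1" by (rule cis_multiple_2pi) simp
  finally show ?thesis using False by simp
qed

lemma tC_real_theta:
  assumes "r\<^sup>2 + s\<^sup>2 < 2 * Y"
  shows "tC Y r s = of_real (1 / sqrt (Y - (r\<^sup>2 + s\<^sup>2) / 2)) * (\<Sum>\<^sub>\<infinity>x. real_theta 0 (1/2) Y r s x)"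
proof -
  have "(if even (m + n) then 1 else - 1) = cis (2 * pi * (1/2) * (of_int m + 0 + (of_int n + 0)))" for m n :: int
    using cis_pi_int[of "m + n"] by simp
  from real_theta_sum[where c="\<lambda>e. if e then 1 else - 1", OF assms this]
  show ?thesis unfolding tC_def by simp
qed

text \<open>Interchanging the first two coordinates of the ball interchanges the cusps \<open>Y = \<infinity>\<close> and \<open>Y = 0\<close>.\<close>

lemma tC_swap:
  assumes rs: "r\<^sup>2 + s\<^sup>2 < 2 * Y"
  shows "tC Y r s = of_real (1 / Y) * tB (1 / Y) (r / Y) (s / Y)"
proof -
  define H where "H = Y - (r\<^sup>2 + s\<^sup>2) / 2"
  have H: "H > 0" using rs by (simp add: H_def)
  have Y: "Y > 0" using rs sum_power2_ge_zero[of r s] by linarith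
  have H': "1 / Y - ((r / Y)\<^sup>2 + (s / Y)\<^sup>2) / 2 = H / Y\<^sup>2"
    using Y by (simp add: H_def field_simps power2_eq_square)
  then have rs': "(r / Y)\<^sup>2 + (s / Y)\<^sup>2 < 2 * (1 / Y)"
  proof -
    have "1 / Y - ((r / Y)\<^sup>2 + (s / Y)\<^sup>2) / 2 > 0" unfolding H' using H Y by simp
    moreover have "a < 2 * b" if "b - a / 2 > 0" for a b :: real using that by simp
    ultimately show ?thesis by blast
  qed
  \<comment> \<open>The shift by one comes from \<open>j - 1/2 = (j - 1) + 1/2\<close>: the dual
    variable of \<open>tC\<close> takes the place of the half-integral variable of
    \<open>tB\<close>.\<close>
  let ?h = "\<lambda>((m, k, l), j). ((j - 1, k, l), m) :: (int \<times> int \<times> int) \<times> int"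
  have bij: "bij ?h"
    by (rule bij_betw_byWitness[where f'="\<lambda>((m, k, l), j). ((j, k, l), m + 1)"]) auto
  have eq: "real_theta (1/2) 0 (1 / Y) (r / Y) (s / Y) (?h x) = real_theta 0 (1/2) Y r s x" for x
  proof -
    obtain m k l j where x: "x = ((m, k, l), j)" by (metis prod.exhaust)
    have "of_int (j - 1) + 1 / 2 = of_int j - 1 / (2 :: real)" by simp
    then show ?thesis
      unfolding x real_theta_def prod.case using qform_swap[OF Y, of r s "of_int j - 1/2" "of_int m" "of_int k" "of_int l"]
      by simp
  qed
  have "(\<Sum>\<^sub>\<infinity>x. real_theta 0 (1/2) Y r s x) = (\<Sum>\<^sub>\<infinity>x. real_theta (1/2) 0 (1 / Y) (r / Y) (s / Y) x)"
    unfolding eq[symmetric] by (rule infsum_reindex_bij_betw[OF bij])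
  moreover have "1 / sqrt H = 1 / Y * (1 / sqrt (H / Y\<^sup>2))"
    using Y by (simp add: real_sqrt_divide)
  ultimately show ?thesis
    unfolding tC_real_theta[OF rs] tB_real_theta[OF rs'] H' H_def[symmetric] by (simp only: of_real_mult mult.assoc)
qed

lemma tA_pos:
  assumes rs: "r\<^sup>2 + s\<^sup>2 < 2 * Y"
  shows "tA Y r s > 0"
proof -
  let ?f = "\<lambda>x :: (int \<times> int \<times> int) \<times> int. case x of ((m, k, l), j) \<Rightarrow> exp (- pi * qform Y r s (of_int m) (of_int j) (of_int k) (of_int l))"
  have f: "real_theta 0 0 Y r s x = of_real (?f x)" for x
    by (simp add: real_theta_def case_prod_unfold)
  have pos: "?f x > 0" for x by (simp add: case_prod_unfold)
  have n: "norm (complex_of_real (?f x)) = ?f x" for x using pos[of x] by simp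
  have sm: "?f summable_on UNIV"
    using abs_summable_real_theta[OF rs, of 0 0] unfolding f n .
  have "(\<Sum>\<^sub>\<infinity>x. real_theta 0 0 Y r s x) = of_real (\<Sum>\<^sub>\<infinity>x. ?f x)"
    unfolding f by (rule infsumI, rule has_sum_of_real, rule has_sum_infsum[OF sm])
  moreover have "(\<Sum>\<^sub>\<infinity>x. ?f x) > 0"
  proof -
    let ?o = "((0, 0, 0), 0) :: (int \<times> int \<times> int) \<times> int"
    have "0 < ?f ?o" by (rule pos)
    also have "?f ?o = sum ?f {?o}" by simp
    also have "\<dots> \<le> (\<Sum>\<^sub>\<infinity>x. ?f x)"
      by (rule finite_sum_le_infsum[OF sm]) (use pos less_imp_le in blast)+
    finally show ?thesis .
  qed
  moreover have "Y - (r\<^sup>2 + s\<^sup>2) / 2 > 0" using rs by simp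
  ultimately show ?thesis
    unfolding tA_real_theta[OF rs] by (simp add: less_complex_def)
qed

section \<open>Positivity\<close>

lemma exp_minus_bounds:
  fixes x :: real
  assumes "x \<ge> 0"
  shows "exp (- x) \<le> 1 - x + x\<^sup>2 / 2 - x ^ 3 / 6 + x ^ 4 / 24"
    and "exp (- x) \<ge> 1 - x + x\<^sup>2 / 2 - x ^ 3 / 6 + x ^ 4 / 24 - x ^ 5 / 120"
proof -
  obtain t where "exp (- x) = (\<Sum>m<5. (- x) ^ m / fact m) + exp t / fact 5 * (- x) ^ 5"
    using Maclaurin_exp_le[of "- x" 5] by blast
  moreover have "exp t / fact 5 * (- x) ^ 5 \<le> 0" using assms by simp
  ultimately show "exp (- x) \<le> 1 - x + x\<^sup>2 / 2 - x ^ 3 / 6 + x ^ 4 / 24"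
    by (simp add: eval_nat_numeral)
  obtain t where "exp (- x) = (\<Sum>m<6. (- x) ^ m / fact m) + exp t / fact 6 * (- x) ^ 6"
    using Maclaurin_exp_le[of "- x" 6] by blast
  moreover have "exp t / fact 6 * (- x) ^ 6 \<ge> 0" by simp
  ultimately show "exp (- x) \<ge> 1 - x + x\<^sup>2 / 2 - x ^ 3 / 6 + x ^ 4 / 24 - x ^ 5 / 120"
    by (simp add: eval_nat_numeral)
qed

text \<open>The quartic Taylor polynomial is sharp only for small arguments, so \<open>x\<close> is
  cut into \<open>n\<close> parts of size at least \<open>y\<close>.\<close>

lemma exp_minus_le_power:
  fixes x y :: real
  assumes "0 \<le> y" "real n * y \<le> x" "1 - y + y\<^sup>2 / 2 - y ^ 3 / 6 + y ^ 4 / 24 \<le> c"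
  shows "exp (- x) \<le> c ^ n"
proof -
  have "exp (- x) \<le> exp (real n * (- y))" using assms(2) by simp
  also have "\<dots> = exp (- y) ^ n" by (rule exp_of_nat_mult)
  also have "\<dots> \<le> c ^ n"
    using exp_minus_bounds(1)[OF assms(1)] assms(3) by (intro power_mono) auto
  finally show ?thesis .
qed

lemma pi_bounds: "pi > 3.1415" "pi < 3.1416"
  using pi_approx by simp_all

lemma has_sum_int_halves:
  fixes f :: "int \<Rightarrow> 'b::topological_comm_monoid_add"
  assumes "((\<lambda>n. f (int n)) has_sum a) UNIV" "((\<lambda>n. f (- int n - 1)) has_sum b) UNIV"
  shows "(f has_sum (a + b)) UNIV"
proof -
  have "(f has_sum a) (range int)"
    by (subst has_sum_reindex) (use assms(1) in \<open>auto simp: o_def\<close>)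
  moreover have "(f has_sum b) (range (\<lambda>n. - int n - 1))"
    by (subst has_sum_reindex) (use assms(2) in \<open>auto simp: o_def inj_def\<close>)
  ultimately have "(f has_sum (a + b)) (range int \<union> range (\<lambda>n. - int n - 1))"
    by (rule has_sum_Un_disjoint) auto
  moreover have "range int \<union> range (\<lambda>n. - int n - 1) = UNIV"
  proof -
    have "x \<in> range int \<union> range (\<lambda>n. - int n - 1)" for x
    proof (cases "x \<ge> 0")
      case True
      then show ?thesis by (metis UnI1 nonneg_int_cases rangeI)
    next
      case False
      then have "x = - int (nat (- x - 1)) - 1" by simp
      then show ?thesis by (metis UnI2 rangeI)
    qed
    then show ?thesis by blast
  qed
  ultimately show ?thesis by simp
qed

lemma has_sum_geometric:
  fixes q :: real
  assumes "0 \<le> q" "q < 1"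
  shows "((\<lambda>n. c * q ^ n) has_sum (c / (1 - q))) UNIV"
  using has_sum_cmult_right[OF sums_nonneg_imp_has_sum[OF geometric_sums[of q]], of c] assms by simp

lemma has_sum_geometric_int:
  fixes q :: real
  assumes "0 \<le> q" "q < 1"
  shows "((\<lambda>k::int. q ^ nat \<bar>k\<bar>) has_sum ((1 + q) / (1 - q))) UNIV"
proof -
  have "nat \<bar>- int n - 1\<bar> = Suc n" for n by simp
  then have "((\<lambda>k::int. q ^ nat \<bar>k\<bar>) has_sum (1 / (1 - q) + q / (1 - q))) UNIV"
    using has_sum_geometric[OF assms, of 1] has_sum_geometric[OF assms, of q] by (intro has_sum_int_halves) simp_all
  then show ?thesis by (simp add: add_divide_distrib)
qed

text \<open>The terms at \<open>0, 1, -1\<close> are kept; the others are compared with a geometric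
  series by \<open>k\<^sup>2 \<ge> \<bar>k\<bar> + 2\<close> for
  \<open>\<bar>k\<bar> \<ge> 2\<close>.\<close>

lemma theta3_le:
  assumes t: "t > 0" and q: "exp (- pi * t) \<le> q" "q < 1"
  shows "theta3 t \<le> 1 + 2 * q + 2 * q ^ 4 / (1 - q)"
proof -
  have q0: "q > 0" using q(1) exp_gt_zero[of "- pi * t"] by linarith
  define g where "g k = q\<^sup>2 * q ^ nat \<bar>k\<bar> + (if k = 0 then 1 - q\<^sup>2 else if \<bar>k\<bar> = 1 then q - q ^ 3 else 0)" for k :: int
  have "((\<lambda>k::int. if k = 0 then 1 - q\<^sup>2 else if \<bar>k\<bar> = 1 then q - q ^ 3 else 0) has_sum (1 - q\<^sup>2 + 2 * (q - q ^ 3))) UNIV"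
    by (rule has_sum_finite_neutralI[of "{-1, 0, 1}"]) (auto simp: algebra_simps)
  from has_sum_add[OF has_sum_cmult_right[OF has_sum_geometric_int] this]
  have g: "(g has_sum (q\<^sup>2 * ((1 + q) / (1 - q)) + (1 - q\<^sup>2 + 2 * (q - q ^ 3)))) UNIV"
    unfolding g_def using q q0 by simp
  have le: "exp (- pi * t * (of_int k)\<^sup>2) \<le> g k" for k :: int
  proof -
    have "exp (- pi * t * (of_int k)\<^sup>2) = exp (real (nat \<bar>k\<bar> ^ 2) * (- pi * t))"
      by (simp add: mult_ac)
    also have "\<dots> = exp (- pi * t) ^ (nat \<bar>k\<bar> ^ 2)" by (rule exp_of_nat_mult)
    also have "\<dots> \<le> q ^ (nat \<bar>k\<bar> ^ 2)" by (rule power_mono) (use q in auto)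
    also have "\<dots> \<le> g k"
    proof -
      consider "k = 0" | "\<bar>k\<bar> = 1" | "nat \<bar>k\<bar> \<ge> 2" by linarith
      then show ?thesis
      proof cases
        case 3
        then have "nat \<bar>k\<bar> * nat \<bar>k\<bar> \<ge> 2 * nat \<bar>k\<bar>" by simp
        then have "2 + nat \<bar>k\<bar> \<le> nat \<bar>k\<bar> ^ 2" using 3 unfolding power2_eq_square by linarith
        then have "q ^ (nat \<bar>k\<bar> ^ 2) \<le> q ^ (2 + nat \<bar>k\<bar>)" using q0 q by (intro power_decreasing) auto
        moreover have "k \<noteq> 0" "\<bar>k\<bar> \<noteq> 1" using 3 by auto
        ultimately show ?thesis by (simp add: g_def power_add power2_eq_square[of q] mult.assoc)
      qed (auto simp: g_def power2_eq_square power3_eq_cube)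
    qed
    finally show ?thesis .
  qed
  have "theta3 t \<le> q\<^sup>2 * ((1 + q) / (1 - q)) + (1 - q\<^sup>2 + 2 * (q - q ^ 3))"
    unfolding theta3_def
    by (rule has_sum_mono[OF has_sum_infsum g]) (use summable_real_gauss[OF t, of 0] le in auto)
  also have "\<dots> = 1 + 2 * q + 2 * q ^ 4 / (1 - q)"
    using q by (simp add: field_simps power2_eq_square power3_eq_cube power4_eq_xxxx)
  finally show ?thesis .
qed

text \<open>The first two values enter the constants of the estimate after the interchange of cusps.
  The third has to stay below \<open>sqrt 2\<close>; this just fails at the self-dual parameter 1/2,
  whence the threshold \<open>13/25\<close>.\<close>

lemma theta3_numeric: "theta3 1 \<le> 1.0867" "theta3 (1/2) \<le> 1.421" "H \<ge> 13/25 \<Longrightarrow> theta3 H \<le> 1.4"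
proof -
  \<comment> \<open>\<open>0.3926\<close> is just below \<open>pi / 8\<close>, and
    \<open>0.6754\<close> just above \<open>exp (- 0.3926)\<close>.\<close>
  have "exp (- pi) \<le> 0.6754 ^ 8"
    by (rule exp_minus_le_power[of "0.3926"]) (use pi_bounds in linarith, use pi_bounds in simp, simp add: power_divide)
  also have "(0.6754 :: real) ^ 8 \<le> 0.04331" by (simp add: power_divide)
  finally have a: "exp (- pi * 1) \<le> 0.04331" by simp
  show "theta3 1 \<le> 1.0867" using theta3_le[OF _ a] by (simp add: power_divide)
  have "exp (- (pi / 2)) \<le> 0.6754 ^ 4"
    by (rule exp_minus_le_power[of "0.3926"]) (use pi_bounds in linarith, use pi_bounds in simp, simp add: power_divide)
  also have "(0.6754 :: real) ^ 4 \<le> 0.2081" by (simp add: power_divide)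
  finally have b: "exp (- pi * (1/2)) \<le> 0.2081" by simp
  show "theta3 (1/2) \<le> 1.421" using theta3_le[OF _ b] by (simp add: power_divide)
  assume H: "H \<ge> 13/25"
  have "3.1415 * (13/25) \<le> pi * H" by (rule mult_mono) (use pi_bounds H in auto)
  then have "exp (- (pi * H)) \<le> 0.6651 ^ 4"
    by (intro exp_minus_le_power[of "0.408"]) (simp_all add: power_divide)
  also have "(0.6651 :: real) ^ 4 \<le> 0.1957" by (simp add: power_divide)
  finally have c: "exp (- pi * H) \<le> 0.1957" by simp
  show "theta3 H \<le> 1.4" using theta3_le[OF _ c] H by (simp add: power_divide)
qed

lemma has_sum_diff:
  fixes f g :: "'a \<Rightarrow> 'b::topological_ab_group_add"
  assumes "(f has_sum a) A" "(g has_sum b) A"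
  shows "((\<lambda>x. f x - g x) has_sum (a - b)) A"
  using has_sum_add[where f=f and A=A and a=a and g="\<lambda>x. - g x" and b="- b"] has_sum_uminus[where f=g and A=A and a="- b"] assms by simp

lemma theta3_ge_1: "t > 0 \<Longrightarrow> theta3 t \<ge> 1"
proof -
  assume t: "t > 0"
  have "(\<Sum>k\<in>{0::int}. exp (- pi * t * (of_int k)\<^sup>2)) \<le> theta3 t"
    unfolding theta3_def by (rule finite_sum_le_infsum) (use summable_real_gauss[OF t, of 0] in auto)
  then show ?thesis by simp
qed

lemma p00_0: "p00 0 = of_real (theta3 1)"
proof -
  have "p00 0 = gauss_period (of_real 1) (of_real 0)"
    unfolding ph_def gauss_period_def by simp
  then show ?thesis unfolding gauss_period_of_real[OF zero_less_one] theta3_def by simp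
qed

text \<open>At the origin both theta factors equal \<open>theta3 1\<close>. The whole sum is
  majorised by \<open>(theta3 1)\<^sup>2\<close> times a two-dimensional Gaussian sum, and removing
  the origin from both sides leaves the error.\<close>

lemma norm_lsum_minus_origin_le:
  fixes \<epsilon> :: complex
  assumes rs: "r\<^sup>2 + s\<^sup>2 < 2 * Y" and \<epsilon>: "norm \<epsilon> = 1"
  shows "norm (lsum K0 p00 p00 Y r s + \<epsilon> * lsum K1 p00 p00 Y r s - of_real ((theta3 1)\<^sup>2))
    \<le> (theta3 1)\<^sup>2 * (theta3 (Y - (r\<^sup>2 + s\<^sup>2) / 2))\<^sup>2 - (theta3 1)\<^sup>2"
proof -
  define h where "h = Y - (r\<^sup>2 + s\<^sup>2) / 2"
  have h0: "h > 0" using rs by (simp add: h_def)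
  let ?c = "theta3 1"
  let ?x = "\<lambda>e. if e then 1 else \<epsilon>"
  let ?t = "lsum K0 p00 p00 Y r s + \<epsilon> * lsum K1 p00 p00 Y r s"
  let ?f = "\<lambda>(m, n). ?x (even (m + n)) * lterm p00 p00 Y r s (lpt 0 m n)"
  let ?d = "\<lambda>p :: int \<times> int. if p = (0, 0) then 1 else 0 :: real"
  let ?g = "\<lambda>(m::int, n::int). exp (- pi * h * (of_int m)\<^sup>2) * exp (- pi * h * (of_int n)\<^sup>2)"
  have le: "norm (?f p) \<le> ?c\<^sup>2 * ?g p" for p
  proof -
    obtain m n where p: "p = (m, n)" by (cases p)
    have "norm (?f p) = norm (lterm p00 p00 Y r s (lpt 0 m n))" unfolding p prod.case norm_mult using \<epsilon> by simp
    also have "\<dots> \<le> ?c\<^sup>2 * exp (- pi * h * (norm (lpt 0 m n))\<^sup>2)"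
      unfolding h_def by (rule norm_lterm_le[OF gauss_bounded_ph gauss_bounded_ph])
    also have "exp (- pi * h * (norm (lpt 0 m n))\<^sup>2) = ?g p"
      unfolding p prod.case cmod_power2 complex.sel mult_exp_exp by (simp add: algebra_simps)
    finally show ?thesis .
  qed
  have sg: "?g summable_on UNIV"
    using abs_summable_times[OF _ _, of "\<lambda>m::int. exp (- pi * h * (of_int m)\<^sup>2)" UNIV "\<lambda>m::int. exp (- pi * h * (of_int m)\<^sup>2)" UNIV]
      summable_real_gauss[OF h0, of 0] by (simp add: case_prod_unfold abs_mult)
  have ig: "infsum ?g UNIV = (theta3 h)\<^sup>2"
    using infsum_times[of "\<lambda>m::int. exp (- pi * h * (of_int m)\<^sup>2)" UNIV "\<lambda>m::int. exp (- pi * h * (of_int m)\<^sup>2)" UNIV]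
      summable_real_gauss[OF h0, of 0] by (simp add: theta3_def power2_eq_square)
  have hd: "(?d has_sum 1) UNIV"
    by (rule has_sum_finite_neutralI[of "{(0, 0)}"]) auto
  have sf: "?f summable_on UNIV"
    by (rule abs_summable_summable, rule summable_on_comparison_test[OF summable_on_cmult_right[OF sg, of "?c\<^sup>2"]]) (use le in auto)
  have T: "infsum ?f UNIV = ?t"
    unfolding lsum_def
    by (subst infsum_cosets[of "lterm p00 p00 Y r s" 0 ?x]) (auto intro: abs_summable_lterm gauss_bounded_ph rs)
  have "((\<lambda>p. ?f p - of_real (?c\<^sup>2 * ?d p)) has_sum (?t - of_real (?c\<^sup>2 * 1))) UNIV"
    unfolding T[symmetric]
    by (intro has_sum_diff has_sum_infsum sf has_sum_of_real has_sum_cmult_right hd)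
  moreover have "((\<lambda>p. ?c\<^sup>2 * ?g p - ?c\<^sup>2 * ?d p) has_sum (?c\<^sup>2 * (theta3 h)\<^sup>2 - ?c\<^sup>2 * 1)) UNIV"
    unfolding ig[symmetric] by (intro has_sum_diff has_sum_cmult_right has_sum_infsum sg hd)
  moreover have "norm (?f p - of_real (?c\<^sup>2 * ?d p)) \<le> ?c\<^sup>2 * ?g p - ?c\<^sup>2 * ?d p" for p
  proof (cases "p = (0, 0)")
    case True
    then show ?thesis
      by (simp add: lterm_def p00_0 power2_eq_square flip: of_real_mult zero_complex.code)
  next
    case False
    then show ?thesis using le[of p] by simp
  qed
  ultimately have "norm (?t - of_real (?c\<^sup>2 * 1)) \<le> ?c\<^sup>2 * (theta3 h)\<^sup>2 - ?c\<^sup>2 * 1"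
    by (rule norm_infsum_le)
  then show ?thesis by (simp only: h_def mult_1_right)
qed

text \<open>Away from the cusp \<open>Y = 0\<close> the term of the origin dominates.\<close>

lemma tC_near_cusp:
  assumes H: "Y - (r\<^sup>2 + s\<^sup>2) / 2 \<ge> 13/25"
  shows "Re (tC Y r s) > 0"
proof -
  define h where "h = Y - (r\<^sup>2 + s\<^sup>2) / 2"
  have h: "h \<ge> 13/25" using H by (simp only: h_def)
  then have h0: "h > 0" by linarith
  have "a < 2 * b" if "b - a / 2 \<ge> 13/25" for a b :: real using that by simp
  from this[OF H] have rs: "r\<^sup>2 + s\<^sup>2 < 2 * Y" .
  let ?c = "theta3 1"
  have "norm (tC Y r s - of_real (?c\<^sup>2)) \<le> ?c\<^sup>2 * (theta3 h)\<^sup>2 - ?c\<^sup>2"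
    using norm_lsum_minus_origin_le[OF rs, of "- 1"] by (simp add: tC_def h_def)
  \<comment> \<open>\<open>1.4\<^sup>2 = 1.96 < 2\<close>, so the error stays below the term of the
    origin.\<close>
  moreover have "(theta3 h)\<^sup>2 \<le> 1.4\<^sup>2"
    using theta3_numeric(3)[OF h] theta3_ge_1[OF h0] by (intro power_mono) auto
  then have "?c\<^sup>2 * (theta3 h)\<^sup>2 \<le> ?c\<^sup>2 * (49/25)" by (intro mult_left_mono) (auto simp: power2_eq_square)
  moreover have "?c\<^sup>2 > 0" using theta3_ge_1[of 1] by simp
  moreover have "- norm (tC Y r s - of_real (?c\<^sup>2)) \<le> Re (tC Y r s) - ?c\<^sup>2"
    using abs_Re_le_cmod[of "tC Y r s - of_real (?c\<^sup>2)"] by simp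
  ultimately show ?thesis by linarith
qed

text \<open>The reflection \<open>k \<mapsto> 2 * Re \<kappa> - k\<close> changes the sign of all terms.\<close>

lemma p00_half_zero: "p00 (lpt (1/2) m n) = 0"
proof -
  let ?z = "lpt (1/2) m n"
  let ?f = "\<lambda>k::int. exp (- of_real pi * (of_int k + of_real 0)\<^sup>2 + 2 * of_real pi * (of_int k + of_real 0) * (?z + \<i> * of_real 0))"
  have z: "?z = of_int (2 * m + 1) / 2 + \<i> * of_int (2 * n + 1) / 2"
    by (simp add: complex_eq_iff)
  have odd: "exp (of_real pi * \<i> * of_int j) = - 1" if "odd j" for j
  proof -
    obtain h where "j = 2 * h + 1" using \<open>odd j\<close> by (rule oddE)
    then have "of_real pi * \<i> * of_int j = 2 * of_real pi * \<i> * of_int h + of_real pi * \<i>" by (simp add: algebra_simps)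
    then show ?thesis by (simp only: exp_add exp_2pi_int exp_pi_i) simp
  qed
  have r: "?f (2 * m + 1 - k) = - ?f k" for k
  proof -
    let ?M = "2 * m + 1" and ?N = "2 * n + 1"
    \<comment> \<open>\<open>?M\<close> and \<open>?N\<close> are twice the coordinates of the
      point, and the reflected term is the original one times
      \<open>exp (pi * \<i> * ?N * (?M - 2 * k))\<close>.\<close>
    have "odd (?M * ?N - 2 * k * ?N)" by simp
    from odd[OF this] have e: "exp (of_real pi * \<i> * of_int (?M * ?N - 2 * k * ?N)) = - 1" .
    have alg: "- p * (M - K + 0)\<^sup>2 + 2 * p * (M - K + 0) * (M / 2 + \<i> * N / 2 + \<i> * 0) =
       p * \<i> * (M * N - 2 * K * N) + (- p * (K + 0)\<^sup>2 + 2 * p * (K + 0) * (M / 2 + \<i> * N / 2 + \<i> * 0))" for p M K N :: complex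
      by (simp add: power2_eq_square field_simps)
    have "?f (2 * m + 1 - k) = exp (of_real pi * \<i> * of_int (?M * ?N - 2 * k * ?N)) * ?f k"
      unfolding z mult_exp_exp
      using alg[of "of_real pi" "of_int ?M" "of_int k" "of_int ?N"] by (simp only: of_int_diff of_int_mult of_int_numeral of_real_0)
    then show ?thesis unfolding e by simp
  qed
  have "infsum ?f UNIV = (\<Sum>\<^sub>\<infinity>k. ?f (2 * m + 1 - k))"
    by (rule infsum_reindex_bij_witness[where i="\<lambda>k. 2 * m + 1 - k" and j="\<lambda>k. 2 * m + 1 - k"]) auto
  also have "\<dots> = - infsum ?f UNIV" unfolding r by (rule infsum_uminus)
  finally have "infsum ?f UNIV = 0" by simp
  then show ?thesis unfolding ph_def by simp
qed

text \<open>\<open>p00\<close> freed of its Gaussian growth along the ray through \<open>z\<close>.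
  In \<open>lterm\<close> this leaves the decay rate \<open>Y - (r\<^sup>2 + s\<^sup>2) / 2\<close>,
  and the factor can be estimated and differentiated in \<open>r\<close> uniformly.\<close>

definition bounded_ph :: "complex \<Rightarrow> real \<Rightarrow> complex" where
  "bounded_ph z r = of_real (exp (- pi * r\<^sup>2 * (norm z)\<^sup>2 / 2)) * p00 (of_real r * z)"

lemma lterm_bounded_ph: "lterm p00 p00 Y r s z = of_real (exp (- pi * (Y - (r\<^sup>2 + s\<^sup>2) / 2) * (norm z)\<^sup>2)) * (bounded_ph z r * bounded_ph z s)"
proof -
  have "exp (- pi * Y * (norm z)\<^sup>2) = exp (- pi * (Y - (r\<^sup>2 + s\<^sup>2) / 2) * (norm z)\<^sup>2) * (exp (- pi * r\<^sup>2 * (norm z)\<^sup>2 / 2) * exp (- pi * s\<^sup>2 * (norm z)\<^sup>2 / 2))"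
    unfolding mult_exp_exp by (rule arg_cong[where f=exp]) (simp add: field_simps)
  then show ?thesis unfolding lterm_def bounded_ph_def by (simp only: of_real_mult mult_ac)
qed

lemma norm_bounded_ph_le: "norm (bounded_ph z r) \<le> theta3 1"
proof -
  have "norm (bounded_ph z r) \<le> exp (- pi * r\<^sup>2 * (norm z)\<^sup>2 / 2) * (theta3 1 * exp (pi * (norm (of_real r * z))\<^sup>2 / 2))"
    unfolding bounded_ph_def norm_mult[of "of_real (exp _)"] norm_of_real abs_exp_cancel
    by (intro mult_left_mono norm_ph_le) simp
  also have "\<dots> = theta3 1 * (exp (- pi * r\<^sup>2 * (norm z)\<^sup>2 / 2) * exp (pi * (norm (of_real r * z))\<^sup>2 / 2))" by simp
  also have "exp (- pi * r\<^sup>2 * (norm z)\<^sup>2 / 2) * exp (pi * (norm (of_real r * z))\<^sup>2 / 2) = 1"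
    unfolding mult_exp_exp by (simp add: norm_mult power_mult_distrib)
  finally show ?thesis by simp
qed

text \<open>\<open>0.3423\<close> is slightly more than \<open>1 / sqrt (pi * e)\<close>, the
  maximum of \<open>\<bar>t\<bar> * exp (- pi * t\<^sup>2 / 2)\<close>.\<close>

lemma abs_mult_gauss_le: "\<bar>t\<bar> * exp (- pi * t\<^sup>2) \<le> 0.3423 * exp (- pi * (1/2) * t\<^sup>2)" for t :: real
proof -
  have "(3.1415 * t\<^sup>2) * 2.7182 \<le> exp (pi * t\<^sup>2)"
  proof -
    have "2.7182 \<le> exp (1::real)" using e_approx_32 by (simp add: abs_if split: if_splits)
    moreover have "pi * t\<^sup>2 \<le> exp (pi * t\<^sup>2 - 1)" using exp_ge_add_one_self[of "pi * t\<^sup>2 - 1"] by simp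
    moreover have "3.1415 * t\<^sup>2 \<le> pi * t\<^sup>2" using pi_bounds by (intro mult_right_mono) auto
    ultimately have "(3.1415 * t\<^sup>2) * 2.7182 \<le> exp (pi * t\<^sup>2 - 1) * exp 1" by (intro mult_mono) auto
    then show ?thesis unfolding mult_exp_exp by simp
  qed
  moreover have "t\<^sup>2 \<le> (0.3423)\<^sup>2 * ((3.1415 * t\<^sup>2) * 2.7182)" by (simp add: power2_eq_square)
  ultimately have "t\<^sup>2 \<le> (0.3423)\<^sup>2 * exp (pi * t\<^sup>2)" by (smt (verit) mult_left_mono zero_le_power2)
  also have "\<dots> = (0.3423 * exp (pi * t\<^sup>2 / 2))\<^sup>2" unfolding power_mult_distrib exp_double[symmetric] by simp
  finally have "\<bar>t\<bar> \<le> 0.3423 * exp (pi * t\<^sup>2 / 2)" using abs_le_square_iff[of t "0.3423 * exp (pi * t\<^sup>2 / 2)"] by simp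
  then have "\<bar>t\<bar> * exp (- pi * t\<^sup>2) \<le> 0.3423 * exp (pi * t\<^sup>2 / 2) * exp (- pi * t\<^sup>2)" by (intro mult_right_mono) auto
  also have "\<dots> = 0.3423 * exp (- pi * (1/2) * t\<^sup>2)" unfolding mult.assoc mult_exp_exp by simp
  finally show ?thesis .
qed

text \<open>By \<open>p00_half_zero\<close> the function vanishes at \<open>r = 1\<close>, so a
  bound on its derivative in \<open>r\<close> yields the factor \<open>1 - r\<close>. The constant
  is \<open>2 * 3.1416 * 0.3423 * 1.421\<close> rounded up: differentiation brings down
  \<open>2 * pi * (k - \<rho> * x) * z\<close>, and \<open>1.421\<close> bounds the Gaussian sum
  that remains.\<close>

lemma norm_bounded_ph_half_le:
  assumes r: "0 \<le> r" "r \<le> 1"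
  shows "norm (bounded_ph (lpt (1/2) m n) r) \<le> 3.0565 * norm (lpt (1/2) m n) * (1 - r)"
proof -
  let ?z = "lpt (1/2) m n"
  define x y where "x = Re ?z" and "y = Im ?z"
  have z: "?z = of_real x + \<i> * of_real y" by (simp add: x_def y_def complex_eq_iff)
  define T where "T k \<rho> = exp (of_real (- pi * (k - \<rho> * x)\<^sup>2) + \<i> * of_real (pi * y * \<rho> * (2 * k - \<rho> * x)))" for k \<rho> :: real
  have gp: "((\<lambda>k::int. T (of_int k) \<rho>) has_sum bounded_ph ?z \<rho>) UNIV" for \<rho>
  proof -
    have "of_real (exp (- pi * \<rho>\<^sup>2 * (norm ?z)\<^sup>2 / 2)) * phterm 0 0 (of_real \<rho> * ?z) k = T (of_int k) \<rho>" for k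
    proof -
      have n: "(norm ?z)\<^sup>2 = x\<^sup>2 + y\<^sup>2" by (simp only: cmod_power2 x_def y_def)
      have ii: "\<i> * (\<i> * w) = - w" for w by (simp flip: mult.assoc)
      show ?thesis unfolding phterm_def n unfolding z T_def exp_of_real[symmetric] mult_exp_exp
        by (rule arg_cong[where f=exp]) (simp add: power2_eq_square field_simps ii)
    qed
    moreover have "((\<lambda>k. of_real (exp (- pi * \<rho>\<^sup>2 * (norm ?z)\<^sup>2 / 2)) * phterm 0 0 (of_real \<rho> * ?z) k) has_sum bounded_ph ?z \<rho>) UNIV"
      unfolding bounded_ph_def ph_eq_infsum by (rule has_sum_cmult_right, rule has_sum_infsum, rule abs_summable_summable, rule abs_summable_phterm)
    ultimately show ?thesis by simp
  qed
  have der: "(T k has_vector_derivative (2 * of_real (pi * (k - \<rho> * x)) * ?z * T k \<rho>)) (at \<rho> within S)" for k \<rho> S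
  proof -
    let ?h = "\<lambda>u. - of_real pi * (of_real k - u * of_real x)\<^sup>2 + \<i> * (of_real pi * of_real y * u * (2 * of_real k - u * of_real x))"
    have T: "T k = (\<lambda>\<rho>. exp (?h (of_real \<rho>)))" unfolding T_def by (rule ext) simp
    have "((\<lambda>u. exp (?h u)) has_field_derivative exp (?h u) * (of_real pi * of_real x * 2 * (of_real k - u * of_real x) + \<i> * of_real pi * of_real y * (2 * of_real k - 2 * u * of_real x))) (at u)" for u
      by (rule derivative_eq_intros refl)+ (simp add: field_simps)
    from has_vector_derivative_real_field[OF this]
    have "(T k has_vector_derivative exp (?h (of_real \<rho>)) * (of_real pi * of_real x * 2 * (of_real k - of_real \<rho> * of_real x) + \<i> * of_real pi * of_real y * (2 * of_real k - 2 * of_real \<rho> * of_real x))) (at \<rho> within S)"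
      unfolding T .
    moreover have "exp (?h (of_real \<rho>)) * (of_real pi * of_real x * 2 * (of_real k - of_real \<rho> * of_real x) + \<i> * of_real pi * of_real y * (2 * of_real k - 2 * of_real \<rho> * of_real x))
      = 2 * of_real (pi * (k - \<rho> * x)) * ?z * T k \<rho>"
      unfolding z T by (simp add: algebra_simps)
    ultimately show ?thesis by simp
  qed
  have nT: "norm (2 * of_real (pi * (k - \<rho> * x)) * ?z * T k \<rho>) \<le> 2 * 3.1416 * norm ?z * 0.3423 * exp (- pi * (1/2) * (k - \<rho> * x)\<^sup>2)" for k \<rho>
  proof -
    have "norm (2 * of_real (pi * (k - \<rho> * x)) * ?z * T k \<rho>) = 2 * pi * norm ?z * (\<bar>k - \<rho> * x\<bar> * exp (- pi * (k - \<rho> * x)\<^sup>2))"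
      unfolding norm_mult norm_of_real by (simp add: T_def abs_mult)
    also have "\<dots> \<le> 2 * 3.1416 * norm ?z * (0.3423 * exp (- pi * (1/2) * (k - \<rho> * x)\<^sup>2))"
      using pi_bounds by (intro mult_mono abs_mult_gauss_le mult_nonneg_nonneg) auto
    finally show ?thesis by simp
  qed
  let ?B = "2 * 3.1416 * norm ?z * 0.3423 * 1.421"
  \<comment> \<open>The mean value estimate is made for finite partial sums with a uniform constant
    and then passes to the limit; the infinite series is never differentiated.\<close>
  have fin: "norm ((\<Sum>k\<in>F. T (of_int k) r) - (\<Sum>k\<in>F. T (of_int k) 1)) \<le> ?B * norm (r - 1)" if F: "finite F" for F :: "int set"
  proof (rule differentiable_bound[of "{0..1}" "\<lambda>\<rho>. \<Sum>k\<in>F. T (of_int k) \<rho>" "\<lambda>\<rho> h. h *\<^sub>R (\<Sum>k\<in>F. 2 * of_real (pi * (of_int k - \<rho> * x)) * ?z * T (of_int k) \<rho>)"])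
    fix \<rho> :: real
    show "((\<lambda>\<rho>. \<Sum>k\<in>F. T (of_int k) \<rho>) has_derivative (\<lambda>h. h *\<^sub>R (\<Sum>k\<in>F. 2 * of_real (pi * (of_int k - \<rho> * x)) * ?z * T (of_int k) \<rho>))) (at \<rho> within {0..1})"
      unfolding has_vector_derivative_def[symmetric] by (intro has_vector_derivative_sum der)
    have "norm (\<Sum>k\<in>F. 2 * of_real (pi * (of_int k - \<rho> * x)) * ?z * T (of_int k) \<rho>) \<le>
        (\<Sum>k\<in>F. 2 * 3.1416 * norm ?z * 0.3423 * exp (- pi * (1/2) * (of_int k + - (\<rho> * x))\<^sup>2))"
      by (rule sum_norm_le) (use nT[of "of_int _" \<rho>] in simp)
    also have "\<dots> = 2 * 3.1416 * norm ?z * 0.3423 * (\<Sum>k\<in>F. exp (- pi * (1/2) * (of_int k + - (\<rho> * x))\<^sup>2))"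
      by (simp only: sum_distrib_left)
    also have "\<dots> \<le> ?B"
    proof (rule mult_left_mono)
      have "(\<Sum>k\<in>F. exp (- pi * (1/2) * (of_int k + - (\<rho> * x))\<^sup>2)) \<le> (\<Sum>\<^sub>\<infinity>k::int. exp (- pi * (1/2) * (of_int k + - (\<rho> * x))\<^sup>2))"
        by (rule finite_sum_le_infsum) (use summable_real_gauss[of "1/2" "- (\<rho> * x)"] F in auto)
      also have "\<dots> \<le> theta3 (1/2)" by (rule real_gauss_le_theta3) simp
      also have "\<dots> \<le> 1.421" by (rule theta3_numeric)
      finally show "(\<Sum>k\<in>F. exp (- pi * (1/2) * (of_int k + - (\<rho> * x))\<^sup>2)) \<le> 1.421" .
    qed simp
    finally have "norm (\<Sum>k\<in>F. 2 * of_real (pi * (of_int k - \<rho> * x)) * ?z * T (of_int k) \<rho>) \<le> ?B" .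
    then show "onorm (\<lambda>h. h *\<^sub>R (\<Sum>k\<in>F. 2 * of_real (pi * (of_int k - \<rho> * x)) * ?z * T (of_int k) \<rho>)) \<le> ?B"
      by (intro onorm_le) (simp only: norm_scaleR real_norm_def mult.commute[of _ "\<bar>_\<bar>"] mult_left_mono abs_ge_zero)
  qed (use r in auto)
  have "((\<lambda>k. T (of_int k) r - T (of_int k) 1) has_sum (bounded_ph ?z r - bounded_ph ?z 1)) UNIV"
    by (intro has_sum_diff gp)
  then have lim: "((\<lambda>F. \<Sum>k\<in>F. T (of_int k) r - T (of_int k) 1) \<longlongrightarrow> bounded_ph ?z r - bounded_ph ?z 1) (finite_subsets_at_top UNIV)"
    by (simp only: has_sum_def)
  have "norm (bounded_ph ?z r - bounded_ph ?z 1) \<le> ?B * norm (r - 1)"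
    by (rule Lim_norm_ubound[OF _ lim])
      (use fin in \<open>auto intro!: eventually_finite_subsets_at_top_weakI simp: sum_subtractf\<close>)
  moreover have "bounded_ph ?z 1 = 0" by (simp only: bounded_ph_def of_real_1 mult_1_left p00_half_zero mult_zero_right)
  moreover have "norm (r - 1) = 1 - r" using r by simp
  ultimately have "norm (bounded_ph ?z r) \<le> ?B * (1 - r)" by (simp only: diff_0_right)
  also have "?B * (1 - r) \<le> 3.0565 * norm ?z * (1 - r)"
    using r by (intro mult_right_mono) (auto simp: field_simps)
  finally show ?thesis .
qed

text \<open>The factor \<open>\<bar>cos \<theta>\<bar>\<close> is kept so that the tail of the next
  series remains proportional to its leading terms near their zero. Geometric growth in
  \<open>n\<close> is harmless against the Gaussian.\<close>

lemma abs_cos_odd_le: "\<bar>cos (real (2 * n + 1) * \<theta>)\<bar> \<le> 3 ^ n * \<bar>cos \<theta>\<bar>"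
proof (induction n)
  case (Suc n)
  have e: "real (2 * Suc n + 1) * \<theta> = real (2 * n + 1) * \<theta> + 2 * \<theta>" by (simp add: algebra_simps)
  have s: "\<bar>sin (2 * \<theta>)\<bar> \<le> 2 * \<bar>cos \<theta>\<bar>"
    unfolding sin_double abs_mult using abs_sin_le_one[of \<theta>] mult_right_mono[of "\<bar>sin \<theta>\<bar>" 1 "\<bar>cos \<theta>\<bar>"] by simp
  have "\<bar>cos (real (2 * Suc n + 1) * \<theta>)\<bar> \<le> \<bar>cos (real (2 * n + 1) * \<theta>)\<bar> * \<bar>cos (2 * \<theta>)\<bar> + \<bar>sin (real (2 * n + 1) * \<theta>)\<bar> * \<bar>sin (2 * \<theta>)\<bar>"
    unfolding e cos_add abs_mult[symmetric] by (rule abs_triangle_ineq4)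
  also have "\<dots> \<le> \<bar>cos (real (2 * n + 1) * \<theta>)\<bar> * 1 + 1 * (2 * \<bar>cos \<theta>\<bar>)"
    by (intro add_mono mult_mono s) auto
  also have "\<dots> \<le> 3 ^ n * \<bar>cos \<theta>\<bar> + 3 ^ n * (2 * \<bar>cos \<theta>\<bar>)"
  proof -
    have "1 * (2 * \<bar>cos \<theta>\<bar>) \<le> 3 ^ n * (2 * \<bar>cos \<theta>\<bar>)" by (intro mult_right_mono) auto
    then show ?thesis using Suc by linarith
  qed
  finally show ?case by (simp add: mult_ac)
qed simp

text \<open>Poisson summation gives a series in \<open>cos ((2 * n + 1) * pi * w)\<close> with
  coefficients \<open>exp (- pi * (n + 1/2)\<^sup>2)\<close>. The terms \<open>n = 0, -1\<close>
  contribute \<open>2 * exp (- pi / 4) * cos (pi * w)\<close>; the others are dominated by a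
  geometric series whose ratio bounds \<open>3 * exp (- 2 * pi)\<close>.\<close>

lemma alternating_gauss_ge:
  assumes w: "0 \<le> cos (pi * w)"
  shows "\<exists>X. (\<Sum>\<^sub>\<infinity>k::int. cis (pi * of_int k) * of_real (exp (- pi * (of_int k - w)\<^sup>2))) = complex_of_real X \<and> 0.9 * cos (pi * w) \<le> X"
proof -
  define c where "c = cos (pi * w)"
  have c: "c \<ge> 0" using w by (simp add: c_def)
  define g where "g n = exp (- pi * (of_int n + 1/2)\<^sup>2)" for n :: int
  have sg: "(\<lambda>n. norm (of_real (g n) * cis (2 * pi * (of_int n + 1/2) * w))) summable_on UNIV"
    using summable_real_gauss[of 1 "1/2"] by (simp add: norm_mult g_def)
  have hs: "((\<lambda>n. of_real (g n) * cis (2 * pi * (of_int n + 1/2) * w)) has_sum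
      (\<Sum>\<^sub>\<infinity>k::int. cis (pi * of_int k) * of_real (exp (- pi * (of_int k - w)\<^sup>2)))) UNIV"
    using has_sum_infsum[OF abs_summable_summable[OF sg]] poisson_characteristic[of 1 "1/2" w] by (simp add: g_def)
  let ?S = "\<Sum>\<^sub>\<infinity>k::int. cis (pi * of_int k) * of_real (exp (- pi * (of_int k - w)\<^sup>2))"
  have re: "((\<lambda>n. g n * cos (2 * pi * (of_int n + 1/2) * w)) has_sum Re ?S) UNIV"
    using has_sum_Re[OF hs] by simp
  have im: "((\<lambda>n. g n * sin (2 * pi * (of_int n + 1/2) * w)) has_sum Im ?S) UNIV"
    using has_sum_Im[OF hs] by simp
  have "Im ?S = - Im ?S"
  proof -
    have "(\<Sum>\<^sub>\<infinity>n. g n * sin (2 * pi * (of_int n + 1/2) * w)) = (\<Sum>\<^sub>\<infinity>n. - (g n * sin (2 * pi * (of_int n + 1/2) * w)))"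
    proof (rule infsum_reindex_bij_witness[where i="\<lambda>n. - n - 1" and j="\<lambda>n. - n - 1"])
      fix n :: int
      have "of_int (- n - 1) + 1/2 = - (of_int n + 1 / (2::real))" by simp
      then show "- (g (- n - 1) * sin (2 * pi * (of_int (- n - 1) + 1/2) * w)) = g n * sin (2 * pi * (of_int n + 1/2) * w)"
        unfolding g_def by (simp only: power2_minus mult_minus_right mult_minus_left sin_minus minus_minus)
    qed auto
    then show ?thesis unfolding infsum_uminus infsumI[OF im] .
  qed
  then have S: "?S = of_real (Re ?S)" by (simp add: complex_eq_iff)
  define q :: real where "q = 0.0073"
  let ?h = "\<lambda>n :: int. exp (- (pi / 4)) * c * (if n \<ge> 0 then q ^ nat n else q ^ nat (- n - 1))"
  have "((\<lambda>n. exp (- (pi / 4)) * c * q ^ n) has_sum (exp (- (pi / 4)) * c / (1 - q))) UNIV"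
    by (rule has_sum_geometric) (simp_all add: q_def)
  then have h: "(?h has_sum (exp (- (pi / 4)) * c / (1 - q) + exp (- (pi / 4)) * c / (1 - q))) UNIV"
    by (intro has_sum_int_halves) simp_all
  have d: "((\<lambda>n::int. if n \<in> {0, -1} then exp (- (pi / 4)) * c else 0) has_sum (exp (- (pi / 4)) * c + exp (- (pi / 4)) * c)) UNIV"
    by (rule has_sum_finite_neutralI[of "{0, -1}"]) auto
  have q1: "3 * exp (- (2 * pi)) \<le> q"
  proof -
    have "exp (- (2 * pi)) \<le> 0.6754 ^ 16"
      by (rule exp_minus_le_power[of "0.3926"]) (use pi_bounds in linarith, use pi_bounds in simp, simp add: power_divide)
    also have "3 * (0.6754 :: real) ^ 16 \<le> 0.0073" by (simp add: power_divide)
    finally show ?thesis by (simp add: q_def)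
  qed
  have key: "\<bar>g n * cos (2 * pi * (of_int n + 1/2) * w)\<bar> \<le> ?h n" if "n \<ge> 0" for n
  proof -
    obtain m where m: "n = int m" using \<open>n \<ge> 0\<close> nonneg_int_cases by blast
    have "g n \<le> exp (- (pi / 4)) * exp (- (2 * pi)) ^ m"
    proof -
      have "real m \<le> real m ^ 2" by (cases m) (auto simp: power2_eq_square)
      then have "pi * (2 * real m) \<le> pi * (real m ^ 2 + real m)" by (intro mult_left_mono) auto
      then show ?thesis unfolding g_def m exp_of_nat_mult[symmetric] mult_exp_exp by (simp add: power2_eq_square algebra_simps)
    qed
    moreover have "\<bar>cos (2 * pi * (of_int n + 1/2) * w)\<bar> \<le> 3 ^ m * c"
      using abs_cos_odd_le[of m "pi * w"] c by (simp add: m c_def algebra_simps)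
    ultimately have "\<bar>g n * cos (2 * pi * (of_int n + 1/2) * w)\<bar> \<le> (exp (- (pi / 4)) * exp (- (2 * pi)) ^ m) * (3 ^ m * c)"
      unfolding abs_mult by (intro mult_mono) (auto simp: g_def)
    also have "\<dots> = exp (- (pi / 4)) * c * (3 * exp (- (2 * pi))) ^ m" by (simp add: power_mult_distrib)
    also have "\<dots> \<le> exp (- (pi / 4)) * c * q ^ m" using q1 c by (intro mult_left_mono power_mono) auto
    finally show ?thesis by (simp add: m)
  qed
  have sym: "g (- n - 1) = g n" "cos (2 * pi * (of_int (- n - 1) + 1/2) * w) = cos (2 * pi * (of_int n + 1/2) * w)" for n
  proof -
    have "of_int (- n - 1) + 1/2 = - (of_int n + 1 / (2::real))" by simp
    then show "g (- n - 1) = g n" "cos (2 * pi * (of_int (- n - 1) + 1/2) * w) = cos (2 * pi * (of_int n + 1/2) * w)"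
      unfolding g_def by (simp_all only: power2_minus mult_minus_right mult_minus_left cos_minus)
  qed
  have key': "\<bar>g n * cos (2 * pi * (of_int n + 1/2) * w)\<bar> \<le> ?h n" for n
  proof (cases "n \<ge> 0")
    case False
    then show ?thesis using key[of "- n - 1"] unfolding sym by simp
  qed (use key in blast)
  \<comment> \<open>Twice the leading terms minus the majorant: exact at \<open>n = 0, -1\<close>,
    where \<open>?h\<close> equals the term, and just \<open>- ?h n\<close> elsewhere.\<close>
  have le: "2 * (if n \<in> {0, -1} then exp (- (pi / 4)) * c else 0) - ?h n \<le> g n * cos (2 * pi * (of_int n + 1/2) * w)" for n
  proof (cases "n \<in> {0, -1}")
    case True
    have "g 0 = exp (- (pi / 4))" by (simp add: g_def power2_eq_square)
    then have "g n = exp (- (pi / 4))" using True sym(1)[of 0] by auto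
    moreover have "cos (2 * pi * (of_int n + 1/2) * w) = c"
      using True sym(2)[of 0] by (auto simp: c_def)
    ultimately show ?thesis using True by auto
  next
    case False
    then show ?thesis using key'[of n] by (smt (verit))
  qed
  have "2 * (exp (- (pi / 4)) * c + exp (- (pi / 4)) * c) - (exp (- (pi / 4)) * c / (1 - q) + exp (- (pi / 4)) * c / (1 - q)) \<le> Re ?S"
    by (rule has_sum_mono[OF has_sum_diff[OF has_sum_cmult_right[OF d] h] re]) (rule le)
  moreover have "0.9 * c \<le> 2 * (exp (- (pi / 4)) * c + exp (- (pi / 4)) * c) - (exp (- (pi / 4)) * c / (1 - q) + exp (- (pi / 4)) * c / (1 - q))"
  proof -
    have "exp (- (pi / 4)) \<ge> exp (- (0.7854::real))" using pi_bounds by simp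
    moreover have "exp (- (0.7854::real)) \<ge> 0.4545" 
      using exp_minus_bounds(2)[of "0.7854"] by (simp add: power_divide)
    ultimately have "0.4545 \<le> exp (- (pi / 4))" by (rule order_trans[rotated])
    then have e: "exp (- (pi / 4)) * c \<ge> 0.4545 * c" using c by (intro mult_right_mono) auto
    define u where "u = exp (- (pi / 4)) * c"
    define v where "v = u / (1 - q)"
    have "v = u * (10000 / 9927)" by (simp add: q_def v_def)
    then have "2 * (u + u) - (v + v) \<ge> 0.9 * c" using e c unfolding u_def[symmetric] by simp
    then show ?thesis unfolding v_def u_def .
  qed
  ultimately have "0.9 * c \<le> Re ?S" by linarith
  then show ?thesis using S unfolding c_def by blast
qed

text \<open>By Poisson summation the sum differs from 1 by phases times the terms of
  \<open>theta3 1 - 1\<close>, so it is at least \<open>2 - theta3 1\<close>.\<close>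

lemma shifted_gauss_ge: "0.9133 \<le> (\<Sum>\<^sub>\<infinity>k::int. exp (- pi * (of_int k + a)\<^sup>2))"
proof -
  let ?s = "\<Sum>\<^sub>\<infinity>k::int. exp (- pi * (of_int k + a)\<^sup>2)"
  let ?f = "\<lambda>n::int. complex_of_real (exp (- pi * (of_int n)\<^sup>2)) * cis (2 * pi * of_int n * (- a))"
  have sm: "(\<lambda>n::int. exp (- pi * (of_int n)\<^sup>2)) summable_on UNIV" using summable_real_gauss[of 1 0] by simp
  have hs: "(?f has_sum infsum ?f UNIV) UNIV"
    by (rule has_sum_infsum, rule abs_summable_summable) (use sm in \<open>simp add: norm_mult\<close>)
  have "infsum ?f UNIV = (\<Sum>\<^sub>\<infinity>j::int. of_real (exp (- pi * (of_int j + a)\<^sup>2)))"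
    using poisson_characteristic[of 1 0 "- a"] by simp
  also have "\<dots> = of_real ?s"
    by (rule infsumI, rule has_sum_of_real, rule has_sum_infsum) (use summable_real_gauss[of 1 a] in simp)
  finally have s: "infsum ?f UNIV = of_real ?s" .
  have d: "((\<lambda>n::int. if n = 0 then 1 else 0 :: real) has_sum 1) UNIV"
    by (rule has_sum_finite_neutralI[of "{0}"]) auto
  have "((\<lambda>n. ?f n - of_real (if n = 0 then 1 else 0)) has_sum (of_real ?s - of_real 1)) UNIV"
    using has_sum_diff[OF hs has_sum_of_real[OF d]] unfolding s .
  moreover have "((\<lambda>n::int. exp (- pi * (of_int n)\<^sup>2) - (if n = 0 then 1 else 0)) has_sum (theta3 1 - 1)) UNIV"
    by (intro has_sum_diff d) (use has_sum_infsum[OF sm] in \<open>simp add: theta3_def\<close>)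
  moreover have "norm (?f n - of_real (if n = 0 then 1 else 0)) \<le> exp (- pi * (of_int n)\<^sup>2) - (if n = 0 then 1 else 0)" for n
    by (auto simp: norm_mult)
  ultimately have "norm (complex_of_real ?s - of_real 1) \<le> theta3 1 - 1" by (rule norm_infsum_le)
  then have "\<bar>?s - 1\<bar> \<le> theta3 1 - 1" by (simp only: norm_of_real flip: of_real_diff)
  then show ?thesis using theta3_numeric(1) by simp
qed

text \<open>With \<open>w = r / 2\<close> the argument is \<open>(w + w) / (1 - \<i>)\<close>, so
  the isogeny formula with second argument 0 factors \<open>p00\<close> into
  \<open>p01 w * p10 w\<close>, an alternating and a positive series at a real point. The zero at
  \<open>r = 1\<close> comes from the alternating one; the constant is
  \<open>sqrt 2 * 0.9 * 0.9133 / 1.0867\<close> rounded down.\<close>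

lemma bounded_ph_unit_ge:
  assumes r: "0 \<le> cos (pi * r / 2)"
  shows "\<exists>x. bounded_ph (Complex (1/2) (1/2)) r = of_real x \<and> 1.06 * cos (pi * r / 2) \<le> x"
proof -
  define w where "w = r / 2"
  let ?z = "Complex (1/2) (1/2)"
  define Z where "Z = (\<Sum>\<^sub>\<infinity>k::int. exp (- pi * (of_int k + (1/2 - w))\<^sup>2))"
  have Z: "0.9133 \<le> Z" unfolding Z_def by (rule shifted_gauss_ge)
  obtain X where X: "(\<Sum>\<^sub>\<infinity>k::int. cis (pi * of_int k) * of_real (exp (- pi * (of_int k - w)\<^sup>2))) = complex_of_real X" "0.9 * cos (pi * w) \<le> X"
    using alternating_gauss_ge[of w] r by (auto simp: w_def)
  have p01: "p01 (of_real w) = of_real (exp (pi * w\<^sup>2 / 2)) * of_real X"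
  proof -
    have "phterm 0 (1/2) (of_real w) k = of_real (exp (pi * w\<^sup>2 / 2)) * (cis (pi * of_int k) * of_real (exp (- pi * (of_int k - w)\<^sup>2)))" for k
      unfolding phterm_def cis_conv_exp exp_of_real[symmetric] mult_exp_exp
      by (rule arg_cong[where f=exp]) (simp add: power2_eq_square field_simps)
    then have "phterm 0 (1/2) (of_real w) = (\<lambda>k. of_real (exp (pi * w\<^sup>2 / 2)) * (cis (pi * of_int k) * of_real (exp (- pi * (of_int k - w)\<^sup>2))))" ..
    then show ?thesis unfolding ph_eq_infsum X(1)[symmetric] by (simp only: infsum_cmult_right')
  qed
  have p10: "p10 (of_real w) = of_real (exp (pi * w\<^sup>2 / 2)) * of_real Z"
  proof -
    have "phterm (1/2) 0 (of_real w) k = of_real (exp (pi * w\<^sup>2 / 2)) * of_real (exp (- pi * (of_int k + (1/2 - w))\<^sup>2))" for k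
      unfolding phterm_def exp_of_real[symmetric] mult_exp_exp
      by (rule arg_cong[where f=exp]) (simp add: power2_eq_square field_simps)
    then have "phterm (1/2) 0 (of_real w) = (\<lambda>k. of_real (exp (pi * w\<^sup>2 / 2)) * of_real (exp (- pi * (of_int k + (1/2 - w))\<^sup>2)))" ..
    moreover have "(\<Sum>\<^sub>\<infinity>k::int. complex_of_real (exp (- pi * (of_int k + (1/2 - w))\<^sup>2))) = of_real Z"
      unfolding Z_def by (rule infsumI, rule has_sum_of_real, rule has_sum_infsum) (use summable_real_gauss[of 1 "1/2 - w"] in simp)
    ultimately show ?thesis unfolding ph_eq_infsum by (simp only: infsum_cmult_right')
  qed
  have t: "theta3 1 \<ge> 1" "theta3 1 \<le> 1.0867" using theta3_ge_1[of 1] theta3_numeric(1) by simp_all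
  have "of_real r * ?z = (of_real w + of_real w) / (1 - \<i>)" "0 = (of_real w - of_real w) / (1 - \<i>)"
    by (simp_all add: w_def complex_eq_iff Re_divide Im_divide power2_eq_square)
  from isogeny_00[OF this] have "p00 (of_real r * ?z) * of_real (theta3 1) = of_real (2 * (exp (pi * w\<^sup>2 / 2) * X) * (exp (pi * w\<^sup>2 / 2) * Z) / sqrt 2)"
    unfolding p00_0 p01 p10 by (simp add: mult_ac)
  then have "p00 (of_real r * ?z) = of_real (2 * (exp (pi * w\<^sup>2 / 2) * X) * (exp (pi * w\<^sup>2 / 2) * Z) / sqrt 2 / theta3 1)"
    using t by (simp add: field_simps)
  then have "bounded_ph ?z r = of_real (exp (- pi * r\<^sup>2 * (norm ?z)\<^sup>2 / 2) * (2 * (exp (pi * w\<^sup>2 / 2) * X) * (exp (pi * w\<^sup>2 / 2) * Z) / sqrt 2 / theta3 1))"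
    unfolding bounded_ph_def by (simp only: of_real_mult)
  also have "exp (- pi * r\<^sup>2 * (norm ?z)\<^sup>2 / 2) * (2 * (exp (pi * w\<^sup>2 / 2) * X) * (exp (pi * w\<^sup>2 / 2) * Z) / sqrt 2 / theta3 1)
     = (exp (- pi * r\<^sup>2 * (norm ?z)\<^sup>2 / 2) * (exp (pi * w\<^sup>2 / 2) * exp (pi * w\<^sup>2 / 2))) * (2 * X * Z / sqrt 2 / theta3 1)"
    by simp
  also have "exp (- pi * r\<^sup>2 * (norm ?z)\<^sup>2 / 2) * (exp (pi * w\<^sup>2 / 2) * exp (pi * w\<^sup>2 / 2)) = 1"
    unfolding mult_exp_exp cmod_power2 by (simp add: w_def power2_eq_square)
  finally have g: "bounded_ph ?z r = of_real (2 * X * Z / sqrt 2 / theta3 1)" by simp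
  have c: "0 \<le> cos (pi * w)" using r by (simp add: w_def)
  have "1.06 * cos (pi * w) \<le> sqrt 2 * (0.9 * cos (pi * w) * 0.9133) / 1.0867"
  proof -
    have "1.4142 \<le> sqrt 2" by (rule real_le_rsqrt) (simp add: power2_eq_square)
    then have "1.4142 * (0.9 * cos (pi * w) * 0.9133) \<le> sqrt 2 * (0.9 * cos (pi * w) * 0.9133)" using c by (intro mult_right_mono) auto
    then show ?thesis using c by (simp add: field_simps)
  qed
  also have "\<dots> \<le> sqrt 2 * (X * Z) / theta3 1"
    using c X Z t by (intro frac_le mult_mono mult_nonneg_nonneg) auto
  also have "sqrt 2 * (X * Z) = 2 / sqrt 2 * (X * Z)" by (simp only: real_div_sqrt[of 2])
  also have "\<dots> / theta3 1 = 2 * X * Z / sqrt 2 / theta3 1" by simp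
  finally have "1.06 * cos (pi * w) \<le> 2 * X * Z / sqrt 2 / theta3 1" .
  then show ?thesis using g unfolding w_def by (intro exI[of _ "2 * X * Z / sqrt 2 / theta3 1"]) simp
qed

text \<open>On \<open>T \<ge> 5/2\<close>, \<open>sqrt T\<close> is absorbed by the exponential at the price of lowering \<open>\<pi> * H\<close> by \<open>1/5\<close>.\<close>

lemma norm_mult_gauss_le:
  fixes T t b :: real
  assumes T: "T = t\<^sup>2" "t \<ge> 0"
  shows "t * exp (- b * T) \<le> 1.5812 * exp (- (1/2)) * exp (- (b - 1/5) * T)"
proof -
  have "T / 2.5 \<le> exp ((T - 2.5) / 2.5)" using exp_ge_add_one_self[of "(T - 2.5) / 2.5"] by (simp add: field_simps)
  then have "t\<^sup>2 \<le> 2.5 * exp ((T - 2.5) / 2.5)" unfolding T by simp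
  also have "\<dots> \<le> 1.5812\<^sup>2 * exp ((T - 2.5) / 2.5)" by (intro mult_right_mono) (simp_all add: power2_eq_square)
  also have "\<dots> = (1.5812 * exp ((T - 2.5) / 5))\<^sup>2"
    unfolding power_mult_distrib exp_double[symmetric] by simp
  finally have "t \<le> 1.5812 * exp ((T - 2.5) / 5)" by (rule power2_le_imp_le) simp
  then have "t * exp (- b * T) \<le> 1.5812 * exp ((T - 2.5) / 5) * exp (- b * T)" by (rule mult_right_mono) simp
  also have "exp ((T - 2.5) / 5) * exp (- b * T) = exp (- (1/2)) * exp (- (b - 1/5) * T)"
    unfolding mult_exp_exp by (rule arg_cong[where f=exp]) (simp add: field_simps)
  then have "1.5812 * exp ((T - 2.5) / 5) * exp (- b * T) = 1.5812 * exp (- (1/2)) * exp (- (b - 1/5) * T)" by (simp only: mult.assoc)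
  finally show ?thesis .
qed

text \<open>For \<open>n \<ge> 0\<close> one has
  \<open>(n + 1/2)\<^sup>2 - 1/4 = n * (n + 1) \<ge> 2 * n\<close>, so each half of the sum is
  dominated by a geometric series of ratio \<open>q\<close>.\<close>

lemma half_gauss_le:
  fixes a q :: real
  assumes "a > 0" and q: "exp (- (2 * a)) \<le> q" "q < 1"
  shows "(\<lambda>n::int. exp (- a * (of_int n + 1/2)\<^sup>2)) summable_on UNIV"
    and "(\<Sum>\<^sub>\<infinity>n::int. exp (- a * (of_int n + 1/2)\<^sup>2)) \<le> 2 * exp (- a / 4) / (1 - q)"
proof -
  let ?f = "\<lambda>n::int. exp (- a * (of_int n + 1/2)\<^sup>2)"
  show sm: "?f summable_on UNIV"
    using summable_real_gauss[of "a / pi" "1/2"] assms(1) by simp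
  have q0: "q > 0" using q(1) exp_gt_zero[of "- (2 * a)"] by linarith
  let ?h = "\<lambda>n :: int. exp (- a / 4) * (if n \<ge> 0 then q ^ nat n else q ^ nat (- n - 1))"
  have "((\<lambda>n. exp (- a / 4) * q ^ n) has_sum (exp (- a / 4) / (1 - q))) UNIV"
    by (rule has_sum_geometric) (use q q0 in simp_all)
  then have h: "(?h has_sum (exp (- a / 4) / (1 - q) + exp (- a / 4) / (1 - q))) UNIV"
    by (intro has_sum_int_halves) simp_all
  have key: "?f n \<le> ?h n" if "n \<ge> 0" for n
  proof -
    obtain m where m: "n = int m" using \<open>n \<ge> 0\<close> nonneg_int_cases by blast
    have "real m \<le> real m ^ 2" by (cases m) (auto simp: power2_eq_square)
    then have "a * (2 * real m) \<le> a * (real m ^ 2 + real m)" using assms(1) by (intro mult_left_mono) auto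
    then have "?f n \<le> exp (- a / 4) * exp (- (2 * a)) ^ m"
      unfolding m exp_of_nat_mult[symmetric] mult_exp_exp by (simp add: power2_eq_square algebra_simps)
    also have "\<dots> \<le> exp (- a / 4) * q ^ m" using q by (intro mult_left_mono power_mono) auto
    finally show ?thesis by (simp add: m)
  qed
  have le: "?f n \<le> ?h n" for n
  proof (cases "n \<ge> 0")
    case False
    have "of_int (- n - 1) + 1/2 = - (of_int n + 1 / (2::real))" by simp
    then have e: "?f (- n - 1) = ?f n" by (simp only: power2_minus)
    have "?f n \<le> ?h (- n - 1)" using key[of "- n - 1"] False unfolding e by linarith
    also have "?h (- n - 1) = ?h n" using False by simp
    finally show ?thesis .
  qed (use key in blast)
  have "infsum ?f UNIV \<le> exp (- a / 4) / (1 - q) + exp (- a / 4) / (1 - q)"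
    by (rule has_sum_mono[OF has_sum_infsum[OF sm] h]) (rule le)
  then show "infsum ?f UNIV \<le> 2 * exp (- a / 4) / (1 - q)" by simp
qed

text \<open>With \<open>y = pi * (1 - r) / 2 \<le> 1.5708\<close> the value is the sine of
  \<open>y\<close>, at least \<open>y * (1 - y\<^sup>2 / 6)\<close>; the constant is
  \<open>1.57 * 0.5887\<close> rounded down.\<close>

lemma cos_half_pi_ge:
  assumes "0 \<le> r" "r \<le> 1"
  shows "cos (pi * r / 2) \<ge> 0.92 * (1 - r)"
proof -
  define u where "u = 1 - r"
  have u: "0 \<le> u" "u \<le> 1" using assms by (simp_all add: u_def)
  define y where "y = pi * u / 2"
  have y: "0 \<le> y" "y \<le> 1.5708" "1.57 * u \<le> y"
    using u pi_bounds mult_right_mono[of "3.14" pi u] mult_mono[of pi "3.1416" u 1] by (auto simp: y_def)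
  have "cos (pi * r / 2) = sin y" unfolding sin_cos_eq y_def u_def by (simp add: field_simps)
  moreover have "sin y \<ge> y - y ^ 3 / 6"
  proof -
    have "y = 0 \<or> 0 < y" using y by linarith
    then show ?thesis
    proof (elim disjE)
      assume "0 < y"
      then obtain t where t: "0 < t" "t \<le> y" "sin y = (\<Sum>m<4. sin_coeff m * y ^ m) + sin (t + 1/2 * real 4 * pi) / fact 4 * y ^ 4"
        using Maclaurin_sin_expansion4[of y 4] by auto
      have "sin (t + 1/2 * real 4 * pi) = sin t" by simp
      also have "\<dots> \<ge> 0" using t y pi_bounds by (intro sin_ge_zero) auto
      finally have "sin (t + 1/2 * real 4 * pi) / fact 4 * y ^ 4 \<ge> 0" by (intro mult_nonneg_nonneg divide_nonneg_nonneg) auto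
      moreover have "(\<Sum>m<4. sin_coeff m * y ^ m) = y - y ^ 3 / 6"
      proof -
        have "{..<4::nat} = {0, 1, 2, 3}" by auto
        then show ?thesis by (simp add: sin_coeff_def fact_numeral)
      qed
      ultimately show ?thesis using t(3) by linarith
    qed simp
  qed
  moreover have "y - y ^ 3 / 6 \<ge> 0.92 * u"
  proof -
    have "y\<^sup>2 \<le> 1.5708\<^sup>2" using y by (intro power_mono) auto
    then have "1 - y\<^sup>2 / 6 \<ge> 0.5887" by (simp add: power2_eq_square)
    then have "(1.57 * u) * 0.5887 \<le> y * (1 - y\<^sup>2 / 6)" using y u by (intro mult_mono) auto
    then show ?thesis using u by (simp add: algebra_simps power2_eq_square power3_eq_cube)
  qed
  ultimately show ?thesis by (simp add: u_def)
qed

text \<open>The four points of smallest norm are related by multiplication by \<open>\<i>\<close>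
  and contribute the same \<open>L\<close>, at least \<open>0.7235 * (1 - r) * E\<close>; all other
  terms together amount to at most \<open>2.4 * (1 - r) * E\<close>, less than four times that. As
  both carry \<open>1 - r\<close>, the comparison is uniform up to the zero at
  \<open>r = 1\<close>.\<close>

lemma tB_pos:
  assumes H: "Y - (r\<^sup>2 + s\<^sup>2) / 2 \<ge> 12/25" and r: "0 \<le> r" "r < 1" and s: "0 \<le> s" "s \<le> 1/2"
  shows "Re (tB Y r s) > 0"
proof -
  define h where "h = Y - (r\<^sup>2 + s\<^sup>2) / 2"
  have h: "h \<ge> 12/25" using H by (simp only: h_def)
  have "a < 2 * b" if "b - a / 2 \<ge> 12/25" for a b :: real using that by simp
  from this[OF H] have rs: "r\<^sup>2 + s\<^sup>2 < 2 * Y" .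
  let ?f = "\<lambda>(m, n). lterm p00 p00 Y r s (lpt (1/2) m n)"
  have f: "?f (m, n) = of_real (exp (- pi * h * (norm (lpt (1/2) m n))\<^sup>2)) * (bounded_ph (lpt (1/2) m n) r * bounded_ph (lpt (1/2) m n) s)" for m n
    unfolding prod.case lterm_bounded_ph h_def ..
  have abs: "(\<lambda>z. norm (lterm p00 p00 Y r s z)) summable_on coset p e" for p e
    by (intro abs_summable_lterm gauss_bounded_ph rs)
  have T: "infsum ?f UNIV = tB Y r s"
    unfolding tB_def using infsum_cosets[of "lterm p00 p00 Y r s" "1/2" "\<lambda>_. 1", OF abs] lsum_symmetries(4)[OF rs]
    by (simp add: lsum_def)
  define F where "F = {0, -1 :: int} \<times> {0, -1 :: int}"
  define L where "L = lterm p00 p00 Y r s (Complex (1/2) (1/2))"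
  have i: "lterm p00 p00 Y r s (\<i> * z) = lterm p00 p00 Y r s z" for z
  proof -
    have "of_real x * (\<i> * z) = \<i> * (of_real x * z)" for x :: real by simp
    then show ?thesis unfolding lterm_def by (simp only: ph_i norm_mult norm_ii mult_1_left)
  qed
  have L: "?f p = L" if "p \<in> F" for p
  proof -
    let ?w = "Complex (1/2) (1/2)"
    have "\<i> * ?w = Complex (- (1/2)) (1/2)" "\<i> * (\<i> * ?w) = Complex (- (1/2)) (- (1/2))" "\<i> * (\<i> * (\<i> * ?w)) = Complex (1/2) (- (1/2))"
      by (simp_all add: complex_eq_iff)
    then have "lterm p00 p00 Y r s (Complex (- (1/2)) (1/2)) = L" "lterm p00 p00 Y r s (Complex (- (1/2)) (- (1/2))) = L" "lterm p00 p00 Y r s (Complex (1/2) (- (1/2))) = L"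
      unfolding L_def by (metis i)+
    then show ?thesis using \<open>p \<in> F\<close> by (auto simp: F_def L_def)
  qed
  \<comment> \<open>The factor \<open>norm z\<close> in the bound of a term is traded, by
    \<open>norm_mult_gauss_le\<close>, for a loss of \<open>1/5\<close> in the decay rate
    \<open>pi * h\<close>.\<close>
  define a where "a = pi * h - 1/5"
  have ph: "pi * h \<ge> 3.1415 * (12/25)" by (rule mult_mono) (use pi_bounds h in auto)
  then have a: "a \<ge> 1.3079" by (simp add: a_def)
  define M where "M = 3.0565 * 1.0867 * 1.5812 * exp (- (1/2)) * (1 - r)"
  have M0: "M \<ge> 0" using r by (simp add: M_def)
  let ?e = "\<lambda>n::int. exp (- a * (of_int n + 1/2)\<^sup>2)"
  let ?g = "\<lambda>(m, n). M * (?e m * ?e n)"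
  have bound: "norm (?f p) \<le> ?g p" for p
  proof -
    obtain m n where p: "p = (m, n)" by (cases p)
    let ?z = "lpt (1/2) m n"
    have "norm (?f p) = exp (- pi * h * (norm ?z)\<^sup>2) * (norm (bounded_ph ?z r) * norm (bounded_ph ?z s))"
      unfolding p f norm_mult norm_of_real abs_exp_cancel ..
    also have "\<dots> \<le> exp (- pi * h * (norm ?z)\<^sup>2) * ((3.0565 * norm ?z * (1 - r)) * 1.0867)"
      using norm_bounded_ph_half_le[OF r(1) less_imp_le[OF r(2)], of m n] order_trans[OF norm_bounded_ph_le theta3_numeric(1), of ?z s] r
      by (intro mult_left_mono mult_mono) auto
    also have "\<dots> = 3.0565 * 1.0867 * (1 - r) * (norm ?z * exp (- (pi * h) * (norm ?z)\<^sup>2))" by simp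
    also have "\<dots> \<le> 3.0565 * 1.0867 * (1 - r) * (1.5812 * exp (- (1/2)) * exp (- (pi * h - 1/5) * (norm ?z)\<^sup>2))"
      using r by (intro mult_left_mono norm_mult_gauss_le) auto
    also have "\<dots> = M * exp (- a * (norm ?z)\<^sup>2)" by (simp only: M_def a_def mult_ac)
    also have "exp (- a * (norm ?z)\<^sup>2) = ?e m * ?e n"
      unfolding mult_exp_exp cmod_power2 complex.sel by (rule arg_cong[where f=exp]) (simp add: algebra_simps)
    finally show ?thesis by (simp add: p)
  qed
  have e12: "exp (- (2 * a)) \<le> 0.0735"
  proof -
    have "exp (- (2 * a)) \<le> 0.7215 ^ 8" by (rule exp_minus_le_power[of "0.3269"]) (use a in \<open>simp_all add: power_divide\<close>)
    also have "(0.7215 :: real) ^ 8 \<le> 0.0735" by (simp add: power_divide)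
    finally show ?thesis .
  qed
  have a0: "a > 0" using a by simp
  have se: "?e summable_on UNIV" by (rule half_gauss_le(1)[OF a0 e12]) simp
  have Te: "infsum ?e UNIV \<le> 2 * exp (- a / 4) / (1 - 0.0735)" by (rule half_gauss_le(2)[OF a0 e12]) simp
  have Te0: "infsum ?e UNIV \<ge> 0" by (rule infsum_nonneg) simp
  have sg: "((\<lambda>(m, n). ?e m * ?e n) has_sum (infsum ?e UNIV)\<^sup>2) UNIV"
  proof -
    have n: "(\<lambda>n. norm (?e n)) summable_on UNIV" using se by simp
    have "(\<lambda>(m, n). ?e m * ?e n) summable_on UNIV"
      using abs_summable_times[OF n n] by (simp add: case_prod_unfold)
    from has_sum_infsum[OF this] show ?thesis using infsum_times[OF n n] by (simp only: UNIV_Times_UNIV power2_eq_square)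
  qed
  have hg: "(?g has_sum (M * (infsum ?e UNIV)\<^sup>2)) UNIV"
    using has_sum_cmult_right[OF sg, of M] by (simp only: case_prod_unfold)
  have sf: "?f summable_on UNIV"
    by (rule abs_summable_summable, rule summable_on_comparison_test[OF has_sum_imp_summable[OF hg]], rule bound, rule norm_ge_zero)
  have dF: "((\<lambda>p. if p \<in> F then c else 0) has_sum (4 * c)) UNIV" for c :: "'c :: real_normed_field"
  proof (rule has_sum_finite_neutralI[of F])
    have "card F = 4" by (simp add: F_def card_cartesian_product)
    then show "4 * c = (\<Sum>p\<in>F. if p \<in> F then c else 0)" by simp
  qed (auto simp: F_def)
  have e0: "?e 0 = exp (- a / 4)" "?e (-1) = exp (- a / 4)" by (simp_all add: power2_eq_square)
  have "((\<lambda>p. ?f p - (if p \<in> F then L else 0)) has_sum (tB Y r s - 4 * L)) UNIV"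
    unfolding T[symmetric] by (rule has_sum_diff[OF has_sum_infsum[OF sf] dF])
  moreover have "((\<lambda>p. ?g p - (if p \<in> F then M * (exp (- a / 4))\<^sup>2 else 0)) has_sum (M * (infsum ?e UNIV)\<^sup>2 - 4 * (M * (exp (- a / 4))\<^sup>2))) UNIV"
    by (rule has_sum_diff[OF hg dF])
  moreover have "norm (?f p - (if p \<in> F then L else 0)) \<le> ?g p - (if p \<in> F then M * (exp (- a / 4))\<^sup>2 else 0)" for p
  proof (cases "p \<in> F")
    case True
    have "?g p = M * (exp (- a / 4))\<^sup>2" using True e0 unfolding F_def by (auto simp: power2_eq_square)
    then show ?thesis using True L[OF True] by simp
  next
    case False
    then show ?thesis using bound[of p] by simp
  qed
  ultimately have n: "norm (tB Y r s - 4 * L) \<le> M * (infsum ?e UNIV)\<^sup>2 - 4 * (M * (exp (- a / 4))\<^sup>2)"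
    by (rule norm_infsum_le)
  define E where "E = exp (- (pi * h / 2))"
  have E: "E > 0" by (simp add: E_def)
  have Ea: "(exp (- a / 4))\<^sup>2 = exp (1/10) * E"
    unfolding E_def mult_exp_exp exp_double[symmetric] by (rule arg_cong[where f=exp]) (simp add: a_def field_simps)
  \<comment> \<open>The full majorant is at most \<open>4.661\<close> times its value at one leading
    point. The four leading points account for 4, which leaves \<open>0.661\<close>.\<close>
  have "(infsum ?e UNIV)\<^sup>2 \<le> (2 * exp (- a / 4) / (1 - 0.0735))\<^sup>2"
    using Te Te0 by (rule power_mono)
  also have "\<dots> = 4 * (exp (- a / 4))\<^sup>2 / 0.9265\<^sup>2" by (simp add: power_mult_distrib power_divide)
  also have "\<dots> \<le> 4.661 * (exp (- a / 4))\<^sup>2"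
  proof -
    have "4 * x / 0.9265\<^sup>2 \<le> 4.661 * x" if "x \<ge> 0" for x :: real using that by (simp add: power2_eq_square)
    then show ?thesis by simp
  qed
  finally have "M * (infsum ?e UNIV)\<^sup>2 \<le> M * (4.661 * (exp (- a / 4))\<^sup>2)" using M0 by (rule mult_left_mono)
  then have "norm (tB Y r s - 4 * L) \<le> 0.661 * (M * (exp (1/10) * E))"
    using n unfolding Ea by (simp add: algebra_simps)
  also have "M * (exp (1/10) * E) = 3.0565 * 1.0867 * 1.5812 * (exp (- (1/2)) * exp (1/10)) * ((1 - r) * E)"
    by (simp add: M_def)
  also have "exp (- (1/2)) * exp (1/10 :: real) = exp (- (2/5))" unfolding mult_exp_exp by simp
  also have "0.661 * (3.0565 * 1.0867 * 1.5812 * exp (- (2/5)) * ((1 - r) * E)) \<le> 0.661 * (3.0565 * 1.0867 * 1.5812 * 0.6715 * ((1 - r) * E))"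
    using exp_minus_bounds(1)[of "2/5"] r E by (intro mult_left_mono mult_right_mono) (auto simp: power_divide)
  also have "\<dots> \<le> 2.4 * ((1 - r) * E)"
    using r E by (simp add: field_simps)
  finally have n': "norm (tB Y r s - 4 * L) \<le> 12/5 * ((1 - r) * E)" by simp
  have cr: "cos (pi * r / 2) \<ge> 0.92 * (1 - r)" using r by (intro cos_half_pi_ge) auto
  \<comment> \<open>\<open>s \<le> 1/2\<close> keeps the second theta factor away from its own zero
    at \<open>s = 1\<close>.\<close>
  have cs: "cos (pi * s / 2) \<ge> 0.7"
  proof -
    have "cos (pi / 4) \<le> cos (pi * s / 2)" using s by (intro cos_monotone_0_pi_le) (auto simp: field_simps)
    moreover have "1.4 \<le> sqrt 2" by (rule real_le_rsqrt) (simp add: power2_eq_square)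
    ultimately show ?thesis by (simp add: cos_45)
  qed
  obtain x where x: "bounded_ph (Complex (1/2) (1/2)) r = of_real x" "1.06 * cos (pi * r / 2) \<le> x" using bounded_ph_unit_ge[of r] cr r by fastforce
  obtain y where y: "bounded_ph (Complex (1/2) (1/2)) s = of_real y" "1.06 * cos (pi * s / 2) \<le> y" using bounded_ph_unit_ge[of s] cs by fastforce
  have "L = of_real (E * (x * y))"
    unfolding L_def lterm_bounded_ph x y h_def[symmetric] E_def cmod_power2 by (simp add: power2_eq_square)
  then have ReL: "Re L = E * (x * y)" by simp
  have "(1.06 * 0.92 * (1 - r)) * (1.06 * 0.7) \<le> x * y"
    using x y cr cs r by (intro mult_mono) auto
  then have le: "E * ((1.06 * 0.92 * (1 - r)) * (1.06 * 0.7)) \<le> E * (x * y)" using E by (intro mult_left_mono) auto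
  have eq: "E * ((1.06 * 0.92 * (1 - r)) * (1.06 * 0.7)) = 7235984 / 10000000 * ((1 - r) * E)" by (simp add: field_simps)
  have "Re L \<ge> 7235984 / 10000000 * ((1 - r) * E)" unfolding ReL eq[symmetric] by (rule le)
  moreover have "(1 - r) * E > 0" using r E by simp
  moreover have "Re (tB Y r s) \<ge> 4 * Re L - norm (tB Y r s - 4 * L)"
    using abs_Re_le_cmod[of "tB Y r s - 4 * L"] by simp
  ultimately show ?thesis using n' by linarith
qed

text \<open>The parameter at the other cusp is \<open>H / Y\<^sup>2\<close>, and \<open>H / Y\<^sup>2 \<ge> 1 / (4 * H)\<close> since \<open>Y \<le> 2 * H\<close>.\<close>

lemma tC_pos:
  assumes "0 \<le> s" "s \<le> r" "r < 1" "r + s \<le> Y" "r < Y"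
  shows "Re (tC Y r s) > 0"
proof -
  define H where "H = Y - (r\<^sup>2 + s\<^sup>2) / 2"
  have sq: "r\<^sup>2 \<le> r" "s\<^sup>2 \<le> s" using assms by (auto simp: power2_eq_square mult_left_le)
  have Y: "Y > 0" using assms by linarith
  have HY: "Y \<le> 2 * H" using assms sq by (simp add: H_def)
  have rs: "r\<^sup>2 + s\<^sup>2 < 2 * Y" using HY Y by (simp add: H_def)
  show ?thesis
  proof (cases "H \<ge> 13/25")
    case True
    then show ?thesis unfolding H_def by (rule tC_near_cusp)
  next
    case False
    have H': "1 / Y - ((r / Y)\<^sup>2 + (s / Y)\<^sup>2) / 2 = H / Y\<^sup>2"
      using Y by (simp add: H_def field_simps power2_eq_square)
    have "Y\<^sup>2 \<le> 2 * H * (2 * H)" unfolding power2_eq_square using HY Y by (intro mult_mono) auto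
    \<comment> \<open>\<open>H < 13/25\<close> gives \<open>4 * H < 52/25 < 25/12\<close>; this
      narrow margin ties the two thresholds together.\<close>
    also have "\<dots> \<le> H * (25 / 12)"
    proof -
      have "H * (4 * H) \<le> H * (25/12)" using False HY Y by (intro mult_left_mono) auto
      then show ?thesis by simp
    qed
    finally have "H / Y\<^sup>2 \<ge> 12/25" using Y by (simp add: field_simps)
    \<comment> \<open>The region supplies the remaining hypotheses: \<open>r / Y < 1\<close> from
      \<open>r < Y\<close>, and \<open>s / Y \<le> 1/2\<close> from
      \<open>2 * s \<le> r + s \<le> Y\<close>.\<close>
    then have "Re (tB (1 / Y) (r / Y) (s / Y)) > 0"
      unfolding H'[symmetric] by (rule tB_pos) (use assms Y in \<open>auto simp: field_simps\<close>)
    then show ?thesis unfolding tC_swap[OF rs] using Y by simp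
  qed
qed

section \<open>Reality and continuity of the theta constants\<close>

lemma infsum_Reals:
  fixes f :: "'a \<Rightarrow> complex"
  assumes "\<And>x. f x \<in> \<real>"
  shows "infsum f A \<in> \<real>"
proof (cases "f summable_on A")
  case True
  have "Im (infsum f A) = (\<Sum>\<^sub>\<infinity>x\<in>A. Im (f x))"
    by (rule infsumI[symmetric], rule has_sum_Im[OF has_sum_infsum[OF True]])
  also have "(\<lambda>x. Im (f x)) = (\<lambda>_. 0)" using assms complex_is_Real_iff by blast
  finally have "Im (infsum f A) = 0" by simp
  then show ?thesis by (simp add: complex_is_Real_iff)
qed (simp add: infsum_not_exists)

lemma tABC_Reals:
  assumes "r\<^sup>2 + s\<^sup>2 < 2 * Y"
  shows "tA Y r s \<in> \<real>" "tB Y r s \<in> \<real>" "tC Y r s \<in> \<real>"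
proof -
  have c: "cis (pi * of_int m) \<in> \<real>" for m using cis_pi_int[of m] by simp
  show "tA Y r s \<in> \<real>" unfolding tA_real_theta[OF assms]
    by (intro Reals_mult infsum_Reals Reals_of_real) (auto simp: real_theta_def case_prod_unfold)
  show "tB Y r s \<in> \<real>" unfolding tB_real_theta[OF assms]
    by (intro Reals_mult infsum_Reals Reals_of_real) (auto simp: real_theta_def case_prod_unfold intro!: Reals_mult c)
  show "tC Y r s \<in> \<real>" unfolding tC_real_theta[OF assms]
    by (intro Reals_mult infsum_Reals Reals_of_real) (auto simp: real_theta_def case_prod_unfold intro!: Reals_mult c)
qed

lemma cnj_ph: "cnj (ph p q z) = ph p (- q) (cnj z)"
  unfolding ph_def by (simp add: exp_cnj flip: infsum_cnj)

text \<open>Conjugating the lattice point exchanges \<open>K2\<close> and \<open>K3\<close> and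
  preserves the product of the two odd factors, while multiplication by \<open>\<i>\<close> shows
  that the two sums are opposite. So the sum is purely imaginary, and \<open>- 4\<close> times its
  square is nonnegative.\<close>

lemma tD2_Reals:
  assumes rs: "r\<^sup>2 + s\<^sup>2 < 2 * Y"
  shows "tD2 Y r s \<in> \<real>" "Re (tD2 Y r s) \<ge> 0"
proof -
  have "cnj (lsum K2 p11 p11 Y r s) = (\<Sum>\<^sub>\<infinity>z\<in>K2. lterm p11 p11 Y r s (cnj z))"
    unfolding lsum_def infsum_cnj[symmetric] lterm_def by (simp add: cnj_ph ph_half_right)
  also have "\<dots> = infsum (lterm p11 p11 Y r s) K3"
  proof (rule infsum_reindex_bij_witness[where i=cnj and j=cnj])
    have c: "cnj z \<in> coset (1/2) (\<not> e)" if "z \<in> coset (1/2) e" for z e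
    proof -
      obtain m n where z: "z = Complex (of_int m + 1/2) (of_int n + 1/2)" "even (m + n) = e" using \<open>z \<in> coset (1/2) e\<close> by (rule coset_E)
      have "cnj z = Complex (of_int m + 1/2) (of_int (- n - 1) + 1/2)" unfolding z by (simp add: complex_eq_iff)
      moreover have "even (m + (- n - 1)) = (\<not> e)" using z(2) by auto
      ultimately show ?thesis by (simp only: coset_I)
    qed
    show "cnj z \<in> K3" if "z \<in> K2" for z using c[OF that] by simp
    show "cnj z \<in> K2" if "z \<in> K3" for z using c[OF that] by simp
  qed auto
  finally have "cnj (lsum K2 p11 p11 Y r s) = - lsum K2 p11 p11 Y r s"
    unfolding lsum_def[symmetric] lsum_symmetries(5)[OF rs] .
  then have "Re (lsum K2 p11 p11 Y r s) = 0" by (simp add: complex_eq_iff)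
  then have "tD2 Y r s = of_real (4 * (Im (lsum K2 p11 p11 Y r s))\<^sup>2)"
    unfolding tD2_def by (simp add: complex_eq_iff power2_eq_square)
  then show "tD2 Y r s \<in> \<real>" "Re (tD2 Y r s) \<ge> 0" by simp_all
qed

text \<open>The absolute value of a term decreases with \<open>y\<close>, so the terms at the left
  end majorise the series on the whole half-line.\<close>

lemma continuous_on_lsum:
  assumes rs: "r\<^sup>2 + s\<^sup>2 < 2 * Y" and fg: "gauss_bounded f" "gauss_bounded g"
  shows "continuous_on {Y..} (\<lambda>y. lsum (coset p e) f g y r s)"
proof -
  have "uniform_limit {Y..} (\<lambda>F y. \<Sum>z\<in>F. lterm f g y r s (z::complex)) (\<lambda>y. lsum (coset p e) f g y r s) (finite_subsets_at_top (coset p e))"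
    unfolding lsum_def
  proof (rule Weierstrass_m_test_general[where M="\<lambda>z. norm (lterm f g Y r s z)"])
    fix z :: complex and y assume "y \<in> {Y..}"
    then have "pi * Y * (norm z)\<^sup>2 \<le> pi * y * (norm z)\<^sup>2" by (intro mult_right_mono mult_left_mono) auto
    then have "exp (- pi * y * (norm z)\<^sup>2) \<le> exp (- pi * Y * (norm z)\<^sup>2)" by simp
    then show "norm (lterm f g y r s z) \<le> norm (lterm f g Y r s z)"
      unfolding lterm_def norm_mult norm_of_real abs_exp_cancel by (intro mult_right_mono) auto
  qed (rule abs_summable_lterm[OF fg rs])
  then show ?thesis
  proof (rule uniform_limit_theorem[rotated])
    show "\<forall>\<^sub>F F in finite_subsets_at_top (coset p e). continuous_on {Y..} (\<lambda>y. \<Sum>z\<in>F. lterm f g y r s z)"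
      unfolding lterm_def by (intro always_eventually allI continuous_intros)
  qed simp
qed

text \<open>For large \<open>Y\<close> the term of the origin dominates \<open>tA\<close>, and
  \<open>tB\<close> has no such term. Halves of \<open>(theta3 1)\<^sup>2\<close> are enough to
  conclude that \<open>tB\<close> is smaller in absolute value.\<close>

lemma tA_tB_near_infinity:
  assumes rs: "r\<^sup>2 + s\<^sup>2 < 2 * Y" and H: "Y - (r\<^sup>2 + s\<^sup>2) / 2 \<ge> 2"
  shows "norm (tA Y r s - (theta3 1)\<^sup>2) < (theta3 1)\<^sup>2 / 2" "norm (tB Y r s) < (theta3 1)\<^sup>2 / 2"
proof -
  define h where "h = Y - (r\<^sup>2 + s\<^sup>2) / 2"
  have h: "h \<ge> 2" using H by (simp only: h_def)
  let ?c = "theta3 1"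
  have c: "?c\<^sup>2 > 0" using theta3_ge_1[of 1] by simp
  have ph: "pi * h \<ge> 3.1415 * 2" by (rule mult_mono) (use pi_bounds h in auto)
  have "exp (- pi * h) \<le> exp (- pi * 1)" using h by simp
  also have "exp (- pi * 1) \<le> 0.6754 ^ 8"
    using exp_minus_le_power[of "0.3926" 8 pi "0.6754"] pi_bounds by (simp add: power_divide)
  also have "(0.6754 :: real) ^ 8 \<le> 0.05" by (simp add: power_divide)
  finally have "theta3 h \<le> 1 + 2 * 0.05 + 2 * 0.05 ^ 4 / (1 - 0.05)" using h by (intro theta3_le) auto
  also have "1 + 2 * 0.05 + 2 * 0.05 ^ 4 / (1 - 0.05) \<le> (1.101 :: real)" by (simp add: power_divide)
  finally have "(theta3 h)\<^sup>2 \<le> 1.101\<^sup>2" using theta3_ge_1[of h] h by (intro power_mono) auto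
  then have "?c\<^sup>2 * (theta3 h)\<^sup>2 \<le> ?c\<^sup>2 * (13/10)" by (intro mult_left_mono) (auto simp: power2_eq_square)
  moreover have "norm (tA Y r s - ?c\<^sup>2) \<le> ?c\<^sup>2 * (theta3 h)\<^sup>2 - ?c\<^sup>2"
    using norm_lsum_minus_origin_le[OF rs, of 1] by (simp add: tA_def h_def)
  ultimately show "norm (tA Y r s - ?c\<^sup>2) < ?c\<^sup>2 / 2" using c by linarith
  let ?e = "\<lambda>n::int. exp (- (pi * h) * (of_int n + 1/2)\<^sup>2)"
  have e1: "exp (- (2 * (pi * h))) \<le> 0.01"
  proof -
    have "exp (- (2 * (pi * h))) \<le> 0.6754 ^ 16"
      by (rule exp_minus_le_power[of "0.3926"]) (use ph in \<open>simp_all add: power_divide\<close>)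
    also have "(0.6754 :: real) ^ 16 \<le> 0.01" by (simp add: power_divide)
    finally show ?thesis .
  qed
  have a0: "pi * h > 0" using h by simp
  have se: "?e summable_on UNIV" by (rule half_gauss_le(1)[OF a0 e1]) simp
  have "infsum ?e UNIV \<le> 2 * exp (- (pi * h) / 4) / (1 - 0.01)" by (rule half_gauss_le(2)[OF a0 e1]) simp
  also have "exp (- (pi * h) / 4) \<le> 0.6754 ^ 4"
    using exp_minus_le_power[of "0.3926" 4 "pi * h / 4" "0.6754"] ph by (simp add: power_divide)
  also have "2 * (0.6754 :: real) ^ 4 / (1 - 0.01) \<le> 0.5" by (simp add: power_divide)
  finally have "infsum ?e UNIV \<le> 0.5" by simp
  then have "(infsum ?e UNIV)\<^sup>2 \<le> 0.5\<^sup>2" by (intro power_mono infsum_nonneg) auto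
  then have Te: "?c\<^sup>2 * (infsum ?e UNIV)\<^sup>2 \<le> ?c\<^sup>2 * (1/4)" by (intro mult_left_mono) (auto simp: power2_eq_square)
  have n: "(\<lambda>n. norm (?e n)) summable_on UNIV" using se by simp
  have "(\<lambda>(m, n). ?e m * ?e n) summable_on UNIV"
    using abs_summable_times[OF n n] by (simp add: case_prod_unfold)
  from has_sum_infsum[OF this] have sg: "((\<lambda>(m, n). ?e m * ?e n) has_sum (infsum ?e UNIV)\<^sup>2) UNIV"
    using infsum_times[OF n n] by (simp only: UNIV_Times_UNIV power2_eq_square)
  let ?f = "\<lambda>(m, n). lterm p00 p00 Y r s (lpt (1/2) m n)"
  let ?g = "\<lambda>(m, n). ?c\<^sup>2 * (?e m * ?e n)"
  have hg: "(?g has_sum (?c\<^sup>2 * (infsum ?e UNIV)\<^sup>2)) UNIV"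
    using has_sum_cmult_right[OF sg, of "?c\<^sup>2"] by (simp only: case_prod_unfold)
  have abs: "(\<lambda>z. norm (lterm p00 p00 Y r s z)) summable_on coset p e" for p e
    by (intro abs_summable_lterm gauss_bounded_ph rs)
  have T: "infsum ?f UNIV = tB Y r s"
    unfolding tB_def using infsum_cosets[of "lterm p00 p00 Y r s" "1/2" "\<lambda>_. 1", OF abs] lsum_symmetries(4)[OF rs]
    by (simp add: lsum_def)
  have bound: "norm (?f p) \<le> ?g p" for p
  proof -
    obtain m n where p: "p = (m, n)" by (cases p)
    have "norm (?f p) \<le> ?c\<^sup>2 * exp (- pi * h * (norm (lpt (1/2) m n))\<^sup>2)"
      unfolding h_def p prod.case by (rule norm_lterm_le[OF gauss_bounded_ph gauss_bounded_ph])
    also have "exp (- pi * h * (norm (lpt (1/2) m n))\<^sup>2) = ?e m * ?e n"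
      unfolding mult_exp_exp cmod_power2 complex.sel by (rule arg_cong[where f=exp]) (simp add: algebra_simps)
    finally show ?thesis by (simp add: p)
  qed
  have "?f summable_on UNIV"
    by (rule abs_summable_summable, rule summable_on_comparison_test[OF has_sum_imp_summable[OF hg]], rule bound, rule norm_ge_zero)
  then have "norm (tB Y r s) \<le> ?c\<^sup>2 * (infsum ?e UNIV)\<^sup>2"
    unfolding T[symmetric] by (intro norm_infsum_le[OF has_sum_infsum hg bound])
  then show "norm (tB Y r s) < ?c\<^sup>2 / 2" using Te c by linarith
qed

text \<open>Only the sign of \<open>A'\<^sup>2 - B'\<^sup>2\<close> is not determined by the quadratic transformation. It cannot change
  along \<open>Y \<rightarrow> \<infinity>\<close>, where it is positive.\<close>

theorem transformed_theta_pos: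
  assumes reg: "0 \<le> s" "s \<le> r" "r < 1" "r + s \<le> Y" "r < Y"
  defines "A' \<equiv> tA (2 * Y) (r - s) (r + s)" and "B' \<equiv> tB (2 * Y) (r - s) (r + s)"
    and "C' \<equiv> tC (2 * Y) (r - s) (r + s)" and "D2' \<equiv> tD2 (2 * Y) (r - s) (r + s)"
  shows "C'\<^sup>2 - D2' > 0" "C'\<^sup>2 + D2' > 0" "A'\<^sup>2 - B'\<^sup>2 > 0"
proof -
  have sq: "r\<^sup>2 \<le> r" "s\<^sup>2 \<le> s" using assms by (auto simp: power2_eq_square mult_left_le)
  have rs: "r\<^sup>2 + s\<^sup>2 < 2 * y" "(r - s)\<^sup>2 + (r + s)\<^sup>2 < 2 * (2 * y)" if "Y \<le> y" for y
  proof -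
    show "r\<^sup>2 + s\<^sup>2 < 2 * y" using sq reg that by linarith
    then show "(r - s)\<^sup>2 + (r + s)\<^sup>2 < 2 * (2 * y)" by (simp add: power2_eq_square algebra_simps)
  qed
  define A B C D A1 B1 C1 D1 where "A y = Re (tA y r s)" and "B y = Re (tB y r s)" and "C y = Re (tC y r s)" and "D y = Re (tD2 y r s)"
    and "A1 y = Re (tA (2 * y) (r - s) (r + s))" and "B1 y = Re (tB (2 * y) (r - s) (r + s))"
    and "C1 y = Re (tC (2 * y) (r - s) (r + s))" and "D1 y = Re (tD2 (2 * y) (r - s) (r + s))" for y
  note defs = A_def B_def C_def D_def A1_def B1_def C1_def D1_def
  have re: "tA y r s = of_real (A y)" "tB y r s = of_real (B y)" "tC y r s = of_real (C y)" "tD2 y r s = of_real (D y)"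
    "tA (2 * y) (r - s) (r + s) = of_real (A1 y)" "tB (2 * y) (r - s) (r + s) = of_real (B1 y)"
    "tC (2 * y) (r - s) (r + s) = of_real (C1 y)" "tD2 (2 * y) (r - s) (r + s) = of_real (D1 y)" if "Y \<le> y" for y
    unfolding defs using tABC_Reals[OF rs(1)[OF that]] tD2_Reals(1)[OF rs(1)[OF that]] tABC_Reals[OF rs(2)[OF that]] tD2_Reals(1)[OF rs(2)[OF that]]
    by (simp_all add: of_real_Re)
  have q: "4 * ((A1 y)\<^sup>2 - (B1 y)\<^sup>2)\<^sup>2 = ((A y)\<^sup>2 + (B y)\<^sup>2 + (C y)\<^sup>2 - D y) * ((A y)\<^sup>2 - (B y)\<^sup>2 + (C y)\<^sup>2 + D y)"
    "4 * ((C1 y)\<^sup>2 + D1 y)\<^sup>2 = ((A y)\<^sup>2 + (B y)\<^sup>2 + (C y)\<^sup>2 + D y) * ((A y)\<^sup>2 - (B y)\<^sup>2 + (C y)\<^sup>2 - D y)"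
    "(C1 y)\<^sup>2 - D1 y = A y * C y" if "Y \<le> y" for y
    using quadratic_transformation[OF rs(1)[OF that]] unfolding re[OF that]
    by (auto intro!: of_real_eq_iff[where 'a=complex, THEN iffD1])
  \<comment> \<open>The region is stable under increasing \<open>Y\<close>, so \<open>tC_pos\<close>
    applies on the whole half-line, as the continuity argument requires.\<close>
  have b3: "(C1 y)\<^sup>2 - D1 y > 0" if "Y \<le> y" for y
  proof -
    have "A y > 0" using tA_pos[OF rs(1)[OF that]] by (simp add: A_def less_complex_def)
    moreover have "C y > 0" unfolding C_def by (rule tC_pos) (use reg that in auto)
    ultimately show ?thesis unfolding q(3)[OF that] by simp
  qed
  have b2: "(C1 y)\<^sup>2 + D1 y > 0" if "Y \<le> y" for y
    using b3[OF that] tD2_Reals(2)[OF rs(2)[OF that]] zero_le_power2[of "C1 y"] unfolding D1_def by linarith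
  \<comment> \<open>The difference of the first two quadratic identities is
    \<open>4 * B\<^sup>2 * D \<ge> 0\<close>, so a zero here would force
    \<open>C1\<^sup>2 + D1 = 0\<close>.\<close>
  have b1: "(A1 y)\<^sup>2 - (B1 y)\<^sup>2 \<noteq> 0" if "Y \<le> y" for y
  proof -
    have "4 * ((A1 y)\<^sup>2 - (B1 y)\<^sup>2)\<^sup>2 = 4 * ((C1 y)\<^sup>2 + D1 y)\<^sup>2 + 4 * ((B y)\<^sup>2 * D y)"
      unfolding q(1,2)[OF that] by (simp add: power2_eq_square algebra_simps)
    moreover have "((C1 y)\<^sup>2 + D1 y)\<^sup>2 > 0" using b2[OF that] by simp
    moreover have "(B y)\<^sup>2 * D y \<ge> 0" using tD2_Reals(2)[OF rs(1)[OF that]] by (simp add: D_def)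
    ultimately have "((A1 y)\<^sup>2 - (B1 y)\<^sup>2)\<^sup>2 > 0" by linarith
    then show ?thesis by auto
  qed
  define Z where "Z = max Y (2 + (r\<^sup>2 + s\<^sup>2))"
  have Z: "Y \<le> Z" by (simp add: Z_def)
  have pos: "(A1 Z)\<^sup>2 - (B1 Z)\<^sup>2 > 0"
  proof -
    have "2 * Z - ((r - s)\<^sup>2 + (r + s)\<^sup>2) / 2 \<ge> 2"
    proof -
      have "((r - s)\<^sup>2 + (r + s)\<^sup>2) / 2 = r\<^sup>2 + s\<^sup>2" by (simp add: power2_eq_square algebra_simps)
      moreover have "Z \<ge> 2 + (r\<^sup>2 + s\<^sup>2)" by (simp add: Z_def)
      then have "2 * Z - (r\<^sup>2 + s\<^sup>2) \<ge> 2" using sum_power2_ge_zero[of r s] by linarith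
      ultimately show ?thesis by (simp only:)
    qed
    note n = tA_tB_near_infinity[OF rs(2)[OF Z] this, unfolded re[OF Z]]
    have "\<bar>A1 Z - (theta3 1)\<^sup>2\<bar> < (theta3 1)\<^sup>2 / 2" using n(1) by (simp only: norm_of_real flip: of_real_power of_real_diff)
    moreover have "\<bar>B1 Z\<bar> < (theta3 1)\<^sup>2 / 2" using n(2) by (simp only: norm_of_real)
    ultimately have "\<bar>B1 Z\<bar> < \<bar>A1 Z\<bar>" by linarith
    from power_strict_mono[OF this, of 2] show ?thesis by simp
  qed
  have cont: "continuous_on {Y..} (\<lambda>y. (A1 y)\<^sup>2 - (B1 y)\<^sup>2)"
  proof -
    have i: "(\<lambda>y. 2 * y) ` {Y..} \<subseteq> {2 * Y..}" by auto
    have l: "continuous_on {Y..} (\<lambda>y. lsum (coset p e) p00 p00 (2 * y) (r - s) (r + s))" for p e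
      by (rule continuous_on_compose2[OF continuous_on_lsum[OF rs(2)[OF order_refl] gauss_bounded_ph gauss_bounded_ph] _ i]) (intro continuous_intros)
    show ?thesis unfolding A1_def B1_def tA_def tB_def by (intro continuous_intros l)
  qed
  have "(A1 Y)\<^sup>2 - (B1 Y)\<^sup>2 > 0"
  proof (rule ccontr)
    assume "\<not> (A1 Y)\<^sup>2 - (B1 Y)\<^sup>2 > 0"
    then have "\<exists>y\<ge>Y. y \<le> Z \<and> (A1 y)\<^sup>2 - (B1 y)\<^sup>2 = 0"
      using pos Z by (intro IVT' continuous_on_subset[OF cont]) auto
    then show False using b1 by blast
  qed
  moreover have "0 < complex_of_real x" if "x > 0" for x using that by (simp add: less_complex_def)
  ultimately show "A'\<^sup>2 - B'\<^sup>2 > 0" "C'\<^sup>2 - D2' > 0" "C'\<^sup>2 + D2' > 0"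
    unfolding assms(6-9) re[OF order_refl] using b3[OF order_refl] b2[OF order_refl]
    by (simp_all only: flip: of_real_power of_real_diff of_real_add)
qed

section \<open>Theta constants at real points of the ball\<close>

definition real_point :: "real \<Rightarrow> real \<Rightarrow> real \<Rightarrow> complex^4" where
  "real_point Y r s = vector [1, - of_real Y, \<i> * of_real r, of_real s]"

lemma real_point_ball:
  assumes "r\<^sup>2 + s\<^sup>2 < 2 * Y"
  shows "real_point Y r s \<in> ball_cone"
proof -
  have "herm (real_point Y r s) = of_real (r\<^sup>2 + s\<^sup>2 - 2 * Y)"
    by (simp add: herm_eq real_point_def complex_eq_iff power2_eq_square)
  then show ?thesis using assms by (simp add: ball_cone_def less_complex_def)
qed

lemma abs_ball3_eq:
  assumes "k \<noteq> 0" "u = k *s v" "v \<in> ball_cone"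
  shows "abs_ball3 u = abs_ball3 v"
proof -
  have "herm u = of_real ((norm k)\<^sup>2) * herm v"
    using complex_norm_square[of k] by (simp add: herm_eq assms(2) algebra_simps)
  moreover have "(norm k)\<^sup>2 > 0" using assms(1) by simp
  ultimately have "u \<in> ball_cone"
    using assms(3) by (simp add: ball_cone_def less_complex_def mult_pos_neg)
  then have "ball_rel u v" using assms by (auto simp: ball_rel_def)
  then show ?thesis by (rule Quotient3_rel_abs[OF Quotient3_ball3])
qed

lemma R_act_real_point:
  assumes rs: "r\<^sup>2 + s\<^sup>2 < 2 * Y"
  shows "R_act (abs_ball3 (real_point Y r s)) = abs_ball3 (real_point (2 * Y) (r - s) (r + s))"
proof -
  have "ball_rel (real_point Y r s) (real_point Y r s)"
    using real_point_ball[OF rs] by (auto simp: ball_rel_def intro!: exI[of _ 1])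
  then have "R_act (abs_ball3 (real_point Y r s)) = abs_ball3 (R_mat *v real_point Y r s)" by (rule R_act.abs_eq)
  also have "\<dots> = abs_ball3 (real_point (2 * Y) (r - s) (r + s))"
  proof (rule abs_ball3_eq)
    show "R_mat *v real_point Y r s = (1 / (1 - \<i>)) *s real_point (2 * Y) (r - s) (r + s)"
      unfolding R_mat_mult by (simp add: real_point_def vec_eq_iff forall_4 algebra_simps)
    have "1 - \<i> \<noteq> 0" by (simp add: complex_eq_iff)
    then show "1 / (1 - \<i>) \<noteq> 0" by simp
    have "(r - s)\<^sup>2 + (r + s)\<^sup>2 < 2 * (2 * Y)" using rs by (simp add: power2_eq_square algebra_simps)
    then show "real_point (2 * Y) (r - s) (r + s) \<in> ball_cone" by (rule real_point_ball)
  qed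
  finally show ?thesis .
qed

text \<open>The matrix \<open>tau_sharp v\<close> for \<open>v = (1, - Y, \<i> r, s)\<close>. With \<open>\<kappa>\<close> the Gaussian integer formed by the first two
  coordinates its quadratic form involves only \<open>\<kappa>\<^sup>2\<close>, \<open>\<kappa>\<close> and \<open>\<bar>\<kappa>\<bar>\<^sup>2\<close>; this is where the sums over \<open>\<int>[\<i>]\<close> come from.\<close>

definition sharp_mat :: "real \<Rightarrow> real \<Rightarrow> real \<Rightarrow> complex^4^4" where
  "sharp_mat Y r s = (let S = complex_of_real (s\<^sup>2 - r\<^sup>2) in
     vector [vector [\<i> * (S + 2 * of_real Y) / 2, - S / 2, of_real r, - \<i> * of_real s],
             vector [- S / 2, - \<i> * (S - 2 * of_real Y) / 2, \<i> * of_real r, of_real s],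
             vector [of_real r, \<i> * of_real r, \<i>, 0],
             vector [- \<i> * of_real s, of_real s, 0, \<i>]])"

lemma matrix_inv_eq:
  fixes Q P :: "complex^4^4"
  assumes "Q ** P = mat 1" "P ** Q = mat 1"
  shows "matrix_inv Q = P"
proof -
  have "matrix_inv Q ** Q = mat 1"
    unfolding matrix_inv_def by (rule someI2[of _ P]) (use assms in auto)
  have "matrix_inv Q = matrix_inv Q ** (Q ** P)" unfolding assms by simp
  also have "\<dots> = P" unfolding matrix_mul_assoc \<open>matrix_inv Q ** Q = mat 1\<close> by simp
  finally show ?thesis .
qed

text \<open>\<open>N21 ** tau + N22\<close> differs from the identity only in its second row, so its
  inverse is explicit. Eliminating \<open>y\<close> in favour of the value \<open>b\<close> of the
  bilinear form then clears all denominators.\<close>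

lemma tau_sharp_real_point:
  assumes rs: "r\<^sup>2 + s\<^sup>2 < 2 * Y"
  shows "tau_sharp (abs_ball3 (real_point Y r s)) = sharp_mat Y r s"
proof -
  let ?v = "real_point Y r s"
  define R S y where "R = complex_of_real r" and "S = complex_of_real s" and "y = complex_of_real Y"
  define b where "b = S\<^sup>2 - R\<^sup>2 - 2 * y"
  have "s\<^sup>2 - r\<^sup>2 - 2 * Y \<noteq> 0" using rs zero_le_power2[of r] by linarith
  then have "complex_of_real (s\<^sup>2 - r\<^sup>2 - 2 * Y) \<noteq> 0" by (simp only: of_real_eq_0_iff not_False_eq_True)
  then have b0: "b \<noteq> 0" by (simp add: b_def R_def S_def y_def)
  have v: "?v = vector [1, - y, \<i> * R, S]" by (simp add: real_point_def R_def S_def y_def)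
  have bilin: "bilin ?v = b"
    unfolding v bilin_def U_mat_def by (simp add: sum_4 b_def power2_eq_square algebra_simps)
  have "ball_rel ?v ?v"
    using real_point_ball[OF rs] by (auto simp: ball_rel_def intro!: exI[of _ 1])
  then have "tau (abs_ball3 ?v) = mat \<i> ** U_mat ** (mat 1 - mat (2 / b) ** (\<chi> i j. ?v$i * ?v$j) ** U_mat)"
    unfolding bilin[symmetric] by (rule tau.abs_eq)
  also have "\<dots> = vector [
      vector [- 2 * \<i> * y\<^sup>2 / b, \<i> + 2 * \<i> * y / b, - 2 * y * R / b, 2 * \<i> * y * S / b],
      vector [\<i> + 2 * \<i> * y / b, - 2 * \<i> / b, 2 * R / b, - 2 * \<i> * S / b],
      vector [- 2 * y * R / b, 2 * R / b, \<i> + 2 * \<i> * R\<^sup>2 / b, 2 * R * S / b],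
      vector [2 * \<i> * y * S / b, - 2 * \<i> * S / b, 2 * R * S / b, \<i> - 2 * \<i> * S\<^sup>2 / b]]"
    (is "_ = ?T")
    unfolding v mat_mult_left
    by (simp add: vec_eq_iff forall_4 matrix_matrix_mult_def sum_4 U_mat_def mat_def power2_eq_square algebra_simps)
  finally have tau: "tau (abs_ball3 ?v) = ?T" .
  let ?Q = "vector [vector [1, 0, 0, 0], vector [\<i> + 2 * \<i> * y / b, - 2 * \<i> / b, 2 * R / b, - 2 * \<i> * S / b],
      vector [0, 0, 1, 0], vector [0, 0, 0, 1]] :: complex^4^4"
  let ?P = "vector [vector [1, 0, 0, 0], vector [b / 2 + y, \<i> * b / 2, - \<i> * R, - S],
      vector [0, 0, 1, 0], vector [0, 0, 0, 1]] :: complex^4^4"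
  have Q: "N21 ** ?T + N22 = ?Q"
    by (simp add: vec_eq_iff forall_4 matrix_matrix_mult_def sum_4 N21_def N22_def diag_mat_def)
  have M: "N11 ** ?T + N12 = vector [
      vector [- 2 * \<i> * y\<^sup>2 / b, \<i> + 2 * \<i> * y / b, - 2 * y * R / b, 2 * \<i> * y * S / b],
      vector [0, - 1, 0, 0],
      vector [- 2 * y * R / b, 2 * R / b, \<i> + 2 * \<i> * R\<^sup>2 / b, 2 * R * S / b],
      vector [2 * \<i> * y * S / b, - 2 * \<i> * S / b, 2 * R * S / b, \<i> - 2 * \<i> * S\<^sup>2 / b]]"
    by (simp add: vec_eq_iff forall_4 matrix_matrix_mult_def sum_4 N11_def N12_def diag_mat_def)
  have inv: "matrix_inv ?Q = ?P"
    by (rule matrix_inv_eq; use b0 in \<open>simp add: vec_eq_iff forall_4 matrix_matrix_mult_def sum_4 mat_def field_simps\<close>)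
  have S: "complex_of_real (s\<^sup>2 - r\<^sup>2) = S\<^sup>2 - R\<^sup>2" by (simp add: R_def S_def)
  have y: "y = (S\<^sup>2 - R\<^sup>2 - b) / 2" by (simp add: b_def)
  have i2: "\<i> * (\<i> * w) = - w" for w by (simp flip: mult.assoc)
  show ?thesis
    unfolding tau_sharp_def tau Q M inv sharp_mat_def Let_def S R_def[symmetric] S_def[symmetric] y_def[symmetric]
    unfolding y
    using b0 by (simp add: vec_eq_iff forall_4 matrix_matrix_mult_def sum_4 power2_eq_square field_simps i2)
qed

text \<open>The first two coordinates share the characteristic \<open>a1\<close>, so that they form
  a point \<open>lpt\<close>; the other two index the series of the two theta factors.\<close>

lemma theta_sharp_mat:
  fixes a1 a3 a4 b1 b2 b3 b4 :: int
  assumes c: "\<And>m n :: int. c (even (m + n)) = exp (of_real pi * \<i> * (of_int b1 * (of_int m + of_int a1 / 2) + of_int b2 * (of_int n + of_int a1 / 2)))"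
  shows "theta (vector [a1, a1, a3, a4]) (vector [b1, b2, b3, b4]) (sharp_mat Y r s) =
    (\<Sum>\<^sub>\<infinity>x. theta_term (of_int a1 / 2) c (of_int a3 / 2) (of_int b3 / 2) (of_int a4 / 2) (of_int b4 / 2) Y (\<i> * of_real r) (of_real s) x)"
proof -
  let ?v = "\<lambda>((m, n), (k, l)). vector [m, n, k, l] :: int^4"
  have bij: "bij ?v"
    by (rule bij_betw_byWitness[where f'="\<lambda>v. ((vec_nth v 1, vec_nth v 2), (vec_nth v 3, vec_nth v 4))"]) (auto simp: vec_eq_iff forall_4)
  show ?thesis unfolding theta_def
  proof (rule infsum_reindex_bij_betw[OF bij, THEN trans[OF sym]], rule infsum_cong)
    fix x :: "(int \<times> int) \<times> (int \<times> int)"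
    obtain m n k l where x: "x = ((m, n), (k, l))" by (metis prod.exhaust)
    define X Y' K L where "X = of_int m + of_int a1 / (2::real)" and "Y' = of_int n + of_int a1 / (2::real)"
      and "K = of_int k + of_int a3 / (2::complex)" and "L = of_int l + of_int a4 / (2::complex)"
    have z: "Complex (of_int m + of_int a1 / 2) (of_int n + of_int a1 / 2) = of_real X + \<i> * of_real Y'"
      by (simp add: complex_eq_iff X_def Y'_def)
    have n: "(norm (Complex (of_int m + of_int a1 / 2) (of_int n + of_int a1 / 2)))\<^sup>2 = X\<^sup>2 + Y'\<^sup>2"
      by (simp add: cmod_power2 X_def Y'_def)
    have i2: "\<i> * (\<i> * w) = - w" for w by (simp flip: mult.assoc)
    have XY: "of_int m + of_int a1 / 2 = complex_of_real X" "of_int n + of_int a1 / 2 = complex_of_real Y'"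
      by (simp_all add: X_def Y'_def)
    show "(let p = (\<chi> i. of_int (?v x $ i) + of_int (vector [a1, a1, a3, a4] $ i) / 2 :: complex^4)
       in exp (2 * of_real pi * \<i> * (1/2 * (\<Sum>i\<in>UNIV. \<Sum>j\<in>UNIV. p$i * sharp_mat Y r s$i$j * p$j)
           + (\<Sum>i\<in>UNIV. p$i * (of_int (vector [b1, b2, b3, b4] $ i) / 2))))) =
      theta_term (of_int a1 / 2) c (of_int a3 / 2) (of_int b3 / 2) (of_int a4 / 2) (of_int b4 / 2) Y (\<i> * of_real r) (of_real s) x"
      unfolding x prod.case theta_term_def phterm_def c n Let_def sharp_mat_def
      unfolding z exp_of_real[symmetric] mult_exp_exp
      by (rule arg_cong[where f=exp], simp add: sum_4 XY K_def[symmetric] L_def[symmetric])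
        (simp add: power2_eq_square field_simps i2)
  qed
qed

text \<open>The argument of the first theta factor is \<open>\<i> * r\<close> times the lattice
  point. Multiplication by \<open>\<i>\<close> fixes \<open>p00\<close> and multiplies
  \<open>p11\<close> by \<open>\<i>\<close>, so the sums return to real \<open>r\<close> at the cost
  of a factor \<open>w\<close>.\<close>

lemma theta_constants_real_point:
  assumes rs: "r\<^sup>2 + s\<^sup>2 < 2 * Y"
  defines "v \<equiv> abs_ball3 (real_point Y r s)"
  shows "a_fun v = (tA Y r s)\<^sup>2 + (tB Y r s)\<^sup>2" "b1_fun v = (tA Y r s)\<^sup>2 - (tB Y r s)\<^sup>2"
    "b2_fun v = (tC Y r s)\<^sup>2 + tD2 Y r s" "b3_fun v = (tC Y r s)\<^sup>2 - tD2 Y r s"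
proof -
  have rs': "(norm (\<i> * complex_of_real r))\<^sup>2 + (norm (complex_of_real s))\<^sup>2 < 2 * Y"
    "(norm (complex_of_real r))\<^sup>2 + (norm (complex_of_real s))\<^sup>2 < 2 * Y"
    using rs by (simp_all add: norm_mult)
  have sum: "(\<Sum>\<^sub>\<infinity>x. theta_term p c p3 q3 p4 q4 Y (\<i> * of_real r) (of_real s) x) =
      w * (c True * lsum (coset p True) (ph p3 q3) (ph p4 q4) Y r s + c False * lsum (coset p False) (ph p3 q3) (ph p4 q4) Y r s)"
    if c: "\<And>e. norm (c e) \<le> 1" and w: "\<And>z. ph p3 q3 (\<i> * z) = w * ph p3 q3 z" for p c p3 q3 p4 q4 w
  proof -
    have "(\<Sum>\<^sub>\<infinity>x. theta_term p c p3 q3 p4 q4 Y (\<i> * of_real r) (of_real s) x) =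
       (\<Sum>\<^sub>\<infinity>(m, n). c (even (m + n)) * of_real (exp (- pi * Y * (norm (lpt p m n))\<^sup>2)) *
        (ph p3 q3 (\<i> * of_real r * lpt p m n) * ph p4 q4 (of_real s * lpt p m n)))"
      by (rule abs_summable_theta_term(2)[where c=c, OF rs'(1) c])
    also have "\<dots> = (\<Sum>\<^sub>\<infinity>mn. w * (case mn of (m, n) \<Rightarrow> c (even (m + n)) * of_real (exp (- pi * Y * (norm (lpt p m n))\<^sup>2)) *
        (ph p3 q3 (of_real r * lpt p m n) * ph p4 q4 (of_real s * lpt p m n))))"
      by (rule infsum_cong) (simp add: case_prod_unfold mult.assoc w)
    also have "\<dots> = w * (\<Sum>\<^sub>\<infinity>x. theta_term p c p3 q3 p4 q4 Y (of_real r) (of_real s) x)"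
      unfolding infsum_cmult_right' abs_summable_theta_term(2)[where c=c, OF rs'(2) c] ..
    finally show ?thesis unfolding infsum_theta_term[where c=c, OF rs c] .
  qed
  have ep: "exp (of_real pi * \<i> * of_int m) = (if even m then 1 else - 1)" for m
  proof -
    have "exp (of_real pi * \<i> * of_int m) = cis (pi * of_int m)" by (simp add: cis_conv_exp mult_ac)
    then show ?thesis using cis_pi_int[of m] by simp
  qed
  have A: "theta (vector [0,0,0,0]) (vector [0,0,0,0]) (sharp_mat Y r s) = tA Y r s"
    using theta_sharp_mat[of "\<lambda>_. 1" 0 0 0 0 0 0 0 Y r s] sum[of "\<lambda>_. 1" 0 0 1 0 0 0] by (simp add: ph_i tA_def)
  have B: "theta (vector [1,1,0,0]) (vector [0,0,0,0]) (sharp_mat Y r s) = tB Y r s"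
    using theta_sharp_mat[of "\<lambda>_. 1" 0 1 0 0 0 0 0 Y r s] sum[of "\<lambda>_. 1" 0 0 1 "1/2" 0 0] lsum_symmetries(4)[OF rs]
    by (simp add: ph_i tB_def)
  have C: "theta (vector [0,0,0,0]) (vector [1,1,0,0]) (sharp_mat Y r s) = tC Y r s"
  proof -
    have "(if even (m + n) then 1 else - 1) = exp (of_real pi * \<i> * (of_int 1 * (of_int m + of_int 0 / 2) + of_int 1 * (of_int n + of_int 0 / 2)))" for m n :: int
      using ep[of "m + n"] by simp
    from theta_sharp_mat[where c="\<lambda>e. if e then 1 else - 1", OF this, of 0 0 0 0 Y r s]
    show ?thesis using sum[of "\<lambda>e. if e then 1 else - 1" 0 0 1 0 0 0] by (simp add: ph_i tC_def)
  qed
  \<comment> \<open>The cosets \<open>K2\<close> and \<open>K3\<close> enter with opposite signs and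
    have opposite sums, so they reinforce each other; the factor \<open>\<i>\<close> is
    \<open>w\<close> for \<open>p11\<close>.\<close>
  have D: "theta (vector [1,1,1,1]) (vector [1,1,1,1]) (sharp_mat Y r s) = - 2 * \<i> * lsum K2 p11 p11 Y r s"
  proof -
    have "(if even (m + n) then - 1 else 1) = exp (of_real pi * \<i> * (of_int 1 * (of_int m + of_int 1 / 2) + of_int 1 * (of_int n + of_int 1 / 2)))" for m n :: int
      using ep[of "m + n + 1"] by (simp add: algebra_simps)
    from theta_sharp_mat[where c="\<lambda>e. if e then - 1 else 1", OF this, of 1 1 1 1 Y r s]
    show ?thesis using sum[of "\<lambda>e. if e then - 1 else 1" "1/2" "1/2" \<i> "1/2" "1/2" "1/2"] lsum_symmetries(5)[OF rs] by (simp add: ph_i)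
  qed
  show "a_fun v = (tA Y r s)\<^sup>2 + (tB Y r s)\<^sup>2" "b1_fun v = (tA Y r s)\<^sup>2 - (tB Y r s)\<^sup>2"
    "b2_fun v = (tC Y r s)\<^sup>2 + tD2 Y r s" "b3_fun v = (tC Y r s)\<^sup>2 - tD2 Y r s"
    unfolding a_fun_def b1_fun_def b2_fun_def b3_fun_def v_def tau_sharp_real_point[OF rs] A B C D tD2_def
    by (simp_all add: power_mult_distrib)
qed

lemma csqrt_4_power2:
  fixes b :: complex
  assumes "b > 0"
  shows "csqrt (4 * b\<^sup>2) / 2 = b" "4 * b\<^sup>2 > 0"
proof -
  obtain x where x: "b = of_real x" "x > 0"
    using assms by (metis complex_is_Real_iff less_complex_def of_real_Re zero_complex.sel)
  have "csqrt (4 * b\<^sup>2) = csqrt ((2 * b)\<^sup>2)" by (simp add: power_mult_distrib)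
  also have "\<dots> = 2 * b" by (rule csqrt_square) (use x in simp)
  finally show "csqrt (4 * b\<^sup>2) / 2 = b" by simp
  have "4 * b\<^sup>2 = of_real (4 * x\<^sup>2)" by (simp add: x)
  then show "4 * b\<^sup>2 > 0" using x(2) by (simp only: less_complex_def) simp
qed

theorem transformation_real_point:
  assumes reg: "0 \<le> s" "s \<le> r" "r < 1" "r + s \<le> Y" "r < Y"
  defines "v \<equiv> abs_ball3 (real_point Y r s)"
  shows "(0 < (a_fun v + b3_fun v) * (b1_fun v + b2_fun v) \<and>
           b1_fun (R_act v) = csqrt ((a_fun v + b3_fun v) * (b1_fun v + b2_fun v)) / 2) \<and>
         (0 < (a_fun v + b2_fun v) * (b1_fun v + b3_fun v) \<and>
           b2_fun (R_act v) = csqrt ((a_fun v + b2_fun v) * (b1_fun v + b3_fun v)) / 2) \<and>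
         (0 < (a_fun v + b1_fun v) * (b2_fun v + b3_fun v) \<and>
           b3_fun (R_act v) = csqrt ((a_fun v + b1_fun v) * (b2_fun v + b3_fun v)) / 2)"
proof -
  have sq: "r\<^sup>2 \<le> r" "s\<^sup>2 \<le> s" using reg by (auto simp: power2_eq_square mult_left_le)
  have rs: "r\<^sup>2 + s\<^sup>2 < 2 * Y" using sq reg by linarith
  then have rs': "(r - s)\<^sup>2 + (r + s)\<^sup>2 < 2 * (2 * Y)" by (simp add: power2_eq_square algebra_simps)
  note th = theta_constants_real_point[OF rs, folded v_def]
  note th' = theta_constants_real_point[OF rs', folded R_act_real_point[OF rs], folded v_def]
  note q = quadratic_transformation[OF rs]
  note pos = transformed_theta_pos[OF reg]
  have 1: "(a_fun v + b3_fun v) * (b1_fun v + b2_fun v) = 4 * (b1_fun (R_act v))\<^sup>2"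
    unfolding th th' q(1) by (simp add: algebra_simps)
  have 2: "(a_fun v + b2_fun v) * (b1_fun v + b3_fun v) = 4 * (b2_fun (R_act v))\<^sup>2"
    unfolding th th' q(2) by (simp add: algebra_simps)
  have 3: "(a_fun v + b1_fun v) * (b2_fun v + b3_fun v) = 4 * (b3_fun (R_act v))\<^sup>2"
    unfolding th th' q(3) by (simp add: power2_eq_square)
  show ?thesis unfolding 1 2 3
    using csqrt_4_power2[of "b1_fun (R_act v)"] csqrt_4_power2[of "b2_fun (R_act v)"] csqrt_4_power2[of "b3_fun (R_act v)"] pos
    unfolding th' by simp
qed

section \<open>Periods\<close>

lemma integrable_powr_unit: "integrable lborel (\<lambda>t. indicator {0..3} t * t powr (- (1/4)) :: real)"
proof -
  have "(\<lambda>t::real. t powr (- (1/4))) absolutely_integrable_on {0..3}"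
    by (rule nonnegative_absolutely_integrable_1[OF has_integral_integrable[OF has_integral_powr_from_0]]) auto
  then have "integrable lebesgue (\<lambda>t. indicator {0..3} t * t powr (- (1/4)) :: real)"
    by (simp add: set_integrable_def)
  then show ?thesis by (subst (asm) integrable_completion) auto
qed

lemma integrable_powr_tail: "integrable lborel (\<lambda>t. indicator {1..} t * t powr (- (5/4)) :: real)"
proof -
  have "(\<lambda>t::real. t powr (- (5/4))) absolutely_integrable_on {1..}"
    by (rule nonnegative_absolutely_integrable_1[OF has_integral_integrable[OF has_integral_powr_to_inf]]) auto
  then have "integrable lebesgue (\<lambda>t. indicator {1..} t * t powr (- (5/4)) :: real)"
    by (simp add: set_integrable_def)
  then show ?thesis by (subst (asm) integrable_completion) auto
qed

lemma integrable_symmetrize: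
  fixes k :: "real \<Rightarrow> real"
  assumes "integrable lborel k" "c \<noteq> 0"
  shows "integrable lborel (\<lambda>t. k (b + c * t) + k (- b + - c * t))"
  using assms lborel_integrable_real_affine_iff[of c k b] lborel_integrable_real_affine_iff[of "- c" k "- b"] by simp

definition weight :: "real set \<Rightarrow> real \<Rightarrow> real" where
  "weight A t = (\<Prod>a\<in>A. \<bar>t - a\<bar> powr (- (1/4)))"

lemma weight_nonneg: "weight A t \<ge> 0"
  unfolding weight_def by (rule prod_nonneg) simp

lemma borel_measurable_weight [measurable]: "weight A \<in> borel_measurable borel"
  unfolding weight_def by measurable

text \<open>For \<open>\<bar>t\<bar> < 2\<close> the nearest branch point is singled out, with an
  integrable singularity of order 1/4, and the other four lie at distance at least
  \<open>\<delta>\<close>. Beyond that all five distances are at least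
  \<open>\<bar>t\<bar> / 2\<close>, and order 5/4 is integrable at infinity.\<close>

lemma integrable_weight:
  assumes A: "finite A" "A \<subseteq> {0..1}" "card A = 5"
  shows "integrable lborel (weight A)"
proof -
  let ?k = "\<lambda>t. indicator {0..3} t * t powr (- (1/4)) :: real"
  let ?l = "\<lambda>t. indicator {1..} t * t powr (- (5/4)) :: real"
  have "\<forall>a\<in>A. \<exists>d>0. \<forall>x\<in>A. x \<noteq> a \<longrightarrow> d \<le> dist a x" using finite_set_avoid[OF A(1)] by blast
  then obtain d where d: "\<And>a. a \<in> A \<Longrightarrow> d a > 0" "\<And>a x. a \<in> A \<Longrightarrow> x \<in> A \<Longrightarrow> x \<noteq> a \<Longrightarrow> d a \<le> dist a x"
    by metis
  define \<delta> where "\<delta> = Min (insert 1 (d ` A)) / 2"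
  have \<delta>: "\<delta> > 0" unfolding \<delta>_def using A d by simp
  have sep: "2 * \<delta> \<le> \<bar>a - x\<bar>" if "a \<in> A" "x \<in> A" "x \<noteq> a" for a x
  proof -
    have "2 * \<delta> \<le> d a" unfolding \<delta>_def using A that by simp
    then show ?thesis using d(2)[OF that] by (simp add: dist_real_def)
  qed
  define K where "K = (\<delta> powr (- (1/4))) ^ 4"
  let ?D = "\<lambda>t. (\<Sum>a\<in>A. K * (?k (- a + 1 * t) + ?k (- (- a) + - 1 * t))) + (?l (0 + 1/2 * t) + ?l (- 0 + - (1/2) * t))"
  have D: "integrable lborel ?D"
    by (intro Bochner_Integration.integrable_add Bochner_Integration.integrable_sum integrable_mult_right integrable_symmetrize integrable_powr_unit integrable_powr_tail)
      simp_all
  have K: "K \<ge> 0" by (simp add: K_def)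
  have k0: "?k u \<ge> 0" "?l u \<ge> 0" for u by simp_all
  have "weight A t \<le> ?D t" for t
  proof (cases "\<bar>t\<bar> \<ge> 2")
    case True
    have "weight A t \<le> (\<Prod>a\<in>A. (\<bar>t\<bar> / 2) powr (- (1/4)))"
      unfolding weight_def
    proof (intro prod_mono conjI powr_mono2')
      fix a assume "a \<in> A"
      then have "0 \<le> a" "a \<le> 1" using A by auto
      then show "\<bar>t\<bar> / 2 \<le> \<bar>t - a\<bar>" using True by linarith
    qed (use True in auto)
    also have "\<dots> = (\<bar>t\<bar> / 2) powr (- (5/4))"
      using True by (simp add: A(3) powr_powr flip: powr_realpow)
    also have "\<dots> \<le> ?l (0 + 1/2 * t) + ?l (- 0 + - (1/2) * t)"
      using True by (cases "t \<ge> 0") (auto simp: indicator_def)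
    also have "\<dots> \<le> ?D t"
      by (rule add_increasing[OF sum_nonneg order_refl]) (intro mult_nonneg_nonneg add_nonneg_nonneg K k0)
    finally show ?thesis .
  next
    case False
    have ne: "A \<noteq> {}" using A by auto
    have "Min ((\<lambda>a. \<bar>t - a\<bar>) ` A) \<in> (\<lambda>a. \<bar>t - a\<bar>) ` A" using A ne by (intro Min_in) auto
    then obtain a where a: "a \<in> A" "\<bar>t - a\<bar> = Min ((\<lambda>a. \<bar>t - a\<bar>) ` A)" by force
    have near: "\<bar>t - a\<bar> \<le> \<bar>t - b\<bar>" if "b \<in> A" for b unfolding a(2) using A that by simp
    have "weight A t = \<bar>t - a\<bar> powr (- (1/4)) * (\<Prod>b\<in>A - {a}. \<bar>t - b\<bar> powr (- (1/4)))"
      unfolding weight_def by (rule prod.remove[OF A(1) a(1)])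
    also have "\<dots> \<le> \<bar>t - a\<bar> powr (- (1/4)) * (\<Prod>b\<in>A - {a}. \<delta> powr (- (1/4)))"
    proof (rule mult_left_mono)
      show "(\<Prod>b\<in>A - {a}. \<bar>t - b\<bar> powr (- (1/4))) \<le> (\<Prod>b\<in>A - {a}. \<delta> powr (- (1/4)))"
      proof (intro prod_mono conjI powr_mono2')
        fix b assume "b \<in> A - {a}"
        then show "\<delta> \<le> \<bar>t - b\<bar>" using sep[of a b] near[of b] a(1) by force
      qed (use \<delta> in auto)
    qed simp
    also have "(\<Prod>b\<in>A - {a}. \<delta> powr (- (1/4))) = K" using A a by (simp add: K_def)
    also have "\<bar>t - a\<bar> powr (- (1/4)) * K = K * \<bar>t - a\<bar> powr (- (1/4))" by (rule mult.commute)
    finally have "weight A t \<le> K * \<bar>t - a\<bar> powr (- (1/4))" .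
    also have "K * \<bar>t - a\<bar> powr (- (1/4)) \<le> K * (?k (- a + 1 * t) + ?k (- (- a) + - 1 * t))"
    proof (rule mult_left_mono[OF _ K])
      show "\<bar>t - a\<bar> powr (- (1/4)) \<le> ?k (- a + 1 * t) + ?k (- (- a) + - 1 * t)"
      proof -
        have "0 \<le> a" "a \<le> 1" using A a by auto
        then show ?thesis using False by (cases "t \<ge> a") (auto simp: indicator_def)
      qed
    qed
    also have "\<dots> \<le> (\<Sum>a\<in>A. K * (?k (- a + 1 * t) + ?k (- (- a) + - 1 * t)))"
      by (rule member_le_sum[OF a(1) _ A(1)]) (use K k0 in \<open>auto intro!: mult_nonneg_nonneg add_nonneg_nonneg\<close>)
    also have "\<dots> \<le> ?D t" using k0 by (simp only: le_add_same_cancel1 add_nonneg_nonneg)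
    finally show ?thesis .
  qed
  then show ?thesis
    by (intro Bochner_Integration.integrable_bound[OF D]) (auto intro!: AE_I2 simp: weight_nonneg abs_of_nonneg order_trans[OF _ abs_ge_self])
qed

text \<open>A branch of \<open>\<Prod>a\<in>A. (z - a) powr (-1/4)\<close> on the upper half plane,
  with factors rotated by \<open>-\<i>\<close> so that the cut of \<open>Ln\<close> stays away from it.\<close>

definition half_plane_branch :: "real set \<Rightarrow> complex \<Rightarrow> complex" where
  "half_plane_branch A z = (\<Prod>a\<in>A. exp (- (Ln (- \<i> * (z - of_real a)) / 4)))"

text \<open>The boundary values from above: \<open>- \<i> * (t - a)\<close> has argument
  \<open>pi / 2\<close> for \<open>t < a\<close> and \<open>- pi / 2\<close> for
  \<open>t > a\<close>, which the exponent \<open>- 1/4\<close> turns into \<open>- pi / 8\<close>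
  and \<open>pi / 8\<close>.\<close>

definition boundary_branch :: "real set \<Rightarrow> real \<Rightarrow> complex" where
  "boundary_branch A t = (\<Prod>a\<in>A. of_real (\<bar>t - a\<bar> powr (- (1/4))) * (if t < a then cis (- pi / 8) else cis (pi / 8)))"

lemma borel_measurable_boundary_branch [measurable]: "boundary_branch A \<in> borel_measurable borel"
  unfolding boundary_branch_def by measurable

lemma norm_boundary_branch: "norm (boundary_branch A t) = weight A t"
  unfolding boundary_branch_def weight_def prod_norm[symmetric]
  by (rule prod.cong) (auto simp: norm_mult)

lemma norm_half_plane_branch:
  assumes "\<And>a. a \<in> A \<Longrightarrow> z \<noteq> of_real a"
  shows "norm (half_plane_branch A z) = (\<Prod>a\<in>A. norm (z - of_real a) powr (- (1/4)))"
  unfolding half_plane_branch_def prod_norm[symmetric]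
proof (rule prod.cong)
  fix a assume "a \<in> A"
  then have "z \<noteq> of_real a" by (rule assms)
  then show "norm (exp (- (Ln (- \<i> * (z - of_real a)) / 4))) = norm (z - of_real a) powr (- (1/4))"
    by (simp add: norm_exp_eq_Re Re_Ln norm_mult powr_def)
qed simp

lemma half_plane_branch_of_real:
  assumes "t \<notin> A"
  shows "half_plane_branch A (of_real t) = boundary_branch A t"
  unfolding half_plane_branch_def boundary_branch_def
proof (rule prod.cong)
  fix a assume "a \<in> A"
  then have ta: "t \<noteq> a" using assms by auto
  define l where "l = ln \<bar>t - a\<bar>"
  define \<theta> where "\<theta> = (if t < a then pi / 2 else - pi / 2)"
  have e: "of_real \<bar>t - a\<bar> = exp (complex_of_real l)" unfolding l_def exp_of_real using ta by simp
  have "cis \<theta> = (if t < a then \<i> else - \<i>)" by (simp add: \<theta>_def cis_conv_exp complex_eq_iff Re_exp Im_exp)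
  then have "- \<i> * (of_real t - of_real a) = of_real \<bar>t - a\<bar> * cis \<theta>" using ta by (auto simp: abs_if algebra_simps)
  also have "\<dots> = exp (of_real l + \<i> * of_real \<theta>)" unfolding e cis_conv_exp by (simp add: exp_add)
  finally have ex: "- \<i> * (of_real t - of_real a) = exp (of_real l + \<i> * of_real \<theta>)" .
  have "\<theta> = pi / 2 \<or> \<theta> = - pi / 2" by (simp add: \<theta>_def)
  then have "- pi < \<theta>" "\<theta> \<le> pi" using pi_gt_zero by (elim disjE; linarith)+
  then have "Ln (- \<i> * (of_real t - of_real a)) = of_real l + \<i> * of_real \<theta>"
    unfolding ex by (intro Ln_exp) simp_all
  then have "exp (- (Ln (- \<i> * (of_real t - of_real a)) / 4)) = exp (of_real (- l / 4)) * cis (- \<theta> / 4)"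
    unfolding cis_conv_exp mult_exp_exp by (simp only:) (rule arg_cong[where f=exp], simp add: field_simps)
  also have "exp (of_real (- l / 4)) = complex_of_real (\<bar>t - a\<bar> powr (- (1/4)))"
    unfolding exp_of_real powr_def l_def using ta by simp
  also have "cis (- \<theta> / 4) = (if t < a then cis (- pi / 8) else cis (pi / 8))" by (simp add: \<theta>_def)
  finally show "exp (- (Ln (- \<i> * (of_real t - of_real a)) / 4)) = of_real (\<bar>t - a\<bar> powr (- (1/4))) * (if t < a then cis (- pi / 8) else cis (pi / 8))" .
qed simp

lemma holomorphic_half_plane_branch: "half_plane_branch A holomorphic_on {z. Im z > 0}"
  unfolding half_plane_branch_def
  by (intro holomorphic_intros) (auto simp: complex_nonpos_Reals_iff)

lemma half_plane_branch_tendsto: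
  assumes "t \<notin> A"
  shows "(\<lambda>n. half_plane_branch A (of_real t + \<i> * of_real (1 / real (Suc n)))) \<longlonglongrightarrow> boundary_branch A t"
proof -
  have l: "(\<lambda>n. - \<i> * (of_real t + \<i> * of_real (1 / real (Suc n)) - of_real a)) \<longlonglongrightarrow> - \<i> * (of_real t + \<i> * of_real 0 - of_real a)" for a
    by (intro tendsto_intros LIMSEQ_Suc[OF lim_1_over_n])
  show ?thesis unfolding half_plane_branch_of_real[OF assms, symmetric] half_plane_branch_def
  proof (rule tendsto_prod)
    fix a assume "a \<in> A"
    then have "- \<i> * (of_real t + \<i> * of_real 0 - of_real a) \<notin> \<real>\<^sub>\<le>\<^sub>0" using assms by (auto simp: complex_nonpos_Reals_iff)
    note lim = tendsto_Ln[OF l this]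
    have "(\<lambda>n. exp (- (Ln (- \<i> * (of_real t + \<i> * of_real (1 / real (Suc n)) - of_real a)) / 4))) \<longlonglongrightarrow> exp (- (Ln (- \<i> * (of_real t + \<i> * of_real 0 - of_real a)) / 4))"
      by (intro tendsto_exp tendsto_minus tendsto_divide tendsto_const lim) simp
    then show "(\<lambda>n. exp (- (Ln (- \<i> * (of_real t + \<i> * of_real (1 / real (Suc n)) - of_real a)) / 4))) \<longlonglongrightarrow> exp (- (Ln (- \<i> * (of_real t - of_real a)) / 4))"
      by (simp only: of_real_0 mult_zero_right add_0_right)
  qed
qed

text \<open>A primitive exists on the convex half plane, so the segment can be replaced by the other
  three sides of a rectangle with top at height \<open>R\<close>. Their total length is at most
  \<open>4 * R\<close>, and every branch point is at distance at least \<open>R - 1\<close> from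
  them.\<close>

lemma norm_integral_half_plane_branch_le:
  assumes A: "finite A" "A \<subseteq> {0..1}" "card A = 5" and R: "R \<ge> 2" and \<epsilon>: "0 < \<epsilon>" "\<epsilon> \<le> 1"
  shows "norm (\<integral>t. indicator {- R..R} t *\<^sub>R half_plane_branch A (of_real t + \<i> * of_real \<epsilon>) \<partial>lborel) \<le> 4 * R * (R - 1) powr (- (5/4))"
proof -
  let ?f = "half_plane_branch A" and ?H = "{z. Im z > 0}"
  have "convex ?H" by (rule convex_halfspace_Im_gt)
  moreover have "open ?H" by (rule open_halfspace_Im_gt)
  ultimately obtain g where g: "\<And>z. z \<in> ?H \<Longrightarrow> (g has_field_derivative ?f z) (at z)"
    using holomorphic_convex_primitive'[OF _ _ holomorphic_half_plane_branch[of A]] at_within_open[OF _ \<open>open ?H\<close>] by metis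
  let ?B = "(R - 1) powr (- (5/4))"
  have bound: "norm (?f z) \<le> ?B" if z: "Im z > 0" and far: "R \<le> \<bar>Re z\<bar> \<or> R \<le> Im z" for z
  proof -
    have "norm (?f z) = (\<Prod>a\<in>A. norm (z - of_real a) powr (- (1/4)))"
      by (rule norm_half_plane_branch) (use z in auto)
    also have "\<dots> \<le> (\<Prod>a\<in>A. (R - 1) powr (- (1/4)))"
    proof (intro prod_mono conjI powr_mono2')
      fix a assume "a \<in> A"
      then have "0 \<le> a" "a \<le> 1" using A by auto
      then have "R - 1 \<le> \<bar>Re (z - of_real a)\<bar> \<or> R - 1 \<le> \<bar>Im (z - of_real a)\<bar>" using far by auto
      then show "R - 1 \<le> norm (z - of_real a)"
        using abs_Re_le_cmod[of "z - of_real a"] abs_Im_le_cmod[of "z - of_real a"] by linarith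
    qed (use R in auto)
    also have "\<dots> = ?B" using R by (simp add: A(3) powr_powr flip: powr_realpow)
    finally show ?thesis .
  qed
  have seg: "norm (g v - g u) \<le> ?B * norm (v - u)"
    if "Im u > 0" "Im v > 0" "\<And>z. z \<in> closed_segment u v \<Longrightarrow> R \<le> \<bar>Re z\<bar> \<or> R \<le> Im z" for u v
  proof (rule field_differentiable_bound[of "closed_segment u v" g ?f])
    fix z assume z: "z \<in> closed_segment u v"
    then have "z \<in> ?H" using closed_segment_subset[of u ?H v] convex_halfspace_Im_gt[of 0] that(1,2) by auto
    then show "(g has_field_derivative ?f z) (at z within closed_segment u v)" "norm (?f z) \<le> ?B"
      using bound that(3)[OF z] by (auto intro: has_field_derivative_at_within g)
  qed auto
  let ?p = "Complex R \<epsilon>" and ?q = "Complex R R" and ?r = "Complex (- R) R" and ?s = "Complex (- R) \<epsilon>"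
  have "norm (g ?q - g ?p) \<le> ?B * norm (?q - ?p)"
  proof (rule seg)
    show "R \<le> \<bar>Re z\<bar> \<or> R \<le> Im z" if "z \<in> closed_segment ?p ?q" for z
      using that R by (auto simp: closed_segment_same_Re)
  qed (use R \<epsilon> in auto)
  moreover have "norm (g ?r - g ?q) \<le> ?B * norm (?r - ?q)"
  proof (rule seg)
    show "R \<le> \<bar>Re z\<bar> \<or> R \<le> Im z" if "z \<in> closed_segment ?q ?r" for z
      using that R by (auto simp: closed_segment_same_Im)
  qed (use R \<epsilon> in auto)
  moreover have "norm (g ?s - g ?r) \<le> ?B * norm (?s - ?r)"
  proof (rule seg)
    show "R \<le> \<bar>Re z\<bar> \<or> R \<le> Im z" if "z \<in> closed_segment ?r ?s" for z
      using that R by (auto simp: closed_segment_same_Re)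
  qed (use R \<epsilon> in auto)
  moreover have "norm (?q - ?p) \<le> R" "norm (?s - ?r) \<le> R"
    using R \<epsilon> by (simp_all add: cmod_def)
  moreover have "?r - ?q = of_real (- 2 * R)" by (simp add: complex_eq_iff)
  then have "norm (?r - ?q) = 2 * R" using R by (simp only: norm_of_real)
  ultimately have "?B * norm (?q - ?p) \<le> ?B * R" "?B * norm (?r - ?q) = ?B * (2 * R)" "?B * norm (?s - ?r) \<le> ?B * R"
    "norm (g ?q - g ?p) \<le> ?B * norm (?q - ?p)" "norm (g ?r - g ?q) \<le> ?B * norm (?r - ?q)" "norm (g ?s - g ?r) \<le> ?B * norm (?s - ?r)"
    by (simp_all add: mult_left_mono)
  moreover have "norm (g ?p - g ?s) \<le> norm (g ?q - g ?p) + norm (g ?r - g ?q) + norm (g ?s - g ?r)"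
  proof -
    have "g ?p - g ?s = - ((g ?q - g ?p) + (g ?r - g ?q) + (g ?s - g ?r))" by simp
    then have "norm (g ?p - g ?s) = norm ((g ?q - g ?p) + (g ?r - g ?q) + (g ?s - g ?r))" by (simp only: norm_minus_cancel)
    also have "\<dots> \<le> norm (g ?q - g ?p) + norm (g ?r - g ?q) + norm (g ?s - g ?r)"
      by (rule norm_triangle_le[OF add_right_mono[OF norm_triangle_ineq]])
    finally show ?thesis .
  qed
  ultimately have le: "norm (g ?p - g ?s) \<le> ?B * (4 * R)" by linarith
  have "(\<integral>t. indicator {- R..R} t *\<^sub>R ?f (of_real t + \<i> * of_real \<epsilon>) \<partial>lborel)
      = g (of_real R + \<i> * of_real \<epsilon>) - g (of_real (- R) + \<i> * of_real \<epsilon>)"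
  proof (rule integral_FTC_Icc)
    show "- R \<le> R" using R by simp
    fix t
    have i: "of_real t + \<i> * of_real \<epsilon> \<in> ?H" using \<epsilon> by simp
    have "((\<lambda>u. g (u + \<i> * of_real \<epsilon>)) has_field_derivative ?f (of_real t + \<i> * of_real \<epsilon>)) (at (of_real t))"
      by (rule DERIV_shift[THEN iffD1]) (rule g[OF i])
    from has_vector_derivative_real_field[OF this]
    show "((\<lambda>t. g (of_real t + \<i> * of_real \<epsilon>)) has_vector_derivative ?f (of_real t + \<i> * of_real \<epsilon>)) (at t within {- R..R})" .
  next
    show "continuous_on {- R..R} (\<lambda>t. ?f (of_real t + \<i> * of_real \<epsilon>))"
      by (rule continuous_on_compose2[OF holomorphic_on_imp_continuous_on[OF holomorphic_half_plane_branch]])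
        (use \<epsilon> in \<open>auto intro!: continuous_intros\<close>)
  qed
  moreover have "of_real R + \<i> * of_real \<epsilon> = ?p" "of_real (- R) + \<i> * of_real \<epsilon> = ?s" by (simp_all add: complex_eq_iff)
  ultimately show ?thesis using le by (simp add: mult_ac)
qed

lemma AE_notin_finite: "finite A \<Longrightarrow> AE t in lborel. t \<notin> A" for A :: "real set"
  by (rule AE_not_in) (simp add: null_sets_def finite_imp_closed emeasure_lborel_countable countable_finite)

text \<open>The contour bound does not involve the height \<open>\<epsilon>\<close>, and off the
  branch points the weight dominates the branch on all parallels, so the height can tend to
  0.\<close>

lemma norm_integral_boundary_branch_le:
  assumes A: "finite A" "A \<subseteq> {0..1}" "card A = 5" and R: "R \<ge> 2"
  shows "norm (\<integral>t. indicator {- R..R} t *\<^sub>R boundary_branch A t \<partial>lborel) \<le> 4 * R * (R - 1) powr (- (5/4))"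
proof -
  let ?f = "\<lambda>n t. indicator {- R..R} t *\<^sub>R half_plane_branch A (of_real t + \<i> * of_real (1 / real (Suc n)))"
  have "(\<lambda>n. \<integral>t. ?f n t \<partial>lborel) \<longlonglongrightarrow> (\<integral>t. indicator {- R..R} t *\<^sub>R boundary_branch A t \<partial>lborel)"
  proof (rule integral_dominated_convergence[where w="weight A"])
    show "AE t in lborel. (\<lambda>n. ?f n t) \<longlonglongrightarrow> indicator {- R..R} t *\<^sub>R boundary_branch A t"
      using AE_notin_finite[OF A(1)] by eventually_elim (intro tendsto_intros half_plane_branch_tendsto)
    show "AE t in lborel. norm (?f n t) \<le> weight A t" for n
      using AE_notin_finite[OF A(1)]
    proof eventually_elim
      case (elim t)
      let ?z = "of_real t + \<i> * of_real (1 / real (Suc n))"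
      have "norm (?f n t) \<le> norm (half_plane_branch A ?z)" by (simp add: indicator_def)
      also have "\<dots> = (\<Prod>a\<in>A. norm (?z - of_real a) powr (- (1/4)))"
        by (rule norm_half_plane_branch) (auto simp: complex_eq_iff)
      also have "\<dots> \<le> weight A t"
        unfolding weight_def
      proof (intro prod_mono conjI powr_mono2')
        fix a assume "a \<in> A"
        then show "0 < \<bar>t - a\<bar>" using elim by auto
        show "\<bar>t - a\<bar> \<le> norm (?z - of_real a)" using abs_Re_le_cmod[of "?z - of_real a"] by simp
      qed auto
      finally show ?case .
    qed
    have "continuous_on UNIV (\<lambda>t. half_plane_branch A (of_real t + \<i> * of_real (1 / real (Suc n))))" for n
      by (rule continuous_on_compose2[OF holomorphic_on_imp_continuous_on[OF holomorphic_half_plane_branch]])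
        (auto intro!: continuous_intros)
    then have [measurable]: "(\<lambda>t. half_plane_branch A (of_real t + \<i> * of_real (1 / real (Suc n)))) \<in> borel_measurable borel" for n
      by (rule borel_measurable_continuous_onI)
    show "?f n \<in> borel_measurable lborel" for n by measurable
  qed (use integrable_weight[OF A] in measurable)
  then show ?thesis
    by (rule Lim_norm_ubound[OF sequentially_bot])
      (intro always_eventually allI norm_integral_half_plane_branch_le A R; simp)
qed

text \<open>Five factors of order 1/4 decay faster than \<open>1 / R\<close>, so the contour bound
  tends to 0 as the interval grows.\<close>

theorem integral_boundary_branch:
  assumes A: "finite A" "A \<subseteq> {0..1}" "card A = 5"
  shows "(\<integral>t. boundary_branch A t \<partial>lborel) = 0"
proof -
  let ?f = "\<lambda>n t. indicator {- (real n + 2)..real n + 2} t *\<^sub>R boundary_branch A t"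
  have "(\<lambda>n. \<integral>t. ?f n t \<partial>lborel) \<longlonglongrightarrow> (\<integral>t. boundary_branch A t \<partial>lborel)"
  proof (rule integral_dominated_convergence[where w="weight A"])
    show "AE t in lborel. (\<lambda>n. ?f n t) \<longlonglongrightarrow> boundary_branch A t"
    proof (rule AE_I2, rule tendsto_eventually)
      fix t :: real
      obtain N where "\<bar>t\<bar> \<le> real N" using real_arch_simple by blast
      then have "?f n t = boundary_branch A t" if "n \<ge> N" for n using that by (auto simp: indicator_def)
      then show "\<forall>\<^sub>F n in sequentially. ?f n t = boundary_branch A t" by (auto simp: eventually_sequentially)
    qed
    show "AE t in lborel. norm (?f n t) \<le> weight A t" for n
      by (auto simp: indicator_def norm_boundary_branch weight_nonneg)
  qed (use integrable_weight[OF A] in measurable)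
  moreover have "(\<lambda>n. \<integral>t. ?f n t \<partial>lborel) \<longlonglongrightarrow> 0"
  proof (rule Lim_null_comparison)
    show "\<forall>\<^sub>F n in sequentially. norm (\<integral>t. ?f n t \<partial>lborel) \<le> 4 * (real n + 2) * (real n + 2 - 1) powr (- (5/4))"
      by (intro always_eventually allI norm_integral_boundary_branch_le A) simp
    show "(\<lambda>n. 4 * (real n + 2) * (real n + 2 - 1) powr (- (5/4))) \<longlonglongrightarrow> 0" by real_asymp
  qed
  ultimately show ?thesis by (rule LIMSEQ_unique)
qed

section \<open>Integrals over chains\<close>

lemma chain_integral_superset:
  assumes "finite T" "Poly_Mapping.keys c \<subseteq> T"
  shows "chain_integral c = (\<Sum>p\<in>T. of_int (Poly_Mapping.lookup c p) * path_integral p)"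
  unfolding chain_integral_def
  by (rule sum.mono_neutral_left) (use assms in \<open>auto simp: in_keys_iff\<close>)

lemma chain_integral_frag_of [simp]: "chain_integral (frag_of p) = path_integral p"
  by (simp add: chain_integral_def keys_frag_of)

lemma chain_integral_diff [simp]: "chain_integral (c - d) = chain_integral c - chain_integral d"
proof -
  let ?T = "Poly_Mapping.keys c \<union> Poly_Mapping.keys d"
  have "Poly_Mapping.keys (c - d) \<subseteq> ?T" by (rule keys_diff)
  then show ?thesis
    by (simp add: chain_integral_superset[of ?T] lookup_minus left_diff_distrib sum_subtractf)
qed

lemma chain_integral_minus [simp]: "chain_integral (- c) = - chain_integral c"
  by (simp add: chain_integral_def lookup_minus sum_negf)

text \<open>\<open>rho\<close> multiplies \<open>w\<close> by \<open>\<i>\<close>, hence the form by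
  \<open>- \<i>\<close>. The hypothesis keeps the path away from the point at infinity, where
  \<open>the\<close> is unspecified.\<close>

lemma path_integral_rho:
  assumes "\<And>t. \<gamma> (ereal t) \<noteq> None"
  shows "path_integral (a, b, rho \<circ> \<gamma>) = - \<i> * path_integral (a, b, \<gamma>)"
proof -
  have 1: "fst (the (rho (\<gamma> (ereal t)))) = fst (the (\<gamma> (ereal t)))" "snd (the (rho (\<gamma> (ereal t)))) = \<i> * snd (the (\<gamma> (ereal t)))" for t
    using assms[of t] by (auto simp: rho_def split: prod.splits)
  have 2: "u / (\<i> * w) = - \<i> * (u / w)" for u w by (simp add: divide_simps)
  show ?thesis unfolding path_integral.simps o_def 1 2 by (rule interval_lebesgue_integral_mult_right)
qed

lemma path_L_arg_lift: "\<exists>a b \<theta>. path_L x j = (a, b, arg_lift x \<theta>)"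
  by (auto simp: path_L_def)

lemma chain_integral_cyc:
  "chain_integral (cyc x j) = 2 * path_integral (path_L x j)"
  "chain_integral (rho_chain (cyc x j)) = - 2 * \<i> * path_integral (path_L x j)"
proof -
  obtain a b \<theta> where L: "path_L x j = (a, b, arg_lift x \<theta>)" using path_L_arg_lift by blast
  have n: "(rho ^^ n) (arg_lift x \<theta> (ereal t)) \<noteq> None" for n t
    by (induction n) (auto simp: arg_lift_def rho_def)
  have g: "arg_lift x \<theta> (ereal t) \<noteq> None" "(rho \<circ> arg_lift x \<theta>) (ereal t) \<noteq> None" "(rho \<circ> (rho \<circ> arg_lift x \<theta>)) (ereal t) \<noteq> None" for t
    using n[of 0 t] n[of 1 t] n[of 2 t] by (simp_all add: numeral_2_eq_2)
  note r = path_integral_rho[of "arg_lift x \<theta>", OF g(1)] path_integral_rho[of "rho \<circ> arg_lift x \<theta>", OF g(2)]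
    path_integral_rho[of "rho \<circ> (rho \<circ> arg_lift x \<theta>)", OF g(3)]
  have i2: "\<i> * (\<i> * w) = - w" for w by (simp flip: mult.assoc)
  show "chain_integral (cyc x j) = 2 * path_integral (path_L x j)"
    "chain_integral (rho_chain (cyc x j)) = - 2 * \<i> * path_integral (path_L x j)"
    unfolding cyc_def rho_chain_def L frag_extend_diff frag_extend_of prod.case chain_integral_diff chain_integral_frag_of r
    by (simp_all add: i2)
qed

definition branch_set :: "real^3 \<Rightarrow> real set" where
  "branch_set x = {0, vec_nth x 1, vec_nth x 2, vec_nth x 3, 1}"

definition weight_integral :: "real set \<Rightarrow> real set \<Rightarrow> real" where
  "weight_integral A T = (\<integral>t. indicator T t * weight A t \<partial>lborel)"

lemma root_powr: "inverse (root 4 \<bar>y\<bar>) = \<bar>y\<bar> powr (- (1/4))"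
  by (cases "y = 0") (simp_all add: root_powr_inverse powr_minus)

lemma path_integral_arg_lift:
  assumes ab: "a \<le> b" and P: "\<And>t. t \<in> einterval a b \<Longrightarrow> curve_poly x (of_real t) = of_real (r t) * cis (4 * \<theta>) \<and> r t \<ge> 0"
  shows "path_integral (a, b, arg_lift x \<theta>) = cis (- \<theta>) * of_real (\<integral>t. indicator (einterval a b) t * inverse (root 4 (r t)) \<partial>lborel)"
proof -
  have "fst (the (arg_lift x \<theta> (ereal s))) = of_real s" for s by (simp add: arg_lift_def)
  then have v: "vector_derivative (\<lambda>s. fst (the (arg_lift x \<theta> (ereal s)))) (at t) = 1" for t
    using vector_derivative_at[OF has_vector_derivative_of_real[OF DERIV_ident]] by simp
  have "path_integral (a, b, arg_lift x \<theta>) = (LBINT t=a..b. cis (- \<theta>) * of_real (inverse (root 4 (r t))))"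
    unfolding path_integral.simps v
  proof (rule interval_integral_cong)
    fix t assume "t \<in> einterval (min a b) (max a b)"
    then have t: "t \<in> einterval a b" using ab by (simp add: min_def max_def)
    show "1 / snd (the (arg_lift x \<theta> (ereal t))) = cis (- \<theta>) * of_real (inverse (root 4 (r t)))"
      unfolding arg_lift_unique(2)[OF conjunct1[OF P[OF t]] conjunct2[OF P[OF t]]]
      by (simp add: divide_inverse cis_inverse[symmetric] mult.commute del: cis_inverse)
  qed
  also have "\<dots> = cis (- \<theta>) * (LBINT t=a..b. of_real (inverse (root 4 (r t))))" by (rule interval_lebesgue_integral_mult_right)
  also have "(LBINT t=a..b. complex_of_real (inverse (root 4 (r t)))) = of_real (LBINT t=a..b. inverse (root 4 (r t)))"
    by (rule interval_lebesgue_integral_of_real)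
  also have "(LBINT t=a..b. inverse (root 4 (r t))) = (\<integral>t. indicator (einterval a b) t * inverse (root 4 (r t)) \<partial>lborel)"
    unfolding interval_lebesgue_integral_le_eq[OF ab] set_lebesgue_integral_def by simp
  finally show ?thesis .
qed

section \<open>The periods of a single curve and the linear relations between them\<close>

context
  fixes x :: "real^3"
  assumes x: "x \<in> X123"
begin

lemma X123_order: "0 < vec_nth x 1" "vec_nth x 1 < vec_nth x 2" "vec_nth x 2 < vec_nth x 3" "vec_nth x 3 < 1"
  using x by (auto simp: X123_def)

lemma branch_set: "finite (branch_set x)" "branch_set x \<subseteq> {0..1}" "card (branch_set x) = 5"
  using X123_order by (auto simp: branch_set_def)

definition real_poly :: "real \<Rightarrow> real" where
  "real_poly t = t * (t - vec_nth x 1) * (t - vec_nth x 2) * (t - vec_nth x 3) * (t - 1)"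

lemma weight_branch_set: "weight (branch_set x) t = inverse (root 4 \<bar>real_poly t\<bar>)"
proof -
  have "weight (branch_set x) t = \<bar>t - 0\<bar> powr (- (1/4)) * (\<bar>t - vec_nth x 1\<bar> powr (- (1/4)) * (\<bar>t - vec_nth x 2\<bar> powr (- (1/4)) * (\<bar>t - vec_nth x 3\<bar> powr (- (1/4)) * \<bar>t - 1\<bar> powr (- (1/4)))))"
    unfolding weight_def branch_set_def using X123_order by simp
  also have "\<dots> = \<bar>real_poly t\<bar> powr (- (1/4))" unfolding real_poly_def abs_mult by (simp add: powr_mult mult_ac)
  finally show ?thesis by (simp add: root_powr)
qed

lemma path_integral_path_L:
  assumes ab: "a \<le> b" and sgn: "\<And>t. t \<in> einterval a b \<Longrightarrow> real_poly t = \<bar>real_poly t\<bar> * \<sigma>" and \<theta>: "cis (4 * \<theta>) = of_real \<sigma>"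
  shows "path_integral (a, b, arg_lift x \<theta>) = cis (- \<theta>) * of_real (weight_integral (branch_set x) (einterval a b))"
  unfolding weight_integral_def weight_branch_set
proof (rule path_integral_arg_lift[OF ab])
  fix t assume t: "t \<in> einterval a b"
  have "curve_poly x (of_real t) = of_real (real_poly t)" by (simp add: curve_poly_def real_poly_def)
  also have "\<dots> = of_real \<bar>real_poly t\<bar> * cis (4 * \<theta>)" unfolding \<theta> using sgn[OF t] by (metis of_real_mult)
  finally show "curve_poly x (of_real t) = of_real \<bar>real_poly t\<bar> * cis (4 * \<theta>) \<and> \<bar>real_poly t\<bar> \<ge> 0" by simp
qed

private abbreviation "J \<equiv> weight_integral (branch_set x)"

text \<open>Only these four paths occur in the cycles; the integrals over the other two intervals
  enter through \<open>J_relations\<close>.\<close>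

lemma path_integrals:
  "path_integral (path_L x 1) = cis (- (5/4 * pi)) * of_real (J {..<0})"
  "path_integral (path_L x 3) = cis (- (3/4 * pi)) * of_real (J {vec_nth x 1<..<vec_nth x 2})"
  "path_integral (path_L x 4) = cis (- (1/2 * pi)) * of_real (J {vec_nth x 2<..<vec_nth x 3})"
  "path_integral (path_L x 6) = of_real (J {1<..})"
proof -
  have e: "einterval (- \<infinity>) 0 = {..<0}" "einterval 1 \<infinity> = {1<..}" "einterval (ereal p) (ereal q) = {p<..<q}" for p q
    by (auto simp: einterval_def)
  note order = X123_order
  have c: "cis (5 * pi) = of_real (- 1)" "cis (3 * pi) = of_real (- 1)" "cis (2 * pi) = of_real 1" "cis 0 = of_real 1"
    using cis_pi_int[of 5] cis_pi_int[of 3] cis_pi_int[of 2] by (simp_all add: mult.commute)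
  have "path_integral (- \<infinity>, 0, arg_lift x (5/4 * pi)) = cis (- (5/4 * pi)) * of_real (J (einterval (- \<infinity>) 0))"
  proof (rule path_integral_path_L)
    fix t assume "t \<in> einterval (- \<infinity>) 0"
    then have "t < 0" by (simp add: e)
    then have "real_poly t < 0" unfolding real_poly_def using order
      by (intro mult_pos_neg mult_neg_neg mult_neg_pos) auto
    then show "real_poly t = \<bar>real_poly t\<bar> * - 1" by simp
  qed (use c in simp_all)
  then show "path_integral (path_L x 1) = cis (- (5/4 * pi)) * of_real (J {..<0})" by (simp add: path_L_def e)
  have "path_integral (ereal (vec_nth x 1), ereal (vec_nth x 2), arg_lift x (3/4 * pi)) = cis (- (3/4 * pi)) * of_real (J (einterval (ereal (vec_nth x 1)) (ereal (vec_nth x 2))))"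
  proof (rule path_integral_path_L)
    fix t assume "t \<in> einterval (ereal (vec_nth x 1)) (ereal (vec_nth x 2))"
    then have "vec_nth x 1 < t" "t < vec_nth x 2" by (simp_all add: e)
    then have "real_poly t < 0" unfolding real_poly_def using order
      by (intro mult_pos_neg mult_neg_neg mult_neg_pos mult_pos_pos) auto
    then show "real_poly t = \<bar>real_poly t\<bar> * - 1" by simp
  qed (use c order in simp_all)
  then show "path_integral (path_L x 3) = cis (- (3/4 * pi)) * of_real (J {vec_nth x 1<..<vec_nth x 2})" by (simp add: path_L_def e)
  have "path_integral (ereal (vec_nth x 2), ereal (vec_nth x 3), arg_lift x (1/2 * pi)) = cis (- (1/2 * pi)) * of_real (J (einterval (ereal (vec_nth x 2)) (ereal (vec_nth x 3))))"
  proof (rule path_integral_path_L)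
    fix t assume "t \<in> einterval (ereal (vec_nth x 2)) (ereal (vec_nth x 3))"
    then have "vec_nth x 2 < t" "t < vec_nth x 3" by (simp_all add: e)
    then have "real_poly t > 0" unfolding real_poly_def using order
      by (intro mult_neg_neg mult_pos_neg mult_pos_pos) auto
    then show "real_poly t = \<bar>real_poly t\<bar> * 1" by simp
  qed (use c order in simp_all)
  then show "path_integral (path_L x 4) = cis (- (1/2 * pi)) * of_real (J {vec_nth x 2<..<vec_nth x 3})" by (simp add: path_L_def e)
  have "path_integral (1, \<infinity>, arg_lift x 0) = cis (- 0) * of_real (J (einterval 1 \<infinity>))"
  proof (rule path_integral_path_L)
    fix t assume "t \<in> einterval 1 \<infinity>"
    then have "1 < t" by (simp add: e)
    then have "real_poly t > 0" unfolding real_poly_def using order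
      by (intro mult_pos_pos) auto
    then show "real_poly t = \<bar>real_poly t\<bar> * 1" by simp
  qed (use c in simp_all)
  then show "path_integral (path_L x 6) = of_real (J {1<..})" by (simp add: path_L_def e)
qed

lemma period_vector_eq:
  "period_vector x = vector [2 * of_real (J {1<..}), - 2 * of_real (sqrt 2 * J {..<0}),
    2 * \<i> * of_real (sqrt 2 * J {vec_nth x 1<..<vec_nth x 2} + J {vec_nth x 2<..<vec_nth x 3}), 2 * of_real (J {vec_nth x 2<..<vec_nth x 3})]"
proof -
  have c1: "cis (- (5/4 * pi)) = Complex (- (sqrt 2 / 2)) (sqrt 2 / 2)"
  proof -
    have "- (5/4 * pi) = - pi + - (pi / 4)" by simp
    then have "cis (- (5/4 * pi)) = cis (- pi) * cis (- (pi / 4))" by (simp only: cis_mult)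
    then show ?thesis by (simp add: complex_eq_iff cos_45 sin_45)
  qed
  have c3: "cis (- (3/4 * pi)) = Complex (- (sqrt 2 / 2)) (- (sqrt 2 / 2))"
  proof -
    have "- (3/4 * pi) = - pi + pi / 4" by simp
    then have "cis (- (3/4 * pi)) = cis (- pi) * cis (pi / 4)" by (simp only: cis_mult)
    then show ?thesis by (simp add: complex_eq_iff cos_45 sin_45)
  qed
  have c4: "cis (- (1/2 * pi)) = - \<i>" by (simp add: complex_eq_iff)
  show ?thesis
    unfolding period_vector_def B1_def B2_def B3_def B4_def chain_integral_diff chain_integral_minus chain_integral_cyc
      path_integrals c1 c3 c4
    by (simp add: vec_eq_iff forall_4 complex_eq_iff algebra_simps)
qed

lemma integrable_indicator_weight:
  "T \<in> sets borel \<Longrightarrow> integrable lborel (\<lambda>t. indicator T t * weight (branch_set x) t)"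
  by (rule integrable_real_mult_indicator[OF _ integrable_weight[OF branch_set], simplified mult.commute]) simp

lemma J_pos:
  assumes "0 \<le> p" "p < q" "q \<le> 1"
  shows "J {p<..<q} > 0"
proof -
  have "(\<integral>t. indicator {p<..<q} t \<partial>lborel) \<le> J {p<..<q}"
    unfolding weight_integral_def
  proof (rule integral_mono_AE)
    show "AE t in lborel. indicator {p<..<q} t \<le> indicator {p<..<q} t * weight (branch_set x) t"
      using AE_notin_finite[OF branch_set(1)]
    proof eventually_elim
      case (elim t)
      have "1 \<le> weight (branch_set x) t" if t: "t \<in> {p<..<q}"
        unfolding weight_def
      proof (rule prod_ge_1)
        fix a assume a: "a \<in> branch_set x"
        have "0 \<le> a" "a \<le> 1" using a branch_set(2) by auto
        moreover have "t \<noteq> a" using a elim by auto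
        moreover have "0 < t" "t < 1" using t assms by auto
        ultimately have "0 < \<bar>t - a\<bar>" "\<bar>t - a\<bar> \<le> 1" by linarith+
        then show "1 \<le> \<bar>t - a\<bar> powr (- (1/4))" using powr_mono2'[of "- (1/4)" "\<bar>t - a\<bar>" 1] by simp
      qed
      then show ?case by (simp add: indicator_def)
    qed
  qed (use assms in \<open>auto intro!: integrable_indicator_weight integrable_real_indicator\<close>)
  moreover have "(\<integral>t. indicator {p<..<q} t \<partial>lborel) = q - p" using assms by simp
  ultimately show ?thesis using assms by linarith
qed

text \<open>The vanishing of the boundary integral is one complex equation, and the phase changes by
  \<open>cis (pi / 4)\<close> at each branch point. Its imaginary part gives the first identity,
  both parts together the second.\<close>

lemma J_relations:
  "J {..<0} = J {vec_nth x 1<..<vec_nth x 2} + J {vec_nth x 3<..<1} + sqrt 2 * J {vec_nth x 2<..<vec_nth x 3}"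
  "J {1<..} = sqrt 2 * J {vec_nth x 1<..<vec_nth x 2} + J {vec_nth x 2<..<vec_nth x 3} + J {0<..<vec_nth x 1}"
proof -
  let ?x = "\<lambda>i. vec_nth x i"
  let ?i = "\<lambda>T t. complex_of_real (indicator T t * weight (branch_set x) t)"
  define w where "w = cis (pi / 8)"
  define v where "v = cis (- pi / 8)"
  have wv: "w * v = 1" by (simp add: w_def v_def cis_mult)
  have v4: "v ^ 2 = cis (- (pi / 4))" by (simp add: v_def Complex.DeMoivre)
  let ?F = "\<lambda>t. w ^ 5 * ?i {1<..} t + w ^ 4 * v * ?i {?x 3<..<1} t + w ^ 3 * v ^ 2 * ?i {?x 2<..<?x 3} t
     + w ^ 2 * v ^ 3 * ?i {?x 1<..<?x 2} t + w * v ^ 4 * ?i {0<..<?x 1} t + v ^ 5 * ?i {..<0} t"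
  have b: "boundary_branch (branch_set x) t = of_real (weight (branch_set x) t) *
      ((if t < 0 then v else w) * ((if t < ?x 1 then v else w) * ((if t < ?x 2 then v else w) * ((if t < ?x 3 then v else w) * (if t < 1 then v else w)))))" for t
    unfolding boundary_branch_def weight_def prod.distrib of_real_prod w_def v_def
    unfolding branch_set_def using X123_order by simp
  have "AE t in lborel. boundary_branch (branch_set x) t = ?F t"
    using AE_notin_finite[OF branch_set(1)]
  proof eventually_elim
    case (elim t)
    then have "t \<noteq> 0" "t \<noteq> ?x 1" "t \<noteq> ?x 2" "t \<noteq> ?x 3" "t \<noteq> 1" by (auto simp: branch_set_def)
    then consider "t < 0" | "0 < t" "t < ?x 1" | "?x 1 < t" "t < ?x 2" | "?x 2 < t" "t < ?x 3" | "?x 3 < t" "t < 1" | "1 < t"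
      by linarith
    then show ?case
      unfolding b by cases (use X123_order in \<open>simp_all add: eval_nat_numeral mult_ac\<close>)
  qed
  then have "(\<integral>t. ?F t \<partial>lborel) = (\<integral>t. boundary_branch (branch_set x) t \<partial>lborel)"
    by (intro integral_cong_AE) auto
  also have "\<dots> = 0" by (rule integral_boundary_branch[OF branch_set])
  finally have "(\<integral>t. ?F t \<partial>lborel) = 0" .
  moreover have "integrable lborel (?i T)" if "T \<in> sets borel" for T
    by (intro integrable_of_real integrable_indicator_weight that)
  moreover have "(\<integral>t. ?i T t \<partial>lborel) = of_real (J T)" for T
    unfolding weight_integral_def by (rule integral_complex_of_real)
  ultimately have "w ^ 5 * of_real (J {1<..}) + w ^ 4 * v * of_real (J {?x 3<..<1}) + w ^ 3 * v ^ 2 * of_real (J {?x 2<..<?x 3})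
     + w ^ 2 * v ^ 3 * of_real (J {?x 1<..<?x 2}) + w * v ^ 4 * of_real (J {0<..<?x 1}) + v ^ 5 * of_real (J {..<0}) = 0"
    by simp
  \<comment> \<open>Multiplication by \<open>v ^ 5\<close> makes the coefficient of the last
    interval equal to 1 and leaves powers of the eighth root of unity
    \<open>v\<^sup>2\<close>.\<close>
  then have "v ^ 5 * (w ^ 5 * of_real (J {1<..}) + w ^ 4 * v * of_real (J {?x 3<..<1}) + w ^ 3 * v ^ 2 * of_real (J {?x 2<..<?x 3})
     + w ^ 2 * v ^ 3 * of_real (J {?x 1<..<?x 2}) + w * v ^ 4 * of_real (J {0<..<?x 1}) + v ^ 5 * of_real (J {..<0})) = 0"
    by (simp only: mult_zero_right)
  moreover have "v ^ 5 * (w ^ 5 * j0 + w ^ 4 * v * j1 + w ^ 3 * v ^ 2 * j2 + w ^ 2 * v ^ 3 * j3 + w * v ^ 4 * j4 + v ^ 5 * j5)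
     = (w * v) ^ 5 * j0 + (w * v) ^ 4 * v\<^sup>2 * j1 + (w * v) ^ 3 * (v\<^sup>2) ^ 2 * j2 + (w * v) ^ 2 * (v\<^sup>2) ^ 3 * j3 + (w * v) * (v\<^sup>2) ^ 4 * j4 + (v\<^sup>2) ^ 5 * j5" for j0 j1 j2 j3 j4 j5
    by (simp add: eval_nat_numeral algebra_simps)
  ultimately have 0: "of_real (J {1<..}) + v\<^sup>2 * of_real (J {?x 3<..<1}) + (v\<^sup>2) ^ 2 * of_real (J {?x 2<..<?x 3})
     + (v\<^sup>2) ^ 3 * of_real (J {?x 1<..<?x 2}) + (v\<^sup>2) ^ 4 * of_real (J {0<..<?x 1}) + (v\<^sup>2) ^ 5 * of_real (J {..<0}) = 0"
    unfolding wv by simp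
  define k where "k = sqrt 2 / 2"
  have k: "k * k = 1 / 2" "2 * k = sqrt 2" by (simp_all add: k_def)
  have "v\<^sup>2 = Complex k (- k)" unfolding v4 by (simp add: complex_eq_iff cos_45 sin_45 k_def)
  moreover have "(Complex k (- k))\<^sup>2 = - \<i>" using k by (simp add: complex_eq_iff power2_eq_square)
  moreover have "(Complex k (- k)) ^ 3 = Complex (- k) (- k)" "(Complex k (- k)) ^ 4 = - 1" "(Complex k (- k)) ^ 5 = Complex (- k) k"
    using \<open>(Complex k (- k))\<^sup>2 = - \<i>\<close> by (simp_all add: eval_nat_numeral complex_eq_iff)
  ultimately have 1: "of_real (J {1<..}) + Complex k (- k) * of_real (J {?x 3<..<1}) + - \<i> * of_real (J {?x 2<..<?x 3})
     + Complex (- k) (- k) * of_real (J {?x 1<..<?x 2}) + - 1 * of_real (J {0<..<?x 1}) + Complex (- k) k * of_real (J {..<0}) = 0"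
    using 0 by simp
  have re: "J {1<..} + k * J {?x 3<..<1} - k * J {?x 1<..<?x 2} - J {0<..<?x 1} - k * J {..<0} = 0"
    using arg_cong[OF 1, of Re] by simp
  have im: "- (k * J {?x 3<..<1}) - J {?x 2<..<?x 3} - k * J {?x 1<..<?x 2} + k * J {..<0} = 0"
    using arg_cong[OF 1, of Im] by simp
  have "2 * k * (- (k * J {?x 3<..<1}) - J {?x 2<..<?x 3} - k * J {?x 1<..<?x 2} + k * J {..<0})
      = 2 * (k * k) * (J {..<0} - J {?x 3<..<1} - J {?x 1<..<?x 2}) - 2 * k * J {?x 2<..<?x 3}"
    by (simp add: algebra_simps)
  then show "J {..<0} = J {?x 1<..<?x 2} + J {?x 3<..<1} + sqrt 2 * J {?x 2<..<?x 3}"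
    unfolding im k by simp
  have "sqrt 2 * J {?x 1<..<?x 2} = k * J {?x 1<..<?x 2} + k * J {?x 1<..<?x 2}" unfolding k(2)[symmetric] by simp
  then show "J {1<..} = sqrt 2 * J {?x 1<..<?x 2} + J {?x 2<..<?x 3} + J {0<..<?x 1}"
    using re im by linarith
qed

text \<open>The first period is real and positive, and dividing by it gives the normal form. In the
  two relations \<open>r < 1\<close> reflects the positive integral over \<open>(0, x1)\<close>, and
  \<open>r + s \<le> Y\<close> the one over \<open>(x3, 1)\<close>.\<close>

theorem per_real_point:
  "\<exists>Y r s. 0 \<le> s \<and> s \<le> r \<and> r < 1 \<and> r + s \<le> Y \<and> r < Y \<and> per x = abs_ball3 (real_point Y r s)"
proof -
  define I1 I2 I3 I4 I5 I6 where "I1 = J {..<0}" and "I2 = J {0<..<vec_nth x 1}" and "I3 = J {vec_nth x 1<..<vec_nth x 2}"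
    and "I4 = J {vec_nth x 2<..<vec_nth x 3}" and "I5 = J {vec_nth x 3<..<1}" and "I6 = J {1<..}"
  note I = I1_def I2_def I3_def I4_def I5_def I6_def
  have rel: "I1 = I3 + I5 + sqrt 2 * I4" "I6 = sqrt 2 * I3 + I4 + I2" using J_relations unfolding I .
  have pos: "I2 > 0" "I3 > 0" "I4 > 0" "I5 > 0" unfolding I by (rule J_pos; use X123_order in linarith)+
  have s3: "sqrt 2 * I3 > 0" using pos by simp
  then have I6: "I6 > 0" using rel pos by linarith
  define Y r s where "Y = sqrt 2 * I1 / I6" and "r = (sqrt 2 * I3 + I4) / I6" and "s = I4 / I6"
  have "sqrt 2 * I1 = sqrt 2 * I3 + sqrt 2 * I5 + 2 * I4"
    unfolding rel(1) by (simp add: algebra_simps)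
  moreover have "sqrt 2 * I5 > 0" using pos by simp
  ultimately have Y1: "(sqrt 2 * I3 + I4) + I4 \<le> sqrt 2 * I1" "sqrt 2 * I3 + I4 < sqrt 2 * I1" using pos by linarith+
  have "sqrt 2 * I3 + I4 < I6" using rel(2) pos by simp
  then have reg: "0 \<le> s" "s \<le> r" "r < 1" "r + s \<le> Y" "r < Y"
    unfolding Y_def r_def s_def using I6 pos s3 Y1
    by (simp_all add: I6 less_imp_le[OF I6] divide_right_mono divide_strict_right_mono add_divide_distrib[symmetric])
  have sq: "r\<^sup>2 \<le> r" "s\<^sup>2 \<le> s" using reg by (auto simp: power2_eq_square mult_left_le)
  have rs: "r\<^sup>2 + s\<^sup>2 < 2 * Y" using sq reg by linarith
  have "per x = abs_ball3 (real_point Y r s)"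
    unfolding per_def
  proof (rule abs_ball3_eq[OF _ _ real_point_ball[OF rs]])
    show "2 * complex_of_real I6 \<noteq> 0" using I6 by simp
    have "complex_of_real I6 * of_real Y = of_real (sqrt 2 * I1)" "complex_of_real I6 * of_real r = of_real (sqrt 2 * I3 + I4)" "complex_of_real I6 * of_real s = of_real I4"
      unfolding of_real_mult[symmetric] Y_def r_def s_def using I6 by simp_all
    then show "period_vector x = (2 * complex_of_real I6) *s real_point Y r s"
      unfolding period_vector_eq I[symmetric] real_point_def
      by (simp add: vec_eq_iff forall_4 algebra_simps flip: of_real_mult of_real_add)
  qed
  then show ?thesis using reg by blast
qed

end

theorem corollary5p5:
  fixes v :: ball3
  assumes "v \<in> ball3_123"
  shows "(0 < (a_fun v + b3_fun v) * (b1_fun v + b2_fun v) \<and>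
           b1_fun (R_act v) = csqrt ((a_fun v + b3_fun v) * (b1_fun v + b2_fun v)) / 2) \<and>
         (0 < (a_fun v + b2_fun v) * (b1_fun v + b3_fun v) \<and>
           b2_fun (R_act v) = csqrt ((a_fun v + b2_fun v) * (b1_fun v + b3_fun v)) / 2) \<and>
         (0 < (a_fun v + b1_fun v) * (b2_fun v + b3_fun v) \<and>
           b3_fun (R_act v) = csqrt ((a_fun v + b1_fun v) * (b2_fun v + b3_fun v)) / 2)"
proof -
  obtain x where x: "x \<in> X123" "v = per x" using assms by (auto simp: ball3_123_def)
  obtain Y r s where "0 \<le> s" "s \<le> r" "r < 1" "r + s \<le> Y" "r < Y" "v = abs_ball3 (real_point Y r s)"
    using per_real_point[OF x(1)] x(2) by blast
  then show ?thesis using transformation_real_point by blast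
qed

end
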